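(* Let $\alpha,\theta\in\mathbb{R}$ be such that $\theta,1,\alpha$ are rationally independent, and let $v:\mathbb{Z}^2\times\mathbb{Z}^2\to\mathbb{T}$ be the bicharacter $v(k,l)=e^{2\pi i(\theta k_1l_1+\theta k_2l_2)}$ for $k=(k_1,k_2)$, $l=(l_1,l_2)\in\mathbb{Z}^2$. Then $\times{\rm tr}\circ p$ is the distribution of a quantum stochastic process factorizing through the quotient $\ast_{\mathbb{N}}\mathbb{A}_\alpha/I_v$ which is spreadable but not $I_v$-braidable.
   Context: $\mathbb{N}$ includes $0$. $\mathbb{A}_\alpha$ is the non-commutative $2$-torus: the universal $C^*$-algebra generated by unitaries $u,w$ with $uw=e^{2\pi i\alpha}wu$. Its canonical trace is the state ${\rm tr}$ with ${\rm tr}(u^iw^j)=\delta_{i,0}\delta_{j,0}$. The group $G=\mathbb{T}^2$ acts on $\mathbb{A}_\alpha$ by rotations ($u\mapsto z_1u$, $w\mapsto z_2w$), so $u^iw^j$ is homogeneous of degree $(i,j)\in\widehat{G}=\mathbb{Z}^2$. Write $\partial a$ for the degree of a homogeneous element $a$. For a unital $C^*$-algebra $\mathfrak{A}$, $\ast_{\mathbb{N}}\mathfrak{A}$ is the (unital, universal) free product of countably many copies of $\mathfrak{A}$ with canonical embeddings $i_j$, $j\in\mathbb{N}$. $I_v$ is the closed two-sided ideal of $\ast_{\mathbb{N}}\mathbb{A}_\alpha$ generated by the elements $i_l(a)i_k(b)-v(\partial a,\partial b)i_k(b)i_l(a)$, with $a,b\in\mathbb{A}_\alpha$ homogeneous and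 $l<k$ in $\mathbb{N}$. The quotient $\ast_{\mathbb{N}}\mathbb{A}_\alpha/I_v$ is the twisted tensor product $\bigotimes_v^{\mathbb{N}}\mathbb{A}_\alpha$, and $p$ is the quotient map. $\times{\rm tr}$ is the product state on it: the unique state with $\times{\rm tr}(p(i_{j_1}(a_1)\cdots i_{j_n}(a_n)))={\rm tr}(a_1)\cdots{\rm tr}(a_n)$ for $j_1<\cdots<j_n$ and $a_1,\dots,a_n\in\mathbb{A}_\alpha$. A quantum stochastic process is a quadruple $(\mathfrak{A},\mathcal{H},\{\iota_j\}_{j\in\mathbb{N}},\xi)$, with $\iota_j$ unital $*$-representations of $\mathfrak{A}$ on the Hilbert space $\mathcal{H}$ and $\xi$ a unit vector cyclic for $\bigvee_j\iota_j(\mathfrak{A})$. Its distribution is the state $\varphi$ on $\ast_{\mathbb{N}}\mathfrak{A}$ with $\varphi(i_{j_1}(a_1)\cdots i_{j_n}(a_n))=\langle\iota_{j_1}(a_1)\cdots\iota_{j_n}(a_n)\xi,\xi\rangle$; every state arises this way via GNS. The process is spreadable if $\varphi$ is invariant under the endomorphisms $i_j(a)\mapsto i_{f(j)}(a)$ for all strictly increasing $f:\mathbb{N}\to\mathbb{N}$. For a closed two-sided ideal $I$ with quotient map $p_I$, the distribution factorizes through $\ast_{\mathbb{N}}\mathfrak{A}/I$ if $\varphi=\widetilde\varphi\circ p_I$ for a state $\widetilde\varphi$ on the quotient. $\mathbb{B}_{\mathbb{N}}$ is Artin's braid group with generators $\sigma_1,\sigma_2,\dots$ and relations $\sigma_i\sigma_j=\sigma_j\sigma_i$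 for $|i-j|\geq2$, and $\sigma_i\sigma_{i+1}\sigma_i=\sigma_{i+1}\sigma_i\sigma_{i+1}$ for all $i\geq1$. A process whose distribution factorizes through $\ast_{\mathbb{N}}\mathfrak{A}/I$ as $\varphi=\widetilde\varphi\circ p_I$ is $I$-braidable if there exists an action (group homomorphism) $\rho:\mathbb{B}_{\mathbb{N}}\to{\rm Aut}(\ast_{\mathbb{N}}\mathfrak{A}/I)$ leaving $\widetilde\varphi$ invariant and such that, with $i_n'=p_I\circ i_n$, one has $i_n'=\rho(\sigma_n\sigma_{n-1}\cdots\sigma_1)\circ i_0'$ for all $n\geq1$, and $i_0'=\rho(\sigma_n)\circ i_0'$ for all $n\geq2$. *)

theory Defs
  imports
    "HOL-Analysis.Analysis"
    "HOL-Library.Poly_Mapping"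
    "HOL-Algebra.Bij"
    "HOL-Algebra.QuotRing"
    "HOL-Algebra.Subrings"
begin

section \<open>Unital C*-algebras\<close>

text \<open>
  Everything is carrier-based, in the style of HOL-Algebra. Maps between structures are extensional
  functions, so that a map is determined by its values on the carrier and can be singled out by
  a definite description.
\<close>

definition complex_ring :: "complex ring" where
  "complex_ring = \<lparr>carrier = UNIV, mult = (*), one = 1, zero = 0, add = (+)\<rparr>"

record 'a cstar = "(complex, 'a) module" +
  star :: "'a \<Rightarrow> 'a"
  cnorm :: "'a \<Rightarrow> real"

text \<open>The distances below are set to zero outside the carrier because \<^locale>\<open>Metric_space\<close>
  demands non-negativity and symmetry on the whole type.\<close>

definition cstar_dist :: "'a cstar \<Rightarrow> 'a \<Rightarrow> 'a \<Rightarrow> real" where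
  "cstar_dist A x y = (if x \<in> carrier A \<and> y \<in> carrier A then cnorm A (x \<ominus>\<^bsub>A\<^esub> y) else 0)"

definition cstar_topology :: "'a cstar \<Rightarrow> 'a topology" where
  "cstar_topology A = Metric_space.mtopology (carrier A) (cstar_dist A)"

locale cstar_algebra = ring A + Module.module complex_ring A for A :: "'a cstar" (structure) +
  assumes smult_mult_left:
      "\<lbrakk>x \<in> carrier A; y \<in> carrier A\<rbrakk> \<Longrightarrow> (c \<odot> x) \<otimes> y = c \<odot> (x \<otimes> y)"
    and smult_mult_right:
      "\<lbrakk>x \<in> carrier A; y \<in> carrier A\<rbrakk> \<Longrightarrow> x \<otimes> (c \<odot> y) = c \<odot> (x \<otimes> y)"
    and star_closed: "x \<in> carrier A \<Longrightarrow> star A x \<in> carrier A"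
    and star_star: "x \<in> carrier A \<Longrightarrow> star A (star A x) = x"
    and star_add: "\<lbrakk>x \<in> carrier A; y \<in> carrier A\<rbrakk> \<Longrightarrow> star A (x \<oplus> y) = star A x \<oplus> star A y"
    and star_smult: "x \<in> carrier A \<Longrightarrow> star A (c \<odot> x) = cnj c \<odot> star A x"
    and star_mult: "\<lbrakk>x \<in> carrier A; y \<in> carrier A\<rbrakk> \<Longrightarrow> star A (x \<otimes> y) = star A y \<otimes> star A x"
    and cnorm_nonneg: "x \<in> carrier A \<Longrightarrow> 0 \<le> cnorm A x"
    and cnorm_eq_0: "x \<in> carrier A \<Longrightarrow> cnorm A x = 0 \<longleftrightarrow> x = \<zero>"
    and cnorm_triangle:
      "\<lbrakk>x \<in> carrier A; y \<in> carrier A\<rbrakk> \<Longrightarrow> cnorm A (x \<oplus> y) \<le> cnorm A x + cnorm A y"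
    and cnorm_smult: "x \<in> carrier A \<Longrightarrow> cnorm A (c \<odot> x) = cmod c * cnorm A x"
    and cnorm_mult:
      "\<lbrakk>x \<in> carrier A; y \<in> carrier A\<rbrakk> \<Longrightarrow> cnorm A (x \<otimes> y) \<le> cnorm A x * cnorm A y"
    and cstar_identity: "x \<in> carrier A \<Longrightarrow> cnorm A (star A x \<otimes> x) = (cnorm A x)\<^sup>2"
    and complete: "Metric_space.mcomplete (carrier A) (cstar_dist A)"

definition star_hom :: "'a cstar \<Rightarrow> 'b cstar \<Rightarrow> ('a \<Rightarrow> 'b) set" where
  "star_hom A B = {h \<in> ring_hom A B \<inter> extensional (carrier A).
     (\<forall>c. \<forall>x\<in>carrier A. h (c \<odot>\<^bsub>A\<^esub> x) = c \<odot>\<^bsub>B\<^esub> h x) \<and>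
     (\<forall>x\<in>carrier A. h (star A x) = star B (h x))}"

definition star_aut_group :: "'a cstar \<Rightarrow> ('a \<Rightarrow> 'a) monoid" where
  "star_aut_group A = BijGroup (carrier A) \<lparr>carrier := star_hom A A \<inter> Bij (carrier A)\<rparr>"

definition is_state :: "'a cstar \<Rightarrow> ('a \<Rightarrow> complex) \<Rightarrow> bool" where
  "is_state A \<phi> \<longleftrightarrow> \<phi> \<in> extensional (carrier A) \<and>
     (\<forall>x\<in>carrier A. \<forall>y\<in>carrier A. \<phi> (x \<oplus>\<^bsub>A\<^esub> y) = \<phi> x + \<phi> y) \<and>
     (\<forall>c. \<forall>x\<in>carrier A. \<phi> (c \<odot>\<^bsub>A\<^esub> x) = c * \<phi> x) \<and>
     (\<forall>x\<in>carrier A. \<phi> (star A x \<otimes>\<^bsub>A\<^esub> x) \<in> \<real>\<^sub>\<ge>\<^sub>0) \<and>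
     \<phi> \<one>\<^bsub>A\<^esub> = 1"

definition cstar_prod :: "'a cstar \<Rightarrow> 'a list \<Rightarrow> 'a" where
  "cstar_prod A xs = foldr (\<lambda>x y. x \<otimes>\<^bsub>A\<^esub> y) xs \<one>\<^bsub>A\<^esub>"

definition cstar_generated :: "'a cstar \<Rightarrow> 'a set \<Rightarrow> 'a set" where
  "cstar_generated A S = \<Inter>{B. subring B A \<and>
     (\<forall>c. \<forall>x\<in>B. c \<odot>\<^bsub>A\<^esub> x \<in> B) \<and> (\<forall>x\<in>B. star A x \<in> B) \<and>
     closedin (cstar_topology A) B \<and> S \<subseteq> B}"

definition closed_ideal_generated :: "'a cstar \<Rightarrow> 'a set \<Rightarrow> 'a set" where
  "closed_ideal_generated A S =
     \<Inter>{I. ideal I A \<and> closedin (cstar_topology A) I \<and> S \<subseteq> I}"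

text \<open>The quotient by a closed two-sided ideal: the quotient ring of HOL-Algebra with the induced
  scalar multiplication and involution and the quotient norm. Closed ideals are self-adjoint, so
  the image of a coset under the involution is again a coset; the image of a coset under
  multiplication by the scalar 0 is not, hence the added ideal.\<close>

definition cstar_quotient :: "'a cstar \<Rightarrow> 'a set \<Rightarrow> 'a set cstar" where
  "cstar_quotient A I =
     \<lparr>carrier = carrier (A Quot I), mult = mult (A Quot I), one = one (A Quot I),
      zero = zero (A Quot I), add = add (A Quot I),
      smult = (\<lambda>c X. \<Union>x\<in>X. I +>\<^bsub>A\<^esub> (c \<odot>\<^bsub>A\<^esub> x)),
      star = (\<lambda>X. star A ` X),
      cnorm = (\<lambda>X. INF x\<in>X. cnorm A x)\<rparr>"

definition quotient_map :: "'a cstar \<Rightarrow> 'a set \<Rightarrow> 'a \<Rightarrow> 'a set" where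
  "quotient_map A I = (\<lambda>x\<in>carrier A. I +>\<^bsub>A\<^esub> x)"


section \<open>Universal C*-algebras of generators and relations\<close>

text \<open>Words in letters \<open>g\<close> and \<open>g\<^sup>*\<close> (the flag marks the adjoint), as an additively written monoid,
  so that \<open>'g sword \<Rightarrow>\<^sub>0 complex\<close> with the convolution product of \<open>Poly_Mapping\<close>
  is the free unital complex *-algebra.\<close>

datatype 'g sword = SWord "('g \<times> bool) list"

primrec letters :: "'g sword \<Rightarrow> ('g \<times> bool) list" where
  "letters (SWord xs) = xs"

instantiation sword :: (type) monoid_add
begin
definition zero_sword :: "'a sword" where "zero_sword = SWord []"
definition plus_sword :: "'a sword \<Rightarrow> 'a sword \<Rightarrow> 'a sword" where
  "plus_sword v w = SWord (letters v @ letters w)"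
instance
proof
  fix a b c :: "'a sword"
  show "a + b + c = a + (b + c)" by (simp add: plus_sword_def)
  show "0 + a = a" by (cases a) (simp add: plus_sword_def zero_sword_def)
  show "a + 0 = a" by (cases a) (simp add: plus_sword_def zero_sword_def)
qed
end

definition word_star :: "'g sword \<Rightarrow> 'g sword" where
  "word_star w = SWord (rev (map (\<lambda>(g, b). (g, \<not> b)) (letters w)))"

lemma word_star_word_star [simp]: "word_star (word_star w) = w"
  by (cases w) (simp add: word_star_def rev_map o_def case_prod_beta)

lemma inj_word_star: "inj word_star"
  by (metis injI word_star_word_star)

type_synonym 'g star_poly = "'g sword \<Rightarrow>\<^sub>0 complex"

definition free_gen :: "'g \<Rightarrow> 'g star_poly" where
  "free_gen g = Poly_Mapping.single (SWord [(g, False)]) 1"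

definition free_scale :: "complex \<Rightarrow> 'g star_poly \<Rightarrow> 'g star_poly" where
  "free_scale c p = Poly_Mapping.single 0 c * p"

definition free_star :: "'g star_poly \<Rightarrow> 'g star_poly" where
  "free_star p = Poly_Mapping.map_key word_star (Poly_Mapping.map cnj p)"

lemma lookup_free_star:
  "Poly_Mapping.lookup (free_star p) w = cnj (Poly_Mapping.lookup p (word_star w))"
  by (simp add: free_star_def map_key.rep_eq inj_word_star Poly_Mapping.map.rep_eq when_def)

definition free_star_algebra :: "'g set \<Rightarrow> 'g star_poly set" where
  "free_star_algebra G = {p. \<forall>w\<in>Poly_Mapping.keys p. fst ` set (letters w) \<subseteq> G}"

definition cstar_seminorm :: "'g set \<Rightarrow> ('g star_poly \<Rightarrow> real) \<Rightarrow> bool" where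
  "cstar_seminorm G N \<longleftrightarrow>
     (\<forall>x\<in>free_star_algebra G. 0 \<le> N x) \<and>
     (\<forall>x\<in>free_star_algebra G. \<forall>y\<in>free_star_algebra G. N (x + y) \<le> N x + N y) \<and>
     (\<forall>c. \<forall>x\<in>free_star_algebra G. N (free_scale c x) = cmod c * N x) \<and>
     (\<forall>x\<in>free_star_algebra G. \<forall>y\<in>free_star_algebra G. N (x * y) \<le> N x * N y) \<and>
     (\<forall>x\<in>free_star_algebra G. N (free_star x * x) = (N x)\<^sup>2)"

text \<open>The largest C*-seminorm annihilating the relations \<open>R\<close>. The seminorms annihilating \<open>R\<close> are
  exactly those induced by *-representations in which the relations hold. The supremum is finite
  whenever the relations bound the norms of the generators, as they do in all uses below.\<close>

definition universal_norm :: "'g set \<Rightarrow> 'g star_poly set \<Rightarrow> 'g star_poly \<Rightarrow> real" where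
  "universal_norm G R x = (SUP N\<in>{N. cstar_seminorm G N \<and> (\<forall>r\<in>R. N r = 0)}. N x)"

definition cauchy_seqs :: "'b::minus set \<Rightarrow> ('b \<Rightarrow> real) \<Rightarrow> (nat \<Rightarrow> 'b) set" where
  "cauchy_seqs V N = {X. (\<forall>n. X n \<in> V) \<and>
     (\<forall>\<epsilon>>0. \<exists>M. \<forall>m\<ge>M. \<forall>n\<ge>M. N (X m - X n) < \<epsilon>)}"

definition limit_class :: "'b::minus set \<Rightarrow> ('b \<Rightarrow> real) \<Rightarrow> (nat \<Rightarrow> 'b) \<Rightarrow> (nat \<Rightarrow> 'b) set" where
  "limit_class V N X = {Y \<in> cauchy_seqs V N. (\<lambda>n. N (X n - Y n)) \<longlonglongrightarrow> 0}"

text \<open>The universal unital C*-algebra with generators \<open>G\<close> and relations \<open>r = 0\<close>, \<open>r \<in> R\<close>: the separated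
  completion of the free *-algebra for \<^const>\<open>universal_norm\<close>, realized by classes of
  Cauchy sequences.\<close>

definition universal_class ::
  "'g set \<Rightarrow> 'g star_poly set \<Rightarrow> (nat \<Rightarrow> 'g star_poly) \<Rightarrow> (nat \<Rightarrow> 'g star_poly) set" where
  "universal_class G R = limit_class (free_star_algebra G) (universal_norm G R)"

definition rep_seq :: "(nat \<Rightarrow> 'b) set \<Rightarrow> nat \<Rightarrow> 'b" where
  "rep_seq S = (SOME X. X \<in> S)"

definition universal_cstar ::
  "'g set \<Rightarrow> 'g star_poly set \<Rightarrow> (nat \<Rightarrow> 'g star_poly) set cstar" where
  "universal_cstar G R =
     \<lparr>carrier = universal_class G R ` cauchy_seqs (free_star_algebra G) (universal_norm G R),
      mult = (\<lambda>S T. universal_class G R (\<lambda>n. rep_seq S n * rep_seq T n)),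
      one = universal_class G R (\<lambda>n. 1),
      zero = universal_class G R (\<lambda>n. 0),
      add = (\<lambda>S T. universal_class G R (\<lambda>n. rep_seq S n + rep_seq T n)),
      smult = (\<lambda>c S. universal_class G R (\<lambda>n. free_scale c (rep_seq S n))),
      star = (\<lambda>S. universal_class G R (\<lambda>n. free_star (rep_seq S n))),
      cnorm = (\<lambda>S. lim (\<lambda>n. universal_norm G R (rep_seq S n)))\<rparr>"

definition universal_gen ::
  "'g set \<Rightarrow> 'g star_poly set \<Rightarrow> 'g \<Rightarrow> (nat \<Rightarrow> 'g star_poly) set" where
  "universal_gen G R g = universal_class G R (\<lambda>n. free_gen g)"


section \<open>The non-commutative 2-torus\<close>

datatype torus_gen = Gen_U | Gen_W

type_synonym torus_elt = "(nat \<Rightarrow> torus_gen star_poly) set"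

definition torus_relations :: "real \<Rightarrow> torus_gen star_poly set" where
  "torus_relations \<alpha> =
     {free_gen Gen_U * free_star (free_gen Gen_U) - 1, free_star (free_gen Gen_U) * free_gen Gen_U - 1,
      free_gen Gen_W * free_star (free_gen Gen_W) - 1, free_star (free_gen Gen_W) * free_gen Gen_W - 1,
      free_gen Gen_U * free_gen Gen_W - free_scale (cis (2 * pi * \<alpha>)) (free_gen Gen_W * free_gen Gen_U)}"

definition nc_torus :: "real \<Rightarrow> torus_elt cstar" where
  "nc_torus \<alpha> = universal_cstar UNIV (torus_relations \<alpha>)"

definition torus_u :: "real \<Rightarrow> torus_elt" where
  "torus_u \<alpha> = universal_gen UNIV (torus_relations \<alpha>) Gen_U"

definition torus_w :: "real \<Rightarrow> torus_elt" where
  "torus_w \<alpha> = universal_gen UNIV (torus_relations \<alpha>) Gen_W"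

definition canonical_trace :: "real \<Rightarrow> torus_elt \<Rightarrow> complex" where
  "canonical_trace \<alpha> = (THE \<tau>. is_state (nc_torus \<alpha>) \<tau> \<and>
     (\<forall>(i :: int) (j :: int). \<tau> (torus_u \<alpha> [^]\<^bsub>nc_torus \<alpha>\<^esub> i \<otimes>\<^bsub>nc_torus \<alpha>\<^esub> torus_w \<alpha> [^]\<^bsub>nc_torus \<alpha>\<^esub> j)
        = (if i = 0 \<and> j = 0 then 1 else 0)))"

definition rotation :: "real \<Rightarrow> complex \<Rightarrow> complex \<Rightarrow> torus_elt \<Rightarrow> torus_elt" where
  "rotation \<alpha> z\<^sub>1 z\<^sub>2 = (THE h. h \<in> carrier (star_aut_group (nc_torus \<alpha>)) \<and>
     h (torus_u \<alpha>) = z\<^sub>1 \<odot>\<^bsub>nc_torus \<alpha>\<^esub> torus_u \<alpha> \<and>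
     h (torus_w \<alpha>) = z\<^sub>2 \<odot>\<^bsub>nc_torus \<alpha>\<^esub> torus_w \<alpha>)"

text \<open>The zero element is homogeneous of every degree.\<close>

definition homogeneous :: "real \<Rightarrow> int \<times> int \<Rightarrow> torus_elt \<Rightarrow> bool" where
  "homogeneous \<alpha> d a \<longleftrightarrow> a \<in> carrier (nc_torus \<alpha>) \<and>
     (\<forall>z\<^sub>1 z\<^sub>2. cmod z\<^sub>1 = 1 \<and> cmod z\<^sub>2 = 1 \<longrightarrow>
        rotation \<alpha> z\<^sub>1 z\<^sub>2 a = (z\<^sub>1 powi fst d * z\<^sub>2 powi snd d) \<odot>\<^bsub>nc_torus \<alpha>\<^esub> a)"


section \<open>Infinite free products\<close>

text \<open>The free product of countably many copies of \<open>A\<close>: the universal unital C*-algebra generated by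
  symbols \<open>(j, a)\<close> subject to the relations that each \<open>a \<mapsto> (j, a)\<close> be a unital *-homomorphism.\<close>

definition free_product_gens :: "'a cstar \<Rightarrow> (nat \<times> 'a) set" where
  "free_product_gens A = UNIV \<times> carrier A"

definition free_product_relations :: "'a cstar \<Rightarrow> (nat \<times> 'a) star_poly set" where
  "free_product_relations A =
     {free_gen (j, a \<oplus>\<^bsub>A\<^esub> b) - (free_gen (j, a) + free_gen (j, b)) |j a b.
        a \<in> carrier A \<and> b \<in> carrier A} \<union>
     {free_gen (j, c \<odot>\<^bsub>A\<^esub> a) - free_scale c (free_gen (j, a)) |j c a. a \<in> carrier A} \<union>
     {free_gen (j, a \<otimes>\<^bsub>A\<^esub> b) - free_gen (j, a) * free_gen (j, b) |j a b.
        a \<in> carrier A \<and> b \<in> carrier A} \<union>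
     {free_gen (j, star A a) - free_star (free_gen (j, a)) |j a. a \<in> carrier A} \<union>
     {free_gen (j, \<one>\<^bsub>A\<^esub>) - 1 |j. True}"

type_synonym 'a free_product_elt = "(nat \<Rightarrow> (nat \<times> 'a) star_poly) set"

definition free_product :: "'a cstar \<Rightarrow> 'a free_product_elt cstar" where
  "free_product A = universal_cstar (free_product_gens A) (free_product_relations A)"

definition free_emb :: "'a cstar \<Rightarrow> nat \<Rightarrow> 'a \<Rightarrow> 'a free_product_elt" where
  "free_emb A j =
     (\<lambda>a\<in>carrier A. universal_gen (free_product_gens A) (free_product_relations A) (j, a))"

definition free_word :: "'a cstar \<Rightarrow> (nat \<times> 'a) list \<Rightarrow> 'a free_product_elt" where
  "free_word A xs = cstar_prod (free_product A) (map (\<lambda>(j, a). free_emb A j a) xs)"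

definition index_endo :: "'a cstar \<Rightarrow> (nat \<Rightarrow> nat) \<Rightarrow> 'a free_product_elt \<Rightarrow> 'a free_product_elt" where
  "index_endo A f = (THE h. h \<in> star_hom (free_product A) (free_product A) \<and>
     (\<forall>j. \<forall>a\<in>carrier A. h (free_emb A j a) = free_emb A (f j) a))"


section \<open>Twisted tensor products of non-commutative tori\<close>

definition twist_ideal ::
  "real \<Rightarrow> (int \<times> int \<Rightarrow> int \<times> int \<Rightarrow> complex) \<Rightarrow> torus_elt free_product_elt set" where
  "twist_ideal \<alpha> v = (let A = nc_torus \<alpha>; F = free_product A in
     closed_ideal_generated F
       {(free_emb A l a \<otimes>\<^bsub>F\<^esub> free_emb A k b) \<ominus>\<^bsub>F\<^esub>
          (v d e \<odot>\<^bsub>F\<^esub> (free_emb A k b \<otimes>\<^bsub>F\<^esub> free_emb A l a)) |l k a b d e.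
        l < k \<and> homogeneous \<alpha> d a \<and> homogeneous \<alpha> e b})"

definition twisted_tensor_product ::
  "real \<Rightarrow> (int \<times> int \<Rightarrow> int \<times> int \<Rightarrow> complex) \<Rightarrow> torus_elt free_product_elt set cstar" where
  "twisted_tensor_product \<alpha> v = cstar_quotient (free_product (nc_torus \<alpha>)) (twist_ideal \<alpha> v)"

definition twist_quotient_map ::
  "real \<Rightarrow> (int \<times> int \<Rightarrow> int \<times> int \<Rightarrow> complex) \<Rightarrow>
     torus_elt free_product_elt \<Rightarrow> torus_elt free_product_elt set" where
  "twist_quotient_map \<alpha> v = quotient_map (free_product (nc_torus \<alpha>)) (twist_ideal \<alpha> v)"

definition product_trace ::
  "real \<Rightarrow> (int \<times> int \<Rightarrow> int \<times> int \<Rightarrow> complex) \<Rightarrow> torus_elt free_product_elt set \<Rightarrow> complex" where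
  "product_trace \<alpha> v = (THE \<omega>. is_state (twisted_tensor_product \<alpha> v) \<omega> \<and>
     (\<forall>xs. sorted_wrt (<) (map fst xs) \<and> snd ` set xs \<subseteq> carrier (nc_torus \<alpha>) \<longrightarrow>
        \<omega> (twist_quotient_map \<alpha> v (free_word (nc_torus \<alpha>) xs))
          = (\<Prod>(j, a)\<leftarrow>xs. canonical_trace \<alpha> a)))"


section \<open>Hilbert spaces\<close>

text \<open>As for modules in HOL-Algebra, the fields \<open>mult\<close> and \<open>one\<close> of the record are irrelevant.\<close>

record 'h hilbert = "(complex, 'h) module" +
  cinner :: "'h \<Rightarrow> 'h \<Rightarrow> complex"

definition hnorm :: "'h hilbert \<Rightarrow> 'h \<Rightarrow> real" where
  "hnorm H x = sqrt (Re (cinner H x x))"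

definition hilbert_dist :: "'h hilbert \<Rightarrow> 'h \<Rightarrow> 'h \<Rightarrow> real" where
  "hilbert_dist H x y = (if x \<in> carrier H \<and> y \<in> carrier H then hnorm H (x \<ominus>\<^bsub>H\<^esub> y) else 0)"

text \<open>Inner products are linear in the first argument.\<close>

locale hilbert_space = Module.module complex_ring H for H :: "'h hilbert" (structure) +
  assumes cinner_add_left: "\<lbrakk>x \<in> carrier H; y \<in> carrier H; z \<in> carrier H\<rbrakk> \<Longrightarrow>
      cinner H (x \<oplus> y) z = cinner H x z + cinner H y z"
    and cinner_smult_left: "\<lbrakk>x \<in> carrier H; y \<in> carrier H\<rbrakk> \<Longrightarrow>
      cinner H (c \<odot> x) y = c * cinner H x y"
    and cinner_commute: "\<lbrakk>x \<in> carrier H; y \<in> carrier H\<rbrakk> \<Longrightarrow> cinner H x y = cnj (cinner H y x)"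
    and cinner_nonneg: "x \<in> carrier H \<Longrightarrow> 0 \<le> Re (cinner H x x)"
    and cinner_eq_0: "x \<in> carrier H \<Longrightarrow> cinner H x x = 0 \<longleftrightarrow> x = \<zero>"
    and complete: "Metric_space.mcomplete (carrier H) (hilbert_dist H)"

definition bounded_operators :: "'h hilbert \<Rightarrow> ('h \<Rightarrow> 'h) cstar" where
  "bounded_operators H =
     \<lparr>carrier = {T \<in> carrier H \<rightarrow>\<^sub>E carrier H.
        (\<forall>x\<in>carrier H. \<forall>y\<in>carrier H. T (x \<oplus>\<^bsub>H\<^esub> y) = T x \<oplus>\<^bsub>H\<^esub> T y) \<and>
        (\<forall>c. \<forall>x\<in>carrier H. T (c \<odot>\<^bsub>H\<^esub> x) = c \<odot>\<^bsub>H\<^esub> T x) \<and>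
        (\<exists>K. \<forall>x\<in>carrier H. hnorm H (T x) \<le> K * hnorm H x)},
      mult = compose (carrier H),
      one = (\<lambda>x\<in>carrier H. x),
      zero = (\<lambda>x\<in>carrier H. \<zero>\<^bsub>H\<^esub>),
      add = (\<lambda>S T. \<lambda>x\<in>carrier H. S x \<oplus>\<^bsub>H\<^esub> T x),
      smult = (\<lambda>c T. \<lambda>x\<in>carrier H. c \<odot>\<^bsub>H\<^esub> T x),
      star = (\<lambda>T. \<lambda>y\<in>carrier H. THE z. z \<in> carrier H \<and>
        (\<forall>x\<in>carrier H. cinner H (T x) y = cinner H x z)),
      cnorm = (\<lambda>T. Inf {K. 0 \<le> K \<and> (\<forall>x\<in>carrier H. hnorm H (T x) \<le> K * hnorm H x)})\<rparr>"


section \<open>Quantum stochastic processes\<close>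

locale quantum_stochastic_process = A: cstar_algebra A + H: hilbert_space H
  for A :: "'a cstar" and H :: "'h hilbert" +
  fixes \<iota> :: "nat \<Rightarrow> 'a \<Rightarrow> 'h \<Rightarrow> 'h" and \<xi> :: 'h
  assumes rep: "\<And>j. \<iota> j \<in> star_hom A (bounded_operators H)"
    and unit_vector: "\<xi> \<in> carrier H" "hnorm H \<xi> = 1"
    and cyclic: "Metric_space.mtopology (carrier H) (hilbert_dist H) closure_of
      {T \<xi> |T. T \<in> cstar_generated (bounded_operators H) (\<Union>j. \<iota> j ` carrier A)} = carrier H"

definition process_distribution ::
  "'a cstar \<Rightarrow> 'h hilbert \<Rightarrow> (nat \<Rightarrow> 'a \<Rightarrow> 'h \<Rightarrow> 'h) \<Rightarrow> 'h \<Rightarrow> 'a free_product_elt \<Rightarrow> complex" where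
  "process_distribution A H \<iota> \<xi> = (THE \<phi>. is_state (free_product A) \<phi> \<and>
     (\<forall>xs. snd ` set xs \<subseteq> carrier A \<longrightarrow> \<phi> (free_word A xs) =
        cinner H (cstar_prod (bounded_operators H) (map (\<lambda>(j, a). \<iota> j a) xs) \<xi>) \<xi>))"

definition spreadable ::
  "'a cstar \<Rightarrow> 'h hilbert \<Rightarrow> (nat \<Rightarrow> 'a \<Rightarrow> 'h \<Rightarrow> 'h) \<Rightarrow> 'h \<Rightarrow> bool" where
  "spreadable A H \<iota> \<xi> \<longleftrightarrow> (\<forall>f. strict_mono f \<longrightarrow>
     compose (carrier (free_product A)) (process_distribution A H \<iota> \<xi>) (index_endo A f)
       = process_distribution A H \<iota> \<xi>)"

text \<open>The process factorizes through the quotient by \<open>I\<close> via the state \<open>\<psi>\<close>, which is unique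
  because the quotient map is onto.\<close>

definition factorizes_via ::
  "'a cstar \<Rightarrow> 'h hilbert \<Rightarrow> (nat \<Rightarrow> 'a \<Rightarrow> 'h \<Rightarrow> 'h) \<Rightarrow> 'h \<Rightarrow> 'a free_product_elt set
     \<Rightarrow> ('a free_product_elt set \<Rightarrow> complex) \<Rightarrow> bool" where
  "factorizes_via A H \<iota> \<xi> I \<psi> \<longleftrightarrow> is_state (cstar_quotient (free_product A) I) \<psi> \<and>
     process_distribution A H \<iota> \<xi> =
       compose (carrier (free_product A)) \<psi> (quotient_map (free_product A) I)"


section \<open>The braid group on infinitely many strands\<close>

text \<open>Words in the letters \<open>\<sigma>\<^sub>n\<close> (flag true) and their inverses (flag false), \<open>n \<ge> 1\<close>, modulo the
  congruence generated by free cancellation and the braid relations.\<close>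

type_synonym braid_word = "(nat \<times> bool) list"

definition braid_words :: "braid_word set" where
  "braid_words = lists ({1..} \<times> UNIV)"

inductive braid_eq :: "braid_word \<Rightarrow> braid_word \<Rightarrow> bool" where
  refl: "braid_eq x x"
| sym: "braid_eq x y \<Longrightarrow> braid_eq y x"
| trans: "braid_eq x y \<Longrightarrow> braid_eq y z \<Longrightarrow> braid_eq x z"
| cong: "braid_eq x y \<Longrightarrow> braid_eq (l @ x @ r) (l @ y @ r)"
| cancel: "1 \<le> i \<Longrightarrow> braid_eq [(i, b), (i, \<not> b)] []"
| far: "1 \<le> i \<Longrightarrow> i + 2 \<le> j \<Longrightarrow> braid_eq [(i, True), (j, True)] [(j, True), (i, True)]"
| braid: "1 \<le> i \<Longrightarrow>
    braid_eq [(i, True), (Suc i, True), (i, True)] [(Suc i, True), (i, True), (Suc i, True)]"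

definition braid_class :: "braid_word \<Rightarrow> braid_word set" where
  "braid_class x = {y \<in> braid_words. braid_eq x y}"

definition braid_group :: "braid_word set monoid" where
  "braid_group =
     \<lparr>carrier = braid_class ` braid_words,
      mult = (\<lambda>X Y. \<Union>x\<in>X. \<Union>y\<in>Y. braid_class (x @ y)),
      one = braid_class []\<rparr>"

definition braid_gen :: "nat \<Rightarrow> braid_word set" where
  "braid_gen n = braid_class [(n, True)]"

text \<open>The product \<open>\<sigma>\<^sub>n \<sigma>\<^sub>n\<^sub>-\<^sub>1 \<cdots> \<sigma>\<^sub>1\<close>.\<close>

primrec braid_desc :: "nat \<Rightarrow> braid_word set" where
  "braid_desc 0 = \<one>\<^bsub>braid_group\<^esub>"
| "braid_desc (Suc n) = braid_gen (Suc n) \<otimes>\<^bsub>braid_group\<^esub> braid_desc n"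

definition quotient_emb ::
  "'a cstar \<Rightarrow> 'a free_product_elt set \<Rightarrow> nat \<Rightarrow> 'a \<Rightarrow> 'a free_product_elt set" where
  "quotient_emb A I n = compose (carrier A) (quotient_map (free_product A) I) (free_emb A n)"

definition braidable ::
  "'a cstar \<Rightarrow> 'h hilbert \<Rightarrow> (nat \<Rightarrow> 'a \<Rightarrow> 'h \<Rightarrow> 'h) \<Rightarrow> 'h \<Rightarrow> 'a free_product_elt set \<Rightarrow> bool" where
  "braidable A H \<iota> \<xi> I \<longleftrightarrow> (\<exists>\<psi>. factorizes_via A H \<iota> \<xi> I \<psi> \<and>
     (\<exists>\<rho> \<in> hom braid_group (star_aut_group (cstar_quotient (free_product A) I)).
        (\<forall>g\<in>carrier braid_group. \<forall>x\<in>carrier (cstar_quotient (free_product A) I).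
           \<psi> (\<rho> g x) = \<psi> x) \<and>
        (\<forall>n\<ge>1. quotient_emb A I n =
           compose (carrier A) (\<rho> (braid_desc n)) (quotient_emb A I 0)) \<and>
        (\<forall>n\<ge>2. quotient_emb A I 0 =
           compose (carrier A) (\<rho> (braid_gen n)) (quotient_emb A I 0))))"

end

theory Submission
  imports Defs
begin

text \<open>
  Let \<open>\<Gamma>\<close> be the direct sum of countably many copies of \<open>\<int>\<^sup>2\<close>. The process lives on \<open>\<ell>\<^sup>2(\<Gamma>)\<close> with
  vacuum \<open>\<xi> = \<delta>\<^sub>0\<close>; the generators of the \<open>j\<close>-th torus act as shifts along the \<open>j\<close>-th copy of \<open>\<int>\<^sup>2\<close>,
  multiplied by characters that produce the required commutation phases. The resulting representation \<open>\<Pi>\<close> of the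
  free product kills the twist ideal, and its vacuum state is the product of the traces on ordered words. Modulo the
  ideal homogeneous letters can be reordered, so ordered words span a dense subspace and a state vanishing on the
  ideal is determined there. This identifies the distribution with the product state, and it gives spreadability,
  since strictly increasing index maps preserve both the ideal and the ordered words.

  In a braiding \<open>\<sigma>\<^sub>1\<close> maps the copy 0 to the copy 1 and fixes the copy 2. The image under \<open>\<sigma>\<^sub>1\<close> of
  \<open>i\<^sub>1(u)\<close> then satisfies the commutation relations with the copies 1 and 2 that \<open>i\<^sub>1(u)\<close> satisfies with the
  copies 0 and 2. Let \<open>y \<in> \<ell>\<^sup>2(\<Gamma>)\<close> be the vector obtained from it. Comparing coefficients, rational
  independence forces every \<open>\<gamma>\<close> with \<open>y\<^sub>\<gamma> \<noteq> 0\<close> to have vanishing \<open>u\<close>-degrees in the copies 1 and 2, while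
  their sum has to be 2. Hence \<open>y = 0\<close>, although \<open>y\<close> is the image of \<open>\<xi>\<close> under a unitary.
\<close>

section \<open>Limits and closed subspaces in C*-algebras\<close>

text \<open>Norms, traces, product states and distributions are given by suprema and definite
  descriptions, so existence, uniqueness and continuity all have to be established. Continuity is
  automatic and rests on one fact: for self-adjoint k of norm below 1, the element 1 - k has a
  self-adjoint square root. Hence the norm of a C*-algebra dominates all its C*-seminorms, which
  makes *-homomorphisms contractive and the norm of a free product finite; the same root bounds
  states. Uniqueness then reduces to dense sets of words.

  The vector y is tractable because the represented algebra commutes with the right multiplications
  \<open>Rop\<close>, while left and right multiplication by a generator agree on \<xi>. A
  commutation relation with a generator thus becomes an equation for single coordinates of y, with
  exponents in \<int>\<alpha> + \<int>\<theta> + \<int>.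

  The contradiction has a simple picture: the image would have to stand after copy 1 and before copy
  2, and no index does. The w-generators of these copies detect their u-degrees through \<alpha>,
  the u-generators detect the sum of these degrees through \<theta>.\<close>

lemma complex_ring_simps [simp]:
  "carrier complex_ring = UNIV" "a \<otimes>\<^bsub>complex_ring\<^esub> b = a * b" "\<one>\<^bsub>complex_ring\<^esub> = 1"
  "\<zero>\<^bsub>complex_ring\<^esub> = 0" "a \<oplus>\<^bsub>complex_ring\<^esub> b = a + b"
  by (simp_all add: complex_ring_def)

lemma cring_complex_ring: "cring complex_ring"
proof (rule cringI)
  show "abelian_group complex_ring"
  proof (rule abelian_groupI)
    fix x assume "x \<in> carrier complex_ring"
    show "\<exists>y\<in>carrier complex_ring. y \<oplus>\<^bsub>complex_ring\<^esub> x = \<zero>\<^bsub>complex_ring\<^esub>"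
      by (rule bexI[of _ "- x"]) simp_all
  qed (simp_all add: add.assoc add.commute)
  show "comm_monoid complex_ring"
    by (rule comm_monoidI) (simp_all add: mult.assoc mult.commute)
qed (simp add: algebra_simps)

text \<open>Norm convergence with membership in the carrier built in; \<open>lim_iff_limitin\<close>
  and \<open>closedin_iff_lim\<close> tie it to \<open>cstar_topology\<close>, so that closedness in
  C*-algebras can be treated with sequences.\<close>

definition cstar_lim :: "'a cstar \<Rightarrow> (nat \<Rightarrow> 'a) \<Rightarrow> 'a \<Rightarrow> bool" where
  "cstar_lim A X x \<longleftrightarrow> (\<forall>n. X n \<in> carrier A) \<and> x \<in> carrier A \<and>
     (\<lambda>n. cnorm A (X n \<ominus>\<^bsub>A\<^esub> x)) \<longlonglongrightarrow> 0"

text \<open>The vehicle of all density arguments: a continuous linear statement is shown to define a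
  closed subspace, and a generation lemma then says that a closed subspace containing enough
  elements is everything.\<close>

definition closed_subspace :: "'a cstar \<Rightarrow> 'a set \<Rightarrow> bool" where
  "closed_subspace A W \<longleftrightarrow> W \<subseteq> carrier A \<and> \<zero>\<^bsub>A\<^esub> \<in> W \<and>
     (\<forall>x\<in>W. \<forall>y\<in>W. x \<oplus>\<^bsub>A\<^esub> y \<in> W) \<and> (\<forall>c. \<forall>x\<in>W. c \<odot>\<^bsub>A\<^esub> x \<in> W) \<and>
     (\<forall>X x. (\<forall>n. X n \<in> W) \<and> cstar_lim A X x \<longrightarrow> x \<in> W)"

context cstar_algebra
begin

lemma smult_in [simp, intro]: "x \<in> carrier A \<Longrightarrow> c \<odot> x \<in> carrier A"
  by (rule smult_closed) simp_all

lemma smult_add_left: "x \<in> carrier A \<Longrightarrow> (a + b) \<odot> x = a \<odot> x \<oplus> b \<odot> x"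
  using smult_l_distr[of a b x] by simp

lemma smult_add_right: "x \<in> carrier A \<Longrightarrow> y \<in> carrier A \<Longrightarrow> a \<odot> (x \<oplus> y) = a \<odot> x \<oplus> a \<odot> y"
  using smult_r_distr[of a x y] by simp

lemma smult_smult [simp]: "x \<in> carrier A \<Longrightarrow> a \<odot> (b \<odot> x) = (a * b) \<odot> x"
  using smult_assoc1[of a b x] by simp

lemma smult_1 [simp]: "x \<in> carrier A \<Longrightarrow> 1 \<odot> x = x"
  using smult_one[of x] by simp

lemma smult_0 [simp]: "x \<in> carrier A \<Longrightarrow> 0 \<odot> x = \<zero>"
  using smult_l_null[of x] by simp

lemma smult_zero [simp]: "c \<odot> \<zero> = \<zero>"
  using smult_r_null[of c] by simp

lemma smult_minus1: "x \<in> carrier A \<Longrightarrow> (-1) \<odot> x = \<ominus> x"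
proof -
  assume x: "x \<in> carrier A"
  have "(-1) \<odot> x \<oplus> x = (-1 + 1) \<odot> x"
    using smult_add_left[OF x, of "-1" 1] x by simp
  then have "(-1) \<odot> x \<oplus> x = \<zero>" using x by simp
  moreover have "(-1) \<odot> x = ((-1) \<odot> x \<oplus> x) \<oplus> \<ominus> x"
    using smult_in[OF x, of "-1"] x by algebra
  ultimately show ?thesis using x by simp
qed

lemma minus_eq_smult: "x \<in> carrier A \<Longrightarrow> y \<in> carrier A \<Longrightarrow> x \<ominus> y = x \<oplus> (-1) \<odot> y"
  by (simp add: a_minus_def smult_minus1)

lemma diff_self [simp]: "x \<in> carrier A \<Longrightarrow> x \<ominus> x = \<zero>"
  by algebra

lemma smult_diff_right: "x \<in> carrier A \<Longrightarrow> y \<in> carrier A \<Longrightarrow> a \<odot> (x \<ominus> y) = a \<odot> x \<ominus> a \<odot> y"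
  by (simp add: minus_eq_smult smult_add_right)

lemma smult_one_mult: "x \<in> carrier A \<Longrightarrow> (c \<odot> \<one>) \<otimes> x = c \<odot> x"
  by (simp add: smult_mult_left)

lemma star_in [simp, intro]: "x \<in> carrier A \<Longrightarrow> star A x \<in> carrier A"
  by (rule star_closed)

declare star_star [simp]

lemma star_one [simp]: "star A \<one> = \<one>"
  using star_mult[of "star A \<one>" \<one>] by simp

lemma star_zero [simp]: "star A \<zero> = \<zero>"
  using star_smult[of \<zero> 0] by simp

lemma star_diff: "x \<in> carrier A \<Longrightarrow> y \<in> carrier A \<Longrightarrow> star A (x \<ominus> y) = star A x \<ominus> star A y"
  by (simp add: minus_eq_smult star_add star_smult)

lemma cnorm_zero [simp]: "cnorm A \<zero> = 0"
  by (simp add: cnorm_eq_0)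

lemma cnorm_minus: "x \<in> carrier A \<Longrightarrow> cnorm A (\<ominus> x) = cnorm A x"
  using cnorm_smult[of x "-1"] by (simp add: smult_minus1)

lemma cnorm_diff_commute:
  "x \<in> carrier A \<Longrightarrow> y \<in> carrier A \<Longrightarrow> cnorm A (x \<ominus> y) = cnorm A (y \<ominus> x)"
proof -
  assume xy: "x \<in> carrier A" "y \<in> carrier A"
  then have "\<ominus> (x \<ominus> y) = y \<ominus> x" by algebra
  then show ?thesis using cnorm_minus[of "x \<ominus> y"] xy by simp
qed

lemma cnorm_diff_triangle:
  assumes "x \<in> carrier A" "y \<in> carrier A" "z \<in> carrier A"
  shows "cnorm A (x \<ominus> z) \<le> cnorm A (x \<ominus> y) + cnorm A (y \<ominus> z)"
proof -
  have "x \<ominus> z = (x \<ominus> y) \<oplus> (y \<ominus> z)" using assms by algebra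
  then show ?thesis using assms cnorm_triangle[of "x \<ominus> y" "y \<ominus> z"] by simp
qed

lemma cnorm_reverse_triangle:
  assumes "x \<in> carrier A" "y \<in> carrier A"
  shows "\<bar>cnorm A x - cnorm A y\<bar> \<le> cnorm A (x \<ominus> y)"
proof -
  have "x = (x \<ominus> y) \<oplus> y" "y = (y \<ominus> x) \<oplus> x" using assms by algebra+
  then show ?thesis
    using assms cnorm_triangle[of "x \<ominus> y" y] cnorm_triangle[of "y \<ominus> x" x]
      cnorm_diff_commute[of x y] by simp
qed

text \<open>The C*-identity and submultiplicativity bound the square of the norm of y by the product
  of the norms of \<open>star A y\<close> and y. Cancel one factor, then apply the result to
  \<open>star A x\<close> as well.\<close>

lemma cnorm_star [simp]: "x \<in> carrier A \<Longrightarrow> cnorm A (star A x) = cnorm A x"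
proof -
  have le: "cnorm A y \<le> cnorm A (star A y)" if "y \<in> carrier A" for y
  proof (cases "cnorm A y = 0")
    case False
    have "(cnorm A y)\<^sup>2 \<le> cnorm A (star A y) * cnorm A y"
      using that cstar_identity cnorm_mult[of "star A y" y] by simp
    then show ?thesis using False cnorm_nonneg[OF that]
      by (simp add: power2_eq_square mult_le_cancel_right)
  qed (simp add: that cnorm_nonneg)
  assume "x \<in> carrier A"
  then show ?thesis using le[of x] le[of "star A x"] by simp
qed

lemma Metric: "Metric_space (carrier A) (cstar_dist A)"
proof
  show "0 \<le> cstar_dist A x y" for x y by (simp add: cstar_dist_def cnorm_nonneg)
  show "cstar_dist A x y = cstar_dist A y x" for x y
    by (simp add: cstar_dist_def cnorm_diff_commute)
  show "cstar_dist A x y = 0 \<longleftrightarrow> x = y" if "x \<in> carrier A" "y \<in> carrier A" for x y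
    using that by (simp add: cstar_dist_def cnorm_eq_0)
  show "cstar_dist A x z \<le> cstar_dist A x y + cstar_dist A y z"
    if "x \<in> carrier A" "y \<in> carrier A" "z \<in> carrier A" for x y z
    using that cnorm_diff_triangle by (simp add: cstar_dist_def)
qed

lemma lim_in: "cstar_lim A X x \<Longrightarrow> X n \<in> carrier A" "cstar_lim A X x \<Longrightarrow> x \<in> carrier A"
  by (auto simp: cstar_lim_def)

lemma lim_iff_limitin:
  "cstar_lim A X x \<longleftrightarrow> (\<forall>n. X n \<in> carrier A) \<and> limitin (cstar_topology A) X x sequentially"
proof -
  interpret Metric_space "carrier A" "cstar_dist A" by (rule Metric)
  show ?thesis
    by (auto simp: cstar_lim_def cstar_topology_def limit_metric_sequentially LIMSEQ_iff
        cstar_dist_def cnorm_nonneg)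
qed

lemma closedin_iff_lim:
  "closedin (cstar_topology A) S \<longleftrightarrow>
     S \<subseteq> carrier A \<and> (\<forall>X x. (\<forall>n. X n \<in> S) \<and> cstar_lim A X x \<longrightarrow> x \<in> S)"
proof -
  interpret Metric_space "carrier A" "cstar_dist A" by (rule Metric)
  show ?thesis
    unfolding lim_iff_limitin cstar_topology_def metric_closedin_iff_sequentially_closed
      image_subset_iff ball_UNIV
    by (meson subsetD)
qed

lemma Cauchy_lim:
  assumes "\<And>n. X n \<in> carrier A"
    and "\<And>\<epsilon>. \<epsilon> > 0 \<Longrightarrow> \<exists>M. \<forall>m\<ge>M. \<forall>n\<ge>M. cnorm A (X m \<ominus> X n) < \<epsilon>"
  obtains x where "cstar_lim A X x"
proof -
  interpret Metric_space "carrier A" "cstar_dist A" by (rule Metric)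
  have "MCauchy X"
    unfolding MCauchy_def cstar_dist_def using assms by (simp add: image_subset_iff)
  then show ?thesis
    using complete assms(1) that unfolding mcomplete_def lim_iff_limitin cstar_topology_def by blast
qed

lemma lim_const: "x \<in> carrier A \<Longrightarrow> cstar_lim A (\<lambda>n. x) x"
  by (simp add: cstar_lim_def)

lemma lim_leI:
  assumes "\<And>n. X n \<in> carrier A" "x \<in> carrier A" "\<And>n. cnorm A (X n \<ominus> x) \<le> f n" "f \<longlonglongrightarrow> 0"
  shows "cstar_lim A X x"
proof -
  have "(\<lambda>n. cnorm A (X n \<ominus> x)) \<longlonglongrightarrow> 0"
    by (rule tendsto_sandwich[of "\<lambda>_. 0" _ _ f]) (use assms cnorm_nonneg in simp_all)
  then show ?thesis using assms by (simp add: cstar_lim_def)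
qed

lemma lim_add:
  assumes "cstar_lim A X x" "cstar_lim A Y y"
  shows "cstar_lim A (\<lambda>n. X n \<oplus> Y n) (x \<oplus> y)"
proof (rule lim_leI)
  note [simp] = lim_in[OF assms(1)] lim_in[OF assms(2)]
  show "cnorm A (X n \<oplus> Y n \<ominus> (x \<oplus> y)) \<le> cnorm A (X n \<ominus> x) + cnorm A (Y n \<ominus> y)" for n
  proof -
    have "X n \<oplus> Y n \<ominus> (x \<oplus> y) = (X n \<ominus> x) \<oplus> (Y n \<ominus> y)"
      using lim_in[OF assms(1)] lim_in[OF assms(2)] by algebra
    then show ?thesis by (simp add: cnorm_triangle)
  qed
  show "(\<lambda>n. cnorm A (X n \<ominus> x) + cnorm A (Y n \<ominus> y)) \<longlonglongrightarrow> 0"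
    using assms tendsto_add[of _ 0 _ _ 0] by (force simp: cstar_lim_def)
qed (use lim_in[OF assms(1)] lim_in[OF assms(2)] in auto)

lemma lim_smult:
  assumes "cstar_lim A X x"
  shows "cstar_lim A (\<lambda>n. c \<odot> X n) (c \<odot> x)"
  using lim_in[OF assms] tendsto_mult_left[of "\<lambda>n. cnorm A (X n \<ominus> x)" 0 _ "cmod c"] assms
  by (simp add: cstar_lim_def cnorm_smult flip: smult_diff_right)

lemma lim_diff:
  assumes "cstar_lim A X x" "cstar_lim A Y y"
  shows "cstar_lim A (\<lambda>n. X n \<ominus> Y n) (x \<ominus> y)"
  using lim_add[OF assms(1) lim_smult[OF assms(2), of "-1"]] lim_in[OF assms(1)] lim_in[OF assms(2)]
  by (simp add: minus_eq_smult)

lemma lim_star: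
  assumes "cstar_lim A X x"
  shows "cstar_lim A (\<lambda>n. star A (X n)) (star A x)"
  using assms lim_in[OF assms] by (simp add: cstar_lim_def flip: star_diff)

lemma lim_cnorm:
  assumes "cstar_lim A X x"
  shows "(\<lambda>n. cnorm A (X n)) \<longlonglongrightarrow> cnorm A x"
proof -
  have "(\<lambda>n. cnorm A (X n) - cnorm A x) \<longlonglongrightarrow> 0"
    by (rule Lim_null_comparison[of _ "\<lambda>n. cnorm A (X n \<ominus> x)"])
      (use assms lim_in[OF assms] cnorm_reverse_triangle in \<open>auto simp: cstar_lim_def\<close>)
  then show ?thesis by (simp add: LIM_zero_iff)
qed

lemma lim_mult:
  assumes "cstar_lim A X x" "cstar_lim A Y y"
  shows "cstar_lim A (\<lambda>n. X n \<otimes> Y n) (x \<otimes> y)"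
proof (rule lim_leI)
  note in1 = lim_in[OF assms(1)] and in2 = lim_in[OF assms(2)]
  show "cnorm A (X n \<otimes> Y n \<ominus> (x \<otimes> y)) \<le>
      cnorm A (X n) * cnorm A (Y n \<ominus> y) + cnorm A (X n \<ominus> x) * cnorm A y" for n
  proof -
    have "X n \<otimes> Y n \<ominus> (x \<otimes> y) = X n \<otimes> (Y n \<ominus> y) \<oplus> (X n \<ominus> x) \<otimes> y"
      using in1 in2 by algebra
    also have "cnorm A \<dots> \<le> cnorm A (X n \<otimes> (Y n \<ominus> y)) + cnorm A ((X n \<ominus> x) \<otimes> y)"
      using in1 in2 by (intro cnorm_triangle) auto
    also have "\<dots> \<le> cnorm A (X n) * cnorm A (Y n \<ominus> y) + cnorm A (X n \<ominus> x) * cnorm A y"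
      using in1 in2 by (intro add_mono cnorm_mult) auto
    finally show ?thesis .
  qed
  have "(\<lambda>n. cnorm A (X n) * cnorm A (Y n \<ominus> y) + cnorm A (X n \<ominus> x) * cnorm A y)
      \<longlonglongrightarrow> cnorm A x * 0 + 0 * cnorm A y"
    using assms by (intro tendsto_intros lim_cnorm) (auto simp: cstar_lim_def)
  then show "(\<lambda>n. cnorm A (X n) * cnorm A (Y n \<ominus> y) + cnorm A (X n \<ominus> x) * cnorm A y) \<longlonglongrightarrow> 0"
    by simp
qed (use lim_in[OF assms(1)] lim_in[OF assms(2)] in auto)

lemma lim_unique:
  assumes "cstar_lim A X x" "cstar_lim A X y"
  shows "x = y"
proof -
  have "cstar_lim A (\<lambda>n. \<zero>) (x \<ominus> y)"
    using lim_diff[OF assms] lim_in[OF assms(1)] by simp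
  then have "(\<lambda>n::nat. 0) \<longlonglongrightarrow> cnorm A (x \<ominus> y)"
    using lim_cnorm by fastforce
  then have "cnorm A (x \<ominus> y) = 0" using LIMSEQ_unique tendsto_const by blast
  then show ?thesis using lim_in(2)[OF assms(1)] lim_in(2)[OF assms(2)] by (simp add: cnorm_eq_0)
qed

lemma lim_Suc: "cstar_lim A X x \<Longrightarrow> cstar_lim A (\<lambda>n. X (Suc n)) x"
  unfolding cstar_lim_def using LIMSEQ_Suc by blast

lemma closed_subspaceI:
  assumes "W \<subseteq> carrier A" "\<zero> \<in> W" "\<And>x y. x \<in> W \<Longrightarrow> y \<in> W \<Longrightarrow> x \<oplus> y \<in> W"
    "\<And>c x. x \<in> W \<Longrightarrow> c \<odot> x \<in> W" "\<And>X x. (\<And>n. X n \<in> W) \<Longrightarrow> cstar_lim A X x \<Longrightarrow> x \<in> W"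
  shows "closed_subspace A W"
  unfolding closed_subspace_def using assms by meson

lemma closed_subspace_carrier: "closed_subspace A (carrier A)"
  by (rule closed_subspaceI) (auto dest: lim_in)

end

section \<open>Square roots near the unit and domination of C*-seminorms by the norm\<close>

context cstar_algebra
begin

lemma ring_A: "ring A"
  by unfold_locales

lemmas one_in = ring.ring_simprules(6)[OF ring_A]
lemmas mult_in = ring.ring_simprules(5)[OF ring_A]
lemmas mult_assoc = ring.ring_simprules(11)[OF ring_A]
lemmas one_mult = ring.ring_simprules(12)[OF ring_A]
lemmas mult_one = monoid.r_one[OF ring.is_monoid[OF ring_A]]
lemmas distrib_right = ring.ring_simprules(13)[OF ring_A]
lemmas distrib_left = ring.ring_simprules(23)[OF ring_A]

lemma Cauchy_geometric:
  assumes X: "\<And>n. X n \<in> carrier A" and r: "0 \<le> r" "r < 1"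
    and d: "\<And>n p. cnorm A (X (n + p) \<ominus> X n) \<le> r ^ n * C"
  obtains x where "cstar_lim A X x"
proof -
  have C: "0 \<le> C" using d[of 0 0] X by simp
  have "(\<lambda>n. r ^ n * C) \<longlonglongrightarrow> 0 * C"
    using r by (intro tendsto_intros LIMSEQ_power_zero) auto
  then have lim: "(\<lambda>n. r ^ n * C) \<longlonglongrightarrow> 0" by simp
  show thesis
  proof (rule Cauchy_lim[OF X _ that])
    fix \<epsilon> :: real assume "\<epsilon> > 0"
    then obtain M where M: "\<And>n. n \<ge> M \<Longrightarrow> r ^ n * C < \<epsilon>"
      using order_tendstoD(2)[OF lim] by (auto simp: eventually_sequentially)
    have le: "cnorm A (X m \<ominus> X n) < \<epsilon>" if "m \<ge> n" "n \<ge> M" for m n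
      using d[of n "m - n"] M[OF that(2)] that(1) by simp
    have "cnorm A (X m \<ominus> X n) < \<epsilon>" if "m \<ge> M" "n \<ge> M" for m n
      using le[of n m] le[of m n] that cnorm_diff_commute[OF X X] by (metis nle_le)
    then show "\<exists>M. \<forall>m\<ge>M. \<forall>n\<ge>M. cnorm A (X m \<ominus> X n) < \<epsilon>" by blast
  qed
qed

text \<open>Iterate \<open>y \<mapsto> (k + y\<^sup>2)/2\<close>, a contraction of the ball of radius \<open>\<parallel>k\<parallel>\<close>; a fixed point satisfies
  \<open>(1 - y)\<^sup>2 = 1 - k\<close>.\<close>

lemma sqrt_one_minus:
  assumes k: "k \<in> carrier A" "star A k = k" "cnorm A k < 1"
    and c: "c \<in> carrier A" "c \<otimes> k = k \<otimes> c"
  obtains b where "b \<in> carrier A" "star A b = b" "b \<otimes> b = \<one> \<ominus> k" "c \<otimes> b = b \<otimes> c"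
proof -
  define r where "r = cnorm A k"
  have r: "0 \<le> r" "r < 1" using k cnorm_nonneg by (auto simp: r_def)
  define T where "T y = (1/2) \<odot> (k \<oplus> y \<otimes> y)" for y
  \<comment> \<open>Self-adjointness and commutation with c are preserved by \<open>T\<close> and
    survive limits, so the fixed point inherits both.\<close>
  define M where "M = {y \<in> carrier A. cnorm A y \<le> r \<and> star A y = y \<and> c \<otimes> y = y \<otimes> c}"
  have zeroM: "\<zero> \<in> M" using r c by (simp add: M_def ring.ring_simprules[OF ring_A])
  have TM: "T y \<in> M" if "y \<in> M" for y
  proof -
    have y: "y \<in> carrier A" "cnorm A y \<le> r" "star A y = y" "c \<otimes> y = y \<otimes> c"
      using that by (auto simp: M_def)
    have "cnorm A (y \<otimes> y) \<le> r * r"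
      using cnorm_mult[OF y(1) y(1)] y(2) cnorm_nonneg[OF y(1)] by (meson mult_mono order_trans r(1))
    also have "\<dots> \<le> r" using r by (simp add: mult_left_le)
    finally have "cnorm A (k \<oplus> y \<otimes> y) \<le> r + r"
      using cnorm_triangle[of k "y \<otimes> y"] k y by (simp add: r_def)
    then have 1: "cnorm A (T y) \<le> r" using k y by (simp add: T_def cnorm_smult)
    have 2: "star A (T y) = T y" using k y by (simp add: T_def star_smult star_add star_mult)
    have "c \<otimes> (y \<otimes> y) = (y \<otimes> y) \<otimes> c" using c(1) y(1,4) mult_assoc by metis
    moreover have "c \<otimes> (k \<oplus> y \<otimes> y) = c \<otimes> k \<oplus> c \<otimes> (y \<otimes> y)" using c(1) k(1) y(1) by algebra
    moreover have "(k \<oplus> y \<otimes> y) \<otimes> c = k \<otimes> c \<oplus> (y \<otimes> y) \<otimes> c" using c(1) k(1) y(1) by algebra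
    ultimately have "c \<otimes> (k \<oplus> y \<otimes> y) = (k \<oplus> y \<otimes> y) \<otimes> c" using c(2) by simp
    then have "c \<otimes> T y = T y \<otimes> c"
      using c k y by (simp add: T_def smult_mult_left smult_mult_right)
    with 1 2 k y show ?thesis by (simp add: M_def T_def)
  qed
  have contr: "cnorm A (T y \<ominus> T z) \<le> r * cnorm A (y \<ominus> z)" if "y \<in> M" "z \<in> M" for y z
  proof -
    have y: "y \<in> carrier A" "cnorm A y \<le> r" and z: "z \<in> carrier A" "cnorm A z \<le> r"
      using that by (auto simp: M_def)
    \<comment> \<open>As y and z need not commute, the difference of their squares is split as y(y -
      z) + (y - z)z. Each term is at most r times the norm of y - z, and the factor 1/2 in
      \<open>T\<close> compensates for there being two.\<close>
    have "(k \<oplus> y \<otimes> y) \<ominus> (k \<oplus> z \<otimes> z) = y \<otimes> (y \<ominus> z) \<oplus> (y \<ominus> z) \<otimes> z"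
      using k y z by algebra
    then have "T y \<ominus> T z = (1/2) \<odot> (y \<otimes> (y \<ominus> z) \<oplus> (y \<ominus> z) \<otimes> z)"
      using k y z by (simp add: T_def flip: smult_diff_right)
    then have "cnorm A (T y \<ominus> T z) \<le> (cnorm A (y \<otimes> (y \<ominus> z)) + cnorm A ((y \<ominus> z) \<otimes> z)) / 2"
      using y z cnorm_triangle[of "y \<otimes> (y \<ominus> z)" "(y \<ominus> z) \<otimes> z"] by (simp add: cnorm_smult)
    also have "\<dots> \<le> (r * cnorm A (y \<ominus> z) + r * cnorm A (y \<ominus> z)) / 2"
    proof -
      have "cnorm A (y \<otimes> (y \<ominus> z)) \<le> r * cnorm A (y \<ominus> z)"
        using cnorm_mult[of y "y \<ominus> z"] y z mult_right_mono[OF y(2), of "cnorm A (y \<ominus> z)"]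
          cnorm_nonneg[of "y \<ominus> z"] by simp
      moreover have "cnorm A ((y \<ominus> z) \<otimes> z) \<le> r * cnorm A (y \<ominus> z)"
        using mult.commute[of r "cnorm A (y \<ominus> z)"] cnorm_mult[of "y \<ominus> z" z] y z mult_left_mono[OF z(2), of "cnorm A (y \<ominus> z)"]
          cnorm_nonneg[of "y \<ominus> z"] by (simp add: mult.commute)
      ultimately show ?thesis by (intro divide_right_mono add_mono) auto
    qed
    finally show ?thesis by simp
  qed
  define Y where "Y n = (T ^^ n) \<zero>" for n
  have YM: "Y n \<in> M" for n by (induction n) (simp_all add: Y_def zeroM TM)
  then have Yin: "Y n \<in> carrier A" for n by (simp add: M_def)
  have geo: "cnorm A (Y (n + p) \<ominus> Y n) \<le> r ^ n * r" for n p
  proof (induction n)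
    case 0
    have "Y p \<ominus> \<zero> = Y p" using Yin[of p] by algebra
    then show ?case using YM[of p] by (simp add: M_def) (simp add: Y_def)
  next
    case (Suc n)
    have "cnorm A (Y (Suc n + p) \<ominus> Y (Suc n)) \<le> r * cnorm A (Y (n + p) \<ominus> Y n)"
      using contr[OF YM YM] by (simp add: Y_def)
    also have "\<dots> \<le> r * (r ^ n * r)" using Suc r by (intro mult_left_mono) auto
    finally show ?case by simp
  qed
  obtain y where y: "cstar_lim A Y y" using Cauchy_geometric[OF Yin r geo] by blast
  have yin: "y \<in> carrier A" using lim_in[OF y] by simp
  have "cstar_lim A (\<lambda>n. T (Y n)) (T y)"
    unfolding T_def by (intro lim_smult lim_add lim_mult lim_const y k)
  moreover have "cstar_lim A (\<lambda>n. T (Y n)) y"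
    using lim_Suc[OF y] by (simp add: Y_def)
  ultimately have "T y = y" by (rule lim_unique)
  then have "2 \<odot> y = k \<oplus> y \<otimes> y" proof -
    assume "T y = y"
    moreover have "2 \<odot> T y = k \<oplus> y \<otimes> y" using yin k by (simp add: T_def)
    ultimately show ?thesis by simp
  qed
  moreover have "2 \<odot> y = y \<oplus> y" using smult_add_left[OF yin, of 1 1] yin by simp
  ultimately have yy: "y \<oplus> y = k \<oplus> y \<otimes> y" by simp
  have "(e \<ominus> y) \<otimes> (e \<ominus> y) = e \<otimes> e \<ominus> (e \<otimes> y \<oplus> y \<otimes> e) \<oplus> y \<otimes> y" if "e \<in> carrier A" for e
    using yin that by algebra
  from this[OF one_in] have "(\<one> \<ominus> y) \<otimes> (\<one> \<ominus> y) = \<one> \<ominus> (y \<oplus> y) \<oplus> y \<otimes> y"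
    using yin by (simp add: one_mult mult_one)
  also have "\<dots> = \<one> \<ominus> k" unfolding yy using yin k by algebra
  finally have 1: "(\<one> \<ominus> y) \<otimes> (\<one> \<ominus> y) = \<one> \<ominus> k" .
  have "star A y = y"
    using lim_unique[OF lim_star[OF y] ] y YM by (simp add: M_def)
  then have 2: "star A (\<one> \<ominus> y) = \<one> \<ominus> y" using yin by (simp add: star_diff)
  have "cstar_lim A (\<lambda>n. c \<otimes> Y n) (c \<otimes> y)" "cstar_lim A (\<lambda>n. Y n \<otimes> c) (y \<otimes> c)"
    by (intro lim_mult lim_const y c)+
  moreover have "(\<lambda>n. c \<otimes> Y n) = (\<lambda>n. Y n \<otimes> c)" using YM by (simp add: M_def)
  ultimately have "c \<otimes> y = y \<otimes> c" using lim_unique by simp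
  moreover have "c \<otimes> (e \<ominus> y) = c \<otimes> e \<ominus> c \<otimes> y" "(e \<ominus> y) \<otimes> c = e \<otimes> c \<ominus> y \<otimes> c"
    if "e \<in> carrier A" for e using c yin that by algebra+
  note this[OF one_in]
  ultimately have 3: "c \<otimes> (\<one> \<ominus> y) = (\<one> \<ominus> y) \<otimes> c"
    using c by (simp add: one_mult mult_one)
  show ?thesis using that[of "\<one> \<ominus> y"] 1 2 3 yin by simp
qed

text \<open>Homogeneity turns a bound on the open unit ball into a bound by the norm: divide x by
  its norm plus e and let e tend to 0. The side condition \<open>P\<close>, such as
  self-adjointness, has to survive real scaling.\<close>

lemma scaled_le_cnorm:
  assumes "\<And>c x. x \<in> carrier A \<Longrightarrow> f (c \<odot> x) = cmod c * f x"
    and "\<And>x. x \<in> carrier A \<Longrightarrow> cnorm A x < 1 \<Longrightarrow> P x \<Longrightarrow> f x \<le> 1"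
    and P: "\<And>t x. x \<in> carrier A \<Longrightarrow> P x \<Longrightarrow> P (complex_of_real t \<odot> x)"
    and x: "x \<in> carrier A" "P x"
  shows "f x \<le> cnorm A x"
proof (rule field_le_epsilon)
  fix e :: real assume e: "0 < e"
  let ?t = "cnorm A x + e"
  have t: "?t > 0" using e cnorm_nonneg[OF x(1)] by simp
  let ?y = "complex_of_real (1 / ?t) \<odot> x"
  have "f ?y \<le> 1"
    using e t x cnorm_nonneg[OF x(1)] by (intro assms(2) P) (auto simp: cnorm_smult norm_divide simp del: of_real_add)
  moreover have "f ?y = f x / ?t"
    using assms(1)[OF x(1), of "complex_of_real (1 / ?t)"] t by (simp add: norm_divide del: of_real_add)
  ultimately show "f x \<le> ?t" using t by (simp add: divide_le_eq)
qed

text \<open>A self-adjoint \<open>k\<close> with \<open>\<parallel>k\<parallel> < 1\<close> is the real part of the unitary \<open>k + i b\<close>, where \<open>b\<^sup>2 = 1 - k\<^sup>2\<close>.\<close>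

lemma cstar_seminorm_le_cnorm:
  assumes pos: "\<And>x. x \<in> carrier A \<Longrightarrow> 0 \<le> q x"
    and tri: "\<And>x y. x \<in> carrier A \<Longrightarrow> y \<in> carrier A \<Longrightarrow> q (x \<oplus> y) \<le> q x + q y"
    and sc: "\<And>c x. x \<in> carrier A \<Longrightarrow> q (c \<odot> x) = cmod c * q x"
    and cst: "\<And>x. x \<in> carrier A \<Longrightarrow> q (star A x \<otimes> x) = (q x)\<^sup>2"
    and x: "x \<in> carrier A"
  shows "q x \<le> cnorm A x"
proof -
  \<comment> \<open>The unit is a self-adjoint idempotent, so the C*-identity forces
    \<open>q \<one>\<close> to be 0 or 1.\<close>
  have "q \<one> = (q \<one>)\<^sup>2" using cst[of \<one>] by (simp add: ring.ring_simprules[OF ring_A])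
  then have "q \<one> * (q \<one> - 1) = 0" by (simp add: algebra_simps power2_eq_square)
  then have q1: "q \<one> \<le> 1" by auto
  have uni: "q y \<le> 1" if "y \<in> carrier A" "star A y \<otimes> y = \<one>" for y
  proof -
    have "(q y)\<^sup>2 \<le> 1\<^sup>2" using cst[OF that(1)] that(2) q1 by simp
    then show ?thesis by (rule power2_le_imp_le) simp
  qed
  have sa: "q k \<le> 1" if k: "k \<in> carrier A" "cnorm A k < 1" "star A k = k" for k
  proof -
    have "cnorm A (k \<otimes> k) \<le> cnorm A k * cnorm A k" using cnorm_mult k by simp
    also have "\<dots> < 1" using k cnorm_nonneg[OF k(1)] by (metis mult_strict_mono' mult_1)
    finally have "cnorm A (k \<otimes> k) < 1" .
    \<comment> \<open>k commutes with its own square, so the root b can be taken to commute with k;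
      this is what makes k + ib unitary.\<close>
    moreover have "star A (k \<otimes> k) = k \<otimes> k" "k \<otimes> (k \<otimes> k) = k \<otimes> k \<otimes> k"
      using k by (simp_all add: star_mult mult_assoc)
    ultimately obtain b where
      b: "b \<in> carrier A" "star A b = b" "b \<otimes> b = \<one> \<ominus> k \<otimes> k" "k \<otimes> b = b \<otimes> k"
      using sqrt_one_minus[of "k \<otimes> k" k] k(1) by (metis mult_in)
    let ?ib = "\<i> \<odot> b"
    have ib: "?ib \<in> carrier A" "k \<otimes> ?ib = ?ib \<otimes> k" "?ib \<otimes> ?ib = k \<otimes> k \<ominus> \<one>" "star A ?ib = \<ominus> ?ib"
    proof -
      have "?ib \<otimes> ?ib = (-1) \<odot> (\<one> \<ominus> k \<otimes> k)"
        using b k by (simp add: smult_mult_left smult_mult_right)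
      also have "\<dots> = k \<otimes> k \<ominus> \<one>" using k by (simp add: smult_minus1) algebra
      finally show "?ib \<otimes> ?ib = k \<otimes> k \<ominus> \<one>" .
    qed (use b k smult_minus1[of ?ib] in \<open>auto simp: smult_mult_left smult_mult_right star_smult\<close>)
    have "(k \<ominus> ?ib) \<otimes> (k \<oplus> ?ib) = k \<otimes> k \<oplus> k \<otimes> ?ib \<ominus> ?ib \<otimes> k \<ominus> ?ib \<otimes> ?ib"
      using k ib(1) by algebra
    also have "\<dots> = \<one>" unfolding ib(2,3) using k ib(1) by algebra
    finally have u: "(k \<ominus> ?ib) \<otimes> (k \<oplus> ?ib) = \<one>" .
    have "(k \<oplus> ?ib) \<otimes> (k \<ominus> ?ib) = k \<otimes> k \<ominus> k \<otimes> ?ib \<oplus> ?ib \<otimes> k \<ominus> ?ib \<otimes> ?ib"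
      using k ib(1) by algebra
    also have "\<dots> = \<one>" unfolding ib(2,3) using k ib(1) by algebra
    finally have u': "(k \<oplus> ?ib) \<otimes> (k \<ominus> ?ib) = \<one>" .
    have st: "star A (k \<oplus> ?ib) = k \<ominus> ?ib" "star A (k \<ominus> ?ib) = k \<oplus> ?ib"
    proof -
      have "k \<oplus> \<ominus> z = k \<ominus> z" "k \<ominus> \<ominus> z = k \<oplus> z" if "z \<in> carrier A" for z
        using k(1) that by algebra+
      from this[OF ib(1)] show "star A (k \<oplus> ?ib) = k \<ominus> ?ib" "star A (k \<ominus> ?ib) = k \<oplus> ?ib"
        using star_add[OF k(1) ib(1)] star_diff[OF k(1) ib(1)] unfolding ib(4) k(3) by simp_all
    qed
    have "q (k \<oplus> ?ib) \<le> 1" "q (k \<ominus> ?ib) \<le> 1" using uni u u' st k ib(1) by simp_all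
    moreover have "(k \<oplus> ?ib) \<oplus> (k \<ominus> ?ib) = 2 \<odot> k"
    proof -
      have "2 \<odot> k = k \<oplus> k" using smult_add_left[OF k(1), of 1 1] k by simp
      moreover have "(k \<oplus> ?ib) \<oplus> (k \<ominus> ?ib) = k \<oplus> k" using k(1) ib(1) by algebra
      ultimately show ?thesis by simp
    qed
    \<comment> \<open>The adjoint k - ib is unitary as well, and 2k is the sum of these two
      unitaries.\<close>
    ultimately have "q (2 \<odot> k) \<le> 2" using tri[of "k \<oplus> ?ib" "k \<ominus> ?ib"] k ib(1) by simp
    then show ?thesis using sc[OF k(1), of 2] by simp
  qed
  have sa': "q k \<le> cnorm A k" if "k \<in> carrier A" "star A k = k" for k
    by (rule scaled_le_cnorm[where f = q and P = "\<lambda>k. star A k = k", OF sc])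
      (simp_all add: that sa star_smult)
  \<comment> \<open>A general x is reduced to the self-adjoint case through x*x, on which both
    C*-identities give squares.\<close>
  have "q (star A x \<otimes> x) \<le> cnorm A (star A x \<otimes> x)"
    by (rule sa') (use x in \<open>simp_all add: star_mult\<close>)
  then have "(q x)\<^sup>2 \<le> (cnorm A x)\<^sup>2"
    unfolding cst[OF x] cstar_identity[OF x] .
  then show ?thesis using cnorm_nonneg[OF x] by (rule power2_le_imp_le)
qed

end

section \<open>Homomorphisms and states\<close>

lemma star_homD:
  assumes "h \<in> star_hom A B"
  shows "x \<in> carrier A \<Longrightarrow> h x \<in> carrier B"
    "x \<in> carrier A \<Longrightarrow> y \<in> carrier A \<Longrightarrow> h (x \<otimes>\<^bsub>A\<^esub> y) = h x \<otimes>\<^bsub>B\<^esub> h y"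
    "x \<in> carrier A \<Longrightarrow> y \<in> carrier A \<Longrightarrow> h (x \<oplus>\<^bsub>A\<^esub> y) = h x \<oplus>\<^bsub>B\<^esub> h y"
    "x \<in> carrier A \<Longrightarrow> h (c \<odot>\<^bsub>A\<^esub> x) = c \<odot>\<^bsub>B\<^esub> h x"
    "x \<in> carrier A \<Longrightarrow> h (star A x) = star B (h x)"
    "h \<one>\<^bsub>A\<^esub> = \<one>\<^bsub>B\<^esub>" "h \<in> extensional (carrier A)"
  using assms by (auto simp: star_hom_def ring_hom_def)

lemma star_homI:
  assumes "h \<in> extensional (carrier A)"
    "\<And>x. x \<in> carrier A \<Longrightarrow> h x \<in> carrier B"
    "\<And>x y. x \<in> carrier A \<Longrightarrow> y \<in> carrier A \<Longrightarrow> h (x \<otimes>\<^bsub>A\<^esub> y) = h x \<otimes>\<^bsub>B\<^esub> h y"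
    "\<And>x y. x \<in> carrier A \<Longrightarrow> y \<in> carrier A \<Longrightarrow> h (x \<oplus>\<^bsub>A\<^esub> y) = h x \<oplus>\<^bsub>B\<^esub> h y"
    "\<And>c x. x \<in> carrier A \<Longrightarrow> h (c \<odot>\<^bsub>A\<^esub> x) = c \<odot>\<^bsub>B\<^esub> h x"
    "\<And>x. x \<in> carrier A \<Longrightarrow> h (star A x) = star B (h x)"
    "h \<one>\<^bsub>A\<^esub> = \<one>\<^bsub>B\<^esub>"
  shows "h \<in> star_hom A B"
  using assms by (auto simp: star_hom_def ring_hom_def)

text \<open>A common frame for *-homomorphisms and for multiplication by a fixed element, so that
  preimages and equalizers are shown to be closed once for both.\<close>

definition cont_linear :: "'a cstar \<Rightarrow> 'b cstar \<Rightarrow> ('a \<Rightarrow> 'b) \<Rightarrow> bool" where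
  "cont_linear A B f \<longleftrightarrow> f \<in> carrier A \<rightarrow> carrier B \<and>
     (\<forall>x\<in>carrier A. \<forall>y\<in>carrier A. f (x \<oplus>\<^bsub>A\<^esub> y) = f x \<oplus>\<^bsub>B\<^esub> f y) \<and>
     (\<forall>c. \<forall>x\<in>carrier A. f (c \<odot>\<^bsub>A\<^esub> x) = c \<odot>\<^bsub>B\<^esub> f x) \<and>
     (\<forall>X x. cstar_lim A X x \<longrightarrow> cstar_lim B (\<lambda>n. f (X n)) (f x))"

text \<open>Kept apart from \<open>cont_linear\<close> because the scalars occur here as the type
  \<open>complex\<close> and not as a \<open>cstar\<close> record.\<close>

definition bounded_functional :: "'a cstar \<Rightarrow> ('a \<Rightarrow> complex) \<Rightarrow> bool" where
  "bounded_functional A f \<longleftrightarrow>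
     (\<forall>x\<in>carrier A. \<forall>y\<in>carrier A. f (x \<oplus>\<^bsub>A\<^esub> y) = f x + f y) \<and>
     (\<forall>c. \<forall>x\<in>carrier A. f (c \<odot>\<^bsub>A\<^esub> x) = c * f x) \<and>
     (\<exists>K. \<forall>x\<in>carrier A. cmod (f x) \<le> K * cnorm A x)"

lemma closed_subspaceD:
  "closed_subspace A W \<Longrightarrow> (\<And>n. X n \<in> W) \<Longrightarrow> cstar_lim A X x \<Longrightarrow> x \<in> W"
  unfolding closed_subspace_def by meson

lemma closed_subspace_in:
  "closed_subspace A W \<Longrightarrow> x \<in> W \<Longrightarrow> x \<in> carrier A"
  unfolding closed_subspace_def by blast

context cstar_algebra
begin

lemma minus_in: "x \<in> carrier A \<Longrightarrow> y \<in> carrier A \<Longrightarrow> x \<ominus> y \<in> carrier A"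
  by simp

lemma star_hom_diff:
  assumes h: "h \<in> star_hom A B" and B: "cstar_algebra B" and "x \<in> carrier A" "y \<in> carrier A"
  shows "h (x \<ominus> y) = h x \<ominus>\<^bsub>B\<^esub> h y"
  using assms star_homD[OF h] by (simp add: minus_eq_smult cstar_algebra.minus_eq_smult[OF B])

lemma star_hom_zero:
  assumes h: "h \<in> star_hom A B" and B: "cstar_algebra B"
  shows "h \<zero> = \<zero>\<^bsub>B\<^esub>"
  using star_homD(4)[OF h, of \<zero> 0] star_homD(1)[OF h, of \<zero>] by (simp add: cstar_algebra.smult_0[OF B])

text \<open>Pulling the norm of \<open>B\<close> back along \<open>h\<close> gives a C*-seminorm on
  \<open>A\<close>, and the norm of \<open>A\<close> dominates all of these.\<close>

lemma star_hom_contractive: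
  assumes h: "h \<in> star_hom A B" and B: "cstar_algebra B" and x: "x \<in> carrier A"
  shows "cnorm B (h x) \<le> cnorm A x"
proof -
  interpret B: cstar_algebra B by (rule B)
  note H = star_homD[OF h]
  show ?thesis
    by (rule cstar_seminorm_le_cnorm[of "\<lambda>x. cnorm B (h x)"])
      (auto simp: H x B.cnorm_nonneg B.cnorm_triangle B.cnorm_smult B.cstar_identity)
qed

lemma star_hom_cont_linear:
  assumes h: "h \<in> star_hom A B" and B: "cstar_algebra B"
  shows "cont_linear A B h"
proof -
  interpret B: cstar_algebra B by (rule B)
  note H = star_homD[OF h]
  have "cstar_lim B (\<lambda>n. h (X n)) (h x)" if X: "cstar_lim A X x" for X x
  proof (rule B.lim_leI)
    show "cnorm B (h (X n) \<ominus>\<^bsub>B\<^esub> h x) \<le> cnorm A (X n \<ominus> x)" for n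
      using star_hom_contractive[OF h B] lim_in[OF X] by (simp flip: star_hom_diff[OF h B])
    show "(\<lambda>n. cnorm A (X n \<ominus> x)) \<longlonglongrightarrow> 0" using X by (simp add: cstar_lim_def)
  qed (use lim_in[OF X] H in auto)
  then show ?thesis using H by (auto simp: cont_linear_def)
qed

lemma cont_linear_mult_left: "a \<in> carrier A \<Longrightarrow> cont_linear A A (\<lambda>x. a \<otimes> x)"
  unfolding cont_linear_def
  by (auto simp: smult_mult_right ring.ring_simprules[OF ring_A] intro!: lim_mult lim_const)

lemma cont_linear_mult_right: "a \<in> carrier A \<Longrightarrow> cont_linear A A (\<lambda>x. x \<otimes> a)"
  unfolding cont_linear_def
  by (auto simp: smult_mult_left ring.ring_simprules[OF ring_A] intro!: lim_mult lim_const)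

lemma closed_subspace_vimage:
  assumes f: "cont_linear A B f" and B: "cstar_algebra B" and W: "closed_subspace B W"
  shows "closed_subspace A {x \<in> carrier A. f x \<in> W}"
proof (rule closed_subspaceI)
  have "\<zero> \<in> carrier A" by simp
  then have "f (0 \<odot> \<zero>) = 0 \<odot>\<^bsub>B\<^esub> f \<zero>" "f \<zero> \<in> carrier B"
    using f unfolding cont_linear_def by blast+
  then have "f \<zero> = \<zero>\<^bsub>B\<^esub>" by (simp add: cstar_algebra.smult_0[OF B])
  then show "\<zero> \<in> {x \<in> carrier A. f x \<in> W}" using W by (simp add: closed_subspace_def)
  show "x \<in> {x \<in> carrier A. f x \<in> W}"
    if "\<And>n. X n \<in> {x \<in> carrier A. f x \<in> W}" "cstar_lim A X x" for X x
  proof -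
    have "cstar_lim B (\<lambda>n. f (X n)) (f x)" using f that(2) by (simp add: cont_linear_def)
    moreover have "\<forall>n. f (X n) \<in> W" using that(1) by simp
    ultimately have "f x \<in> W" using closed_subspaceD[OF W, of "\<lambda>n. f (X n)" "f x"] by simp
    then show ?thesis using lim_in(2)[OF that(2)] by blast
  qed
qed (use f W in \<open>simp_all add: cont_linear_def closed_subspace_def Pi_iff\<close>)

lemma closed_subspace_equalizer:
  assumes f: "cont_linear A B f" and g: "cont_linear A B g" and B: "cstar_algebra B"
  shows "closed_subspace A {x \<in> carrier A. f x = g x}"
proof (rule closed_subspaceI)
  interpret B: cstar_algebra B by (rule B)
  have "\<zero> \<in> carrier A" by simp
  then have "f (0 \<odot> \<zero>) = 0 \<odot>\<^bsub>B\<^esub> f \<zero>" "f \<zero> \<in> carrier B" "g (0 \<odot> \<zero>) = 0 \<odot>\<^bsub>B\<^esub> g \<zero>" "g \<zero> \<in> carrier B"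
    using f g unfolding cont_linear_def by blast+
  then show "\<zero> \<in> {x \<in> carrier A. f x = g x}" by simp
  show "x \<in> {x \<in> carrier A. f x = g x}"
    if "\<And>n. X n \<in> {x \<in> carrier A. f x = g x}" "cstar_lim A X x" for X x
  proof -
    have "cstar_lim B (\<lambda>n. f (X n)) (f x)" "cstar_lim B (\<lambda>n. g (X n)) (g x)"
      using f g that(2) by (simp_all add: cont_linear_def)
    then show ?thesis using that B.lim_unique lim_in[OF that(2)] by simp
  qed
qed (use f g in \<open>auto simp: cont_linear_def\<close>)

lemma closed_subspace_Inter:
  assumes "\<And>W. W \<in> \<W> \<Longrightarrow> closed_subspace A W" "\<W> \<noteq> {}"
  shows "closed_subspace A (\<Inter>\<W>)"
proof (rule closed_subspaceI)
  note D = assms(1)[unfolded closed_subspace_def]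
  show "\<Inter>\<W> \<subseteq> carrier A" using D assms(2) by blast
  show "\<zero> \<in> \<Inter>\<W>" using D by blast
  show "x \<oplus> y \<in> \<Inter>\<W>" if "x \<in> \<Inter>\<W>" "y \<in> \<Inter>\<W>" for x y using D that by blast
  show "c \<odot> x \<in> \<Inter>\<W>" if "x \<in> \<Inter>\<W>" for c x using D that by blast
  show "x \<in> \<Inter>\<W>" if X: "\<And>n. X n \<in> \<Inter>\<W>" and x: "cstar_lim A X x" for X x
  proof
    fix W assume W: "W \<in> \<W>"
    then have "\<forall>n. X n \<in> W" using X by blast
    then show "x \<in> W" using D[OF W] x by blast
  qed
qed

section \<open>Bounded functionals and states\<close>

lemma bounded_functional_lim:
  assumes f: "bounded_functional A f" and X: "cstar_lim A X x"
  shows "(\<lambda>n. f (X n)) \<longlonglongrightarrow> f x"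
proof -
  obtain K where K: "\<And>x. x \<in> carrier A \<Longrightarrow> cmod (f x) \<le> K * cnorm A x"
    using f unfolding bounded_functional_def by blast
  have "f (X n) - f x = f (X n \<ominus> x)" for n
    using f lim_in[OF X] by (simp add: bounded_functional_def minus_eq_smult)
  then have b: "norm (f (X n) - f x) \<le> K * cnorm A (X n \<ominus> x)" for n
    using K[of "X n \<ominus> x"] lim_in[OF X] by (metis minus_in)
  have l: "(\<lambda>n. K * cnorm A (X n \<ominus> x)) \<longlonglongrightarrow> 0"
    using X tendsto_mult_left[of "\<lambda>n. cnorm A (X n \<ominus> x)" 0 _ K] by (simp add: cstar_lim_def)
  have "(\<lambda>n. f (X n) - f x) \<longlonglongrightarrow> 0"
    by (rule Lim_null_comparison[OF always_eventually[OF allI[OF b]] l])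
  then show ?thesis by (simp add: LIM_zero_iff)
qed

lemma closed_subspace_functional_eq:
  assumes f: "bounded_functional A f" and g: "bounded_functional A g"
  shows "closed_subspace A {x \<in> carrier A. f x = g x}"
proof (rule closed_subspaceI)
  have "\<zero> \<in> carrier A" by simp
  then have "f (0 \<odot> \<zero>) = 0 * f \<zero>" "g (0 \<odot> \<zero>) = 0 * g \<zero>"
    using f g unfolding bounded_functional_def by blast+
  then show "\<zero> \<in> {x \<in> carrier A. f x = g x}" by simp
  show "x \<in> {x \<in> carrier A. f x = g x}"
    if "\<And>n. X n \<in> {x \<in> carrier A. f x = g x}" "cstar_lim A X x" for X x
    using bounded_functional_lim[OF f that(2)] bounded_functional_lim[OF g that(2)] that
      lim_in[OF that(2)] LIMSEQ_unique by force
qed (use f g in \<open>auto simp: bounded_functional_def\<close>)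

text \<open>That this value is real and nonnegative yields, for c = 1 and c = \<i>, compatibility of
  states with the involution and, for c = - \<phi> x, the Cauchy-Schwarz inequality against the
  unit.\<close>

lemma state_expand:
  assumes \<phi>: "is_state A \<phi>" and x: "x \<in> carrier A"
  shows "\<phi> (star A (x \<oplus> c \<odot> \<one>) \<otimes> (x \<oplus> c \<odot> \<one>)) =
    \<phi> (star A x \<otimes> x) + c * \<phi> (star A x) + cnj c * \<phi> x + cnj c * c"
proof -
  have "star A (x \<oplus> c \<odot> \<one>) \<otimes> (x \<oplus> c \<odot> \<one>) = (star A x \<oplus> cnj c \<odot> \<one>) \<otimes> (x \<oplus> c \<odot> \<one>)"
    using x by (simp add: star_add star_smult)
  also have "\<dots> = star A x \<otimes> x \<oplus> star A x \<otimes> (c \<odot> \<one>) \<oplus> cnj c \<odot> \<one> \<otimes> x \<oplus> cnj c \<odot> \<one> \<otimes> (c \<odot> \<one>)"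
    using x smult_in[OF one_in] star_in[OF x] by algebra
  also have "\<dots> = star A x \<otimes> x \<oplus> c \<odot> star A x \<oplus> cnj c \<odot> x \<oplus> (cnj c * c) \<odot> \<one>"
    using x by (simp add: smult_mult_left smult_mult_right one_mult mult_one mult.commute)
  finally show ?thesis using \<phi> x by (simp add: is_state_def)
qed

lemma state_nonneg:
  assumes "is_state A \<phi>" "x \<in> carrier A"
  shows "0 \<le> Re (\<phi> (star A x \<otimes> x))" "Im (\<phi> (star A x \<otimes> x)) = 0"
proof -
  have "\<phi> (star A x \<otimes> x) \<in> \<real>\<^sub>\<ge>\<^sub>0" using assms unfolding is_state_def by blast
  then show "0 \<le> Re (\<phi> (star A x \<otimes> x))" "Im (\<phi> (star A x \<otimes> x)) = 0"
    by (auto simp: complex_nonneg_Reals_iff)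
qed

lemma state_star:
  assumes \<phi>: "is_state A \<phi>" and x: "x \<in> carrier A"
  shows "\<phi> (star A x) = cnj (\<phi> x)"
proof -
  note re = state_nonneg(2)[OF \<phi>]
  have *: "Im (c * \<phi> (star A x) + cnj c * \<phi> x + cnj c * c) = 0" for c
    using re[of "x \<oplus> c \<odot> \<one>"] re[of x] state_expand[OF \<phi> x, of c] x by (simp add: ring.ring_simprules[OF ring_A])
  show ?thesis using *[of 1] *[of \<i>] by (simp add: complex_eq_iff)
qed

lemma state_Cauchy_Schwarz:
  assumes \<phi>: "is_state A \<phi>" and x: "x \<in> carrier A"
  shows "(cmod (\<phi> x))\<^sup>2 \<le> Re (\<phi> (star A x \<otimes> x))"
proof -
  have "0 \<le> Re (\<phi> (star A (x \<oplus> (- \<phi> x) \<odot> \<one>) \<otimes> (x \<oplus> (- \<phi> x) \<odot> \<one>)))"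
    by (rule state_nonneg[OF \<phi>]) (use x in simp)
  also have "\<dots> = Re (\<phi> (star A x \<otimes> x)) - (cmod (\<phi> x))\<^sup>2"
    unfolding state_expand[OF \<phi> x] state_star[OF \<phi> x] cmod_power2
    by (simp add: power2_eq_square)
  finally show ?thesis by simp
qed

text \<open>If x has norm below 1, then 1 - x*x is the square of a self-adjoint element, so the
  state is nonnegative on it and at most 1 on x*x; Cauchy-Schwarz transfers the bound to x.\<close>

lemma state_bounded:
  assumes \<phi>: "is_state A \<phi>"
  shows "bounded_functional A \<phi>"
proof -
  have 1: "cmod (\<phi> x) \<le> 1" if x: "x \<in> carrier A" "cnorm A x < 1" for x
  proof -
    let ?k = "star A x \<otimes> x"
    have "cnorm A ?k < 1" unfolding cstar_identity[OF x(1)]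
      using power_strict_mono[of "cnorm A x" 1 2] x(2) cnorm_nonneg[OF x(1)] by simp
    moreover have "star A ?k = ?k" using x(1) by (simp add: star_mult)
    ultimately obtain b where b: "b \<in> carrier A" "star A b = b" "b \<otimes> b = \<one> \<ominus> ?k"
      using sqrt_one_minus[of ?k ?k] x(1) by (metis mult_in star_in)
    have "0 \<le> Re (\<phi> (\<one> \<ominus> ?k))"
      using state_nonneg(1)[OF \<phi> b(1)] b by simp
    also have "\<phi> (\<one> \<ominus> ?k) = 1 - \<phi> ?k"
      using \<phi> x by (simp add: is_state_def minus_eq_smult)
    finally have "Re (\<phi> ?k) \<le> 1" by simp
    then have "(cmod (\<phi> x))\<^sup>2 \<le> 1\<^sup>2"
      using state_Cauchy_Schwarz[OF \<phi> x(1)] by simp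
    then show ?thesis by (rule power2_le_imp_le) simp
  qed
  have "cmod (\<phi> x) \<le> cnorm A x" if "x \<in> carrier A" for x
  proof (rule scaled_le_cnorm[where f = "\<lambda>x. cmod (\<phi> x)" and P = "\<lambda>x. True"])
    show "cmod (\<phi> (c \<odot> x)) = cmod c * cmod (\<phi> x)" if "x \<in> carrier A" for c x
      using \<phi> that by (simp add: is_state_def norm_mult)
  qed (use 1 that in auto)
  then show ?thesis using \<phi> unfolding is_state_def bounded_functional_def
    by (metis mult_1)
qed

end

section \<open>Universal C*-algebras\<close>

lemma lookup_free_scale:
  "Poly_Mapping.lookup (free_scale c p) w = c * Poly_Mapping.lookup p w"
  unfolding free_scale_def mult_map_scale_conv_mult[symmetric]
  by (simp add: Poly_Mapping.map.rep_eq when_def)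

lemma free_scale_simps [simp]:
  "free_scale a (free_scale b p) = free_scale (a * b) p"
  "free_scale 1 p = p" "free_scale 0 p = 0" "free_scale c 0 = 0"
  "free_scale a p * q = free_scale a (p * q)"
proof -
  show "free_scale a p * q = free_scale a (p * q)" by (simp add: free_scale_def mult.assoc)
qed (auto intro!: poly_mapping_eqI simp: lookup_free_scale mult.assoc)

lemma free_scale_add_left: "free_scale (a + b) p = free_scale a p + free_scale b p"
  and free_scale_add_right: "free_scale a (p + q) = free_scale a p + free_scale a q"
  and free_scale_diff_right: "free_scale a (p - q) = free_scale a p - free_scale a q"
  and free_scale_minus1: "free_scale (-1) p = - p"
  by (auto intro!: poly_mapping_eqI
      simp: lookup_free_scale lookup_add lookup_minus algebra_simps)

lemma poly_mapping_eq_sum: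
  "(p :: 'a \<Rightarrow>\<^sub>0 'b::comm_monoid_add) =
    (\<Sum>w\<in>Poly_Mapping.keys p. Poly_Mapping.single w (Poly_Mapping.lookup p w))"
  by (auto intro!: poly_mapping_eqI simp: lookup_sum lookup_single when_def in_keys_iff
      sum.delta' if_distrib cong: if_cong)

lemma star_poly_induct [case_names zero single add]:
  assumes "P 0" "\<And>w c. P (Poly_Mapping.single w c)" "\<And>p q. P p \<Longrightarrow> P q \<Longrightarrow> P (p + q)"
  shows "P (p :: 'g star_poly)"
proof -
  have "P (\<Sum>w\<in>S. Poly_Mapping.single w (Poly_Mapping.lookup p w))" if "finite S" for S
    using that by induction (auto intro: assms)
  from this[OF finite_keys[of p]] show ?thesis unfolding poly_mapping_eq_sum[of p, symmetric] .
qed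

text \<open>Scalars sit at the empty word, which is neutral for concatenation, so they are central
  although words do not commute.\<close>

lemma mult_free_scale [simp]: "p * free_scale c q = free_scale c (p * q)"
proof -
  have "p * Poly_Mapping.single 0 c = Poly_Mapping.single 0 c * p"
    by (induction p rule: star_poly_induct) (auto simp: mult_single algebra_simps)
  then show ?thesis by (simp add: free_scale_def flip: mult.assoc)
qed

lemma letters_0 [simp]: "letters 0 = []"
  by (simp add: zero_sword_def)

lemma word_star_plus: "word_star (v + w) = word_star w + word_star v"
  by (simp add: word_star_def plus_sword_def)

lemma word_star_0 [simp]: "word_star 0 = 0"
  by (simp add: word_star_def zero_sword_def)

lemma free_star_add: "free_star (p + q) = free_star p + free_star q"
  and free_star_diff: "free_star (p - q) = free_star p - free_star q"
  and free_star_scale: "free_star (free_scale c p) = free_scale (cnj c) (free_star p)"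
  and free_star_star [simp]: "free_star (free_star p) = p"
  and free_star_0 [simp]: "free_star 0 = 0"
  by (auto intro!: poly_mapping_eqI
      simp: lookup_free_star lookup_free_scale lookup_add lookup_minus)

lemma free_star_single [simp]:
  "free_star (Poly_Mapping.single w c) = Poly_Mapping.single (word_star w) (cnj c)"
  by (intro poly_mapping_eqI) (auto simp: lookup_free_star lookup_single when_def)

lemma free_star_1 [simp]: "free_star 1 = 1"
  using free_star_single[of 0 1] by simp

lemma free_star_mult: "free_star (p * q) = free_star q * free_star p"
proof (induction p rule: star_poly_induct)
  case (single w c)
  show ?case
    by (induction q rule: star_poly_induct)
      (auto simp: mult_single word_star_plus mult.commute free_star_add algebra_simps)
qed (auto simp: free_star_add algebra_simps)

lemma free_star_algebra_single:
  "fst ` set (letters w) \<subseteq> G \<Longrightarrow> Poly_Mapping.single w c \<in> free_star_algebra G"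
  by (simp add: free_star_algebra_def)

lemma free_star_algebra_closed [simp, intro]:
  "0 \<in> free_star_algebra G" "1 \<in> free_star_algebra G"
  "p \<in> free_star_algebra G \<Longrightarrow> q \<in> free_star_algebra G \<Longrightarrow> p + q \<in> free_star_algebra G"
  "p \<in> free_star_algebra G \<Longrightarrow> free_scale c p \<in> free_star_algebra G"
  "p \<in> free_star_algebra G \<Longrightarrow> q \<in> free_star_algebra G \<Longrightarrow> p - q \<in> free_star_algebra G"
  "p \<in> free_star_algebra G \<Longrightarrow> q \<in> free_star_algebra G \<Longrightarrow> p * q \<in> free_star_algebra G"
  "p \<in> free_star_algebra G \<Longrightarrow> free_star p \<in> free_star_algebra G"
  "g \<in> G \<Longrightarrow> free_gen g \<in> free_star_algebra G"
proof -
  show "0 \<in> free_star_algebra G" by (simp add: free_star_algebra_def)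
  have "Poly_Mapping.single 0 1 \<in> free_star_algebra G"
    by (rule free_star_algebra_single) (simp add: zero_sword_def)
  then show "1 \<in> free_star_algebra G" by simp
  show add: "p + q \<in> free_star_algebra G" if "p \<in> free_star_algebra G" "q \<in> free_star_algebra G" for p q
    using that keys_add[of p q] unfolding free_star_algebra_def by blast
  show sc: "free_scale c p \<in> free_star_algebra G" if "p \<in> free_star_algebra G" for c p
    using that by (auto simp: free_star_algebra_def in_keys_iff lookup_free_scale)
  show "p - q \<in> free_star_algebra G" if "p \<in> free_star_algebra G" "q \<in> free_star_algebra G"
    using add[OF that(1) sc[OF that(2), of "-1"]] by (simp add: free_scale_minus1)
  show "p * q \<in> free_star_algebra G" if p: "p \<in> free_star_algebra G" and q: "q \<in> free_star_algebra G"
    unfolding free_star_algebra_def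
  proof clarify
    fix w x b assume "w \<in> Poly_Mapping.keys (p * q)" and x: "(x, b) \<in> set (letters w)"
    then obtain u v where "w = u + v" "u \<in> Poly_Mapping.keys p" "v \<in> Poly_Mapping.keys q"
      using keys_mult[of p q] by blast
    with p q x show "fst (x, b) \<in> G"
      unfolding free_star_algebra_def by (fastforce simp: plus_sword_def)
  qed
  show "free_star p \<in> free_star_algebra G" if "p \<in> free_star_algebra G"
  proof -
    have eq: "fst ` set (letters (word_star w)) = fst ` set (letters w)" for w :: "'a sword"
      by (auto simp: word_star_def image_image case_prod_beta)
    have "fst ` set (letters w) \<subseteq> G" if "w \<in> Poly_Mapping.keys (free_star p)" for w
    proof -
      have "word_star w \<in> Poly_Mapping.keys p" using that by (simp add: in_keys_iff lookup_free_star)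
      then show ?thesis
        using \<open>p \<in> free_star_algebra G\<close> eq[of w] unfolding free_star_algebra_def by blast
    qed
    then show ?thesis unfolding free_star_algebra_def by blast
  qed
  show "free_gen g \<in> free_star_algebra G" if "g \<in> G"
    unfolding free_gen_def by (rule free_star_algebra_single) (use that in simp)
qed

lemma free_star_algebra_induct [consumes 1, case_names zero single add]:
  assumes p: "p \<in> free_star_algebra G" and "P 0"
    and single: "\<And>w c. fst ` set (letters w) \<subseteq> G \<Longrightarrow> P (Poly_Mapping.single w c)"
    and add: "\<And>p q. p \<in> free_star_algebra G \<Longrightarrow> q \<in> free_star_algebra G \<Longrightarrow> P p \<Longrightarrow> P q \<Longrightarrow> P (p + q)"
  shows "P p"
proof -
  let ?s = "\<lambda>S. \<Sum>w\<in>S. Poly_Mapping.single w (Poly_Mapping.lookup p w)"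
  have "P (?s S) \<and> ?s S \<in> free_star_algebra G" if "finite S" "S \<subseteq> Poly_Mapping.keys p" for S
    using that
  proof induction
    case (insert w S)
    then have "fst ` set (letters w) \<subseteq> G" using p unfolding free_star_algebra_def by blast
    then show ?case using insert by (auto intro!: single add free_star_algebra_single)
  qed (use assms in auto)
  from this[OF finite_keys[of p] order_refl] show ?thesis unfolding poly_mapping_eq_sum[of p, symmetric] by simp
qed

section \<open>Evaluation of noncommutative polynomials in a C*-algebra\<close>

primrec letter_val :: "('g \<Rightarrow> 'b) \<Rightarrow> 'b cstar \<Rightarrow> 'g \<times> bool \<Rightarrow> 'b" where
  "letter_val \<phi> B (g, b) = (if b then star B (\<phi> g) else \<phi> g)"

definition word_val :: "('g \<Rightarrow> 'b) \<Rightarrow> 'b cstar \<Rightarrow> 'g sword \<Rightarrow> 'b" where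
  "word_val \<phi> B w = foldr (\<lambda>l y. letter_val \<phi> B l \<otimes>\<^bsub>B\<^esub> y) (letters w) \<one>\<^bsub>B\<^esub>"

text \<open>The evaluation homomorphism sending each generator \<open>g\<close> to
  \<open>\<phi> g\<close>; its laws hold on \<open>free_star_algebra G\<close>, for values of the
  generators in the carrier.\<close>

definition poly_val :: "('g \<Rightarrow> 'b) \<Rightarrow> 'b cstar \<Rightarrow> 'g star_poly \<Rightarrow> 'b" where
  "poly_val \<phi> B p =
     finsum B (\<lambda>w. Poly_Mapping.lookup p w \<odot>\<^bsub>B\<^esub> word_val \<phi> B w) (Poly_Mapping.keys p)"

locale poly_valuation = B: cstar_algebra B for B :: "'b cstar" +
  fixes G :: "'g set" and \<phi> :: "'g \<Rightarrow> 'b"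
  assumes gen_in: "g \<in> G \<Longrightarrow> \<phi> g \<in> carrier B"
begin

abbreviation "val \<equiv> poly_val \<phi> B"

lemma word_val_in [simp]: "fst ` set (letters w) \<subseteq> G \<Longrightarrow> word_val \<phi> B w \<in> carrier B"
proof -
  have "fst ` set xs \<subseteq> G \<Longrightarrow> foldr (\<lambda>l y. letter_val \<phi> B l \<otimes>\<^bsub>B\<^esub> y) xs \<one>\<^bsub>B\<^esub> \<in> carrier B" for xs
    by (induction xs) (auto simp: gen_in B.one_in B.mult_in)
  then show "fst ` set (letters w) \<subseteq> G \<Longrightarrow> word_val \<phi> B w \<in> carrier B" by (simp add: word_val_def)
qed

lemma word_val_plus:
  assumes "fst ` set (letters v) \<subseteq> G" "fst ` set (letters w) \<subseteq> G"
  shows "word_val \<phi> B (v + w) = word_val \<phi> B v \<otimes>\<^bsub>B\<^esub> word_val \<phi> B w"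
proof -
  let ?f = "\<lambda>xs z. foldr (\<lambda>l y. letter_val \<phi> B l \<otimes>\<^bsub>B\<^esub> y) xs z"
  have in': "?f xs \<one>\<^bsub>B\<^esub> \<in> carrier B" if "fst ` set xs \<subseteq> G" for xs
    using word_val_in[of "SWord xs"] that by (simp add: word_val_def)
  have "?f xs z = ?f xs \<one>\<^bsub>B\<^esub> \<otimes>\<^bsub>B\<^esub> z" if "fst ` set xs \<subseteq> G" "z \<in> carrier B" for xs z
    using that
  proof (induction xs)
    case (Cons a xs)
    have "letter_val \<phi> B a \<in> carrier B" using Cons.prems by (cases a) (auto simp: gen_in)
    then show ?case using Cons in'[of xs] by (simp add: B.mult_assoc)
  qed (simp add: B.one_mult)
  from this[OF assms(1) word_val_in[OF assms(2)]] show ?thesis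
    by (simp add: word_val_def plus_sword_def)
qed

lemma word_val_star:
  assumes "fst ` set (letters w) \<subseteq> G"
  shows "word_val \<phi> B (word_star w) = star B (word_val \<phi> B w)"
proof -
  have "word_val \<phi> B (word_star (SWord xs)) = star B (word_val \<phi> B (SWord xs))"
    if "fst ` set xs \<subseteq> G" for xs
    using that
  proof (induction xs)
    case Nil
    show ?case by (simp add: word_val_def word_star_def)
  next
    case (Cons a xs)
    obtain g b where a: "a = (g, b)" by fastforce
    have g: "\<phi> g \<in> carrier B" using Cons.prems a by (simp add: gen_in)
    have sub: "fst ` set (letters (word_star (SWord xs))) \<subseteq> G"
      using Cons.prems by (auto simp: word_star_def)
    have "SWord (a # xs) = SWord [a] + SWord xs" by (simp add: plus_sword_def)
    then have "word_star (SWord (a # xs)) = word_star (SWord xs) + SWord [(g, \<not> b)]"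
      by (simp add: word_star_plus) (simp add: word_star_def a)
    then have "word_val \<phi> B (word_star (SWord (a # xs))) =
        star B (word_val \<phi> B (SWord xs)) \<otimes>\<^bsub>B\<^esub> letter_val \<phi> B (g, \<not> b)"
      using Cons sub g a by (simp add: word_val_plus) (simp add: word_val_def B.mult_one)
    also have "\<dots> = star B (letter_val \<phi> B a \<otimes>\<^bsub>B\<^esub> word_val \<phi> B (SWord xs))"
      using Cons.prems g a by (simp add: B.star_mult)
    also have "\<dots> = star B (word_val \<phi> B (SWord (a # xs)))" by (simp add: word_val_def)
    finally show ?case .
  qed
  from this[of "letters w"] assms show ?thesis by (cases w) simp
qed

lemma abelian_monoid_B: "abelian_monoid B"
  by (rule abelian_group.axioms(1)[OF ring.axioms(1)[OF B.ring_A]])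

text \<open>Letting the sum run over any finite set of words that contains the keys allows
  polynomials with different supports to be added, even when terms cancel.\<close>

lemma val_eq_finsum:
  assumes "finite S" "Poly_Mapping.keys p \<subseteq> S"
    and S: "\<And>w. w \<in> S \<Longrightarrow> fst ` set (letters w) \<subseteq> G"
  shows "val p = finsum B (\<lambda>w. Poly_Mapping.lookup p w \<odot>\<^bsub>B\<^esub> word_val \<phi> B w) S"
  unfolding poly_val_def finsum_def
proof (rule comm_monoid.finprod_mono_neutral_cong_left
    [OF abelian_monoid.a_comm_monoid[OF abelian_monoid_B] assms(1,2)])
  fix w assume "w \<in> S - Poly_Mapping.keys p"
  then have "Poly_Mapping.lookup p w = 0" "word_val \<phi> B w \<in> carrier B"
    using S by (auto simp: in_keys_iff)
  then show "Poly_Mapping.lookup p w \<odot>\<^bsub>B\<^esub> word_val \<phi> B w = \<one>\<^bsub>add_monoid B\<^esub>" by simp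
next
  show "(\<lambda>w. Poly_Mapping.lookup p w \<odot>\<^bsub>B\<^esub> word_val \<phi> B w) \<in> S \<rightarrow> carrier (add_monoid B)"
    using S by auto
qed simp

lemma val_in [simp]: "p \<in> free_star_algebra G \<Longrightarrow> val p \<in> carrier B"
  unfolding poly_val_def
  by (rule abelian_monoid.finsum_closed[OF abelian_monoid_B]) (auto simp: free_star_algebra_def)

lemma val_0 [simp]: "val 0 = \<zero>\<^bsub>B\<^esub>"
  unfolding poly_val_def by (simp add: abelian_monoid.finsum_empty[OF abelian_monoid_B])

lemma val_single:
  assumes "fst ` set (letters w) \<subseteq> G"
  shows "val (Poly_Mapping.single w c) = c \<odot>\<^bsub>B\<^esub> word_val \<phi> B w"
proof -
  have "val (Poly_Mapping.single w c) =
      finsum B (\<lambda>v. Poly_Mapping.lookup (Poly_Mapping.single w c) v \<odot>\<^bsub>B\<^esub> word_val \<phi> B v) (insert w {})"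
    by (rule val_eq_finsum) (use assms in auto)
  also have "\<dots> = Poly_Mapping.lookup (Poly_Mapping.single w c) w \<odot>\<^bsub>B\<^esub> word_val \<phi> B w \<oplus>\<^bsub>B\<^esub>
      finsum B (\<lambda>v. Poly_Mapping.lookup (Poly_Mapping.single w c) v \<odot>\<^bsub>B\<^esub> word_val \<phi> B v) {}"
    by (rule abelian_monoid.finsum_insert[OF abelian_monoid_B]) (use assms in auto)
  finally show ?thesis using assms by (simp add: abelian_monoid.finsum_empty[OF abelian_monoid_B])
qed

lemma val_add:
  assumes "p \<in> free_star_algebra G" "q \<in> free_star_algebra G"
  shows "val (p + q) = val p \<oplus>\<^bsub>B\<^esub> val q"
proof -
  let ?S = "Poly_Mapping.keys p \<union> Poly_Mapping.keys q"
  let ?t = "\<lambda>p w. Poly_Mapping.lookup p w \<odot>\<^bsub>B\<^esub> word_val \<phi> B w"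
  have S: "fst ` set (letters w) \<subseteq> G" if "w \<in> ?S" for w
    using assms that unfolding free_star_algebra_def by blast
  have "val (p + q) = finsum B (?t (p + q)) ?S"
    by (rule val_eq_finsum) (use keys_add[of p q] S in auto)
  also have "\<dots> = finsum B (\<lambda>w. ?t p w \<oplus>\<^bsub>B\<^esub> ?t q w) ?S"
    using S by (intro abelian_monoid.finsum_cong'[OF abelian_monoid_B])
      (auto simp: lookup_add B.smult_add_left)
  also have "\<dots> = finsum B (?t p) ?S \<oplus>\<^bsub>B\<^esub> finsum B (?t q) ?S"
    by (rule abelian_monoid.finsum_addf[OF abelian_monoid_B]) (use S in auto)
  also have "\<dots> = val p \<oplus>\<^bsub>B\<^esub> val q"
    using S by (intro arg_cong2[where f = "add B"] val_eq_finsum[symmetric]) auto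
  finally show ?thesis .
qed

lemma val_scale:
  assumes "p \<in> free_star_algebra G"
  shows "val (free_scale c p) = c \<odot>\<^bsub>B\<^esub> val p"
  using assms
proof (induction p rule: free_star_algebra_induct)
  case (single w d)
  then show ?case by (simp add: free_scale_def mult_single val_single)
qed (simp_all add: free_scale_add_right val_add B.smult_add_right)

lemma val_diff:
  assumes "p \<in> free_star_algebra G" "q \<in> free_star_algebra G"
  shows "val (p - q) = val p \<ominus>\<^bsub>B\<^esub> val q"
  using val_add[OF assms(1) free_star_algebra_closed(4)[OF assms(2), of "-1"]] assms
    val_scale[OF assms(2), of "-1"]
  by (simp add: B.minus_eq_smult free_scale_minus1)

lemma val_mult:
  assumes "p \<in> free_star_algebra G" "q \<in> free_star_algebra G"
  shows "val (p * q) = val p \<otimes>\<^bsub>B\<^esub> val q"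
  using assms(1)
proof (induction p rule: free_star_algebra_induct)
  case zero
  then show ?case using assms(2) by (simp add: ring.ring_simprules[OF B.ring_A])
next
  case (single v c)
  note v = single
  show ?case
    using assms(2)
  proof (induction q rule: free_star_algebra_induct)
    case zero
    then show ?case using v by (simp add: val_single ring.ring_simprules[OF B.ring_A])
  next
    case (single w d)
    moreover have "fst ` set (letters (v + w)) \<subseteq> G" using v single by (auto simp: plus_sword_def)
    ultimately show ?case
      using v by (simp add: mult_single val_single word_val_plus B.smult_mult_left B.smult_mult_right
          mult.commute)
  next
    case (add p q)
    then show ?case using v
      by (simp add: distrib_left val_add B.distrib_left free_star_algebra_single)
  qed
next
  case (add p q)
  then show ?case using assms(2)
    by (simp add: distrib_right val_add B.distrib_right)
qed

lemma val_star:
  assumes "p \<in> free_star_algebra G"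
  shows "val (free_star p) = star B (val p)"
  using assms
proof (induction p rule: free_star_algebra_induct)
  case (single w c)
  moreover have "fst ` set (letters (word_star w)) \<subseteq> G" using single by (auto simp: word_star_def)
  ultimately show ?case by (simp add: val_single word_val_star B.star_smult)
qed (simp_all add: free_star_add val_add B.star_add)

lemma val_1 [simp]: "val 1 = \<one>\<^bsub>B\<^esub>"
  using val_single[of 0 1] by (simp add: word_val_def B.one_in)

lemma val_gen: "g \<in> G \<Longrightarrow> val (free_gen g) = \<phi> g"
  unfolding free_gen_def
  by (subst val_single) (simp_all add: word_val_def gen_in B.mult_one)

text \<open>An evaluation that kills the relations thereby competes in the supremum defining
  \<open>universal_norm\<close>; this is what makes evaluations contractive.\<close>

lemma cstar_seminorm_val: "cstar_seminorm G (\<lambda>p. cnorm B (val p))"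
  unfolding cstar_seminorm_def
  by (auto simp: val_add val_scale val_mult val_star B.cnorm_nonneg B.cnorm_triangle
      B.cnorm_smult B.cnorm_mult B.cstar_identity)

end

text \<open>One passage from norm-Cauchy sequences to \<open>mcomplete\<close>, shared by the
  universal algebras, the sequence space and its operators. It is stated for abelian groups because
  completeness is itself an axiom of the structures being built.\<close>

lemma mcomplete_normI:
  fixes A (structure)
  assumes A: "abelian_group A"
    and N_nonneg: "\<And>x. x \<in> carrier A \<Longrightarrow> 0 \<le> N x"
    and eq_0: "\<And>x. x \<in> carrier A \<Longrightarrow> N x = 0 \<longleftrightarrow> x = \<zero>"
    and tri: "\<And>x y. x \<in> carrier A \<Longrightarrow> y \<in> carrier A \<Longrightarrow> N (x \<oplus> y) \<le> N x + N y"
    and minus: "\<And>x. x \<in> carrier A \<Longrightarrow> N (\<ominus> x) = N x"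
    and compl: "\<And>X. (\<And>n. X n \<in> carrier A) \<Longrightarrow>
      (\<And>\<epsilon>. \<epsilon> > 0 \<Longrightarrow> \<exists>M. \<forall>m\<ge>M. \<forall>n\<ge>M. N (X m \<ominus> X n) < \<epsilon>) \<Longrightarrow>
      \<exists>x\<in>carrier A. (\<lambda>n. N (X n \<ominus> x)) \<longlonglongrightarrow> 0"
    and d_def: "d = (\<lambda>x y. if x \<in> carrier A \<and> y \<in> carrier A then N (x \<ominus> y) else 0)"
  shows "Metric_space.mcomplete (carrier A) d"
proof -
  interpret abelian_group A by (rule A)
  have sym: "N (x \<ominus> y) = N (y \<ominus> x)" if "x \<in> carrier A" "y \<in> carrier A" for x y
  proof -
    have "\<ominus> (x \<ominus> y) = y \<ominus> x" using that by (simp add: minus_eq minus_add a_comm)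
    then show ?thesis using minus[of "x \<ominus> y"] that by simp
  qed
  interpret Metric_space "carrier A" d
  proof
    show "0 \<le> d x y" for x y by (simp add: d_def N_nonneg)
    show "d x y = d y x" for x y by (simp add: d_def sym)
    show "d x y = 0 \<longleftrightarrow> x = y" if "x \<in> carrier A" "y \<in> carrier A" for x y
    proof -
      have "x = (x \<ominus> y) \<oplus> y" using that by (simp add: minus_eq a_assoc l_neg)
      then have "x \<ominus> y = \<zero> \<longleftrightarrow> x = y" using that by (metis l_zero minus_eq r_neg)
      then show ?thesis using that by (simp add: d_def eq_0)
    qed
    show "d x z \<le> d x y + d y z"
      if "x \<in> carrier A" "y \<in> carrier A" "z \<in> carrier A" for x y z
    proof -
      have "x \<ominus> z = (x \<ominus> y) \<oplus> (y \<ominus> z)"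
        using that by (simp add: minus_eq a_assoc r_neg1)
      then show ?thesis using that tri[of "x \<ominus> y" "y \<ominus> z"] by (simp add: d_def)
    qed
  qed
  have dd: "d x y = N (x \<ominus> y)" if "x \<in> carrier A" "y \<in> carrier A" for x y
    using that d_def by simp
  show ?thesis
    unfolding mcomplete_def
  proof (intro allI impI)
    fix X assume "MCauchy X"
    then have X: "X n \<in> carrier A" for n by (auto simp: MCauchy_def)
    have C: "\<exists>M. \<forall>m\<ge>M. \<forall>n\<ge>M. N (X m \<ominus> X n) < \<epsilon>" if e: "\<epsilon> > 0" for \<epsilon>
    proof -
      have "\<exists>M. \<forall>m n. M \<le> m \<longrightarrow> M \<le> n \<longrightarrow> d (X m) (X n) < \<epsilon>"
        using conjunct2[OF \<open>MCauchy X\<close>[unfolded MCauchy_def]] e by simp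
      then show ?thesis unfolding dd[OF X X] by blast
    qed
    have "\<exists>x\<in>carrier A. (\<lambda>n. N (X n \<ominus> x)) \<longlonglongrightarrow> 0" by (rule compl[OF X C])
    then obtain x where x: "x \<in> carrier A" "(\<lambda>n. N (X n \<ominus> x)) \<longlonglongrightarrow> 0" by blast
    have "limitin mtopology X x sequentially"
    proof -
      have "\<bar>N (X n \<ominus> x)\<bar> = N (X n \<ominus> x)" for n using N_nonneg[of "X n \<ominus> x"] X x(1) by simp
      then show ?thesis using x X by (simp add: limit_metric_sequentially LIMSEQ_iff dd)
    qed
    then show "\<exists>x. limitin mtopology X x sequentially" by blast
  qed
qed

text \<open>Bounds of the generators, uniform over the C*-seminorms annihilating the relations, make
  the supremum in \<^const>\<open>universal_norm\<close> finite.\<close>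

locale bounded_relations =
  fixes G :: "'g set" and R :: "'g star_poly set"
  assumes gen_bounded: "g \<in> G \<Longrightarrow> \<exists>C. \<forall>N. cstar_seminorm G N \<longrightarrow> (\<forall>r\<in>R. N r = 0) \<longrightarrow> N (free_gen g) \<le> C"
begin

abbreviation "V \<equiv> free_star_algebra G"
abbreviation "U \<equiv> universal_norm G R"
abbreviation "SN \<equiv> {N. cstar_seminorm G N \<and> (\<forall>r\<in>R. N r = 0)}"

text \<open>Guarantees that the supremum in \<open>universal_norm\<close> is taken over a nonempty
  set.\<close>

lemma zero_SN: "(\<lambda>x. 0) \<in> SN"
  by (simp add: cstar_seminorm_def)

lemma seminorm_one_le: assumes "cstar_seminorm G N" shows "N 1 \<le> 1"
proof -
  have "N (free_star 1 * 1) = (N 1)\<^sup>2"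
    using assms free_star_algebra_closed(2)[of G] unfolding cstar_seminorm_def by blast
  then have "N 1 * (N 1 - 1) = 0" by (simp add: power2_eq_square algebra_simps)
  then show ?thesis by auto
qed

lemma seminorm_star_le:
  assumes N: "cstar_seminorm G N" and x: "x \<in> V"
  shows "N (free_star x) \<le> N x"
proof (cases "N (free_star x) = 0")
  case True
  then show ?thesis using N x by (simp add: cstar_seminorm_def)
next
  case False
  have "N (free_star (free_star x) * free_star x) = (N (free_star x))\<^sup>2"
    using N free_star_algebra_closed(7)[OF x] unfolding cstar_seminorm_def by blast
  moreover have "N (x * free_star x) \<le> N x * N (free_star x)" "0 \<le> N (free_star x)"
    using N x free_star_algebra_closed(7)[OF x] unfolding cstar_seminorm_def by blast+
  ultimately have "N (free_star x) * N (free_star x) \<le> N x * N (free_star x)" "0 < N (free_star x)"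
    using False by (simp_all add: power2_eq_square)
  then show ?thesis by simp
qed

text \<open>Words are bounded letter by letter through submultiplicativity, polynomials term by term
  through the triangle inequality; no bound depends on the seminorm.\<close>

lemma seminorms_bounded:
  assumes "x \<in> V"
  shows "\<exists>C. \<forall>N\<in>SN. N x \<le> C"
  using assms
proof (induction x rule: free_star_algebra_induct)
  case zero
  have z: "N 0 \<le> 0" if "N \<in> SN" for N
  proof -
    have "N (free_scale 0 0) = cmod 0 * N 0"
      using that free_star_algebra_closed(1)[of G] unfolding cstar_seminorm_def by blast
    then show ?thesis by simp
  qed
  show ?case by (intro exI[of _ 0] ballI z)
next
  case (single w c)
  have word: "\<exists>C\<ge>0. \<forall>N\<in>SN. N (Poly_Mapping.single (SWord xs) 1) \<le> C" if "fst ` set xs \<subseteq> G" for xs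
    using that
  proof (induction xs)
    case Nil
    have "Poly_Mapping.single (SWord []) 1 = (1 :: 'g star_poly)"
      by (simp flip: zero_sword_def)
    then show ?case using seminorm_one_le by (intro exI[of _ 1]) auto
  next
    case (Cons a xs)
    obtain g b where a: "a = (g, b)" by fastforce
    have g: "g \<in> G" using Cons.prems a by simp
    obtain C where C: "C \<ge> 0" "\<And>N. N \<in> SN \<Longrightarrow> N (Poly_Mapping.single (SWord xs) 1) \<le> C"
      using Cons by auto
    obtain D where D: "\<And>N. N \<in> SN \<Longrightarrow> N (free_gen g) \<le> D" using gen_bounded[OF g] by auto
    let ?l = "Poly_Mapping.single (SWord [a]) 1 :: 'g star_poly"
    let ?x = "Poly_Mapping.single (SWord xs) 1 :: 'g star_poly"
    have l: "?l \<in> V" and x: "?x \<in> V" using Cons.prems by (intro free_star_algebra_single; simp)+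
    have split: "Poly_Mapping.single (SWord (a # xs)) 1 = ?l * ?x"
      by (simp add: mult_single plus_sword_def)
    have "N (Poly_Mapping.single (SWord (a # xs)) 1) \<le> \<bar>D\<bar> * C" if N: "N \<in> SN" for N
    proof -
      have "?l = (if b then free_star (free_gen g) else free_gen g)"
        by (simp add: a free_gen_def word_star_def)
      then have "N ?l \<le> \<bar>D\<bar>"
        using D[OF N] seminorm_star_le[of N "free_gen g"] N g by (auto intro: order_trans)
      moreover have "N (?l * ?x) \<le> N ?l * N ?x" "0 \<le> N ?x"
        using N l x unfolding cstar_seminorm_def by blast+
      moreover have "N ?l * N ?x \<le> \<bar>D\<bar> * C"
        using \<open>N ?l \<le> \<bar>D\<bar>\<close> C(2)[OF N] \<open>0 \<le> N ?x\<close> by (intro mult_mono) auto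
      ultimately show ?thesis unfolding split by linarith
    qed
    then show ?case using C(1) by (intro exI[of _ "\<bar>D\<bar> * C"]) auto
  qed
  obtain xs where w: "w = SWord xs" by (cases w) blast
  obtain C where C: "\<And>N. N \<in> SN \<Longrightarrow> N (Poly_Mapping.single w 1) \<le> C"
    using word[of xs] single w by auto
  have "N (Poly_Mapping.single w c) \<le> cmod c * C" if N: "N \<in> SN" for N
  proof -
    have "Poly_Mapping.single w 1 \<in> V" using single by (rule free_star_algebra_single)
    then have "N (free_scale c (Poly_Mapping.single w 1)) = cmod c * N (Poly_Mapping.single w 1)"
      using N unfolding cstar_seminorm_def by blast
    moreover have "free_scale c (Poly_Mapping.single w 1) = Poly_Mapping.single w c"
      by (simp add: free_scale_def mult_single)
    ultimately show ?thesis using C[OF N] by (simp add: mult_left_mono)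
  qed
  then show ?case by blast
next
  case (add p q)
  then obtain C D where C: "\<And>N. N \<in> SN \<Longrightarrow> N p \<le> C" and D: "\<And>N. N \<in> SN \<Longrightarrow> N q \<le> D" by blast
  have "N (p + q) \<le> C + D" if "N \<in> SN" for N
  proof -
    have "N (p + q) \<le> N p + N q" using that add(1,2) unfolding cstar_seminorm_def by blast
    then show ?thesis using C[OF that] D[OF that] by simp
  qed
  then show ?case by blast
qed

lemma seminorm_le_U:
  assumes "cstar_seminorm G N" "\<And>r. r \<in> R \<Longrightarrow> N r = 0" "x \<in> V"
  shows "N x \<le> U x"
proof -
  obtain C where "\<And>N. N \<in> SN \<Longrightarrow> N x \<le> C" using seminorms_bounded[OF assms(3)] by blast
  then have "bdd_above ((\<lambda>N. N x) ` SN)" by (rule bdd_aboveI2)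
  then show ?thesis unfolding universal_norm_def using assms by (intro cSUP_upper) auto
qed

lemma U_le: "(\<And>N. N \<in> SN \<Longrightarrow> N x \<le> C) \<Longrightarrow> U x \<le> C"
  unfolding universal_norm_def using zero_SN by (intro cSUP_least) blast+

lemma N_le_U: "N \<in> SN \<Longrightarrow> x \<in> V \<Longrightarrow> N x \<le> U x"
  by (rule seminorm_le_U) auto

lemma U_relation: "r \<in> R \<Longrightarrow> U r = 0"
proof -
  assume "r \<in> R"
  then have "(\<lambda>N. N r) ` SN = {0}" using zero_SN by auto
  then show ?thesis unfolding universal_norm_def by simp
qed

lemma U_nonneg: "x \<in> V \<Longrightarrow> 0 \<le> U x"
  using N_le_U[OF zero_SN] by simp

lemma U_add: "x \<in> V \<Longrightarrow> y \<in> V \<Longrightarrow> U (x + y) \<le> U x + U y"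
proof (rule U_le)
  fix N assume *: "x \<in> V" "y \<in> V" "N \<in> SN"
  then have "N (x + y) \<le> N x + N y" unfolding cstar_seminorm_def by blast
  also have "\<dots> \<le> U x + U y" using * by (intro add_mono N_le_U)
  finally show "N (x + y) \<le> U x + U y" .
qed

lemma U_mult: "x \<in> V \<Longrightarrow> y \<in> V \<Longrightarrow> U (x * y) \<le> U x * U y"
proof (rule U_le)
  fix N assume *: "x \<in> V" "y \<in> V" "N \<in> SN"
  then have "N (x * y) \<le> N x * N y" "0 \<le> N y" unfolding cstar_seminorm_def by blast+
  moreover have "N x * N y \<le> U x * U y"
    using * \<open>0 \<le> N y\<close> by (intro mult_mono N_le_U U_nonneg)
  ultimately show "N (x * y) \<le> U x * U y" by linarith
qed

lemma U_scale_le: "x \<in> V \<Longrightarrow> U (free_scale c x) \<le> cmod c * U x"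
proof (rule U_le)
  fix N assume *: "x \<in> V" "N \<in> SN"
  then have "N (free_scale c x) = cmod c * N x" unfolding cstar_seminorm_def by blast
  then show "N (free_scale c x) \<le> cmod c * U x" using N_le_U[OF *(2,1)] by (simp add: mult_left_mono)
qed

lemma U_scale: "x \<in> V \<Longrightarrow> U (free_scale c x) = cmod c * U x"
proof (cases "c = 0")
  case True
  assume "x \<in> V"
  then show ?thesis using True U_scale_le[of x 0] U_nonneg[of 0] by simp
next
  case False
  assume x: "x \<in> V"
  have "U x \<le> cmod (1 / c) * U (free_scale c x)"
    using U_scale_le[of "free_scale c x" "1 / c"] x False by simp
  then show ?thesis using U_scale_le[OF x, of c] False
    by (simp add: norm_divide pos_le_divide_eq mult.commute)
qed

text \<open>The C*-identity survives the supremum because squaring is monotone on nonnegative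
  numbers; one inequality is direct, the other passes through the square root.\<close>

lemma U_cstar: "x \<in> V \<Longrightarrow> U (free_star x * x) = (U x)\<^sup>2"
proof (rule antisym)
  assume x: "x \<in> V"
  have N2: "N (free_star x * x) = (N x)\<^sup>2" "0 \<le> N x" if "N \<in> SN" for N
    using that x unfolding cstar_seminorm_def by blast+
  show "U (free_star x * x) \<le> (U x)\<^sup>2"
  proof (rule U_le)
    fix N assume N: "N \<in> SN"
    show "N (free_star x * x) \<le> (U x)\<^sup>2"
      using N2[OF N] N_le_U[OF N x] by (simp add: power_mono)
  qed
  have "U x \<le> sqrt (U (free_star x * x))"
  proof (rule U_le)
    fix N assume N: "N \<in> SN"
    have "(N x)\<^sup>2 \<le> U (free_star x * x)"
      using N_le_U[OF N, of "free_star x * x"] x N2[OF N] by simp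
    then show "N x \<le> sqrt (U (free_star x * x))" by (rule real_le_rsqrt)
  qed
  then have "(U x)\<^sup>2 \<le> (sqrt (U (free_star x * x)))\<^sup>2"
    using U_nonneg[OF x] by (intro power_mono)
  then show "(U x)\<^sup>2 \<le> U (free_star x * x)"
    using U_nonneg[of "free_star x * x"] x by simp
qed

lemma U_seminorm: "cstar_seminorm G U"
  unfolding cstar_seminorm_def by (simp add: U_nonneg U_add U_mult U_scale U_cstar)

lemma U_star: "x \<in> V \<Longrightarrow> U (free_star x) = U x"
  using seminorm_star_le[OF U_seminorm, of x] seminorm_star_le[OF U_seminorm, of "free_star x"]
  by simp

lemma U_0 [simp]: "U 0 = 0"
  using U_scale[of 0 0] by simp

lemma U_minus: "x \<in> V \<Longrightarrow> y \<in> V \<Longrightarrow> U (x - y) = U (y - x)"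
  using U_scale[of "x - y" "-1"] by (simp add: free_scale_minus1)

lemma U_diff_triangle: "x \<in> V \<Longrightarrow> y \<in> V \<Longrightarrow> z \<in> V \<Longrightarrow> U (x - z) \<le> U (x - y) + U (y - z)"
  using U_add[of "x - y" "y - z"] by simp

lemma U_reverse: "x \<in> V \<Longrightarrow> y \<in> V \<Longrightarrow> \<bar>U x - U y\<bar> \<le> U (x - y)"
  using U_add[of "x - y" y] U_add[of "y - x" x] U_minus[of x y] by simp

end

section \<open>The completion by classes of Cauchy sequences\<close>

context bounded_relations
begin

abbreviation "CS \<equiv> cauchy_seqs V U"
abbreviation "cl \<equiv> universal_class G R"

lemma CS_in: "X \<in> CS \<Longrightarrow> X n \<in> V"
  by (simp add: cauchy_seqs_def)

lemma CS_Cauchy: "X \<in> CS \<Longrightarrow> \<epsilon> > 0 \<Longrightarrow> \<exists>M. \<forall>m\<ge>M. \<forall>n\<ge>M. U (X m - X n) < \<epsilon>"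
  by (simp add: cauchy_seqs_def)

text \<open>Dominating the increments by those of sequences that are already Cauchy.\<close>

lemma CS_I:
  assumes X: "X \<in> CS" and Y: "Y \<in> CS" and K: "0 \<le> K" and Z: "\<And>n. Z n \<in> V"
    and le: "\<And>m n. U (Z m - Z n) \<le> K * (U (X m - X n) + U (Y m - Y n))"
  shows "Z \<in> CS"
  unfolding cauchy_seqs_def
proof (intro CollectI conjI allI impI Z)
  fix \<epsilon> :: real assume e: "\<epsilon> > 0"
  define \<delta> where "\<delta> = \<epsilon> / (2 * (K + 1))"
  have d: "\<delta> > 0" using e K by (simp add: \<delta>_def)
  obtain M where M: "\<And>m n. m \<ge> M \<Longrightarrow> n \<ge> M \<Longrightarrow> U (X m - X n) < \<delta>" using CS_Cauchy[OF X d] by blast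
  obtain L where L: "\<And>m n. m \<ge> L \<Longrightarrow> n \<ge> L \<Longrightarrow> U (Y m - Y n) < \<delta>" using CS_Cauchy[OF Y d] by blast
  have "U (Z m - Z n) < \<epsilon>" if "m \<ge> max M L" "n \<ge> max M L" for m n
  proof -
    have "U (X m - X n) + U (Y m - Y n) \<le> 2 * \<delta>" using M[of m n] L[of m n] that by simp
    then have "K * (U (X m - X n) + U (Y m - Y n)) \<le> K * (2 * \<delta>)" using K by (rule mult_left_mono)
    also have "\<dots> < (K + 1) * (2 * \<delta>)" using d by simp
    also have "\<dots> = \<epsilon>" using K by (simp add: \<delta>_def field_simps)
    finally show ?thesis using le[of m n] by linarith
  qed
  then show "\<exists>M. \<forall>m\<ge>M. \<forall>n\<ge>M. U (Z m - Z n) < \<epsilon>" by blast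
qed

lemma CS_const: "x \<in> V \<Longrightarrow> (\<lambda>n. x) \<in> CS"
  by (simp add: cauchy_seqs_def)

lemma CS_bounded: "X \<in> CS \<Longrightarrow> \<exists>K\<ge>0. \<forall>n. U (X n) \<le> K"
proof -
  assume X: "X \<in> CS"
  obtain M where M: "\<And>m n. m \<ge> M \<Longrightarrow> n \<ge> M \<Longrightarrow> U (X m - X n) < 1" using CS_Cauchy[OF X, of 1] by auto
  let ?K = "(\<Sum>i\<le>M. U (X i)) + 1"
  have nn: "0 \<le> U (X i)" for i using U_nonneg[OF CS_in[OF X]] .
  have le: "U (X i) \<le> (\<Sum>i\<le>M. U (X i))" if "i \<le> M" for i
    by (rule member_le_sum) (use that nn in auto)
  have "U (X n) \<le> ?K" for n
  proof (cases "n \<le> M")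
    case False
    then have "U (X n - X M) < 1" using M[of n M] by simp
    then show ?thesis using U_reverse[OF CS_in[OF X] CS_in[OF X], of n M] le[of M] by linarith
  qed (use le in force)
  moreover have "0 \<le> ?K" using nn by (simp add: sum_nonneg add_nonneg_nonneg)
  ultimately show ?thesis by blast
qed

lemma CS_add: assumes "X \<in> CS" "Y \<in> CS" shows "(\<lambda>n. X n + Y n) \<in> CS"
proof (rule CS_I[OF assms, of 1])
  show "U (X m + Y m - (X n + Y n)) \<le> 1 * (U (X m - X n) + U (Y m - Y n))" for m n
    using U_add[of "X m - X n" "Y m - Y n"] assms CS_in by (simp add: algebra_simps)
qed (use assms CS_in in auto)

lemma CS_scale: assumes "X \<in> CS" shows "(\<lambda>n. free_scale c (X n)) \<in> CS"
proof (rule CS_I[OF assms assms, of "cmod c"])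
  show "U (free_scale c (X m) - free_scale c (X n)) \<le> cmod c * (U (X m - X n) + U (X m - X n))" for m n
    using assms CS_in U_nonneg[of "X m - X n"]
    by (simp add: U_scale distrib_left flip: free_scale_diff_right)
qed (use assms CS_in in auto)

lemma CS_star: assumes "X \<in> CS" shows "(\<lambda>n. free_star (X n)) \<in> CS"
proof (rule CS_I[OF assms assms, of 1])
  show "U (free_star (X m) - free_star (X n)) \<le> 1 * (U (X m - X n) + U (X m - X n))" for m n
    using assms CS_in U_nonneg[of "X m - X n"] by (simp add: U_star flip: free_star_diff)
qed (use assms CS_in in auto)

lemma CS_mult: assumes "X \<in> CS" "Y \<in> CS" shows "(\<lambda>n. X n * Y n) \<in> CS"
proof -
  obtain K L where K: "K \<ge> 0" "\<And>n. U (X n) \<le> K" and L: "L \<ge> 0" "\<And>n. U (Y n) \<le> L"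
    using CS_bounded[OF assms(1)] CS_bounded[OF assms(2)] by blast
  note in1 = CS_in[OF assms(1)] and in2 = CS_in[OF assms(2)]
  show ?thesis
  proof (rule CS_I[OF assms, of "K + L"])
    fix m n
    let ?a = "U (X m - X n)" and ?b = "U (Y m - Y n)"
    have nn: "0 \<le> ?a" "0 \<le> ?b" using in1 in2 by (auto intro: U_nonneg)
    have "X m * Y m - X n * Y n = X m * (Y m - Y n) + (X m - X n) * Y n"
      by (simp add: algebra_simps)
    then have "U (X m * Y m - X n * Y n) \<le> U (X m * (Y m - Y n)) + U ((X m - X n) * Y n)"
      using U_add[of "X m * (Y m - Y n)" "(X m - X n) * Y n"] in1 in2 by simp
    also have "\<dots> \<le> U (X m) * ?b + ?a * U (Y n)"
      using in1 in2 by (intro add_mono U_mult) auto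
    also have "\<dots> \<le> K * ?b + ?a * L"
      using K L nn U_nonneg[OF in1] U_nonneg[OF in2] by (intro add_mono mult_mono) auto
    also have "\<dots> \<le> (K + L) * (?a + ?b)"
      using K L nn by (simp add: algebra_simps)
    finally show "U (X m * Y m - X n * Y n) \<le> (K + L) * (?a + ?b)" .
  qed (use in1 in2 K L in auto)
qed

definition eqv :: "(nat \<Rightarrow> 'g star_poly) \<Rightarrow> (nat \<Rightarrow> 'g star_poly) \<Rightarrow> bool" where
  "eqv X Y \<longleftrightarrow> X \<in> CS \<and> Y \<in> CS \<and> (\<lambda>n. U (X n - Y n)) \<longlonglongrightarrow> 0"

lemma cl_eq: "cl X = {Y \<in> CS. (\<lambda>n. U (X n - Y n)) \<longlonglongrightarrow> 0}"
  by (simp add: universal_class_def limit_class_def)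

lemma null_le: "(\<And>n. 0 \<le> f n) \<Longrightarrow> (\<And>n. f n \<le> g n) \<Longrightarrow> g \<longlonglongrightarrow> (0::real) \<Longrightarrow> f \<longlonglongrightarrow> 0"
  by (rule tendsto_sandwich[of "\<lambda>_. 0" f sequentially g]) (simp_all add: always_eventually)

lemma null_add: "f \<longlonglongrightarrow> 0 \<Longrightarrow> g \<longlonglongrightarrow> 0 \<Longrightarrow> (\<lambda>n. f n + g n) \<longlonglongrightarrow> (0::real)"
  using tendsto_add[of f 0 sequentially g 0] by simp

lemma eqv_sym: "eqv X Y \<Longrightarrow> eqv Y X"
  using U_minus by (simp add: eqv_def CS_in)

lemma eqv_trans: assumes "eqv X Y" "eqv Y Z" shows "eqv X Z"
proof -
  have c: "X \<in> CS" "Y \<in> CS" "Z \<in> CS" using assms by (auto simp: eqv_def)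
  have "(\<lambda>n. U (X n - Z n)) \<longlonglongrightarrow> 0"
  proof (rule null_le)
    show "U (X n - Z n) \<le> U (X n - Y n) + U (Y n - Z n)" for n
      using U_diff_triangle c CS_in by blast
    show "(\<lambda>n. U (X n - Y n) + U (Y n - Z n)) \<longlonglongrightarrow> 0"
      using assms by (intro null_add) (simp_all add: eqv_def)
  qed (use c in \<open>auto intro!: U_nonneg simp: CS_in\<close>)
  then show ?thesis using c by (simp add: eqv_def)
qed

lemma cl_eq_iff:
  assumes "X \<in> CS" "Y \<in> CS"
  shows "cl X = cl Y \<longleftrightarrow> eqv X Y"
proof
  assume "cl X = cl Y"
  moreover have "Y \<in> cl Y" using assms by (simp add: cl_eq)
  ultimately have "Y \<in> cl X" by simp
  then show "eqv X Y" using assms by (simp add: cl_eq eqv_def)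
next
  assume e: "eqv X Y"
  have "Z \<in> cl W \<longleftrightarrow> eqv W Z" if "W \<in> CS" for W Z using that by (auto simp: cl_eq eqv_def)
  then have "Z \<in> cl X \<longleftrightarrow> Z \<in> cl Y" for Z
    using assms eqv_trans[OF e, of Z] eqv_trans[OF eqv_sym[OF e], of Z] by metis
  then show "cl X = cl Y" by blast
qed

text \<open>\<open>rep_seq\<close> picks an arbitrary member of a class, so the operations on
  classes see a representative that is known only up to \<open>eqv\<close>.\<close>

lemma rep: assumes "X \<in> CS" shows "eqv X (rep_seq (cl X))"
proof -
  have "X \<in> cl X" using assms by (simp add: cl_eq)
  then have "rep_seq (cl X) \<in> cl X" unfolding rep_seq_def by (rule someI[of "\<lambda>Y. Y \<in> cl X"])
  then show ?thesis using assms by (simp add: cl_eq eqv_def)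
qed

lemma eqv_add: assumes "eqv X X'" "eqv Y Y'" shows "eqv (\<lambda>n. X n + Y n) (\<lambda>n. X' n + Y' n)"
proof -
  have c: "X \<in> CS" "Y \<in> CS" "X' \<in> CS" "Y' \<in> CS" using assms by (auto simp: eqv_def)
  have "(\<lambda>n. U (X n + Y n - (X' n + Y' n))) \<longlonglongrightarrow> 0"
  proof (rule null_le)
    show "U (X n + Y n - (X' n + Y' n)) \<le> U (X n - X' n) + U (Y n - Y' n)" for n
      using U_add[of "X n - X' n" "Y n - Y' n"] c CS_in by (simp add: algebra_simps)
    show "(\<lambda>n. U (X n - X' n) + U (Y n - Y' n)) \<longlonglongrightarrow> 0"
      using assms by (intro null_add) (simp_all add: eqv_def)
  qed (use c in \<open>auto intro!: U_nonneg simp: CS_in\<close>)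
  then show ?thesis using c by (simp add: eqv_def CS_add)
qed

lemma eqv_scale: assumes "eqv X X'" shows "eqv (\<lambda>n. free_scale c (X n)) (\<lambda>n. free_scale c (X' n))"
proof -
  have c: "X \<in> CS" "X' \<in> CS" using assms by (auto simp: eqv_def)
  then have "U (free_scale c (X n) - free_scale c (X' n)) = cmod c * U (X n - X' n)" for n
    using CS_in by (simp add: U_scale flip: free_scale_diff_right)
  then show ?thesis
    using assms c tendsto_mult_left[of "\<lambda>n. U (X n - X' n)" 0 sequentially "cmod c"]
    by (simp add: eqv_def CS_scale)
qed

lemma eqv_star: assumes "eqv X X'" shows "eqv (\<lambda>n. free_star (X n)) (\<lambda>n. free_star (X' n))"
proof -
  have c: "X \<in> CS" "X' \<in> CS" using assms by (auto simp: eqv_def)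
  then have "U (free_star (X n) - free_star (X' n)) = U (X n - X' n)" for n
    using CS_in by (simp add: U_star flip: free_star_diff)
  then show ?thesis using assms c by (simp add: eqv_def CS_star)
qed

lemma eqv_mult: assumes "eqv X X'" "eqv Y Y'" shows "eqv (\<lambda>n. X n * Y n) (\<lambda>n. X' n * Y' n)"
proof -
  have c: "X \<in> CS" "Y \<in> CS" "X' \<in> CS" "Y' \<in> CS" using assms by (auto simp: eqv_def)
  note V = CS_in[OF c(1)] CS_in[OF c(2)] CS_in[OF c(3)] CS_in[OF c(4)]
  obtain K L where K: "\<And>n. U (X n) \<le> K" and L: "\<And>n. U (Y' n) \<le> L"
    using CS_bounded[OF c(1)] CS_bounded[OF c(4)] by blast
  have "(\<lambda>n. U (X n * Y n - X' n * Y' n)) \<longlonglongrightarrow> 0"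
  proof (rule null_le)
    fix n
    have "X n * Y n - X' n * Y' n = X n * (Y n - Y' n) + (X n - X' n) * Y' n"
      by (simp add: algebra_simps)
    then have "U (X n * Y n - X' n * Y' n) \<le> U (X n * (Y n - Y' n)) + U ((X n - X' n) * Y' n)"
      using U_add[of "X n * (Y n - Y' n)" "(X n - X' n) * Y' n"] V by simp
    also have "\<dots> \<le> U (X n) * U (Y n - Y' n) + U (X n - X' n) * U (Y' n)"
      using V by (intro add_mono U_mult) auto
    also have "\<dots> \<le> K * U (Y n - Y' n) + U (X n - X' n) * L"
      using K[of n] L[of n] V by (intro add_mono mult_right_mono mult_left_mono U_nonneg) auto
    finally show "U (X n * Y n - X' n * Y' n) \<le> K * U (Y n - Y' n) + U (X n - X' n) * L" .
    show "0 \<le> U (X n * Y n - X' n * Y' n)" using V by (intro U_nonneg) auto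
  next
    have "(\<lambda>n. K * U (Y n - Y' n) + U (X n - X' n) * L) \<longlonglongrightarrow> K * 0 + 0 * L"
      using assms by (intro tendsto_intros) (auto simp: eqv_def)
    then show "(\<lambda>n. K * U (Y n - Y' n) + U (X n - X' n) * L) \<longlonglongrightarrow> 0" by simp
  qed
  then show ?thesis using c by (simp add: eqv_def CS_mult)
qed

lemma U_convergent: assumes "X \<in> CS" shows "(\<lambda>n. U (X n)) \<longlonglongrightarrow> lim (\<lambda>n. U (X n))"
proof -
  have "Cauchy (\<lambda>n. U (X n))"
  proof (rule metric_CauchyI)
    fix e :: real assume "e > 0"
    then obtain M where "\<And>m n. m \<ge> M \<Longrightarrow> n \<ge> M \<Longrightarrow> U (X m - X n) < e" using CS_Cauchy[OF assms] by blast
    then have "\<forall>m\<ge>M. \<forall>n\<ge>M. dist (U (X m)) (U (X n)) < e"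
      using U_reverse[OF CS_in[OF assms] CS_in[OF assms]] by (simp add: dist_real_def) (meson le_less_trans)
    then show "\<exists>M. \<forall>m\<ge>M. \<forall>n\<ge>M. dist (U (X m)) (U (X n)) < e" by blast
  qed
  then show ?thesis using real_Cauchy_convergent convergent_LIMSEQ_iff by blast
qed

abbreviation "UA \<equiv> universal_cstar G R"

lemma carrier_UA: "carrier UA = cl ` CS"
  by (simp add: universal_cstar_def)

lemma cl_in [simp]: "X \<in> CS \<Longrightarrow> cl X \<in> carrier UA"
  by (simp add: carrier_UA)

text \<open>Every operation respects \<open>eqv\<close>, so it may be computed with any
  representative in place of the chosen one.\<close>

lemma UA_ops:
  "\<one>\<^bsub>UA\<^esub> = cl (\<lambda>n. 1)" "\<zero>\<^bsub>UA\<^esub> = cl (\<lambda>n. 0)"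
  "X \<in> CS \<Longrightarrow> Y \<in> CS \<Longrightarrow> cl X \<otimes>\<^bsub>UA\<^esub> cl Y = cl (\<lambda>n. X n * Y n)"
  "X \<in> CS \<Longrightarrow> Y \<in> CS \<Longrightarrow> cl X \<oplus>\<^bsub>UA\<^esub> cl Y = cl (\<lambda>n. X n + Y n)"
  "X \<in> CS \<Longrightarrow> c \<odot>\<^bsub>UA\<^esub> cl X = cl (\<lambda>n. free_scale c (X n))"
  "X \<in> CS \<Longrightarrow> star UA (cl X) = cl (\<lambda>n. free_star (X n))"
proof -
  show "\<one>\<^bsub>UA\<^esub> = cl (\<lambda>n. 1)" "\<zero>\<^bsub>UA\<^esub> = cl (\<lambda>n. 0)" by (simp_all add: universal_cstar_def)
  have *: "cl X = cl Y" if "eqv Y X" for X Y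
    using eqv_sym[OF that] by (subst cl_eq_iff) (auto simp: eqv_def)
  show "cl X \<otimes>\<^bsub>UA\<^esub> cl Y = cl (\<lambda>n. X n * Y n)" if "X \<in> CS" "Y \<in> CS" for X Y
    using *[OF eqv_mult[OF rep[OF that(1)] rep[OF that(2)]]] by (simp add: universal_cstar_def)
  show "cl X \<oplus>\<^bsub>UA\<^esub> cl Y = cl (\<lambda>n. X n + Y n)" if "X \<in> CS" "Y \<in> CS" for X Y
    using *[OF eqv_add[OF rep[OF that(1)] rep[OF that(2)]]] by (simp add: universal_cstar_def)
  show "c \<odot>\<^bsub>UA\<^esub> cl X = cl (\<lambda>n. free_scale c (X n))" if "X \<in> CS" for X
    using *[OF eqv_scale[OF rep[OF that(1)]]] by (simp add: universal_cstar_def)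
  show "star UA (cl X) = cl (\<lambda>n. free_star (X n))" if "X \<in> CS" for X
    using *[OF eqv_star[OF rep[OF that(1)]]] by (simp add: universal_cstar_def)
qed

lemma cnorm_cl: assumes "X \<in> CS" shows "(\<lambda>n. U (X n)) \<longlonglongrightarrow> cnorm UA (cl X)"
proof -
  let ?Y = "rep_seq (cl X)"
  have e: "eqv X ?Y" by (rule rep[OF assms])
  then have Y: "?Y \<in> CS" by (simp add: eqv_def)
  have "(\<lambda>n. U (X n) - U (?Y n)) \<longlonglongrightarrow> 0"
  proof (rule Lim_null_comparison)
    show "(\<lambda>n. U (X n - ?Y n)) \<longlonglongrightarrow> 0" using e by (simp add: eqv_def)
    show "\<forall>\<^sub>F n in sequentially. norm (U (X n) - U (?Y n)) \<le> U (X n - ?Y n)"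
      using U_reverse CS_in[OF assms] CS_in[OF Y] by (simp add: always_eventually)
  qed
  from tendsto_add[OF this U_convergent[OF Y]] show ?thesis
    by (simp add: universal_cstar_def)
qed

lemma cnorm_cl_const: "x \<in> V \<Longrightarrow> cnorm UA (cl (\<lambda>n. x)) = U x"
  using LIMSEQ_unique[OF cnorm_cl[OF CS_const] tendsto_const] by simp

lemma CS_zero_one: "(\<lambda>n. 0) \<in> CS" "(\<lambda>n. 1) \<in> CS"
  by (auto intro: CS_const)

lemma UA_E: assumes "x \<in> carrier UA" obtains X where "X \<in> CS" "x = cl X"
  using assms by (auto simp: carrier_UA)

lemmas UA_simps = UA_ops CS_zero_one CS_add CS_mult CS_scale CS_star

lemma abelian_group_UA: "abelian_group UA"
proof (rule abelian_groupI)
  fix x assume "x \<in> carrier UA"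
  then obtain X where X: "X \<in> CS" "x = cl X" by (rule UA_E)
  show "\<exists>y\<in>carrier UA. y \<oplus>\<^bsub>UA\<^esub> x = \<zero>\<^bsub>UA\<^esub>"
    using X by (intro bexI[of _ "cl (\<lambda>n. free_scale (-1) (X n))"])
      (simp_all add: UA_simps, simp add: free_scale_minus1)
qed (auto elim!: UA_E simp: UA_simps add_ac)

lemma ring_UA: "ring UA"
proof (rule ringI)
  show "monoid UA"
    by (rule monoidI) (auto elim!: UA_E simp: UA_simps mult.assoc)
qed (auto elim!: UA_E simp: UA_simps abelian_group_UA algebra_simps)

lemma module_UA: "Module.module complex_ring UA"
  by (rule moduleI[OF cring_complex_ring abelian_group_UA])
    (auto elim!: UA_E simp: UA_simps free_scale_add_left free_scale_add_right)

lemma diff_cl: assumes "X \<in> CS" "Y \<in> CS" shows "cl X \<ominus>\<^bsub>UA\<^esub> cl Y = cl (\<lambda>n. X n - Y n)"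
proof -
  have Y': "(\<lambda>n. - Y n) \<in> CS" using CS_scale[OF assms(2), of "-1"] by (simp add: free_scale_minus1)
  have "cl (\<lambda>n. - Y n) \<oplus>\<^bsub>UA\<^esub> cl Y = \<zero>\<^bsub>UA\<^esub>" using Y' assms by (simp add: UA_simps)
  then have "\<ominus>\<^bsub>UA\<^esub> cl Y = cl (\<lambda>n. - Y n)"
    using abelian_group.minus_equality[OF abelian_group_UA] assms Y' by simp
  then show ?thesis using assms Y' by (simp add: a_minus_def UA_simps)
qed

lemma CS_diff: "X \<in> CS \<Longrightarrow> Y \<in> CS \<Longrightarrow> (\<lambda>n. X n - Y n) \<in> CS"
  using CS_add[OF _ CS_scale[of Y "-1"], of X] by (simp add: free_scale_minus1)

lemma cnorm_nonneg_UA: "x \<in> carrier UA \<Longrightarrow> 0 \<le> cnorm UA x"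
  by (elim UA_E, simp) (rule LIMSEQ_le_const[OF cnorm_cl], auto intro: U_nonneg CS_in)

lemma cnorm_triangle_UA:
  assumes "x \<in> carrier UA" "y \<in> carrier UA"
  shows "cnorm UA (x \<oplus>\<^bsub>UA\<^esub> y) \<le> cnorm UA x + cnorm UA y"
proof -
  obtain X Y where X: "X \<in> CS" "x = cl X" and Y: "Y \<in> CS" "y = cl Y" using assms by (auto elim!: UA_E)
  have "(\<lambda>n. U (X n + Y n)) \<longlonglongrightarrow> cnorm UA (x \<oplus>\<^bsub>UA\<^esub> y)"
    using cnorm_cl[OF CS_add[OF X(1) Y(1)]] X Y by (simp add: UA_simps)
  moreover have "(\<lambda>n. U (X n) + U (Y n)) \<longlonglongrightarrow> cnorm UA x + cnorm UA y"
    using X Y by (auto intro!: tendsto_add cnorm_cl)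
  ultimately show ?thesis
    by (rule LIMSEQ_le) (use X Y CS_in in \<open>auto intro!: U_add\<close>)
qed

lemma cnorm_smult_UA:
  assumes "x \<in> carrier UA"
  shows "cnorm UA (c \<odot>\<^bsub>UA\<^esub> x) = cmod c * cnorm UA x"
proof -
  obtain X where X: "X \<in> CS" "x = cl X" using assms by (auto elim!: UA_E)
  have "(\<lambda>n. cmod c * U (X n)) \<longlonglongrightarrow> cnorm UA (c \<odot>\<^bsub>UA\<^esub> x)"
    using cnorm_cl[OF CS_scale[OF X(1), of c]] X CS_in by (simp add: UA_simps U_scale)
  moreover have "(\<lambda>n. cmod c * U (X n)) \<longlonglongrightarrow> cmod c * cnorm UA x"
    using X by (auto intro!: tendsto_mult_left cnorm_cl)
  ultimately show ?thesis by (rule LIMSEQ_unique)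
qed

lemma cnorm_mult_UA:
  assumes "x \<in> carrier UA" "y \<in> carrier UA"
  shows "cnorm UA (x \<otimes>\<^bsub>UA\<^esub> y) \<le> cnorm UA x * cnorm UA y"
proof -
  obtain X Y where X: "X \<in> CS" "x = cl X" and Y: "Y \<in> CS" "y = cl Y" using assms by (auto elim!: UA_E)
  have "(\<lambda>n. U (X n * Y n)) \<longlonglongrightarrow> cnorm UA (x \<otimes>\<^bsub>UA\<^esub> y)"
    using cnorm_cl[OF CS_mult[OF X(1) Y(1)]] X Y by (simp add: UA_simps)
  moreover have "(\<lambda>n. U (X n) * U (Y n)) \<longlonglongrightarrow> cnorm UA x * cnorm UA y"
    using X Y by (auto intro!: tendsto_mult cnorm_cl)
  ultimately show ?thesis
    by (rule LIMSEQ_le) (use X Y CS_in in \<open>auto intro!: U_mult\<close>)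
qed

lemma cstar_identity_UA:
  assumes "x \<in> carrier UA"
  shows "cnorm UA (star UA x \<otimes>\<^bsub>UA\<^esub> x) = (cnorm UA x)\<^sup>2"
proof -
  obtain X where X: "X \<in> CS" "x = cl X" using assms by (auto elim!: UA_E)
  have "(\<lambda>n. (U (X n))\<^sup>2) \<longlonglongrightarrow> cnorm UA (star UA x \<otimes>\<^bsub>UA\<^esub> x)"
    using cnorm_cl[OF CS_mult[OF CS_star[OF X(1)] X(1)]] X CS_in by (simp add: UA_simps U_cstar)
  moreover have "(\<lambda>n. (U (X n))\<^sup>2) \<longlonglongrightarrow> (cnorm UA x)\<^sup>2"
    using X by (auto intro!: tendsto_power cnorm_cl)
  ultimately show ?thesis by (rule LIMSEQ_unique)
qed

lemma cnorm_eq_0_UA: assumes "x \<in> carrier UA" shows "cnorm UA x = 0 \<longleftrightarrow> x = \<zero>\<^bsub>UA\<^esub>"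
proof -
  obtain X where X: "X \<in> CS" "x = cl X" using assms by (auto elim!: UA_E)
  show ?thesis
  proof
    assume "cnorm UA x = 0"
    then have "eqv X (\<lambda>n. 0)" using cnorm_cl[OF X(1)] X by (simp add: eqv_def CS_zero_one)
    then show "x = \<zero>\<^bsub>UA\<^esub>" using X by (simp add: UA_simps cl_eq_iff)
  qed (use cnorm_cl_const[of 0] in \<open>simp add: UA_simps\<close>)
qed

lemma UA_approx:
  assumes "x \<in> carrier UA" "\<epsilon> > 0"
  shows "\<exists>z\<in>V. cnorm UA (x \<ominus>\<^bsub>UA\<^esub> cl (\<lambda>n. z)) \<le> \<epsilon>"
proof -
  obtain X where X: "X \<in> CS" "x = cl X" using assms by (auto elim!: UA_E)
  obtain M where M: "\<And>m n. m \<ge> M \<Longrightarrow> n \<ge> M \<Longrightarrow> U (X m - X n) < \<epsilon>"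
    using CS_Cauchy[OF X(1) assms(2)] by blast
  have V: "X M \<in> V" by (rule CS_in[OF X(1)])
  have "(\<lambda>n. U (X n - X M)) \<longlonglongrightarrow> cnorm UA (x \<ominus>\<^bsub>UA\<^esub> cl (\<lambda>n. X M))"
    using cnorm_cl[OF CS_diff[OF X(1) CS_const[OF V]]] X(2) diff_cl[OF X(1) CS_const[OF V]] by simp
  then have "cnorm UA (x \<ominus>\<^bsub>UA\<^esub> cl (\<lambda>n. X M)) \<le> \<epsilon>"
    by (rule LIMSEQ_le_const2) (use M[of _ M] in \<open>auto intro!: exI[of _ M] less_imp_le\<close>)
  then show ?thesis using V by blast
qed

text \<open>The terms of a Cauchy sequence, seen as constant sequences, converge to its class. So
  the polynomials are dense in the completion.\<close>

lemma cl_limit: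
  assumes "X \<in> CS"
  shows "(\<lambda>k. cnorm UA (cl (\<lambda>n. X k) \<ominus>\<^bsub>UA\<^esub> cl X)) \<longlonglongrightarrow> 0"
proof (rule LIMSEQ_I)
  fix r :: real assume r: "r > 0"
  obtain M where M: "\<And>m n. m \<ge> M \<Longrightarrow> n \<ge> M \<Longrightarrow> U (X m - X n) < r / 2"
    using CS_Cauchy[OF assms, of "r / 2"] r by auto
  have "norm (cnorm UA (cl (\<lambda>n. X k) \<ominus>\<^bsub>UA\<^esub> cl X) - 0) < r" if "k \<ge> M" for k
  proof -
    note c = CS_const[OF CS_in[OF assms, of k]]
    have e: "cl (\<lambda>n. X k) \<ominus>\<^bsub>UA\<^esub> cl X = cl (\<lambda>n. X k - X n)" by (rule diff_cl[OF c assms])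
    have "(\<lambda>n. U (X k - X n)) \<longlonglongrightarrow> cnorm UA (cl (\<lambda>n. X k) \<ominus>\<^bsub>UA\<^esub> cl X)"
      unfolding e by (rule cnorm_cl[OF CS_diff[OF c assms]])
    then have "cnorm UA (cl (\<lambda>n. X k) \<ominus>\<^bsub>UA\<^esub> cl X) \<le> r / 2"
      by (rule LIMSEQ_le_const2) (use M[of k] that in \<open>auto intro!: exI[of _ M] less_imp_le\<close>)
    moreover have "0 \<le> cnorm UA (cl (\<lambda>n. X k) \<ominus>\<^bsub>UA\<^esub> cl X)"
      unfolding e by (rule cnorm_nonneg_UA) (rule cl_in[OF CS_diff[OF c assms]])
    ultimately show ?thesis using r by simp
  qed
  then show "\<exists>no. \<forall>k\<ge>no. norm (cnorm UA (cl (\<lambda>n. X k) \<ominus>\<^bsub>UA\<^esub> cl X) - 0) < r" by blast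
qed

lemma cnorm_diff_triangle_UA:
  assumes "x \<in> carrier UA" "y \<in> carrier UA" "z \<in> carrier UA"
  shows "cnorm UA (x \<ominus>\<^bsub>UA\<^esub> z) \<le> cnorm UA (x \<ominus>\<^bsub>UA\<^esub> y) + cnorm UA (y \<ominus>\<^bsub>UA\<^esub> z)"
proof -
  interpret ring UA by (rule ring_UA)
  have "x \<ominus>\<^bsub>UA\<^esub> z = (x \<ominus>\<^bsub>UA\<^esub> y) \<oplus>\<^bsub>UA\<^esub> (y \<ominus>\<^bsub>UA\<^esub> z)" using assms by algebra
  then show ?thesis using cnorm_triangle_UA[of "x \<ominus>\<^bsub>UA\<^esub> y" "y \<ominus>\<^bsub>UA\<^esub> z"] assms by simp
qed

lemma cnorm_minus_UA: assumes "x \<in> carrier UA" shows "cnorm UA (\<ominus>\<^bsub>UA\<^esub> x) = cnorm UA x"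
proof -
  obtain X where X: "X \<in> CS" "x = cl X" using assms by (auto elim!: UA_E)
  have "\<zero>\<^bsub>UA\<^esub> \<ominus>\<^bsub>UA\<^esub> x = (-1) \<odot>\<^bsub>UA\<^esub> x"
    using diff_cl[OF CS_zero_one(1) X(1)] X by (simp add: UA_simps free_scale_minus1)
  moreover have "\<zero>\<^bsub>UA\<^esub> \<ominus>\<^bsub>UA\<^esub> x = \<ominus>\<^bsub>UA\<^esub> x"
  proof -
    interpret ring UA by (rule ring_UA)
    show ?thesis using assms by algebra
  qed
  ultimately show ?thesis using cnorm_smult_UA[OF assms, of "-1"] by simp
qed

text \<open>A diagonal argument: the k-th class is replaced by a polynomial \<open>Z k\<close> at
  distance at most \<open>1 / Suc k\<close>. These polynomials form a Cauchy sequence, and its class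
  is the limit.\<close>

lemma complete_UA: "Metric_space.mcomplete (carrier UA) (cstar_dist UA)"
proof (rule mcomplete_normI[OF abelian_group_UA cnorm_nonneg_UA cnorm_eq_0_UA cnorm_triangle_UA cnorm_minus_UA])
  fix S :: "nat \<Rightarrow> (nat \<Rightarrow> 'g star_poly) set"
  assume S: "\<And>n. S n \<in> carrier UA"
    and C: "\<And>\<epsilon>. \<epsilon> > 0 \<Longrightarrow> \<exists>M. \<forall>m\<ge>M. \<forall>n\<ge>M. cnorm UA (S m \<ominus>\<^bsub>UA\<^esub> S n) < \<epsilon>"
  interpret ring UA by (rule ring_UA)
  have "\<exists>z\<in>V. cnorm UA (S k \<ominus>\<^bsub>UA\<^esub> cl (\<lambda>n. z)) \<le> 1 / Suc k" for k
    by (rule UA_approx[OF S]) simp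
  then obtain Z where Z: "\<And>k. Z k \<in> V" "\<And>k. cnorm UA (S k \<ominus>\<^bsub>UA\<^esub> cl (\<lambda>n. Z k)) \<le> 1 / Suc k" by metis
  let ?z = "\<lambda>k. cl (\<lambda>n. Z k)"
  have z: "?z k \<in> carrier UA" for k by (rule cl_in[OF CS_const[OF Z(1)]])
  have sym: "cnorm UA (a \<ominus>\<^bsub>UA\<^esub> b) = cnorm UA (b \<ominus>\<^bsub>UA\<^esub> a)" if "a \<in> carrier UA" "b \<in> carrier UA" for a b
  proof -
    have "\<ominus>\<^bsub>UA\<^esub> (a \<ominus>\<^bsub>UA\<^esub> b) = b \<ominus>\<^bsub>UA\<^esub> a" using that by algebra
    then show ?thesis using cnorm_minus_UA[of "a \<ominus>\<^bsub>UA\<^esub> b"] that by simp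
  qed
  have lim0: "(\<lambda>k. 1 / Suc k :: real) \<longlonglongrightarrow> 0" using LIMSEQ_inverse_real_of_nat by (simp add: inverse_eq_divide)
  have ZC: "Z \<in> CS"
    unfolding cauchy_seqs_def
  proof (intro CollectI conjI allI impI Z(1))
    fix \<epsilon> :: real assume e: "\<epsilon> > 0"
    obtain M where M: "\<And>m n. m \<ge> M \<Longrightarrow> n \<ge> M \<Longrightarrow> cnorm UA (S m \<ominus>\<^bsub>UA\<^esub> S n) < \<epsilon> / 3"
      using C[of "\<epsilon> / 3"] e by auto
    obtain L where L: "\<And>k. k \<ge> L \<Longrightarrow> 1 / Suc k < \<epsilon> / 3"
      using order_tendstoD(2)[OF lim0, of "\<epsilon> / 3"] e by (auto simp: eventually_sequentially)
    have "U (Z m - Z n) < \<epsilon>" if "m \<ge> max M L" "n \<ge> max M L" for m n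
    proof -
      have "U (Z m - Z n) = cnorm UA (?z m \<ominus>\<^bsub>UA\<^esub> ?z n)"
        using diff_cl[OF CS_const[OF Z(1)] CS_const[OF Z(1)]] cnorm_cl_const[of "Z m - Z n"] Z(1) by simp
      also have "\<dots> \<le> cnorm UA (?z m \<ominus>\<^bsub>UA\<^esub> S m) + cnorm UA (S m \<ominus>\<^bsub>UA\<^esub> ?z n)"
        by (rule cnorm_diff_triangle_UA[OF z S z])
      also have "cnorm UA (S m \<ominus>\<^bsub>UA\<^esub> ?z n) \<le> cnorm UA (S m \<ominus>\<^bsub>UA\<^esub> S n) + cnorm UA (S n \<ominus>\<^bsub>UA\<^esub> ?z n)"
        by (rule cnorm_diff_triangle_UA[OF S S z])
      finally show ?thesis
        using M[of m n] L[of m] L[of n] Z(2)[of m] Z(2)[of n] sym[OF z S, of m m] that by simp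
    qed
    then show "\<exists>M. \<forall>m\<ge>M. \<forall>n\<ge>M. U (Z m - Z n) < \<epsilon>" by blast
  qed
  have "(\<lambda>k. cnorm UA (S k \<ominus>\<^bsub>UA\<^esub> cl Z)) \<longlonglongrightarrow> 0"
  proof (rule null_le)
    show "cnorm UA (S k \<ominus>\<^bsub>UA\<^esub> cl Z) \<le> 1 / Suc k + cnorm UA (?z k \<ominus>\<^bsub>UA\<^esub> cl Z)" for k
      using cnorm_diff_triangle_UA[OF S z cl_in[OF ZC], of k k] Z(2)[of k] by simp
    show "(\<lambda>k. 1 / Suc k + cnorm UA (?z k \<ominus>\<^bsub>UA\<^esub> cl Z)) \<longlonglongrightarrow> 0"
      using tendsto_add[OF lim0 cl_limit[OF ZC]] by simp
    show "0 \<le> cnorm UA (S k \<ominus>\<^bsub>UA\<^esub> cl Z)" for k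
      using S cl_in[OF ZC] by (intro cnorm_nonneg_UA) simp
  qed
  then show "\<exists>x\<in>carrier UA. (\<lambda>n. cnorm UA (S n \<ominus>\<^bsub>UA\<^esub> x)) \<longlonglongrightarrow> 0" using cl_in[OF ZC] by blast
qed (simp_all add: cstar_dist_def fun_eq_iff)

theorem cstar_algebra_UA: "cstar_algebra UA"
proof (rule cstar_algebra.intro[OF ring_UA module_UA], unfold_locales)
  show "Metric_space.mcomplete (carrier UA) (cstar_dist UA)" by (rule complete_UA)
qed ((rule cnorm_nonneg_UA cnorm_eq_0_UA cnorm_triangle_UA cnorm_smult_UA cnorm_mult_UA
    cstar_identity_UA; assumption) |
  (auto elim!: UA_E simp: UA_simps free_star_mult free_star_add free_star_scale)[1])+

end

section \<open>Generation and universal property of the universal algebra\<close>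

context bounded_relations
begin

abbreviation "gen \<equiv> universal_gen G R"

abbreviation "const_cl p \<equiv> cl (\<lambda>n. p)"

lemma gen_eq: "gen g = const_cl (free_gen g)"
  by (simp add: universal_gen_def)

lemma const_cl_simps:
  "p \<in> V \<Longrightarrow> const_cl p \<in> carrier UA"
  "const_cl 1 = \<one>\<^bsub>UA\<^esub>" "const_cl 0 = \<zero>\<^bsub>UA\<^esub>"
  "p \<in> V \<Longrightarrow> q \<in> V \<Longrightarrow> const_cl (p * q) = const_cl p \<otimes>\<^bsub>UA\<^esub> const_cl q"
  "p \<in> V \<Longrightarrow> q \<in> V \<Longrightarrow> const_cl (p + q) = const_cl p \<oplus>\<^bsub>UA\<^esub> const_cl q"
  "p \<in> V \<Longrightarrow> q \<in> V \<Longrightarrow> const_cl (p - q) = const_cl p \<ominus>\<^bsub>UA\<^esub> const_cl q"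
  "p \<in> V \<Longrightarrow> const_cl (free_scale c p) = c \<odot>\<^bsub>UA\<^esub> const_cl p"
  "p \<in> V \<Longrightarrow> const_cl (free_star p) = star UA (const_cl p)"
  by (simp_all add: UA_ops CS_const diff_cl)

lemma gen_in_UA: "g \<in> G \<Longrightarrow> gen g \<in> carrier UA"
  by (simp add: gen_eq const_cl_simps)

lemma const_cl_eqI:
  assumes "p - q \<in> R" "p \<in> V" "q \<in> V"
  shows "const_cl p = const_cl q"
  using assms by (simp add: cl_eq_iff eqv_def CS_const U_relation)

text \<open>Words come from products, polynomials from linear combinations, everything else from
  limits. The adjoints of the generators are required in \<open>W\<close> because words contain
  starred letters.\<close>

lemma UA_generated:
  assumes W: "closed_subspace UA W" "\<one>\<^bsub>UA\<^esub> \<in> W"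
    and mult: "\<And>x y. x \<in> W \<Longrightarrow> y \<in> W \<Longrightarrow> x \<otimes>\<^bsub>UA\<^esub> y \<in> W"
    and gen: "\<And>g. g \<in> G \<Longrightarrow> gen g \<in> W" "\<And>g. g \<in> G \<Longrightarrow> star UA (gen g) \<in> W"
  shows "W = carrier UA"
proof -
  note Wd = W(1)[unfolded closed_subspace_def]
  have word: "const_cl (Poly_Mapping.single (SWord xs) 1) \<in> W" if "fst ` set xs \<subseteq> G" for xs
    using that
  proof (induction xs)
    case Nil
    have "Poly_Mapping.single (SWord []) 1 = (1 :: 'g star_poly)" by (simp flip: zero_sword_def)
    then show ?case using W(2) by (simp add: const_cl_simps)
  next
    case (Cons a xs)
    obtain g b where a: "a = (g, b)" by fastforce
    have g: "g \<in> G" using Cons.prems a by simp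
    let ?l = "Poly_Mapping.single (SWord [a]) 1 :: 'g star_poly"
    let ?x = "Poly_Mapping.single (SWord xs) 1 :: 'g star_poly"
    have V: "?l \<in> V" "?x \<in> V" using Cons.prems by (intro free_star_algebra_single; simp)+
    have "?l = (if b then free_star (free_gen g) else free_gen g)"
      by (simp add: a free_gen_def word_star_def)
    then have "const_cl ?l \<in> W" using gen[OF g] g by (simp add: gen_eq const_cl_simps)
    moreover have "Poly_Mapping.single (SWord (a # xs)) 1 = ?l * ?x"
      by (simp add: mult_single plus_sword_def)
    ultimately show ?case using mult Cons V by (simp add: const_cl_simps)
  qed
  have poly: "const_cl p \<in> W" if "p \<in> V" for p
    using that
  proof (induction p rule: free_star_algebra_induct)
    case zero
    show ?case using Wd by (simp add: const_cl_simps)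
  next
    case (single w c)
    have V: "Poly_Mapping.single w 1 \<in> V" using single by (rule free_star_algebra_single)
    have "const_cl (Poly_Mapping.single w 1) \<in> W"
      using word[of "letters w"] single by (cases w) simp
    moreover have "Poly_Mapping.single w c = free_scale c (Poly_Mapping.single w 1)"
      by (simp add: free_scale_def mult_single)
    ultimately show ?case using Wd V by (simp add: const_cl_simps)
  next
    case (add p q)
    then show ?case using Wd by (simp add: const_cl_simps)
  qed
  have "x \<in> W" if x: "x \<in> carrier UA" for x
  proof -
    obtain X where X: "X \<in> CS" "x = cl X" using x by (rule UA_E)
    have "cstar_lim UA (\<lambda>k. const_cl (X k)) x"
      using cl_limit[OF X(1)] X CS_in[OF X(1)] by (simp add: cstar_lim_def const_cl_simps)
    moreover have "const_cl (X k) \<in> W" for k using poly CS_in[OF X(1)] by blast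
    ultimately show ?thesis using closed_subspaceD[OF W(1)] by metis
  qed
  then show ?thesis using Wd by blast
qed

lemma star_hom_UA_eqI:
  assumes B: "cstar_algebra B" and h: "h \<in> star_hom UA B" and k: "k \<in> star_hom UA B"
    and eq: "\<And>g. g \<in> G \<Longrightarrow> h (gen g) = k (gen g)"
  shows "h = k"
proof -
  interpret UA: cstar_algebra UA by (rule cstar_algebra_UA)
  have "{x \<in> carrier UA. h x = k x} = carrier UA"
  proof (rule UA_generated)
    show "closed_subspace UA {x \<in> carrier UA. h x = k x}"
      by (rule UA.closed_subspace_equalizer[OF UA.star_hom_cont_linear[OF h B]
          UA.star_hom_cont_linear[OF k B] B])
  qed (auto simp: star_homD[OF h] star_homD[OF k] eq gen_in_UA UA.one_in UA.mult_in)
  then have "\<And>x. x \<in> carrier UA \<Longrightarrow> h x = k x" by blast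
  then show ?thesis using star_homD(7)[OF h] star_homD(7)[OF k] by (rule extensionalityI[rotated 2])
qed

text \<open>Evaluation kills the relations, so it is contractive for the universal norm and maps
  Cauchy sequences to convergent ones; the homomorphism is the limit of the evaluations.\<close>

theorem universal_hom:
  assumes B: "cstar_algebra B" and \<phi>: "\<And>g. g \<in> G \<Longrightarrow> \<phi> g \<in> carrier B"
    and R: "\<And>r. r \<in> R \<Longrightarrow> poly_val \<phi> B r = \<zero>\<^bsub>B\<^esub>"
  obtains h where "h \<in> star_hom UA B" "\<And>g. g \<in> G \<Longrightarrow> h (gen g) = \<phi> g"
proof -
  interpret B: cstar_algebra B by (rule B)
  interpret poly_valuation B G \<phi> by unfold_locales (rule \<phi>)
  have le: "cnorm B (val p) \<le> U p" if "p \<in> V" for p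
    using seminorm_le_U[OF cstar_seminorm_val _ that] R by simp
  have ex: "\<exists>y. cstar_lim B (\<lambda>n. val (X n)) y" if X: "X \<in> CS" for X
  proof -
    have V: "X n \<in> V" for n by (rule CS_in[OF X])
    have d: "cnorm B (val (X m) \<ominus>\<^bsub>B\<^esub> val (X n)) \<le> U (X m - X n)" for m n
      using le[of "X m - X n"] V by (simp add: val_diff)
    have "\<exists>M. \<forall>m\<ge>M. \<forall>n\<ge>M. cnorm B (val (X m) \<ominus>\<^bsub>B\<^esub> val (X n)) < \<epsilon>" if "\<epsilon> > 0" for \<epsilon>
      using CS_Cauchy[OF X that] le_less_trans[OF d] by blast
    then show ?thesis using B.Cauchy_lim[of "\<lambda>n. val (X n)"] V by (metis val_in)
  qed
  define h where "h = (\<lambda>S\<in>carrier UA. THE y. cstar_lim B (\<lambda>n. val (rep_seq S n)) y)"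
  \<comment> \<open>The limit does not depend on the representative, since the evaluations of
    equivalent sequences differ by a null sequence.\<close>
  have hI: "h (cl X) = y" if X: "X \<in> CS" and y: "cstar_lim B (\<lambda>n. val (X n)) y" for X y
  proof -
    let ?Y = "rep_seq (cl X)"
    have e: "eqv X ?Y" by (rule rep[OF X])
    then have Y: "?Y \<in> CS" by (simp add: eqv_def)
    note V = CS_in[OF X] CS_in[OF Y]
    have "cstar_lim B (\<lambda>n. val (X n) \<ominus>\<^bsub>B\<^esub> val (?Y n)) \<zero>\<^bsub>B\<^esub>"
    proof (rule B.lim_leI)
      show "cnorm B (val (X n) \<ominus>\<^bsub>B\<^esub> val (?Y n) \<ominus>\<^bsub>B\<^esub> \<zero>\<^bsub>B\<^esub>) \<le> U (X n - ?Y n)" for n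
        using le[of "X n - ?Y n"] V by (simp add: val_diff B.minus_eq_smult)
      show "(\<lambda>n. U (X n - ?Y n)) \<longlonglongrightarrow> 0" using e by (simp add: eqv_def)
    qed (use V in \<open>auto intro: B.minus_in\<close>)
    from B.lim_diff[OF y this] have "cstar_lim B (\<lambda>n. val (?Y n)) y"
    proof -
      have "val (X n) \<ominus>\<^bsub>B\<^esub> (val (X n) \<ominus>\<^bsub>B\<^esub> val (?Y n)) = val (?Y n)" for n
      proof -
        have "a \<ominus>\<^bsub>B\<^esub> (a \<ominus>\<^bsub>B\<^esub> b) = b" if "a \<in> carrier B" "b \<in> carrier B" for a b using that by algebra
        then show ?thesis using V by simp
      qed
      moreover have "y \<ominus>\<^bsub>B\<^esub> \<zero>\<^bsub>B\<^esub> = y" using B.lim_in(2)[OF y] by (simp add: B.minus_eq_smult)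
      ultimately show ?thesis using \<open>cstar_lim B (\<lambda>n. val (X n) \<ominus>\<^bsub>B\<^esub> (val (X n) \<ominus>\<^bsub>B\<^esub> val (?Y n))) (y \<ominus>\<^bsub>B\<^esub> \<zero>\<^bsub>B\<^esub>)\<close> by simp
    qed
    then have "(THE y. cstar_lim B (\<lambda>n. val (?Y n)) y) = y"
      using B.lim_unique by (intro the_equality) auto
    then show ?thesis using X by (simp add: h_def)
  qed
  have "h \<in> star_hom UA B"
  proof (rule star_homI)
    show "h \<in> extensional (carrier UA)" by (simp add: h_def)
    show "h \<one>\<^bsub>UA\<^esub> = \<one>\<^bsub>B\<^esub>"
      unfolding UA_ops by (rule hI) (simp_all add: CS_zero_one B.lim_const B.one_in)
    fix x assume "x \<in> carrier UA"
    then obtain X where X: "X \<in> CS" "x = cl X" by (rule UA_E)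
    obtain a where a: "cstar_lim B (\<lambda>n. val (X n)) a" using ex[OF X(1)] by blast
    have hx: "h x = a" using hI[OF X(1) a] X(2) by simp
    show "h x \<in> carrier B" using hx B.lim_in(2)[OF a] by simp
    show "h (c \<odot>\<^bsub>UA\<^esub> x) = c \<odot>\<^bsub>B\<^esub> h x" for c
      using X CS_in[OF X(1)] B.lim_smult[OF a, of c] hx
      by (auto simp: UA_simps val_scale intro!: hI)
    show "h (star UA x) = star B (h x)"
      using X CS_in[OF X(1)] B.lim_star[OF a] hx
      by (auto simp: UA_simps val_star intro!: hI)
    fix y assume "y \<in> carrier UA"
    then obtain Y where Y: "Y \<in> CS" "y = cl Y" by (rule UA_E)
    obtain b where b: "cstar_lim B (\<lambda>n. val (Y n)) b" using ex[OF Y(1)] by blast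
    have hy: "h y = b" using hI[OF Y(1) b] Y(2) by simp
    show "h (x \<otimes>\<^bsub>UA\<^esub> y) = h x \<otimes>\<^bsub>B\<^esub> h y"
      using X Y CS_in[OF X(1)] CS_in[OF Y(1)] B.lim_mult[OF a b] hx hy
      by (auto simp: UA_simps val_mult intro!: hI)
    show "h (x \<oplus>\<^bsub>UA\<^esub> y) = h x \<oplus>\<^bsub>B\<^esub> h y"
      using X Y CS_in[OF X(1)] CS_in[OF Y(1)] B.lim_add[OF a b] hx hy
      by (auto simp: UA_simps val_add intro!: hI)
  qed
  moreover have "h (gen g) = \<phi> g" if "g \<in> G" for g
    unfolding gen_eq by (rule hI) (simp_all add: that CS_const val_gen B.lim_const \<phi>)
  ultimately show ?thesis using that by blast
qed

end

section \<open>Operators on square-summable sequences\<close>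

definition l2 :: "(nat \<Rightarrow> complex) set" where
  "l2 = {x. summable (\<lambda>n. (cmod (x n))\<^sup>2)}"

definition ip :: "(nat \<Rightarrow> complex) \<Rightarrow> (nat \<Rightarrow> complex) \<Rightarrow> complex" where
  "ip x y = (suminf (\<lambda>n. x n * cnj (y n)))"

definition l2norm :: "(nat \<Rightarrow> complex) \<Rightarrow> real" where
  "l2norm x = sqrt (suminf (\<lambda>n. (cmod (x n))\<^sup>2))"

lemma L2_set_le_l2norm: "x \<in> l2 \<Longrightarrow> L2_set (\<lambda>n. cmod (x n)) {..<N} \<le> l2norm x"
  unfolding L2_set_def l2norm_def l2_def by (auto intro!: sum_le_suminf)

text \<open>Norm estimates are made on finite initial sections, where the inequalities for
  \<open>L2_set\<close> are available, and are transferred to sequences by this rule.\<close>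

lemma l2I:
  assumes "\<And>N. L2_set (\<lambda>n. cmod (x n)) {..<N} \<le> K"
  shows "x \<in> l2" "l2norm x \<le> K"
proof -
  have K: "0 \<le> K" using assms[of 0] by (simp add: L2_set_def)
  have le: "(\<Sum>n<N. (cmod (x n))\<^sup>2) \<le> K\<^sup>2" for N
    using power_mono[OF assms[of N], of 2] by (simp add: L2_set_def sum_nonneg)
  have s: "summable (\<lambda>n. (cmod (x n))\<^sup>2)"
    by (rule summableI_nonneg_bounded[OF _ le]) simp
  then show "x \<in> l2" by (simp add: l2_def)
  have "(suminf (\<lambda>n. (cmod (x n))\<^sup>2)) \<le> K\<^sup>2" by (rule suminf_le_const[OF s le])
  then show "l2norm x \<le> K" using K by (simp add: l2norm_def real_le_lsqrt suminf_nonneg s)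
qed

lemma l2norm_nonneg: "x \<in> l2 \<Longrightarrow> 0 \<le> l2norm x"
  by (simp add: l2norm_def l2_def suminf_nonneg)

lemma cmod_le_l2norm: "x \<in> l2 \<Longrightarrow> cmod (x n) \<le> l2norm x"
proof -
  assume x: "x \<in> l2"
  have "cmod (x n) \<le> L2_set (\<lambda>n. cmod (x n)) {..<Suc n}"
    by (rule member_le_L2_set) auto
  then show ?thesis using L2_set_le_l2norm[OF x, of "Suc n"] by simp
qed

lemma l2_zero [simp]: "(\<lambda>n. 0) \<in> l2" "l2norm (\<lambda>n. 0) = 0"
  by (simp_all add: l2_def l2norm_def)

lemma l2norm_eq_0: "x \<in> l2 \<Longrightarrow> l2norm x = 0 \<longleftrightarrow> x = (\<lambda>n. 0)"
  using cmod_le_l2norm[of x] by fastforce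

lemma l2_add:
  assumes x: "x \<in> l2" and y: "y \<in> l2"
  shows "(\<lambda>n. x n + y n) \<in> l2" "l2norm (\<lambda>n. x n + y n) \<le> l2norm x + l2norm y"
proof -
  have "L2_set (\<lambda>n. cmod (x n + y n)) {..<N} \<le> l2norm x + l2norm y" for N
  proof -
    have "L2_set (\<lambda>n. cmod (x n + y n)) {..<N} \<le> L2_set (\<lambda>n. cmod (x n) + cmod (y n)) {..<N}"
      by (rule L2_set_mono) (simp_all add: norm_triangle_ineq)
    also have "\<dots> \<le> L2_set (\<lambda>n. cmod (x n)) {..<N} + L2_set (\<lambda>n. cmod (y n)) {..<N}"
      by (rule L2_set_triangle_ineq)
    also have "\<dots> \<le> l2norm x + l2norm y" by (intro add_mono L2_set_le_l2norm x y)
    finally show ?thesis .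
  qed
  from l2I[OF this] show "(\<lambda>n. x n + y n) \<in> l2" "l2norm (\<lambda>n. x n + y n) \<le> l2norm x + l2norm y"
    by simp_all
qed

lemma l2_scale:
  assumes "x \<in> l2"
  shows "(\<lambda>n. c * x n) \<in> l2" "l2norm (\<lambda>n. c * x n) = cmod c * l2norm x"
  using assms by (simp_all add: l2_def l2norm_def norm_mult power_mult_distrib suminf_mult summable_mult
      real_sqrt_mult)

lemma l2_diff:
  assumes x: "x \<in> l2" and y: "y \<in> l2"
  shows "(\<lambda>n. x n - y n) \<in> l2" "l2norm (\<lambda>n. x n - y n) \<le> l2norm x + l2norm y"
    "l2norm (\<lambda>n. x n - y n) = l2norm (\<lambda>n. y n - x n)"
  using l2_add[OF x l2_scale(1)[OF y, of "-1"]] l2_scale(2)[OF y, of "-1"]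
  by (simp_all add: l2norm_def norm_minus_commute)

lemma ip_abs_summable:
  assumes "x \<in> l2" "y \<in> l2"
  shows "summable (\<lambda>n. cmod (x n * cnj (y n)))" "(suminf (\<lambda>n. cmod (x n * cnj (y n)))) \<le> l2norm x * l2norm y"
proof -
  have le: "(\<Sum>n<N. cmod (x n * cnj (y n))) \<le> l2norm x * l2norm y" for N
  proof -
    have "(\<Sum>n<N. cmod (x n * cnj (y n))) = (\<Sum>n<N. \<bar>cmod (x n)\<bar> * \<bar>cmod (y n)\<bar>)" by (simp add: norm_mult)
    also have "\<dots> \<le> L2_set (\<lambda>n. cmod (x n)) {..<N} * L2_set (\<lambda>n. cmod (y n)) {..<N}"
      by (rule L2_set_mult_ineq)
    also have "\<dots> \<le> l2norm x * l2norm y"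
      by (intro mult_mono L2_set_le_l2norm assms l2norm_nonneg) (simp add: L2_set_def sum_nonneg)
    finally show ?thesis .
  qed
  show s: "summable (\<lambda>n. cmod (x n * cnj (y n)))" by (rule summableI_nonneg_bounded[OF _ le]) simp
  show "(suminf (\<lambda>n. cmod (x n * cnj (y n)))) \<le> l2norm x * l2norm y" by (rule suminf_le_const[OF s le])
qed

lemma ip_summable: "x \<in> l2 \<Longrightarrow> y \<in> l2 \<Longrightarrow> summable (\<lambda>n. x n * cnj (y n))"
  using ip_abs_summable(1) by (rule summable_norm_cancel)

lemma Cauchy_Schwarz_l2: "x \<in> l2 \<Longrightarrow> y \<in> l2 \<Longrightarrow> cmod (ip x y) \<le> l2norm x * l2norm y"
  unfolding ip_def using summable_norm[OF ip_abs_summable(1)] ip_abs_summable(2) by (meson order_trans)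

lemma ip_add_left: "x \<in> l2 \<Longrightarrow> y \<in> l2 \<Longrightarrow> z \<in> l2 \<Longrightarrow> ip (\<lambda>n. x n + y n) z = ip x z + ip y z"
  unfolding ip_def by (simp add: distrib_right suminf_add ip_summable)

lemma ip_scale_left: "x \<in> l2 \<Longrightarrow> y \<in> l2 \<Longrightarrow> ip (\<lambda>n. c * x n) y = c * ip x y"
  unfolding ip_def by (simp add: mult.assoc suminf_mult ip_summable)

lemma ip_commute: "x \<in> l2 \<Longrightarrow> y \<in> l2 \<Longrightarrow> ip x y = cnj (ip y x)"
  unfolding ip_def using sums_cnj[of "\<lambda>n. y n * cnj (x n)" "suminf (\<lambda>n. y n * cnj (x n))"]
  by (simp add: summable_sums ip_summable mult.commute sums_iff)

lemma ip_add_right: "x \<in> l2 \<Longrightarrow> y \<in> l2 \<Longrightarrow> z \<in> l2 \<Longrightarrow> ip z (\<lambda>n. x n + y n) = ip z x + ip z y"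
  using ip_commute[of z "\<lambda>n. x n + y n"] ip_add_left[of x y z] l2_add(1)[of x y]
    ip_commute[of z x] ip_commute[of z y] by simp

lemma ip_scale_right: "x \<in> l2 \<Longrightarrow> y \<in> l2 \<Longrightarrow> ip x (\<lambda>n. c * y n) = cnj c * ip x y"
  using ip_commute[of x "\<lambda>n. c * y n"] ip_scale_left[of y x c] l2_scale ip_commute[of y x] by simp

lemma ip_diff_left: "x \<in> l2 \<Longrightarrow> y \<in> l2 \<Longrightarrow> z \<in> l2 \<Longrightarrow> ip (\<lambda>n. x n - y n) z = ip x z - ip y z"
  using ip_add_left[of x "\<lambda>n. -1 * y n" z] ip_scale_left[of y z "-1"] l2_scale(1)[of y "-1"] by simp

lemma ip_self: "x \<in> l2 \<Longrightarrow> ip x x = of_real ((l2norm x)\<^sup>2)"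
proof -
  assume x: "x \<in> l2"
  have "(\<lambda>n. complex_of_real ((cmod (x n))\<^sup>2)) sums of_real (suminf (\<lambda>n. (cmod (x n))\<^sup>2))"
    using x by (intro sums_of_real summable_sums) (simp add: l2_def)
  then have "(\<lambda>n. x n * cnj (x n)) sums of_real (suminf (\<lambda>n. (cmod (x n))\<^sup>2))"
    by (simp only: complex_norm_square)
  then show ?thesis using x by (simp add: ip_def sums_iff l2norm_def suminf_nonneg l2_def)
qed

text \<open>The limit is taken coordinatewise. Bounds on initial sections are finite sums and pass
  to the limit, which gives both square-summability and convergence in norm.\<close>

lemma l2_complete:
  assumes X: "\<And>k. X k \<in> l2"
    and C: "\<And>\<epsilon>. \<epsilon> > 0 \<Longrightarrow> \<exists>M. \<forall>m\<ge>M. \<forall>n\<ge>M. l2norm (\<lambda>i. X m i - X n i) < \<epsilon>"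
  shows "\<exists>x\<in>l2. (\<lambda>k. l2norm (\<lambda>i. X k i - x i)) \<longlonglongrightarrow> 0"
proof -
  have "Cauchy (\<lambda>k. X k i)" for i
  proof (rule metric_CauchyI)
    fix e :: real assume "e > 0"
    then obtain M where M: "\<And>m n. m \<ge> M \<Longrightarrow> n \<ge> M \<Longrightarrow> l2norm (\<lambda>i. X m i - X n i) < e" using C by blast
    have "dist (X m i) (X n i) < e" if "m \<ge> M" "n \<ge> M" for m n
      using cmod_le_l2norm[OF l2_diff(1)[OF X[of m] X[of n]], of i] M[OF that] by (simp add: dist_norm)
    then show "\<exists>M. \<forall>m\<ge>M. \<forall>n\<ge>M. dist (X m i) (X n i) < e" by blast
  qed
  then have "\<exists>l. (\<lambda>k. X k i) \<longlonglongrightarrow> l" for i using Cauchy_convergent convergent_def by blast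
  then obtain x where x: "\<And>i. (\<lambda>k. X k i) \<longlonglongrightarrow> x i" by metis
  have key: "(\<lambda>i. X m i - x i) \<in> l2 \<and> l2norm (\<lambda>i. X m i - x i) \<le> e"
    if M: "\<And>n. n \<ge> M \<Longrightarrow> l2norm (\<lambda>i. X m i - X n i) < e" for m e M
  proof -
    have "L2_set (\<lambda>i. cmod (X m i - x i)) {..<N} \<le> e" for N
    proof (rule LIMSEQ_le_const2)
      show "(\<lambda>n. L2_set (\<lambda>i. cmod (X m i - X n i)) {..<N}) \<longlonglongrightarrow> L2_set (\<lambda>i. cmod (X m i - x i)) {..<N}"
        unfolding L2_set_def by (intro tendsto_intros x)
      have "L2_set (\<lambda>i. cmod (X m i - X n i)) {..<N} \<le> e" if "n \<ge> M" for n
        using L2_set_le_l2norm[OF l2_diff(1)[OF X X], of m n N] M[OF that] by simp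
      then show "\<exists>M. \<forall>n\<ge>M. L2_set (\<lambda>i. cmod (X m i - X n i)) {..<N} \<le> e" by blast
    qed
    from l2I[of "\<lambda>i. X m i - x i", OF this] show ?thesis by blast
  qed
  obtain M where "\<And>m n. m \<ge> M \<Longrightarrow> n \<ge> M \<Longrightarrow> l2norm (\<lambda>i. X m i - X n i) < 1" using C[of 1] by auto
  then have "(\<lambda>i. X M i - x i) \<in> l2" using key[of M M 1] by simp
  then have xl: "x \<in> l2" using l2_diff(1)[OF X[of M], of "\<lambda>i. X M i - x i"] by simp
  have "(\<lambda>k. l2norm (\<lambda>i. X k i - x i)) \<longlonglongrightarrow> 0"
  proof (rule LIMSEQ_I)
    fix r :: real assume r: "r > 0"
    then obtain M where M: "\<And>m n. m \<ge> M \<Longrightarrow> n \<ge> M \<Longrightarrow> l2norm (\<lambda>i. X m i - X n i) < r / 2"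
      using C[of "r / 2"] by auto
    have "norm (l2norm (\<lambda>i. X k i - x i) - 0) < r" if "k \<ge> M" for k
      using key[of M k "r / 2"] M[OF that] r l2norm_nonneg[of "\<lambda>i. X k i - x i"] by simp
    then show "\<exists>no. \<forall>k\<ge>no. norm (l2norm (\<lambda>i. X k i - x i) - 0) < r" by blast
  qed
  then show ?thesis using xl by blast
qed

section \<open>The Hilbert space of square-summable sequences\<close>

definition ell2 :: "(nat \<Rightarrow> complex) hilbert" where
  "ell2 = \<lparr>carrier = l2, mult = (\<lambda>x y. x), one = (\<lambda>n. 0), zero = (\<lambda>n. 0),
     add = (\<lambda>x y n. x n + y n), smult = (\<lambda>c x n. c * x n), cinner = ip\<rparr>"

lemma ell2_simps [simp]:
  "carrier ell2 = l2" "\<zero>\<^bsub>ell2\<^esub> = (\<lambda>n. 0)" "x \<oplus>\<^bsub>ell2\<^esub> y = (\<lambda>n. x n + y n)"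
  "c \<odot>\<^bsub>ell2\<^esub> x = (\<lambda>n. c * x n)" "cinner ell2 = ip"
  by (simp_all add: ell2_def)

lemma abelian_group_ell2: "abelian_group ell2"
proof (rule abelian_groupI)
  fix x assume "x \<in> carrier ell2"
  then show "\<exists>y\<in>carrier ell2. y \<oplus>\<^bsub>ell2\<^esub> x = \<zero>\<^bsub>ell2\<^esub>"
    using l2_scale(1)[of x "-1"] by (intro bexI[of _ "\<lambda>n. -1 * x n"]) auto
qed (auto simp: l2_add add_ac)

lemma module_ell2: "Module.module complex_ring ell2"
  by (rule moduleI[OF cring_complex_ring abelian_group_ell2])
    (auto simp: l2_scale algebra_simps)

lemma ell2_minus [simp]: "x \<in> l2 \<Longrightarrow> \<ominus>\<^bsub>ell2\<^esub> x = (\<lambda>n. - x n)"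
  using abelian_group.minus_equality[OF abelian_group_ell2, of "\<lambda>n. - x n" x] l2_scale(1)[of x "-1"] by simp

lemma ell2_diff [simp]: "x \<in> l2 \<Longrightarrow> y \<in> l2 \<Longrightarrow> x \<ominus>\<^bsub>ell2\<^esub> y = (\<lambda>n. x n - y n)"
  by (simp add: a_minus_def)

lemma hnorm_ell2: "x \<in> l2 \<Longrightarrow> hnorm ell2 x = l2norm x"
  by (simp add: hnorm_def ip_self l2norm_nonneg)

lemma hilbert_space_ell2: "hilbert_space ell2"
proof (rule hilbert_space.intro[OF module_ell2], unfold_locales)
  show "Metric_space.mcomplete (carrier ell2) (hilbert_dist ell2)"
  proof (rule mcomplete_normI[OF abelian_group_ell2, where N = l2norm])
    show "\<exists>x\<in>carrier ell2. (\<lambda>n. l2norm (X n \<ominus>\<^bsub>ell2\<^esub> x)) \<longlonglongrightarrow> 0"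
      if X: "\<And>n. X n \<in> carrier ell2"
        and C: "\<And>\<epsilon>. \<epsilon> > 0 \<Longrightarrow> \<exists>M. \<forall>m\<ge>M. \<forall>n\<ge>M. l2norm (X m \<ominus>\<^bsub>ell2\<^esub> X n) < \<epsilon>" for X
      using l2_complete[of X] X C by simp
    show "hilbert_dist ell2 = (\<lambda>x y. if x \<in> carrier ell2 \<and> y \<in> carrier ell2 then l2norm (x \<ominus>\<^bsub>ell2\<^esub> y) else 0)"
      by (auto simp: hilbert_dist_def fun_eq_iff hnorm_ell2 l2_diff)
    show "l2norm (\<ominus>\<^bsub>ell2\<^esub> x) = l2norm x" if "x \<in> carrier ell2" for x
      using that by (simp add: l2norm_def)
  qed (simp_all add: l2norm_nonneg l2norm_eq_0 l2_add)
  show "cinner ell2 x y = cnj (cinner ell2 y x)" if "x \<in> carrier ell2" "y \<in> carrier ell2" for x y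
    using ip_commute[of x y] that by simp
qed (simp_all add: ip_add_left ip_scale_left ip_self l2norm_eq_0)

section \<open>Basis vectors, truncations and adjoints\<close>

definition l2basis :: "nat \<Rightarrow> nat \<Rightarrow> complex" where
  "l2basis n = (\<lambda>i. if i = n then 1 else 0)"

definition l2trunc :: "nat \<Rightarrow> (nat \<Rightarrow> complex) \<Rightarrow> nat \<Rightarrow> complex" where
  "l2trunc N x = (\<lambda>i. if i < N then x i else 0)"

lemma l2trunc_in [simp]: "l2trunc N x \<in> l2"
  unfolding l2_def l2trunc_def
  by (auto intro!: summable_finite[of "{..<N}"] split: if_splits)

lemma l2norm_l2trunc: "l2norm (l2trunc N x) = L2_set (\<lambda>n. cmod (x n)) {..<N}"
proof -
  have "suminf (\<lambda>n. (cmod (l2trunc N x n))\<^sup>2) = (\<Sum>n<N. (cmod (l2trunc N x n))\<^sup>2)"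
    by (rule suminf_finite) (auto simp: l2trunc_def)
  then show ?thesis by (simp add: l2norm_def L2_set_def l2trunc_def)
qed

lemma l2basis_in [simp]: "l2basis n \<in> l2"
  unfolding l2_def l2basis_def
  by (auto intro!: summable_finite[of "{n}"] split: if_splits)

lemma ip_l2basis [simp]: "ip x (l2basis n) = x n"
proof -
  have "ip x (l2basis n) = (\<Sum>i\<in>{n}. x i * cnj (l2basis n i))"
    unfolding ip_def by (rule suminf_finite) (auto simp: l2basis_def)
  then show ?thesis by (simp add: l2basis_def)
qed

lemma l2norm_l2basis [simp]: "l2norm (l2basis n) = 1"
proof -
  have "ip (l2basis n) (l2basis n) = 1" unfolding ip_l2basis by (simp add: l2basis_def)
  then have "complex_of_real ((l2norm (l2basis n))\<^sup>2) = 1"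
    using ip_self[OF l2basis_in] by metis
  then have "(l2norm (l2basis n))\<^sup>2 = 1" by (metis of_real_eq_1_iff)
  then show ?thesis using l2norm_nonneg[of "l2basis n"] by (simp add: power2_eq_1_iff)
qed

lemma l2trunc_tendsto:
  assumes x: "x \<in> l2"
  shows "(\<lambda>N. l2norm (\<lambda>n. x n - l2trunc N x n)) \<longlonglongrightarrow> 0"
proof -
  let ?f = "\<lambda>n. (cmod (x n))\<^sup>2"
  have s: "summable ?f" using x by (simp add: l2_def)
  have eq: "l2norm (\<lambda>n. x n - l2trunc N x n) = sqrt (suminf ?f - (\<Sum>n<N. ?f n))" for N
  proof -
    have 1: "(\<lambda>n. if n \<in> {..<N} then ?f n else 0) sums (\<Sum>n<N. ?f n)"
      by (rule sums_If_finite_set) simp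
    have "(\<lambda>n. ?f n - (if n \<in> {..<N} then ?f n else 0)) sums (suminf ?f - (\<Sum>n<N. ?f n))"
      by (rule sums_diff[OF summable_sums[OF s] 1])
    moreover have "(\<lambda>n. ?f n - (if n \<in> {..<N} then ?f n else 0)) = (\<lambda>n. (cmod (x n - l2trunc N x n))\<^sup>2)"
      by (auto simp: l2trunc_def fun_eq_iff)
    ultimately show ?thesis by (simp add: l2norm_def sums_iff)
  qed
  have "(\<lambda>N. sqrt (suminf ?f - (\<Sum>n<N. ?f n))) \<longlonglongrightarrow> sqrt (suminf ?f - suminf ?f)"
    by (intro tendsto_intros summable_LIMSEQ s)
  then show ?thesis by (simp add: eq)
qed

definition bounded_op :: "((nat \<Rightarrow> complex) \<Rightarrow> (nat \<Rightarrow> complex)) \<Rightarrow> bool" where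
  "bounded_op T \<longleftrightarrow> (\<forall>x\<in>l2. T x \<in> l2) \<and>
     (\<forall>x\<in>l2. \<forall>y\<in>l2. T (\<lambda>n. x n + y n) = (\<lambda>n. T x n + T y n)) \<and>
     (\<forall>c. \<forall>x\<in>l2. T (\<lambda>n. c * x n) = (\<lambda>n. c * T x n)) \<and>
     (\<exists>K. \<forall>x\<in>l2. l2norm (T x) \<le> K * l2norm x)"

lemma bounded_opD:
  assumes "bounded_op T" "x \<in> l2"
  shows "T x \<in> l2" "y \<in> l2 \<Longrightarrow> T (\<lambda>n. x n + y n) = (\<lambda>n. T x n + T y n)"
    "T (\<lambda>n. c * x n) = (\<lambda>n. c * T x n)"
  using assms by (auto simp: bounded_op_def)

lemma bounded_op_zero: "bounded_op T \<Longrightarrow> T (\<lambda>n. 0) = (\<lambda>n. 0)"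
  using bounded_opD(3)[of T "\<lambda>n. 0" 0] by simp

lemma bounded_op_diff:
  "bounded_op T \<Longrightarrow> x \<in> l2 \<Longrightarrow> y \<in> l2 \<Longrightarrow> T (\<lambda>n. x n - y n) = (\<lambda>n. T x n - T y n)"
  using bounded_opD(2)[of T x "\<lambda>n. -1 * y n"] bounded_opD(3)[of T y "-1"] l2_scale(1)[of y "-1"] by simp

lemma bounded_op_bound:
  assumes "bounded_op T" obtains K where "K \<ge> 0" "\<And>x. x \<in> l2 \<Longrightarrow> l2norm (T x) \<le> K * l2norm x"
proof -
  obtain K where K: "\<And>x. x \<in> l2 \<Longrightarrow> l2norm (T x) \<le> K * l2norm x"
    using assms unfolding bounded_op_def by blast
  have "l2norm (T x) \<le> \<bar>K\<bar> * l2norm x" if "x \<in> l2" for x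
    by (rule order_trans[OF K[OF that] mult_right_mono[OF abs_ge_self l2norm_nonneg[OF that]]])
  then show ?thesis using that[of "\<bar>K\<bar>"] by simp
qed

lemma bounded_op_tendsto:
  assumes T: "bounded_op T" and x: "x \<in> l2" and y: "y \<in> l2"
  shows "(\<lambda>N. ip (T (l2trunc N x)) y) \<longlonglongrightarrow> ip (T x) y"
proof -
  obtain K where K: "K \<ge> 0" "\<And>x. x \<in> l2 \<Longrightarrow> l2norm (T x) \<le> K * l2norm x"
    using bounded_op_bound[OF T] by blast
  have le: "norm (ip (T x) y - ip (T (l2trunc N x)) y) \<le> K * l2norm (\<lambda>n. x n - l2trunc N x n) * l2norm y" for N
  proof -
    have d: "(\<lambda>n. x n - l2trunc N x n) \<in> l2" by (rule l2_diff(1)[OF x]) simp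
    have "ip (T x) y - ip (T (l2trunc N x)) y = ip (T (\<lambda>n. x n - l2trunc N x n)) y"
      using bounded_opD(1)[OF T] x y by (simp add: bounded_op_diff[OF T] ip_diff_left)
    also have "norm \<dots> \<le> l2norm (T (\<lambda>n. x n - l2trunc N x n)) * l2norm y"
      by (rule Cauchy_Schwarz_l2[OF bounded_opD(1)[OF T d] y])
    also have "\<dots> \<le> K * l2norm (\<lambda>n. x n - l2trunc N x n) * l2norm y"
      by (rule mult_right_mono[OF K(2)[OF d] l2norm_nonneg[OF y]])
    finally show ?thesis .
  qed
  have lim: "(\<lambda>N. K * l2norm (\<lambda>n. x n - l2trunc N x n) * l2norm y) \<longlonglongrightarrow> 0"
    using tendsto_mult_right[OF tendsto_mult_left[OF l2trunc_tendsto[OF x], of K], of "l2norm y"] by simp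
  have "(\<lambda>N. ip (T x) y - ip (T (l2trunc N x)) y) \<longlonglongrightarrow> 0"
    by (rule Lim_null_comparison[OF always_eventually[OF allI[OF le]] lim])
  from tendsto_diff[OF tendsto_const[of "ip (T x) y"] this] show ?thesis by simp
qed

lemma bounded_op_l2trunc:
  assumes T: "bounded_op T" and y: "y \<in> l2"
  shows "ip (T (l2trunc N x)) y = (\<Sum>n<N. x n * ip (T (l2basis n)) y)"
proof (induction N)
  case 0
  have "l2trunc 0 x = (\<lambda>n. 0)" by (simp add: l2trunc_def)
  then show ?case using bounded_op_zero[OF T] by (simp add: ip_def)
next
  case (Suc N)
  have "l2trunc (Suc N) x = (\<lambda>i. l2trunc N x i + x N * l2basis N i)"
    by (auto simp: l2trunc_def l2basis_def fun_eq_iff less_Suc_eq)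
  then have "T (l2trunc (Suc N) x) = (\<lambda>i. T (l2trunc N x) i + x N * T (l2basis N) i)"
    using bounded_opD(2)[OF T, of "l2trunc N x" "\<lambda>i. x N * l2basis N i"]
      bounded_opD(3)[OF T, of "l2basis N" "x N"] l2_scale(1)[of "l2basis N" "x N"] by simp
  then show ?case
    using Suc bounded_opD(1)[OF T] y by (simp add: ip_add_left l2_scale ip_scale_left)
qed

text \<open>Riesz representation by hand: the coordinates of z are forced by testing on basis
  vectors, and evaluating on the truncation of z itself bounds the norm of that truncation.\<close>

lemma adjoint_exists:
  assumes T: "bounded_op T" and y: "y \<in> l2"
  obtains z where "z \<in> l2" "\<And>x. x \<in> l2 \<Longrightarrow> ip (T x) y = ip x z"
proof -
  obtain K where K: "K \<ge> 0" "\<And>x. x \<in> l2 \<Longrightarrow> l2norm (T x) \<le> K * l2norm x"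
    using bounded_op_bound[OF T] by blast
  define z where "z = (\<lambda>n. cnj (ip (T (l2basis n)) y))"
  have "L2_set (\<lambda>n. cmod (z n)) {..<N} \<le> K * l2norm y" for N
  proof -
    let ?S = "L2_set (\<lambda>n. cmod (z n)) {..<N}"
    have "ip (T (l2trunc N z)) y = (\<Sum>n<N. z n * cnj (z n))"
      using bounded_op_l2trunc[OF T y] by (simp add: z_def)
    also have "\<dots> = (\<Sum>n<N. complex_of_real ((cmod (z n))\<^sup>2))"
      by (simp only: complex_norm_square)
    also have "\<dots> = complex_of_real (?S\<^sup>2)" by (simp add: L2_set_def sum_nonneg)
    finally have "?S * ?S = cmod (ip (T (l2trunc N z)) y)" by (simp add: power2_eq_square norm_mult)
    also have "\<dots> \<le> l2norm (T (l2trunc N z)) * l2norm y"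
      by (rule Cauchy_Schwarz_l2[OF bounded_opD(1)[OF T] y]) simp
    also have "\<dots> \<le> (K * ?S) * l2norm y"
      using K(2)[of "l2trunc N z"] l2norm_nonneg[OF y] by (simp add: mult_right_mono l2norm_l2trunc)
    \<comment> \<open>One factor \<open>?S\<close> is cancelled if it is positive; if it is 0, the
      bound holds because its right side is nonnegative. The bound is the same for all
      truncations.\<close>
    finally have "?S * ?S \<le> (K * l2norm y) * ?S" by (simp add: algebra_simps)
    moreover have "0 \<le> ?S" by (simp add: L2_set_def sum_nonneg)
    moreover have "0 \<le> K * l2norm y" using K l2norm_nonneg[OF y] by simp
    ultimately show ?thesis by (metis mult_right_le_imp_le order_le_less)
  qed
  from l2I(1)[OF this] have z: "z \<in> l2" .
  have "ip (T x) y = ip x z" if x: "x \<in> l2" for x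
  proof (rule LIMSEQ_unique[OF bounded_op_tendsto[OF T x y]])
    have "(\<lambda>N. \<Sum>n<N. x n * cnj (z n)) \<longlonglongrightarrow> ip x z"
      unfolding ip_def by (rule summable_LIMSEQ[OF ip_summable[OF x z]])
    then show "(\<lambda>N. ip (T (l2trunc N x)) y) \<longlonglongrightarrow> ip x z"
      by (simp add: bounded_op_l2trunc[OF T y] z_def)
  qed
  then show ?thesis using that z by blast
qed

lemma l2_eqI:
  assumes "y \<in> l2" "z \<in> l2" "\<And>x. x \<in> l2 \<Longrightarrow> ip x y = ip x z"
  shows "y = z"
proof
  fix n
  have "cnj (ip y (l2basis n)) = cnj (ip z (l2basis n))"
    using assms(3)[of "l2basis n"] ip_commute[of "l2basis n"] assms(1,2) by simp
  then show "y n = z n" by simp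
qed

section \<open>The C*-algebra of bounded operators\<close>

abbreviation BL :: "((nat \<Rightarrow> complex) \<Rightarrow> (nat \<Rightarrow> complex)) cstar" where
  "BL \<equiv> bounded_operators ell2"

lemma carrier_BL: "T \<in> carrier BL \<longleftrightarrow> T \<in> extensional l2 \<and> bounded_op T"
proof -
  have "(\<exists>K. \<forall>x\<in>l2. hnorm ell2 (T x) \<le> K * hnorm ell2 x) \<longleftrightarrow> (\<exists>K. \<forall>x\<in>l2. l2norm (T x) \<le> K * l2norm x)"
    if "\<forall>x\<in>l2. T x \<in> l2" using that by (simp add: hnorm_ell2)
  then show ?thesis
    unfolding bounded_operators_def bounded_op_def PiE_def Pi_iff by (simp, blast)
qed

lemma BL_ext: "S \<in> carrier BL \<Longrightarrow> T \<in> carrier BL \<Longrightarrow> (\<And>x. x \<in> l2 \<Longrightarrow> S x = T x) \<Longrightarrow> S = T"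
  by (auto simp: carrier_BL intro: extensionalityI)

lemma BL_D:
  assumes "T \<in> carrier BL" "x \<in> l2"
  shows "T x \<in> l2" "y \<in> l2 \<Longrightarrow> T (\<lambda>n. x n + y n) = (\<lambda>n. T x n + T y n)"
    "T (\<lambda>n. c * x n) = (\<lambda>n. c * T x n)" "y \<in> l2 \<Longrightarrow> T (\<lambda>n. x n - y n) = (\<lambda>n. T x n - T y n)"
  using assms bounded_opD bounded_op_diff by (auto simp: carrier_BL)

lemma BL_apply:
  "x \<in> l2 \<Longrightarrow> (S \<otimes>\<^bsub>BL\<^esub> T) x = S (T x)" "x \<in> l2 \<Longrightarrow> \<one>\<^bsub>BL\<^esub> x = x" "x \<in> l2 \<Longrightarrow> \<zero>\<^bsub>BL\<^esub> x = (\<lambda>n. 0)"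
  "x \<in> l2 \<Longrightarrow> (S \<oplus>\<^bsub>BL\<^esub> T) x = (\<lambda>n. S x n + T x n)" "x \<in> l2 \<Longrightarrow> (c \<odot>\<^bsub>BL\<^esub> T) x = (\<lambda>n. c * T x n)"
  by (simp_all add: bounded_operators_def compose_def)

lemma BL_norm:
  assumes T: "T \<in> carrier BL"
  shows "x \<in> l2 \<Longrightarrow> l2norm (T x) \<le> cnorm BL T * l2norm x" "0 \<le> cnorm BL T"
    "0 \<le> K \<Longrightarrow> (\<And>x. x \<in> l2 \<Longrightarrow> l2norm (T x) \<le> K * l2norm x) \<Longrightarrow> cnorm BL T \<le> K"
proof -
  let ?S = "{K. 0 \<le> K \<and> (\<forall>x\<in>l2. l2norm (T x) \<le> K * l2norm x)}"
  have S: "cnorm BL T = Inf ?S"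
    using BL_D(1)[OF T] by (simp add: bounded_operators_def hnorm_ell2 cong: conj_cong)
  have Tb: "bounded_op T" using T by (simp add: carrier_BL)
  obtain B where "B \<ge> 0" "\<And>x. x \<in> l2 \<Longrightarrow> l2norm (T x) \<le> B * l2norm x"
    using bounded_op_bound[OF Tb] by metis
  then have "B \<in> ?S" by blast
  then have ne: "?S \<noteq> {}" by blast
  show "0 \<le> cnorm BL T" unfolding S by (rule cInf_greatest[OF ne]) blast
  show "l2norm (T x) \<le> cnorm BL T * l2norm x" if x: "x \<in> l2" for x
  proof (cases "l2norm x = 0")
    case True
    obtain K where "K \<in> ?S" using ne by blast
    then show ?thesis using x True by force
  next
    case False
    then have p: "l2norm x > 0" using l2norm_nonneg[OF x] by simp
    have "l2norm (T x) / l2norm x \<le> Inf ?S"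
      by (rule cInf_greatest[OF ne]) (use p x in \<open>auto simp: divide_le_eq\<close>)
    then show ?thesis unfolding S using p by (simp add: divide_le_eq)
  qed
  show "cnorm BL T \<le> K" if "0 \<le> K" "\<And>x. x \<in> l2 \<Longrightarrow> l2norm (T x) \<le> K * l2norm x"
    unfolding S by (rule cInf_lower) (use that in \<open>auto intro!: bdd_belowI[of _ 0]\<close>)
qed

lemma BL_I:
  assumes "T \<in> extensional l2" "\<And>x. x \<in> l2 \<Longrightarrow> T x \<in> l2"
    "\<And>x y. x \<in> l2 \<Longrightarrow> y \<in> l2 \<Longrightarrow> T (\<lambda>n. x n + y n) = (\<lambda>n. T x n + T y n)"
    "\<And>c x. x \<in> l2 \<Longrightarrow> T (\<lambda>n. c * x n) = (\<lambda>n. c * T x n)"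
    "\<And>x. x \<in> l2 \<Longrightarrow> l2norm (T x) \<le> K * l2norm x"
  shows "T \<in> carrier BL"
  using assms unfolding carrier_BL bounded_op_def by blast

lemma BL_closed_aux:
  assumes S: "S \<in> carrier BL" and T: "T \<in> carrier BL"
  shows "S \<otimes>\<^bsub>BL\<^esub> T \<in> carrier BL" "S \<oplus>\<^bsub>BL\<^esub> T \<in> carrier BL" "c \<odot>\<^bsub>BL\<^esub> T \<in> carrier BL"
    "cnorm BL (S \<otimes>\<^bsub>BL\<^esub> T) \<le> cnorm BL S * cnorm BL T" "cnorm BL (S \<oplus>\<^bsub>BL\<^esub> T) \<le> cnorm BL S + cnorm BL T"
    "cnorm BL (c \<odot>\<^bsub>BL\<^esub> T) \<le> cmod c * cnorm BL T"
proof -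
  note SD = BL_D[OF S] and TD = BL_D[OF T] and n = BL_norm(2)[OF S] BL_norm(2)[OF T]
  have 1: "l2norm ((S \<otimes>\<^bsub>BL\<^esub> T) x) \<le> (cnorm BL S * cnorm BL T) * l2norm x" if x: "x \<in> l2" for x
    using BL_norm(1)[OF S TD(1)[OF x]] mult_left_mono[OF BL_norm(1)[OF T x] n(1)] x
    by (simp add: BL_apply mult.assoc)
  show m: "S \<otimes>\<^bsub>BL\<^esub> T \<in> carrier BL"
    by (rule BL_I[OF _ _ _ _ 1]) (simp_all add: SD TD BL_apply l2_add l2_scale, simp add: bounded_operators_def extensional_def compose_def)
  show "cnorm BL (S \<otimes>\<^bsub>BL\<^esub> T) \<le> cnorm BL S * cnorm BL T"
    by (rule BL_norm(3)[OF m _ 1]) (use n in auto)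
  have 2: "l2norm ((S \<oplus>\<^bsub>BL\<^esub> T) x) \<le> (cnorm BL S + cnorm BL T) * l2norm x" if x: "x \<in> l2" for x
    using l2_add(2)[OF SD(1)[OF x] TD(1)[OF x]] BL_norm(1)[OF S x] BL_norm(1)[OF T x] x
    by (simp add: BL_apply distrib_right)
  show a: "S \<oplus>\<^bsub>BL\<^esub> T \<in> carrier BL"
    by (rule BL_I[OF _ _ _ _ 2])
      (simp_all add: SD TD BL_apply l2_add l2_scale algebra_simps, simp add: bounded_operators_def extensional_def compose_def)
  show "cnorm BL (S \<oplus>\<^bsub>BL\<^esub> T) \<le> cnorm BL S + cnorm BL T"
    by (rule BL_norm(3)[OF a _ 2]) (use n in auto)
  have 3: "l2norm ((c \<odot>\<^bsub>BL\<^esub> T) x) \<le> (cmod c * cnorm BL T) * l2norm x" if x: "x \<in> l2" for x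
    using mult_left_mono[OF BL_norm(1)[OF T x], of "cmod c"] x TD(1)[OF x]
    by (simp add: BL_apply l2_scale mult.assoc)
  show s: "c \<odot>\<^bsub>BL\<^esub> T \<in> carrier BL"
    by (rule BL_I[OF _ _ _ _ 3])
      (simp_all add: SD TD BL_apply l2_add l2_scale algebra_simps, simp add: bounded_operators_def extensional_def compose_def)
  show "cnorm BL (c \<odot>\<^bsub>BL\<^esub> T) \<le> cmod c * cnorm BL T"
    by (rule BL_norm(3)[OF s _ 3]) (use n in auto)
qed

lemma one_BL_in: "\<one>\<^bsub>BL\<^esub> \<in> carrier BL"
  by (rule BL_I[where K = 1])
    (simp_all add: BL_apply l2_add l2_scale, simp add: bounded_operators_def extensional_def compose_def)

lemma zero_BL_in: "\<zero>\<^bsub>BL\<^esub> \<in> carrier BL"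
  by (rule BL_I[where K = 0])
    (simp_all add: BL_apply l2_add l2_scale, simp add: bounded_operators_def extensional_def compose_def)

lemma BL_smult:
  assumes "T \<in> carrier BL"
  shows "c \<odot>\<^bsub>BL\<^esub> T \<in> carrier BL" "cnorm BL (c \<odot>\<^bsub>BL\<^esub> T) \<le> cmod c * cnorm BL T"
  using BL_closed_aux(3,6)[OF assms assms] by blast+

lemmas BL_closed = BL_closed_aux(1,2) BL_smult(1) one_BL_in zero_BL_in BL_closed_aux(4,5)

text \<open>Resolves the definite description in \<open>star\<close>: existence is
  \<open>adjoint_exists\<close>, uniqueness is nondegeneracy of \<open>ip\<close>. The norm bound
  comes from the vector z = T*y, whose squared norm is the inner product of Tz with y.\<close>

lemma BL_star:
  assumes T: "T \<in> carrier BL"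
  shows "star BL T \<in> carrier BL" "x \<in> l2 \<Longrightarrow> y \<in> l2 \<Longrightarrow> ip (T x) y = ip x (star BL T y)"
    "cnorm BL (star BL T) \<le> cnorm BL T"
proof -
  have Tb: "bounded_op T" using T by (simp add: carrier_BL)
  have st: "star BL T y = (THE z. z \<in> l2 \<and> (\<forall>x\<in>l2. ip (T x) y = ip x z))" if "y \<in> l2" for y
    using that by (simp add: bounded_operators_def extensional_def compose_def)
  have *: "star BL T y \<in> l2 \<and> (\<forall>x\<in>l2. ip (T x) y = ip x (star BL T y))" if y: "y \<in> l2" for y
  proof -
    obtain z where "z \<in> l2" "\<And>x. x \<in> l2 \<Longrightarrow> ip (T x) y = ip x z" using adjoint_exists[OF Tb y] by blast
    then have "\<exists>!z. z \<in> l2 \<and> (\<forall>x\<in>l2. ip (T x) y = ip x z)" by (intro ex1I[of _ z]) (auto intro!: l2_eqI)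
    from theI'[OF this] show ?thesis unfolding st[OF y] .
  qed
  then have in': "star BL T y \<in> l2" and adj: "\<And>x. x \<in> l2 \<Longrightarrow> ip (T x) y = ip x (star BL T y)" if "y \<in> l2" for y
    using that by blast+
  show "ip (T x) y = ip x (star BL T y)" if "x \<in> l2" "y \<in> l2" for x y using adj that by blast
  have bound: "l2norm (star BL T y) \<le> cnorm BL T * l2norm y" if y: "y \<in> l2" for y
  proof -
    let ?z = "star BL T y"
    have z: "?z \<in> l2" by (rule in'[OF y])
    have "complex_of_real (l2norm ?z * l2norm ?z) = ip (T ?z) y"
      using adj[OF y z] ip_self[OF z] by (simp add: power2_eq_square)
    then have "l2norm ?z * l2norm ?z = cmod (ip (T ?z) y)"
      by (metis abs_mult_self_eq norm_of_real abs_mult)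
    also have "\<dots> \<le> l2norm (T ?z) * l2norm y" by (rule Cauchy_Schwarz_l2[OF BL_D(1)[OF T z] y])
    also have "\<dots> \<le> (cnorm BL T * l2norm ?z) * l2norm y"
      by (rule mult_right_mono[OF BL_norm(1)[OF T z] l2norm_nonneg[OF y]])
    finally have "l2norm ?z * l2norm ?z \<le> (cnorm BL T * l2norm y) * l2norm ?z" by (simp add: algebra_simps)
    moreover have "0 \<le> l2norm ?z" "0 \<le> cnorm BL T * l2norm y"
      using l2norm_nonneg[OF z] l2norm_nonneg[OF y] BL_norm(2)[OF T] by auto
    ultimately show ?thesis by (metis mult_right_le_imp_le order_le_less)
  qed
  show s: "star BL T \<in> carrier BL"
  proof (rule BL_I[OF _ in' _ _ bound])
    show "star BL T \<in> extensional l2" by (simp add: bounded_operators_def extensional_def compose_def)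
    show "star BL T (\<lambda>n. y n + y' n) = (\<lambda>n. star BL T y n + star BL T y' n)" if "y \<in> l2" "y' \<in> l2" for y y'
      by (rule l2_eqI) (use that in' adj[symmetric] BL_D(1)[OF T] in \<open>auto simp: l2_add ip_add_right\<close>)
    show "star BL T (\<lambda>n. c * y n) = (\<lambda>n. c * star BL T y n)" if "y \<in> l2" for c y
      by (rule l2_eqI) (use that in' adj[symmetric] BL_D(1)[OF T] in \<open>auto simp: l2_scale ip_scale_right\<close>)
  qed
  show "cnorm BL (star BL T) \<le> cnorm BL T"
    by (rule BL_norm(3)[OF s BL_norm(2)[OF T] bound])
qed

lemma BL_star_eqI:
  assumes "T \<in> carrier BL" "S \<in> carrier BL" "\<And>x y. x \<in> l2 \<Longrightarrow> y \<in> l2 \<Longrightarrow> ip (T x) y = ip x (S y)"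
  shows "star BL T = S"
proof (rule BL_ext[OF BL_star(1)[OF assms(1)] assms(2)])
  fix y assume y: "y \<in> l2"
  show "star BL T y = S y"
    by (rule l2_eqI) (use y assms BL_D(1) BL_star[OF assms(1)] in \<open>auto simp flip: assms(3)\<close>)
qed

lemma abelian_group_BL: "abelian_group BL"
proof (rule abelian_groupI)
  fix x assume x: "x \<in> carrier BL"
  show "\<exists>y\<in>carrier BL. y \<oplus>\<^bsub>BL\<^esub> x = \<zero>\<^bsub>BL\<^esub>"
    by (rule bexI[of _ "(-1) \<odot>\<^bsub>BL\<^esub> x"], rule BL_ext)
      (use x in \<open>auto simp: BL_closed BL_apply\<close>)
next
  fix x y z assume *: "x \<in> carrier BL" "y \<in> carrier BL" "z \<in> carrier BL"
  show "x \<oplus>\<^bsub>BL\<^esub> y \<oplus>\<^bsub>BL\<^esub> z = x \<oplus>\<^bsub>BL\<^esub> (y \<oplus>\<^bsub>BL\<^esub> z)"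
    by (rule BL_ext) (use * in \<open>auto simp: BL_closed BL_apply add_ac\<close>)
next
  fix x y assume *: "x \<in> carrier BL" "y \<in> carrier BL"
  show "x \<oplus>\<^bsub>BL\<^esub> y = y \<oplus>\<^bsub>BL\<^esub> x"
    by (rule BL_ext) (use * in \<open>auto simp: BL_closed BL_apply add_ac\<close>)
  show "x \<oplus>\<^bsub>BL\<^esub> y \<in> carrier BL" using * by (rule BL_closed)
next
  fix x assume x: "x \<in> carrier BL"
  show "\<zero>\<^bsub>BL\<^esub> \<oplus>\<^bsub>BL\<^esub> x = x"
    by (rule BL_ext) (use x in \<open>auto simp: BL_closed BL_apply\<close>)
next
  show "\<zero>\<^bsub>BL\<^esub> \<in> carrier BL" by (rule zero_BL_in)
qed

lemma ring_BL: "ring BL"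
proof (rule ringI[OF abelian_group_BL])
  show "monoid BL"
  proof (rule monoidI)
    fix x y z assume *: "x \<in> carrier BL" "y \<in> carrier BL" "z \<in> carrier BL"
    show "x \<otimes>\<^bsub>BL\<^esub> y \<otimes>\<^bsub>BL\<^esub> z = x \<otimes>\<^bsub>BL\<^esub> (y \<otimes>\<^bsub>BL\<^esub> z)"
      by (rule BL_ext) (use * in \<open>auto simp: BL_closed BL_apply BL_D\<close>)
    show "x \<otimes>\<^bsub>BL\<^esub> y \<in> carrier BL" by (rule BL_closed) (use * in auto)
    show "\<one>\<^bsub>BL\<^esub> \<otimes>\<^bsub>BL\<^esub> x = x" "x \<otimes>\<^bsub>BL\<^esub> \<one>\<^bsub>BL\<^esub> = x"
      by (rule BL_ext; use * in \<open>auto simp: BL_closed one_BL_in BL_apply BL_D\<close>)+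
  qed (rule one_BL_in)
  fix x y z assume *: "x \<in> carrier BL" "y \<in> carrier BL" "z \<in> carrier BL"
  show "(x \<oplus>\<^bsub>BL\<^esub> y) \<otimes>\<^bsub>BL\<^esub> z = x \<otimes>\<^bsub>BL\<^esub> z \<oplus>\<^bsub>BL\<^esub> y \<otimes>\<^bsub>BL\<^esub> z" "z \<otimes>\<^bsub>BL\<^esub> (x \<oplus>\<^bsub>BL\<^esub> y) = z \<otimes>\<^bsub>BL\<^esub> x \<oplus>\<^bsub>BL\<^esub> z \<otimes>\<^bsub>BL\<^esub> y"
    by (rule BL_ext; use * in \<open>auto simp: BL_closed BL_apply BL_D\<close>)+
qed

lemma module_BL: "Module.module complex_ring BL"
proof (rule moduleI[OF cring_complex_ring abelian_group_BL])
  fix a b x y assume *: "x \<in> carrier BL" "y \<in> carrier BL"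
  show "a \<odot>\<^bsub>BL\<^esub> x \<in> carrier BL" by (rule BL_closed) (use * in auto)
  show "(a \<oplus>\<^bsub>complex_ring\<^esub> b) \<odot>\<^bsub>BL\<^esub> x = a \<odot>\<^bsub>BL\<^esub> x \<oplus>\<^bsub>BL\<^esub> b \<odot>\<^bsub>BL\<^esub> x"
    "a \<odot>\<^bsub>BL\<^esub> (x \<oplus>\<^bsub>BL\<^esub> y) = a \<odot>\<^bsub>BL\<^esub> x \<oplus>\<^bsub>BL\<^esub> a \<odot>\<^bsub>BL\<^esub> y"
    "(a \<otimes>\<^bsub>complex_ring\<^esub> b) \<odot>\<^bsub>BL\<^esub> x = a \<odot>\<^bsub>BL\<^esub> (b \<odot>\<^bsub>BL\<^esub> x)" "\<one>\<^bsub>complex_ring\<^esub> \<odot>\<^bsub>BL\<^esub> x = x"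
    by (rule BL_ext; use * in \<open>auto simp: BL_closed BL_apply BL_D algebra_simps\<close>)+
qed

lemma BL_minus:
  assumes "T \<in> carrier BL"
  shows "\<ominus>\<^bsub>BL\<^esub> T = (-1) \<odot>\<^bsub>BL\<^esub> T"
proof -
  have "(-1) \<odot>\<^bsub>BL\<^esub> T \<oplus>\<^bsub>BL\<^esub> T = \<zero>\<^bsub>BL\<^esub>"
    by (rule BL_ext) (use assms in \<open>auto simp: BL_closed BL_apply\<close>)
  then show ?thesis
    using abelian_group.minus_equality[OF abelian_group_BL] assms BL_smult(1)[OF assms] by simp
qed

lemma BL_diff_apply:
  "S \<in> carrier BL \<Longrightarrow> T \<in> carrier BL \<Longrightarrow> x \<in> l2 \<Longrightarrow> (S \<ominus>\<^bsub>BL\<^esub> T) x = (\<lambda>n. S x n - T x n)"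
  by (simp add: a_minus_def BL_minus BL_apply)

lemma BL_norm_smult:
  assumes T: "T \<in> carrier BL"
  shows "cnorm BL (c \<odot>\<^bsub>BL\<^esub> T) = cmod c * cnorm BL T"
proof (cases "c = 0")
  case True
  then show ?thesis using BL_smult(2)[OF T, of c] BL_norm(2)[OF BL_smult(1)[OF T, of c]] by simp
next
  case False
  have "(1 / c) \<odot>\<^bsub>BL\<^esub> (c \<odot>\<^bsub>BL\<^esub> T) = T"
    by (rule BL_ext) (use T False in \<open>auto simp: BL_closed BL_apply\<close>)
  then have "cnorm BL T \<le> cmod (1 / c) * cnorm BL (c \<odot>\<^bsub>BL\<^esub> T)"
    using BL_smult(2)[OF BL_smult(1)[OF T], of "1 / c" c] by simp
  then show ?thesis using BL_smult(2)[OF T, of c] False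
    by (simp add: norm_divide pos_le_divide_eq mult.commute)
qed

lemma BL_norm_eq_0: assumes T: "T \<in> carrier BL" shows "cnorm BL T = 0 \<longleftrightarrow> T = \<zero>\<^bsub>BL\<^esub>"
proof
  assume "cnorm BL T = 0"
  then have "T x = (\<lambda>n. 0)" if "x \<in> l2" for x
    using BL_norm(1)[OF T that] l2norm_nonneg[OF BL_D(1)[OF T that]] l2norm_eq_0[OF BL_D(1)[OF T that]] by simp
  then show "T = \<zero>\<^bsub>BL\<^esub>" by (intro BL_ext[OF T zero_BL_in]) (simp add: BL_apply)
next
  assume "T = \<zero>\<^bsub>BL\<^esub>"
  then have "cnorm BL T \<le> 0" by (intro BL_norm(3)[OF T]) (simp_all add: BL_apply)
  then show "cnorm BL T = 0" using BL_norm(2)[OF T] by simp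
qed

text \<open>The squared norm of Tx is the inner product of x with T*Tx, which bounds the norm of T
  by the root of the norm of T*T; the other inequality is submultiplicativity.\<close>

lemma BL_cstar:
  assumes T: "T \<in> carrier BL"
  shows "cnorm BL (star BL T \<otimes>\<^bsub>BL\<^esub> T) = (cnorm BL T)\<^sup>2"
proof (rule antisym)
  note S = BL_star(1)[OF T]
  let ?P = "star BL T \<otimes>\<^bsub>BL\<^esub> T"
  have P: "?P \<in> carrier BL" by (rule BL_closed(1)[OF S T])
  show "cnorm BL ?P \<le> (cnorm BL T)\<^sup>2"
    using BL_closed(6)[OF S T] mult_right_mono[OF BL_star(3)[OF T] BL_norm(2)[OF T]]
    by (simp add: power2_eq_square)
  have b: "l2norm (T x) \<le> sqrt (cnorm BL ?P) * l2norm x" if x: "x \<in> l2" for x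
  proof -
    have "complex_of_real ((l2norm (T x))\<^sup>2) = ip (T x) (T x)" using ip_self[OF BL_D(1)[OF T x]] by simp
    also have "\<dots> = ip x (?P x)" using BL_star(2)[OF T x BL_D(1)[OF T x]] x by (simp add: BL_apply)
    finally have "cmod (complex_of_real ((l2norm (T x))\<^sup>2)) = cmod (ip x (?P x))" by simp
    then have "(l2norm (T x))\<^sup>2 = cmod (ip x (?P x))" by (simp add: norm_power)
    also have "\<dots> \<le> l2norm x * l2norm (?P x)" by (rule Cauchy_Schwarz_l2[OF x BL_D(1)[OF P x]])
    also have "\<dots> \<le> l2norm x * (cnorm BL ?P * l2norm x)"
      by (rule mult_left_mono[OF BL_norm(1)[OF P x] l2norm_nonneg[OF x]])
    also have "\<dots> = (sqrt (cnorm BL ?P) * l2norm x)\<^sup>2"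
      unfolding power_mult_distrib real_sqrt_pow2[OF BL_norm(2)[OF P]]
      by (simp only: power2_eq_square mult.left_commute)
    finally show ?thesis
      by (rule power2_le_imp_le) (simp add: BL_norm(2)[OF P] l2norm_nonneg[OF x])
  qed
  have "cnorm BL T \<le> sqrt (cnorm BL ?P)"
    by (rule BL_norm(3)[OF T _ b]) (simp_all add: BL_norm(2)[OF P])
  then have "(cnorm BL T)\<^sup>2 \<le> (sqrt (cnorm BL ?P))\<^sup>2" using BL_norm(2)[OF T] by (rule power_mono)
  then show "(cnorm BL T)\<^sup>2 \<le> cnorm BL ?P" using BL_norm(2)[OF P] by simp
qed

text \<open>Pointwise limits exist by completeness of the sequence space and define a linear map.
  The estimate \<open>key\<close> carries a uniform operator bound through initial sections, which
  gives boundedness of the limit and convergence in norm.\<close>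

lemma complete_BL: "Metric_space.mcomplete (carrier BL) (cstar_dist BL)"
proof (rule mcomplete_normI[OF abelian_group_BL, where N = "cnorm BL"])
  fix X :: "nat \<Rightarrow> (nat \<Rightarrow> complex) \<Rightarrow> nat \<Rightarrow> complex"
  assume X: "\<And>n. X n \<in> carrier BL"
    and C: "\<And>\<epsilon>. \<epsilon> > 0 \<Longrightarrow> \<exists>M. \<forall>m\<ge>M. \<forall>n\<ge>M. cnorm BL (X m \<ominus>\<^bsub>BL\<^esub> X n) < \<epsilon>"
  have D: "X m \<ominus>\<^bsub>BL\<^esub> X n \<in> carrier BL" for m n
    using abelian_group.minus_closed[OF abelian_group_BL X X] .
  have dle: "l2norm (\<lambda>i. X m x i - X n x i) \<le> cnorm BL (X m \<ominus>\<^bsub>BL\<^esub> X n) * l2norm x" if "x \<in> l2" for x m n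
    using BL_norm(1)[OF D that, of m n] by (simp add: BL_diff_apply[OF X X that])
  have "\<exists>y\<in>l2. (\<lambda>k. l2norm (\<lambda>i. X k x i - y i)) \<longlonglongrightarrow> 0" if x: "x \<in> l2" for x
  proof (rule l2_complete)
    fix \<epsilon> :: real assume e: "\<epsilon> > 0"
    have p: "0 < l2norm x + 1" using l2norm_nonneg[OF x] by simp
    obtain M where M: "\<And>m n. m \<ge> M \<Longrightarrow> n \<ge> M \<Longrightarrow> cnorm BL (X m \<ominus>\<^bsub>BL\<^esub> X n) < \<epsilon> / (l2norm x + 1)"
      using C[of "\<epsilon> / (l2norm x + 1)"] e p by auto
    have "l2norm (\<lambda>i. X m x i - X n x i) < \<epsilon>" if "m \<ge> M" "n \<ge> M" for m n
    proof -
      have "l2norm (\<lambda>i. X m x i - X n x i) \<le> cnorm BL (X m \<ominus>\<^bsub>BL\<^esub> X n) * (l2norm x + 1)"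
        using dle[OF x, of m n] BL_norm(2)[OF D, of m n] by (simp add: distrib_left)
      also have "\<dots> < \<epsilon>" using M[OF that] p by (simp add: pos_less_divide_eq)
      finally show ?thesis .
    qed
    then show "\<exists>M. \<forall>m\<ge>M. \<forall>n\<ge>M. l2norm (\<lambda>i. X m x i - X n x i) < \<epsilon>" by blast
  qed (rule BL_D(1)[OF X x])
  then obtain L where L: "\<And>x. x \<in> l2 \<Longrightarrow> L x \<in> l2"
      "\<And>x. x \<in> l2 \<Longrightarrow> (\<lambda>k. l2norm (\<lambda>i. X k x i - L x i)) \<longlonglongrightarrow> 0" by metis
  have pt: "(\<lambda>k. X k x i) \<longlonglongrightarrow> L x i" if x: "x \<in> l2" for x i
  proof -
    have le: "norm (X k x i - L x i) \<le> l2norm (\<lambda>i. X k x i - L x i)" for k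
      using cmod_le_l2norm[OF l2_diff(1)[OF BL_D(1)[OF X x] L(1)[OF x]], of k i] by simp
    have "(\<lambda>k. X k x i - L x i) \<longlonglongrightarrow> 0"
      by (rule Lim_null_comparison[OF always_eventually[OF allI[OF le]] L(2)[OF x]])
    then show ?thesis by (simp add: LIM_zero_iff)
  qed
  define T where "T = (\<lambda>x\<in>l2. L x)"
  have key: "l2norm (\<lambda>i. X m x i - L x i) \<le> e * l2norm x"
    if x: "x \<in> l2" and M: "\<And>n. n \<ge> M \<Longrightarrow> cnorm BL (X m \<ominus>\<^bsub>BL\<^esub> X n) \<le> e" for x m e M
  proof (rule l2I(2))
    fix N
    show "L2_set (\<lambda>i. cmod (X m x i - L x i)) {..<N} \<le> e * l2norm x"
    proof (rule LIMSEQ_le_const2)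
      show "(\<lambda>n. L2_set (\<lambda>i. cmod (X m x i - X n x i)) {..<N}) \<longlonglongrightarrow> L2_set (\<lambda>i. cmod (X m x i - L x i)) {..<N}"
        unfolding L2_set_def by (intro tendsto_intros pt x)
      have "L2_set (\<lambda>i. cmod (X m x i - X n x i)) {..<N} \<le> e * l2norm x" if "n \<ge> M" for n
      proof -
        have "L2_set (\<lambda>i. cmod (X m x i - X n x i)) {..<N} \<le> l2norm (\<lambda>i. X m x i - X n x i)"
          by (rule L2_set_le_l2norm[OF l2_diff(1)[OF BL_D(1)[OF X x] BL_D(1)[OF X x]]])
        also have "\<dots> \<le> cnorm BL (X m \<ominus>\<^bsub>BL\<^esub> X n) * l2norm x" by (rule dle[OF x])
        also have "\<dots> \<le> e * l2norm x" by (rule mult_right_mono[OF M[OF that] l2norm_nonneg[OF x]])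
        finally show ?thesis .
      qed
      then show "\<exists>M. \<forall>n\<ge>M. L2_set (\<lambda>i. cmod (X m x i - X n x i)) {..<N} \<le> e * l2norm x" by blast
    qed
  qed
  obtain M where M: "\<And>m n. m \<ge> M \<Longrightarrow> n \<ge> M \<Longrightarrow> cnorm BL (X m \<ominus>\<^bsub>BL\<^esub> X n) < 1" using C[of 1] by auto
  have T: "T \<in> carrier BL"
  proof (rule BL_I)
    show "T \<in> extensional l2" by (simp add: T_def)
    show "T x \<in> l2" if "x \<in> l2" for x using L(1) that by (simp add: T_def)
    show "T (\<lambda>n. x n + y n) = (\<lambda>n. T x n + T y n)" if "x \<in> l2" "y \<in> l2" for x y
    proof
      fix i
      have "(\<lambda>k. X k x i + X k y i) \<longlonglongrightarrow> L (\<lambda>n. x n + y n) i"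
        using pt[OF l2_add(1)[OF that], of i] BL_D(2)[OF X that(1) that(2)] by simp
      moreover have "(\<lambda>k. X k x i + X k y i) \<longlonglongrightarrow> L x i + L y i" by (intro tendsto_add pt that)
      ultimately show "T (\<lambda>n. x n + y n) i = T x i + T y i"
        using LIMSEQ_unique that l2_add(1)[OF that] by (simp add: T_def)
    qed
    show "T (\<lambda>n. c * x n) = (\<lambda>n. c * T x n)" if "x \<in> l2" for c x
    proof
      fix i
      have "(\<lambda>k. c * X k x i) \<longlonglongrightarrow> L (\<lambda>n. c * x n) i"
        using pt[OF l2_scale(1)[OF that], of c i] BL_D(3)[OF X that] by simp
      moreover have "(\<lambda>k. c * X k x i) \<longlonglongrightarrow> c * L x i" by (intro tendsto_mult_left pt that)
      ultimately show "T (\<lambda>n. c * x n) i = c * T x i"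
        using LIMSEQ_unique that l2_scale(1)[OF that] by (simp add: T_def)
    qed
    show "l2norm (T x) \<le> (1 + cnorm BL (X M)) * l2norm x" if x: "x \<in> l2" for x
    proof -
      have "l2norm (\<lambda>i. X M x i - (X M x i - L x i)) \<le> l2norm (X M x) + l2norm (\<lambda>i. X M x i - L x i)"
        by (rule l2_diff(2)[OF BL_D(1)[OF X x] l2_diff(1)[OF BL_D(1)[OF X x] L(1)[OF x]]])
      moreover have "l2norm (\<lambda>i. X M x i - L x i) \<le> 1 * l2norm x"
        by (rule key[OF x, of M]) (rule less_imp_le[OF M[OF order_refl]])
      ultimately show ?thesis using BL_norm(1)[OF X x, of M] x by (simp add: T_def distrib_right)
    qed
  qed
  have DT: "X k \<ominus>\<^bsub>BL\<^esub> T \<in> carrier BL" for k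
    using abelian_group.minus_closed[OF abelian_group_BL X T] .
  have "(\<lambda>k. cnorm BL (X k \<ominus>\<^bsub>BL\<^esub> T)) \<longlonglongrightarrow> 0"
  proof (rule LIMSEQ_I)
    fix r :: real assume r: "r > 0"
    then obtain M where M: "\<And>m n. m \<ge> M \<Longrightarrow> n \<ge> M \<Longrightarrow> cnorm BL (X m \<ominus>\<^bsub>BL\<^esub> X n) < r / 2"
      using C[of "r / 2"] by auto
    have "norm (cnorm BL (X k \<ominus>\<^bsub>BL\<^esub> T) - 0) < r" if k: "k \<ge> M" for k
    proof -
      have "cnorm BL (X k \<ominus>\<^bsub>BL\<^esub> T) \<le> r / 2"
      proof (rule BL_norm(3)[OF DT])
        fix x assume x: "x \<in> l2"
        have "l2norm (\<lambda>i. X k x i - L x i) \<le> r / 2 * l2norm x"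
          by (rule key[OF x, of M]) (rule less_imp_le[OF M[OF k]])
        then show "l2norm ((X k \<ominus>\<^bsub>BL\<^esub> T) x) \<le> r / 2 * l2norm x"
          using x BL_diff_apply[OF X T x, of k] by (simp add: T_def)
      qed (use r in simp)
      then show ?thesis using BL_norm(2)[OF DT, of k] r by simp
    qed
    then show "\<exists>no. \<forall>k\<ge>no. norm (cnorm BL (X k \<ominus>\<^bsub>BL\<^esub> T) - 0) < r" by blast
  qed
  then show "\<exists>x\<in>carrier BL. (\<lambda>n. cnorm BL (X n \<ominus>\<^bsub>BL\<^esub> x)) \<longlonglongrightarrow> 0" by (rule bexI[OF _ T])
next
  show "cstar_dist BL = (\<lambda>x y. if x \<in> carrier BL \<and> y \<in> carrier BL then cnorm BL (x \<ominus>\<^bsub>BL\<^esub> y) else 0)"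
    by (simp add: cstar_dist_def fun_eq_iff)
qed (simp_all add: BL_norm(2) BL_norm_eq_0 BL_closed BL_minus BL_norm_smult)

theorem cstar_algebra_BL: "cstar_algebra BL"
proof (rule cstar_algebra.intro[OF ring_BL module_BL], unfold_locales)
  fix x y c assume x: "x \<in> carrier BL" and y: "y \<in> carrier BL"
  show "c \<odot>\<^bsub>BL\<^esub> x \<otimes>\<^bsub>BL\<^esub> y = c \<odot>\<^bsub>BL\<^esub> (x \<otimes>\<^bsub>BL\<^esub> y)" "x \<otimes>\<^bsub>BL\<^esub> (c \<odot>\<^bsub>BL\<^esub> y) = c \<odot>\<^bsub>BL\<^esub> (x \<otimes>\<^bsub>BL\<^esub> y)"
    by (rule BL_ext; use x y in \<open>auto simp: BL_closed BL_apply BL_D\<close>)+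
  note S = BL_star(1)[OF x] BL_star(1)[OF y] and a = BL_star(2)[OF x] BL_star(2)[OF y]
  have conj_adj: "ip (star BL x u) w = ip u (x w)" if "u \<in> l2" "w \<in> l2" for u w
    using ip_commute[OF BL_D(1)[OF S(1) that(1)] that(2)] a(1)[OF that(2,1)]
      ip_commute[OF that(1) BL_D(1)[OF x that(2)]] by simp
  show "star BL (star BL x) = x"
    by (rule BL_star_eqI) (use S x conj_adj in auto)
  show "star BL (x \<oplus>\<^bsub>BL\<^esub> y) = star BL x \<oplus>\<^bsub>BL\<^esub> star BL y"
    by (rule BL_star_eqI) (use S x y in \<open>auto simp: BL_closed BL_apply BL_D ip_add_left ip_add_right a\<close>)
  show "star BL (c \<odot>\<^bsub>BL\<^esub> x) = cnj c \<odot>\<^bsub>BL\<^esub> star BL x"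
    by (rule BL_star_eqI) (use S x in \<open>auto simp: BL_closed BL_apply BL_D ip_scale_left ip_scale_right a\<close>)
  show "star BL (x \<otimes>\<^bsub>BL\<^esub> y) = star BL y \<otimes>\<^bsub>BL\<^esub> star BL x"
    by (rule BL_star_eqI) (use S x y in \<open>auto simp: BL_closed BL_apply BL_D a\<close>)
qed (auto simp: BL_norm(2) BL_norm_eq_0 BL_closed BL_norm_smult BL_cstar BL_star(1) complete_BL)

section \<open>Free products\<close>

context cstar_algebra
begin

text \<open>The elements that map every closed subspace generated by \<open>D\<close> into itself form a closed subalgebra.\<close>

lemma closed_span_eq:
  assumes gen: "\<And>M. closed_subspace A M \<Longrightarrow> \<one> \<in> M \<Longrightarrow> (\<And>x y. x \<in> M \<Longrightarrow> y \<in> M \<Longrightarrow> x \<otimes> y \<in> M) \<Longrightarrow>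
      X \<subseteq> M \<Longrightarrow> M = carrier A"
    and X: "X \<subseteq> carrier A" and D: "D \<subseteq> carrier A" "\<one> \<in> D"
    and XD: "\<And>g d. g \<in> X \<Longrightarrow> d \<in> D \<Longrightarrow> g \<otimes> d \<in> D"
    and W: "closed_subspace A W" and DW: "D \<subseteq> W"
  shows "W = carrier A"
proof -
  \<comment> \<open>The intersection of this family is the closed linear span of
    \<open>D\<close>.\<close>
  define S where "S = {W. closed_subspace A W \<and> D \<subseteq> W}"
  have WS: "W \<in> S" and cS: "carrier A \<in> S"
    using W DW D closed_subspace_carrier by (simp_all add: S_def)
  have cl: "closed_subspace A (\<Inter>S)"
    by (rule closed_subspace_Inter) (use WS in \<open>auto simp: S_def\<close>)
  have sub: "\<Inter>S \<subseteq> carrier A" using cS by blast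
  have left: "g \<otimes> x \<in> \<Inter>S" if g: "g \<in> X" and x: "x \<in> \<Inter>S" for g x
  proof
    fix W assume W: "W \<in> S"
    have gA: "g \<in> carrier A" using g X by blast
    have "closed_subspace A {x \<in> carrier A. g \<otimes> x \<in> W}"
      by (rule closed_subspace_vimage[OF cont_linear_mult_left[OF gA] cstar_algebra_axioms])
        (use W in \<open>simp add: S_def\<close>)
    moreover have "D \<subseteq> {x \<in> carrier A. g \<otimes> x \<in> W}" using W XD[OF g] D unfolding S_def by blast
    ultimately have "{x \<in> carrier A. g \<otimes> x \<in> W} \<in> S" by (simp add: S_def)
    then show "g \<otimes> x \<in> W" using x by blast
  qed
  define M where "M = {m \<in> carrier A. \<forall>x\<in>\<Inter>S. m \<otimes> x \<in> \<Inter>S}"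
  have M: "M = carrier A"
  proof (rule gen)
    let ?W = "\<lambda>x. {m \<in> carrier A. m \<otimes> x \<in> \<Inter>S}"
    have "M = \<Inter>(insert (carrier A) (?W ` \<Inter>S))" by (auto simp: M_def)
    moreover have "closed_subspace A (?W x)" if "x \<in> \<Inter>S" for x
      by (rule closed_subspace_vimage[OF cont_linear_mult_right cstar_algebra_axioms cl])
        (use that sub in blast)
    then have "closed_subspace A V" if "V \<in> insert (carrier A) (?W ` \<Inter>S)" for V
      using that closed_subspace_carrier by blast
    then have "closed_subspace A (\<Inter>(insert (carrier A) (?W ` \<Inter>S)))"
      by (intro closed_subspace_Inter) auto
    ultimately show "closed_subspace A M" by simp
    have "\<one> \<otimes> x \<in> \<Inter>S" if "x \<in> \<Inter>S" for x
      using that sub one_mult[of x] by (metis subsetD)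
    then show "\<one> \<in> M" unfolding M_def using one_in by blast
    show "x \<otimes> y \<in> M" if x: "x \<in> M" and y: "y \<in> M" for x y
    proof -
      have "x \<otimes> y \<otimes> z \<in> \<Inter>S" if z: "z \<in> \<Inter>S" for z
      proof -
        have "x \<otimes> (y \<otimes> z) \<in> \<Inter>S" using x y z unfolding M_def by blast
        moreover have "x \<otimes> y \<otimes> z = x \<otimes> (y \<otimes> z)"
          by (rule mult_assoc) (use x y z sub in \<open>unfold M_def, blast+\<close>)
        ultimately show ?thesis by simp
      qed
      moreover have "x \<otimes> y \<in> carrier A" using x y mult_in unfolding M_def by blast
      ultimately show ?thesis unfolding M_def by blast
    qed
    show "X \<subseteq> M" unfolding M_def using X left by blast
  qed
  have one: "\<one> \<in> \<Inter>S" using D(2) unfolding S_def by blast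
  have "x \<in> W" if x: "x \<in> carrier A" for x
  proof -
    \<comment> \<open>Applied to the unit, which lies in \<open>D\<close>, invariance of the span
      becomes membership in it.\<close>
    have "x \<otimes> \<one> \<in> \<Inter>S" using x M one unfolding M_def by blast
    then show ?thesis using WS mult_one[OF x] by auto
  qed
  then show ?thesis using closed_subspace_in[OF W] by blast
qed

section \<open>The infinite free product and its universal property\<close>

abbreviation "FG \<equiv> free_product_gens A"
abbreviation "FR \<equiv> free_product_relations A"

lemma FR_I:
  "a \<in> carrier A \<Longrightarrow> b \<in> carrier A \<Longrightarrow> free_gen (j, a \<oplus> b) - (free_gen (j, a) + free_gen (j, b)) \<in> FR"
  "a \<in> carrier A \<Longrightarrow> free_gen (j, c \<odot> a) - free_scale c (free_gen (j, a)) \<in> FR"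
  "a \<in> carrier A \<Longrightarrow> b \<in> carrier A \<Longrightarrow> free_gen (j, a \<otimes> b) - free_gen (j, a) * free_gen (j, b) \<in> FR"
  "a \<in> carrier A \<Longrightarrow> free_gen (j, star A a) - free_star (free_gen (j, a)) \<in> FR"
  "free_gen (j, \<one>) - 1 \<in> FR"
  unfolding free_product_relations_def by blast+

text \<open>For fixed \<open>j\<close>, the values \<open>N (free_gen (j, a))\<close> define a
  C*-seminorm in a, because \<open>N\<close> kills the relations. It therefore lies below the norm
  of \<open>A\<close>, uniformly in \<open>N\<close>.\<close>

lemma free_product_seminorm_le:
  assumes N: "cstar_seminorm FG N" and R: "\<forall>r\<in>FR. N r = 0" and a: "a \<in> carrier A"
  shows "N (free_gen (j, a)) \<le> cnorm A a"
proof -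
  have eqI: "N p = N q" if "p \<in> free_star_algebra FG" "q \<in> free_star_algebra FG" "p - q \<in> FR" for p q
  proof -
    have tri: "N (x + y) \<le> N x + N y" and sc: "N (free_scale c x) = cmod c * N x"
      if "x \<in> free_star_algebra FG" "y \<in> free_star_algebra FG" for x y c
      using N that unfolding cstar_seminorm_def by blast+
    have z: "N (p - q) = 0" using R that(3) by blast
    have "N (q - p) = N (p - q)"
      using sc[of "p - q" "p - q" "-1"] that by (simp add: free_scale_minus1)
    then show ?thesis using tri[of "p - q" q] tri[of "q - p" p] that z by simp
  qed
  have g: "free_gen (j, x) \<in> free_star_algebra FG" if "x \<in> carrier A" for x
    using that by (simp add: free_product_gens_def)
  have Nnn: "0 \<le> N p" and tri: "N (p + q) \<le> N p + N q" and Nmul: "N (p * q) \<le> N p * N q"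
    and Nsc: "N (free_scale c p) = cmod c * N p" and Ncst: "N (free_star p * p) = (N p)\<^sup>2"
    if "p \<in> free_star_algebra FG" "q \<in> free_star_algebra FG" for p q c
    using N that unfolding cstar_seminorm_def by blast+
  note Nnn = Nnn[OF _ free_star_algebra_closed(1)] and Nsc = Nsc[OF _ free_star_algebra_closed(1)]
    and Ncst = Ncst[OF _ free_star_algebra_closed(1)]
  show ?thesis
  proof (rule cstar_seminorm_le_cnorm[where q = "\<lambda>a. N (free_gen (j, a))"])
    fix x assume x: "x \<in> carrier A"
    show "0 \<le> N (free_gen (j, x))" by (rule Nnn[OF g[OF x]])
    show "N (free_gen (j, c \<odot> x)) = cmod c * N (free_gen (j, x))" for c
    proof -
      have "N (free_gen (j, c \<odot> x)) = N (free_scale c (free_gen (j, x)))"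
        by (rule eqI) (use x g in \<open>simp_all add: FR_I one_in mult_in\<close>)
      then show ?thesis using Nsc[OF g[OF x]] by simp
    qed
    show "N (free_gen (j, star A x \<otimes> x)) = (N (free_gen (j, x)))\<^sup>2"
    proof -
      have 1: "N (free_gen (j, star A x \<otimes> x)) = N (free_gen (j, star A x) * free_gen (j, x))"
        by (rule eqI) (use x g in \<open>simp_all add: FR_I one_in mult_in\<close>)
      have r: "free_gen (j, star A x) - free_star (free_gen (j, x)) \<in> FR"
        by (rule FR_I(4)[OF x])
      \<comment> \<open>The relation identifies the letter of \<open>star A x\<close> with the
        formal adjoint only up to this difference. The product of \<open>?d\<close> with a letter is
        not among the relations, but it is null by submultiplicativity.\<close>
      let ?d = "free_gen (j, star A x) - free_star (free_gen (j, x))"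
      have d: "?d \<in> free_star_algebra FG" using g x by simp
      have "N (?d * free_gen (j, x)) \<le> N ?d * N (free_gen (j, x))"
        by (rule Nmul[OF d g[OF x]])
      moreover have "0 \<le> N (?d * free_gen (j, x))"
        by (rule Nnn) (use d g[OF x] in simp)
      ultimately have z: "N (?d * free_gen (j, x)) = 0" using R r by simp
      have e: "free_gen (j, star A x) * free_gen (j, x) =
          ?d * free_gen (j, x) + free_star (free_gen (j, x)) * free_gen (j, x)"
        by (simp add: algebra_simps)
      have e': "free_star (free_gen (j, x)) * free_gen (j, x) =
          free_scale (-1) (?d * free_gen (j, x)) + free_gen (j, star A x) * free_gen (j, x)"
        by (simp add: algebra_simps free_scale_minus1)
      have sc: "N (free_scale (-1) (?d * free_gen (j, x))) = 0"
        using Nsc[OF free_star_algebra_closed(6)[OF d g[OF x]], of "-1"] z by simp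
      have "N (free_gen (j, star A x) * free_gen (j, x)) \<le> N (free_star (free_gen (j, x)) * free_gen (j, x))"
        unfolding e using tri[of "?d * free_gen (j, x)" "free_star (free_gen (j, x)) * free_gen (j, x)"] z d g[OF x]
        by simp
      moreover have "N (free_star (free_gen (j, x)) * free_gen (j, x)) \<le> N (free_gen (j, star A x) * free_gen (j, x))"
        using tri[of "free_scale (-1) (?d * free_gen (j, x))" "free_gen (j, star A x) * free_gen (j, x)"] sc d g x
        by (simp flip: e')
      moreover have "N (free_star (free_gen (j, x)) * free_gen (j, x)) = (N (free_gen (j, x)))\<^sup>2"
        by (rule Ncst[OF g[OF x]])
      ultimately show ?thesis using 1 by simp
    qed
    fix y assume y: "y \<in> carrier A"
    have "N (free_gen (j, x \<oplus> y)) = N (free_gen (j, x) + free_gen (j, y))"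
      by (rule eqI) (use x y g in \<open>simp_all add: FR_I one_in mult_in\<close>)
    then show "N (free_gen (j, x \<oplus> y)) \<le> N (free_gen (j, x)) + N (free_gen (j, y))"
      using tri[OF g[OF x] g[OF y]] by simp
  qed (rule a)
qed

lemma bounded_relations_free_product: "bounded_relations FG FR"
proof
  fix g assume "g \<in> FG"
  then obtain j a where "g = (j, a)" "a \<in> carrier A" by (auto simp: free_product_gens_def)
  then show "\<exists>C. \<forall>N. cstar_seminorm FG N \<longrightarrow> (\<forall>r\<in>FR. N r = 0) \<longrightarrow> N (free_gen g) \<le> C"
    using free_product_seminorm_le by blast
qed

abbreviation "FP \<equiv> free_product A"
abbreviation "emb \<equiv> free_emb A"

lemma cstar_algebra_FP: "cstar_algebra FP"
  unfolding free_product_def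
  by (rule bounded_relations.cstar_algebra_UA[OF bounded_relations_free_product])

lemma emb_star_hom: "emb j \<in> star_hom A FP"
proof -
  interpret bounded_relations FG FR by (rule bounded_relations_free_product)
  have g: "free_gen (j, x) \<in> V" if "x \<in> carrier A" for x
    using that by (simp add: free_product_gens_def)
  have e: "emb j x = const_cl (free_gen (j, x))" if "x \<in> carrier A" for x
    using that by (simp add: free_emb_def gen_eq)
  show ?thesis
    unfolding free_product_def
  proof (rule star_homI)
    show "emb j \<in> extensional (carrier A)" by (simp add: free_emb_def)
    have "const_cl (free_gen (j, \<one>)) = const_cl 1"
      by (rule const_cl_eqI) (use g one_in in \<open>simp_all add: FR_I one_in mult_in\<close>)
    then show "emb j \<one> = \<one>\<^bsub>UA\<^esub>" by (simp add: e one_in const_cl_simps)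
    fix x assume x: "x \<in> carrier A"
    show "emb j x \<in> carrier UA" using x g by (simp add: e const_cl_simps)
    have "const_cl (free_gen (j, c \<odot> x)) = const_cl (free_scale c (free_gen (j, x)))" for c
      by (rule const_cl_eqI) (use g x in \<open>simp_all add: FR_I one_in mult_in\<close>)
    then show "emb j (c \<odot> x) = c \<odot>\<^bsub>UA\<^esub> emb j x" for c using x g by (simp add: e const_cl_simps)
    have "const_cl (free_gen (j, star A x)) = const_cl (free_star (free_gen (j, x)))"
      by (rule const_cl_eqI) (use g x in \<open>simp_all add: FR_I one_in mult_in\<close>)
    then show "emb j (star A x) = star UA (emb j x)" using x g by (simp add: e const_cl_simps)
    fix y assume y: "y \<in> carrier A"
    have "const_cl (free_gen (j, x \<otimes> y)) = const_cl (free_gen (j, x) * free_gen (j, y))"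
      by (rule const_cl_eqI) (use g x y mult_in in \<open>simp_all add: FR_I one_in mult_in\<close>)
    then show "emb j (x \<otimes> y) = emb j x \<otimes>\<^bsub>UA\<^esub> emb j y"
      using x y g mult_in by (simp add: e const_cl_simps)
    have "const_cl (free_gen (j, x \<oplus> y)) = const_cl (free_gen (j, x) + free_gen (j, y))"
      by (rule const_cl_eqI) (use g x y in \<open>simp_all add: FR_I one_in mult_in\<close>)
    then show "emb j (x \<oplus> y) = emb j x \<oplus>\<^bsub>UA\<^esub> emb j y"
      using x y g by (simp add: e const_cl_simps)
  qed
qed

lemma FP_generated:
  assumes W: "closed_subspace FP W" "\<one>\<^bsub>FP\<^esub> \<in> W"
    and mult: "\<And>x y. x \<in> W \<Longrightarrow> y \<in> W \<Longrightarrow> x \<otimes>\<^bsub>FP\<^esub> y \<in> W"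
    and emb: "\<And>j a. a \<in> carrier A \<Longrightarrow> emb j a \<in> W"
  shows "W = carrier FP"
proof -
  interpret bounded_relations FG FR by (rule bounded_relations_free_product)
  have g: "gen (j, a) = emb j a" if "a \<in> carrier A" for j a using that by (simp add: free_emb_def)
  show ?thesis
    unfolding free_product_def
  proof (rule UA_generated)
    fix h assume "h \<in> FG"
    then obtain j a where ja: "h = (j, a)" "a \<in> carrier A" by (auto simp: free_product_gens_def)
    show "gen h \<in> W" using ja g emb by simp
    have "star UA (gen h) = emb j (star A a)"
      using ja g star_homD(5)[OF emb_star_hom] by (simp add: free_product_def)
    then show "star UA (gen h) \<in> W" using emb ja by simp
  qed (use W mult in \<open>auto simp: free_product_def\<close>)
qed

lemma FP_hom_exists:
  assumes B: "cstar_algebra B" and \<kappa>: "\<And>j. \<kappa> j \<in> star_hom A B"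
  obtains h where "h \<in> star_hom FP B" "\<And>j a. a \<in> carrier A \<Longrightarrow> h (emb j a) = \<kappa> j a"
proof -
  interpret bounded_relations FG FR by (rule bounded_relations_free_product)
  interpret B: cstar_algebra B by (rule B)
  let ?\<phi> = "\<lambda>(j, a). \<kappa> j a"
  note K = star_homD[OF \<kappa>]
  interpret P: poly_valuation B FG ?\<phi>
    by unfold_locales (auto simp: free_product_gens_def K)
  have g: "free_gen (j, x) \<in> V" and v: "P.val (free_gen (j, x)) = \<kappa> j x" if "x \<in> carrier A" for j x
    using that P.val_gen[of "(j, x)"] by (simp_all add: free_product_gens_def)
  have "P.val r = \<zero>\<^bsub>B\<^esub>" if "r \<in> FR" for r
    using that unfolding free_product_relations_def
    by (auto simp: P.val_diff P.val_add P.val_mult P.val_scale P.val_star g v K one_in mult_in)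
  then obtain h where "h \<in> star_hom UA B" "\<And>x. x \<in> FG \<Longrightarrow> h (gen x) = ?\<phi> x"
    using universal_hom[OF B, of ?\<phi>] P.gen_in by metis
  then show ?thesis
    by (intro that[of h]) (auto simp: free_product_def free_emb_def free_product_gens_def)
qed

lemma FP_hom_eqI:
  assumes B: "cstar_algebra B" and h: "h \<in> star_hom FP B" and k: "k \<in> star_hom FP B"
    and eq: "\<And>j a. a \<in> carrier A \<Longrightarrow> h (emb j a) = k (emb j a)"
  shows "h = k"
proof -
  interpret FP: cstar_algebra FP by (rule cstar_algebra_FP)
  note E = star_homD[OF emb_star_hom]
  have "{x \<in> carrier FP. h x = k x} = carrier FP"
  proof (rule FP_generated)
    show "closed_subspace FP {x \<in> carrier FP. h x = k x}"
      by (rule FP.closed_subspace_equalizer[OF FP.star_hom_cont_linear[OF h B]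
          FP.star_hom_cont_linear[OF k B] B])
  qed (auto simp: star_homD[OF h] star_homD[OF k] eq E FP.one_in FP.mult_in)
  then have "\<And>x. x \<in> carrier FP \<Longrightarrow> h x = k x" by blast
  then show ?thesis using star_homD(7)[OF h] star_homD(7)[OF k] by (rule extensionalityI[rotated 2])
qed

text \<open>Resolves the definite description: existence is the universal property applied to the
  reindexed embeddings, uniqueness is generation by the embedded copies.\<close>

lemma index_endo:
  "index_endo A f \<in> star_hom FP FP"
  "a \<in> carrier A \<Longrightarrow> index_endo A f (emb j a) = emb (f j) a"
proof -
  obtain h where h: "h \<in> star_hom FP FP" "\<And>j a. a \<in> carrier A \<Longrightarrow> h (emb j a) = emb (f j) a"
    using FP_hom_exists[OF cstar_algebra_FP, of "\<lambda>j. emb (f j)"] emb_star_hom by metis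
  have "index_endo A f = h"
    unfolding index_endo_def
  proof (rule the_equality)
    show "h \<in> star_hom FP FP \<and> (\<forall>j. \<forall>a\<in>carrier A. h (emb j a) = emb (f j) a)" using h by simp
    fix k assume k: "k \<in> star_hom FP FP \<and> (\<forall>j. \<forall>a\<in>carrier A. k (emb j a) = emb (f j) a)"
    show "k = h"
      by (rule FP_hom_eqI[OF cstar_algebra_FP conjunct1[OF k] h(1)]) (simp add: k h(2))
  qed
  then show "index_endo A f \<in> star_hom FP FP"
    "a \<in> carrier A \<Longrightarrow> index_endo A f (emb j a) = emb (f j) a" using h by auto
qed

end

lemma cstar_prod_simps [simp]:
  "cstar_prod B [] = \<one>\<^bsub>B\<^esub>" "cstar_prod B (x # xs) = x \<otimes>\<^bsub>B\<^esub> cstar_prod B xs"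
  by (simp_all add: cstar_prod_def)

lemma free_word_simps [simp]:
  "free_word A [] = \<one>\<^bsub>free_product A\<^esub>"
  "free_word A ((j, a) # xs) = free_emb A j a \<otimes>\<^bsub>free_product A\<^esub> free_word A xs"
  by (simp_all add: free_word_def)

context cstar_algebra
begin

lemma free_word_in: "snd ` set xs \<subseteq> carrier A \<Longrightarrow> free_word A xs \<in> carrier FP"
proof (induction xs)
  case Nil
  show ?case using cstar_algebra.one_in[OF cstar_algebra_FP] by simp
next
  case (Cons x xs)
  then show ?case
    using cstar_algebra.mult_in[OF cstar_algebra_FP] star_homD(1)[OF emb_star_hom]
    by (cases x) auto
qed

lemma star_hom_free_word:
  assumes h: "h \<in> star_hom FP B" and xs: "snd ` set xs \<subseteq> carrier A"
  shows "h (free_word A xs) = cstar_prod B (map (\<lambda>(j, a). h (emb j a)) xs)"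
  using xs
proof (induction xs)
  case Nil
  show ?case using star_homD(6)[OF h] by simp
next
  case (Cons x xs)
  then show ?case
    using star_homD(2)[OF h star_homD(1)[OF emb_star_hom] free_word_in] by (cases x) auto
qed

text \<open>Words in any order and with repetitions are stable under multiplication by a letter.
  Density of their span makes a distribution unique on the free product itself, where letters cannot
  be reordered.\<close>

lemma FP_spanned:
  assumes W: "closed_subspace FP W"
    and words: "\<And>xs. snd ` set xs \<subseteq> carrier A \<Longrightarrow> free_word A xs \<in> W"
  shows "W = carrier FP"
proof -
  interpret FP: cstar_algebra FP by (rule cstar_algebra_FP)
  note E = star_homD[OF emb_star_hom]
  show ?thesis
  proof (rule FP.closed_span_eq[OF _ _ _ _ _ W])
    let ?D = "{free_word A xs | xs. snd ` set xs \<subseteq> carrier A}"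
    show "M = carrier FP"
      if "closed_subspace FP M" "\<one>\<^bsub>FP\<^esub> \<in> M" "\<And>x y. x \<in> M \<Longrightarrow> y \<in> M \<Longrightarrow> x \<otimes>\<^bsub>FP\<^esub> y \<in> M"
        "{emb j a | j a. a \<in> carrier A} \<subseteq> M" for M
      by (rule FP_generated) (use that in blast)+
    show "{emb j a | j a. a \<in> carrier A} \<subseteq> carrier FP" using E(1) by blast
    show "?D \<subseteq> W" using words by blast
    show "?D \<subseteq> carrier FP" using free_word_in by blast
    have "free_word A [] \<in> ?D" by (intro CollectI exI[of _ "[]"]) simp
    then show "\<one>\<^bsub>FP\<^esub> \<in> ?D" by simp
    fix g d assume "g \<in> {emb j a | j a. a \<in> carrier A}" "d \<in> ?D"
    then obtain j a xs where *: "g = emb j a" "a \<in> carrier A" "d = free_word A xs" "snd ` set xs \<subseteq> carrier A"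
      unfolding mem_Collect_eq by metis
    then have "g \<otimes>\<^bsub>FP\<^esub> d = free_word A ((j, a) # xs)" "snd ` set ((j, a) # xs) \<subseteq> carrier A" by simp_all
    then show "g \<otimes>\<^bsub>FP\<^esub> d \<in> ?D" by blast
  qed
qed

end

section \<open>The non-commutative torus\<close>

text \<open>Unitarity of a generator g gives N(g)^2 = N(g*g) \<le> N(g*g - 1) + N(1) \<le>
  1.\<close>

lemma bounded_relations_torus: "bounded_relations UNIV (torus_relations \<alpha>)"
proof
  fix g :: torus_gen
  have "N (free_gen g) \<le> 1" if N: "cstar_seminorm UNIV N" and R: "\<forall>r\<in>torus_relations \<alpha>. N r = 0" for N
  proof -
    have V: "p \<in> free_star_algebra UNIV" for p :: "torus_gen star_poly" by (simp add: free_star_algebra_def)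
    have cst: "N (free_star p * p) = (N p)\<^sup>2" and tri: "N (p + q) \<le> N p + N q" and nn: "0 \<le> N p" for p q
      using N V unfolding cstar_seminorm_def by blast+
    have "N 1 * (N 1 - 1) = 0" using cst[of 1] by (simp add: power2_eq_square algebra_simps)
    then have "N 1 \<le> 1" by auto
    moreover have "free_star (free_gen g) * free_gen g - 1 \<in> torus_relations \<alpha>"
      by (cases g) (auto simp: torus_relations_def)
    then have "N (free_star (free_gen g) * free_gen g - 1) = 0" using R by blast
    ultimately have "(N (free_gen g))\<^sup>2 \<le> 1\<^sup>2"
      using tri[of "free_star (free_gen g) * free_gen g - 1" 1] cst[of "free_gen g"] by simp
    then show ?thesis by (rule power2_le_imp_le) simp
  qed
  then show "\<exists>C. \<forall>N. cstar_seminorm UNIV N \<longrightarrow> (\<forall>r\<in>torus_relations \<alpha>. N r = 0) \<longrightarrow> N (free_gen g) \<le> C"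
    by blast
qed

locale nctorus =
  fixes \<alpha> :: real
begin

abbreviation "\<A> \<equiv> nc_torus \<alpha>"
abbreviation "u \<equiv> torus_u \<alpha>"
abbreviation "w \<equiv> torus_w \<alpha>"
abbreviation "\<omega> \<equiv> cis (2 * pi * \<alpha>)"

lemma cstar_algebra_torus: "cstar_algebra \<A>"
  unfolding nc_torus_def
  by (rule bounded_relations.cstar_algebra_UA[OF bounded_relations_torus])

sublocale T: cstar_algebra \<A>
  by (rule cstar_algebra_torus)

lemma u_in [simp]: "u \<in> carrier \<A>" and w_in [simp]: "w \<in> carrier \<A>"
  unfolding nc_torus_def torus_u_def torus_w_def
  by (simp_all add: bounded_relations.gen_in_UA[OF bounded_relations_torus])

lemma torus_rel:
  "u \<otimes>\<^bsub>\<A>\<^esub> star \<A> u = \<one>\<^bsub>\<A>\<^esub>" "star \<A> u \<otimes>\<^bsub>\<A>\<^esub> u = \<one>\<^bsub>\<A>\<^esub>"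
  "w \<otimes>\<^bsub>\<A>\<^esub> star \<A> w = \<one>\<^bsub>\<A>\<^esub>" "star \<A> w \<otimes>\<^bsub>\<A>\<^esub> w = \<one>\<^bsub>\<A>\<^esub>"
  "u \<otimes>\<^bsub>\<A>\<^esub> w = \<omega> \<odot>\<^bsub>\<A>\<^esub> (w \<otimes>\<^bsub>\<A>\<^esub> u)"
proof -
  interpret bounded_relations UNIV "torus_relations \<alpha>" by (rule bounded_relations_torus)
  let ?u = "free_gen Gen_U" and ?w = "free_gen Gen_W"
  have V: "p \<in> V" for p :: "torus_gen star_poly" by (simp add: free_star_algebra_def)
  have "const_cl (?u * free_star ?u) = const_cl 1" "const_cl (free_star ?u * ?u) = const_cl 1"
    "const_cl (?w * free_star ?w) = const_cl 1" "const_cl (free_star ?w * ?w) = const_cl 1"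
    "const_cl (?u * ?w) = const_cl (free_scale \<omega> (?w * ?u))"
    by (rule const_cl_eqI; simp add: V torus_relations_def)+
  then show "u \<otimes>\<^bsub>\<A>\<^esub> star \<A> u = \<one>\<^bsub>\<A>\<^esub>" "star \<A> u \<otimes>\<^bsub>\<A>\<^esub> u = \<one>\<^bsub>\<A>\<^esub>"
    "w \<otimes>\<^bsub>\<A>\<^esub> star \<A> w = \<one>\<^bsub>\<A>\<^esub>" "star \<A> w \<otimes>\<^bsub>\<A>\<^esub> w = \<one>\<^bsub>\<A>\<^esub>"
    "u \<otimes>\<^bsub>\<A>\<^esub> w = \<omega> \<odot>\<^bsub>\<A>\<^esub> (w \<otimes>\<^bsub>\<A>\<^esub> u)"
    unfolding nc_torus_def torus_u_def torus_w_def gen_eq by (simp_all add: const_cl_simps V)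
qed

text \<open>The set contains the adjoints, so that generation of the torus can be phrased with
  products and limits alone.\<close>

definition "gens = {u, w, star \<A> u, star \<A> w}"

lemma gens_in: "gens \<subseteq> carrier \<A>"
  by (auto simp: gens_def)

lemma torus_generated:
  assumes W: "closed_subspace \<A> W" "\<one>\<^bsub>\<A>\<^esub> \<in> W"
    and mult: "\<And>x y. x \<in> W \<Longrightarrow> y \<in> W \<Longrightarrow> x \<otimes>\<^bsub>\<A>\<^esub> y \<in> W" and g: "gens \<subseteq> W"
  shows "W = carrier \<A>"
proof -
  interpret bounded_relations UNIV "torus_relations \<alpha>" by (rule bounded_relations_torus)
  have "gen h \<in> W \<and> star UA (gen h) \<in> W" for h
    using g by (cases h) (auto simp: gens_def nc_torus_def torus_u_def torus_w_def)
  then show ?thesis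
    using UA_generated[of W] W mult unfolding nc_torus_def by blast
qed

lemma torus_hom_eqI:
  assumes B: "cstar_algebra B" and h: "h \<in> star_hom \<A> B" and k: "k \<in> star_hom \<A> B"
    and eq: "h u = k u" "h w = k w"
  shows "h = k"
proof (rule bounded_relations.star_hom_UA_eqI[OF bounded_relations_torus B])
  show "h \<in> star_hom (universal_cstar UNIV (torus_relations \<alpha>)) B"
    "k \<in> star_hom (universal_cstar UNIV (torus_relations \<alpha>)) B" using h k by (simp_all add: nc_torus_def)
  show "h (universal_gen UNIV (torus_relations \<alpha>) g) = k (universal_gen UNIV (torus_relations \<alpha>) g)" for g
    using eq by (cases g) (simp_all add: torus_u_def torus_w_def)
qed

lemma torus_hom_exists:
  assumes B: "cstar_algebra B" and U: "U \<in> carrier B" and W: "W \<in> carrier B"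
    and rel: "U \<otimes>\<^bsub>B\<^esub> star B U = \<one>\<^bsub>B\<^esub>" "star B U \<otimes>\<^bsub>B\<^esub> U = \<one>\<^bsub>B\<^esub>"
      "W \<otimes>\<^bsub>B\<^esub> star B W = \<one>\<^bsub>B\<^esub>" "star B W \<otimes>\<^bsub>B\<^esub> W = \<one>\<^bsub>B\<^esub>"
      "U \<otimes>\<^bsub>B\<^esub> W = \<omega> \<odot>\<^bsub>B\<^esub> (W \<otimes>\<^bsub>B\<^esub> U)"
  obtains h where "h \<in> star_hom \<A> B" "h u = U" "h w = W"
proof -
  interpret bounded_relations UNIV "torus_relations \<alpha>" by (rule bounded_relations_torus)
  interpret B: cstar_algebra B by (rule B)
  let ?\<phi> = "case_torus_gen U W"
  have phi: "?\<phi> g \<in> carrier B" for g using U W by (cases g) auto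
  interpret P: poly_valuation B UNIV ?\<phi> by unfold_locales (rule phi)
  have V: "p \<in> V" for p :: "torus_gen star_poly" by (simp add: free_star_algebra_def)
  have v: "P.val (free_gen Gen_U) = U" "P.val (free_gen Gen_W) = W"
    using P.val_gen[of Gen_U] P.val_gen[of Gen_W] by simp_all
  have "P.val r = \<zero>\<^bsub>B\<^esub>" if "r \<in> torus_relations \<alpha>" for r
    using that U W unfolding torus_relations_def
    by (auto simp: P.val_diff P.val_mult P.val_scale P.val_star V v rel B.one_in B.mult_in)
  then obtain h where "h \<in> star_hom UA B" "\<And>x. h (gen x) = ?\<phi> x"
    using universal_hom[OF B, of ?\<phi>] phi by (metis UNIV_I)
  then show ?thesis
    by (intro that[of h]) (auto simp: nc_torus_def torus_u_def torus_w_def)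
qed

section \<open>Rotations and homogeneous elements\<close>

lemma rotation_hom_exists:
  assumes z: "cmod z\<^sub>1 = 1" "cmod z\<^sub>2 = 1"
  obtains h where "h \<in> star_hom \<A> \<A>" "h u = z\<^sub>1 \<odot>\<^bsub>\<A>\<^esub> u" "h w = z\<^sub>2 \<odot>\<^bsub>\<A>\<^esub> w"
proof -
  have zz: "z * cnj z = 1" "cnj z * z = 1" if "cmod z = 1" for z
    using complex_norm_square[of z] that by (simp_all add: mult.commute)
  show ?thesis
    by (rule torus_hom_exists[OF cstar_algebra_torus, of "z\<^sub>1 \<odot>\<^bsub>\<A>\<^esub> u" "z\<^sub>2 \<odot>\<^bsub>\<A>\<^esub> w"])
      (simp_all add: T.star_smult T.smult_mult_left T.smult_mult_right torus_rel zz z T.one_in T.mult_in that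
        mult_ac)
qed

text \<open>Bijectivity comes from the homomorphism with conjugate parameters: both composites fix u
  and w, so they are the identity.\<close>

lemma rotation:
  assumes z: "cmod z\<^sub>1 = 1" "cmod z\<^sub>2 = 1"
  shows "rotation \<alpha> z\<^sub>1 z\<^sub>2 \<in> star_hom \<A> \<A>" "rotation \<alpha> z\<^sub>1 z\<^sub>2 u = z\<^sub>1 \<odot>\<^bsub>\<A>\<^esub> u"
    "rotation \<alpha> z\<^sub>1 z\<^sub>2 w = z\<^sub>2 \<odot>\<^bsub>\<A>\<^esub> w"
proof -
  obtain h where h: "h \<in> star_hom \<A> \<A>" "h u = z\<^sub>1 \<odot>\<^bsub>\<A>\<^esub> u" "h w = z\<^sub>2 \<odot>\<^bsub>\<A>\<^esub> w"
    using rotation_hom_exists[OF z] by blast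
  have cz: "cmod (cnj z\<^sub>1) = 1" "cmod (cnj z\<^sub>2) = 1" using z by simp_all
  obtain k where k: "k \<in> star_hom \<A> \<A>" "k u = cnj z\<^sub>1 \<odot>\<^bsub>\<A>\<^esub> u" "k w = cnj z\<^sub>2 \<odot>\<^bsub>\<A>\<^esub> w"
    using rotation_hom_exists[OF cz] by blast
  note H = star_homD[OF h(1)] and K = star_homD[OF k(1)]
  have zz: "z * cnj z = 1" if "cmod z = 1" for z
    using complex_norm_square[of z] that by simp
  let ?id = "\<lambda>x\<in>carrier \<A>. x"
  have id: "?id \<in> star_hom \<A> \<A>" by (rule star_homI) (auto simp: T.one_in T.mult_in)
  have comp: "compose (carrier \<A>) f g \<in> star_hom \<A> \<A>" if "f \<in> star_hom \<A> \<A>" "g \<in> star_hom \<A> \<A>" for f g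
    by (rule star_homI)
      (auto simp: compose_def star_homD[OF that(1)] star_homD[OF that(2)] T.one_in T.mult_in)
  have zz': "cnj z * z = 1" if "cmod z = 1" for z
    using zz[OF that] by (simp add: mult.commute)
  have "compose (carrier \<A>) h k = ?id"
    by (rule torus_hom_eqI[OF cstar_algebra_torus comp[OF h(1) k(1)] id])
      (simp_all add: compose_def h(2,3) k(2,3) H(4) zz zz' z)
  moreover have "compose (carrier \<A>) k h = ?id"
    by (rule torus_hom_eqI[OF cstar_algebra_torus comp[OF k(1) h(1)] id])
      (simp_all add: compose_def h(2,3) k(2,3) K(4) zz zz' z)
  ultimately have ck: "compose (carrier \<A>) h k x = x" "compose (carrier \<A>) k h x = x"
    if "x \<in> carrier \<A>" for x using that by simp_all
  then have hk: "h (k x) = x" "k (h x) = x" if "x \<in> carrier \<A>" for x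
    using ck[OF that] that by (simp_all add: compose_def)
  have "bij_betw h (carrier \<A>) (carrier \<A>)"
    by (rule bij_betwI[where g = k]) (auto simp: H K hk)
  then have "h \<in> carrier (star_aut_group \<A>)"
    using h H by (simp add: star_aut_group_def Bij_def)
  moreover have "g = h" if "g \<in> carrier (star_aut_group \<A>)" "g u = z\<^sub>1 \<odot>\<^bsub>\<A>\<^esub> u" "g w = z\<^sub>2 \<odot>\<^bsub>\<A>\<^esub> w" for g
    using that h by (intro torus_hom_eqI[OF cstar_algebra_torus]) (auto simp: star_aut_group_def)
  ultimately have "rotation \<alpha> z\<^sub>1 z\<^sub>2 = h"
    unfolding rotation_def using h(2,3) by (intro the_equality conjI) blast+
  then show "rotation \<alpha> z\<^sub>1 z\<^sub>2 \<in> star_hom \<A> \<A>" "rotation \<alpha> z\<^sub>1 z\<^sub>2 u = z\<^sub>1 \<odot>\<^bsub>\<A>\<^esub> u"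
    "rotation \<alpha> z\<^sub>1 z\<^sub>2 w = z\<^sub>2 \<odot>\<^bsub>\<A>\<^esub> w" using h by simp_all
qed

lemma homogeneous_u: "homogeneous \<alpha> (1, 0) u"
  and homogeneous_w: "homogeneous \<alpha> (0, 1) w"
  by (simp_all add: homogeneous_def rotation)

lemma homogeneous_mult:
  assumes "homogeneous \<alpha> d a" "homogeneous \<alpha> e b"
  shows "homogeneous \<alpha> (fst d + fst e, snd d + snd e) (a \<otimes>\<^bsub>\<A>\<^esub> b)"
  unfolding homogeneous_def
proof (intro conjI allI impI)
  have ab: "a \<in> carrier \<A>" "b \<in> carrier \<A>" using assms by (auto simp: homogeneous_def)
  then show "a \<otimes>\<^bsub>\<A>\<^esub> b \<in> carrier \<A>" by (rule T.mult_in)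
  fix z\<^sub>1 z\<^sub>2 assume z: "cmod z\<^sub>1 = 1 \<and> cmod z\<^sub>2 = 1"
  then have nz: "z\<^sub>1 \<noteq> 0" "z\<^sub>2 \<noteq> 0" by auto
  have "rotation \<alpha> z\<^sub>1 z\<^sub>2 (a \<otimes>\<^bsub>\<A>\<^esub> b) = rotation \<alpha> z\<^sub>1 z\<^sub>2 a \<otimes>\<^bsub>\<A>\<^esub> rotation \<alpha> z\<^sub>1 z\<^sub>2 b"
    using star_homD(2)[OF rotation(1)] z ab by simp
  then show "rotation \<alpha> z\<^sub>1 z\<^sub>2 (a \<otimes>\<^bsub>\<A>\<^esub> b) =
      (z\<^sub>1 powi fst (fst d + fst e, snd d + snd e) * z\<^sub>2 powi snd (fst d + fst e, snd d + snd e)) \<odot>\<^bsub>\<A>\<^esub> (a \<otimes>\<^bsub>\<A>\<^esub> b)"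
    using assms z ab nz
    by (simp add: homogeneous_def T.smult_mult_left T.smult_mult_right T.mult_in power_int_add mult_ac)
qed

lemma homogeneous_star:
  assumes "homogeneous \<alpha> d a"
  shows "homogeneous \<alpha> (- fst d, - snd d) (star \<A> a)"
  unfolding homogeneous_def
proof (intro conjI allI impI)
  have a: "a \<in> carrier \<A>" using assms by (auto simp: homogeneous_def)
  then show "star \<A> a \<in> carrier \<A>" by simp
  fix z\<^sub>1 z\<^sub>2 assume z: "cmod z\<^sub>1 = 1 \<and> cmod z\<^sub>2 = 1"
  have pw: "cnj y powi k = y powi (- k)" if "cmod y = 1" for y k
  proof -
    have "cnj y = inverse y" using that complex_norm_square[of y]
      by (metis inverse_unique of_real_1 one_power2)
    then show ?thesis by (simp add: power_int_minus power_int_inverse)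
  qed
  have "rotation \<alpha> z\<^sub>1 z\<^sub>2 (star \<A> a) = star \<A> (rotation \<alpha> z\<^sub>1 z\<^sub>2 a)"
    using star_homD(5)[OF rotation(1)] z a by simp
  then show "rotation \<alpha> z\<^sub>1 z\<^sub>2 (star \<A> a) =
      (z\<^sub>1 powi fst (- fst d, - snd d) * z\<^sub>2 powi snd (- fst d, - snd d)) \<odot>\<^bsub>\<A>\<^esub> star \<A> a"
    using assms z a by (simp add: homogeneous_def T.star_smult pw)
qed

lemma gens_homogeneous: "g \<in> gens \<Longrightarrow> \<exists>d. homogeneous \<alpha> d g"
  using homogeneous_u homogeneous_w homogeneous_star[OF homogeneous_u] homogeneous_star[OF homogeneous_w]
  unfolding gens_def by blast

end

text \<open>The torus is only a monoid under multiplication, so integer powers of its unitaries are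
  controlled through an explicit two-sided inverse y. Later x is u or w and y is its
  adjoint.\<close>

lemma (in monoid) int_pow_unit_step:
  assumes x: "x \<in> carrier G" "y \<in> carrier G" "x \<otimes> y = \<one>" "y \<otimes> x = \<one>"
  shows "x [^] (i :: int) \<in> carrier G" "x \<otimes> x [^] (i :: int) = x [^] (i + 1)" "y \<otimes> x [^] (i :: int) = x [^] (i - 1)"
proof -
  have inv: "x [^] n \<otimes> y [^] n = \<one>" "y [^] n \<otimes> x [^] n = \<one>" for n :: nat
  proof (induction n)
    case (Suc n)
    have "a [^] Suc n \<otimes> b [^] Suc n = \<one>"
      if "a \<in> carrier G" "b \<in> carrier G" "a \<otimes> b = \<one>" "a [^] n \<otimes> b [^] n = \<one>" for a b
    proof -
      have "a [^] Suc n \<otimes> b [^] Suc n = (a [^] n \<otimes> a) \<otimes> (b \<otimes> b [^] n)"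
        using that(2) nat_pow_Suc2[of b n] by simp
      also have "\<dots> = a [^] n \<otimes> (a \<otimes> b) \<otimes> b [^] n" using that(1,2) by (simp add: m_assoc)
      finally show ?thesis using that by simp
    qed
    then show "x [^] Suc n \<otimes> y [^] Suc n = \<one>" "y [^] Suc n \<otimes> x [^] Suc n = \<one>"
      using Suc x by blast+
  qed simp_all
  have neg: "x [^] (- int n) = y [^] n" for n
  proof (cases "n = 0")
    case False
    have "inv (x [^] n) = y [^] n"
      using inv[of n] x by (intro inv_char) auto
    then show ?thesis using False by (simp add: int_pow_def2)
  qed simp
  have pos: "x [^] (int n) = x [^] n" for n by (simp add: int_pow_int)
  show "x [^] i \<in> carrier G"
    by (cases i rule: int_cases2) (simp_all add: pos neg x)
  show st: "x \<otimes> x [^] i = x [^] (i + 1)" for i :: int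
  proof (cases i rule: int_cases2)
    case (nonneg n)
    then have "i + 1 = int (Suc n)" by simp
    then show ?thesis using nonneg nat_pow_Suc2[OF x(1), of n] by (simp only: pos)
  next
    case (nonpos n)
    show ?thesis
    proof (cases n)
      case 0
      then show ?thesis using nonpos x pos[of 1] by simp
    next
      case (Suc m)
      then have "i + 1 = - int m" using nonpos by simp
      moreover have "x \<otimes> y [^] Suc m = y [^] m"
      proof -
        have "x \<otimes> y [^] Suc m = x \<otimes> (y \<otimes> y [^] m)" using nat_pow_Suc2[of y m] x(2) by simp
        also have "\<dots> = (x \<otimes> y) \<otimes> y [^] m" using x(1,2) by (simp add: m_assoc)
        also have "\<dots> = y [^] m" unfolding x(3) using x(2) by simp
        finally show ?thesis .
      qed
      moreover have "x [^] i = y [^] Suc m" using neg[of n] unfolding nonpos Suc .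
      ultimately show ?thesis using neg[of m] by metis
    qed
  qed
  have in': "x [^] j \<in> carrier G" for j :: int
    by (cases j rule: int_cases2) (simp_all add: pos neg x)
  have "y \<otimes> (x \<otimes> x [^] (i - 1)) = x [^] (i - 1)"
    using m_assoc[OF x(2,1) in'[of "i - 1"]] x(4) in'[of "i - 1"] by simp
  then show "y \<otimes> x [^] i = x [^] (i - 1)" using st[of "i - 1"] by simp
qed

section \<open>The twisted regular representation\<close>

text \<open>Absolute summability lets the series be read as an unordered sum, which a bijection may
  rearrange.\<close>

lemma suminf_reindex_bij:
  fixes f :: "nat \<Rightarrow> complex"
  assumes "summable (\<lambda>n. cmod (f n))" "bij b"
  shows "suminf (\<lambda>n. f (b n)) = suminf f"
proof -
  have "f sums suminf f" by (rule summable_sums[OF summable_norm_cancel[OF assms(1)]])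
  then have "(f has_sum suminf f) UNIV" by (rule norm_summable_imp_has_sum[OF assms(1)])
  then have "((\<lambda>n. f (b n)) has_sum suminf f) UNIV"
    using has_sum_reindex_bij_betw[of b UNIV UNIV f] assms(2) by simp
  from sums_unique[OF has_sum_imp_sums[OF this]] show ?thesis by simp
qed

text \<open>Index \<open>2j\<close> carries the degree in \<open>u\<close> of the \<open>j\<close>-th torus and \<open>2j + 1\<close> the degree in \<open>w\<close>.\<close>

type_synonym dual = "nat \<Rightarrow>\<^sub>0 int"

lemma countable_dual: "countable (UNIV :: dual set)"
proof -
  let ?g = "\<lambda>p :: dual. (\<lambda>k. (k, Poly_Mapping.lookup p k)) ` Poly_Mapping.keys p"
  have "inj ?g"
  proof (rule injI, rule poly_mapping_eqI)
    fix p q :: dual and k assume eq: "?g p = ?g q"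
    have "Poly_Mapping.lookup p k = c \<longleftrightarrow> (k, c) \<in> ?g p" if "c \<noteq> 0" for p :: dual and c
      using that by (auto simp: in_keys_iff)
    then show "Poly_Mapping.lookup p k = Poly_Mapping.lookup q k" using eq by metis
  qed
  moreover have "countable (range ?g)"
    by (rule countable_subset[OF _ countable_Collect_finite]) auto
  ultimately show ?thesis using countable_image_inj_on by blast
qed

lemma infinite_dual: "infinite (UNIV :: dual set)"
proof
  assume "finite (UNIV :: dual set)"
  then have "finite (range (Poly_Mapping.single (0::nat) :: int \<Rightarrow> dual))" by (rule rev_finite_subset) simp
  moreover have "inj (Poly_Mapping.single (0::nat) :: int \<Rightarrow> dual)"
    by (rule injI) (metis lookup_single_eq)
  ultimately show False using finite_imageD infinite_UNIV_int by blast
qed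

text \<open>An enumeration identifies \<open>\<ell>\<^sup>2(\<Gamma>)\<close> with \<open>\<ell>\<^sup>2(\<nat>)\<close>.\<close>

definition en :: "dual \<Rightarrow> nat" where "en = to_nat_on UNIV"
definition de :: "nat \<Rightarrow> dual" where "de = from_nat_into UNIV"

lemma de_en [simp]: "de (en \<gamma>) = \<gamma>" and en_de [simp]: "en (de n) = n"
  unfolding en_def de_def
  using countable_dual infinite_dual by (simp_all add: from_nat_into_to_nat_on to_nat_on_from_nat_into_infinite)

lemma en_eq_iff [simp]: "en \<gamma> = en \<delta> \<longleftrightarrow> \<gamma> = \<delta>"
  by (metis de_en)

definition delta :: "dual \<Rightarrow> nat \<Rightarrow> complex" where
  "delta \<gamma> = l2basis (en \<gamma>)"

lemma delta_in [simp]: "delta \<gamma> \<in> l2"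
  by (simp add: delta_def)

lemma ip_delta [simp]: "ip x (delta \<gamma>) = x (en \<gamma>)"
  by (simp add: delta_def)

lemma delta_en: "delta \<gamma> (en \<delta>) = (if \<delta> = \<gamma> then 1 else 0)"
  by (simp add: delta_def l2basis_def)

text \<open>In the basis \<open>delta\<close> this sends the vector at \<gamma> to
  \<open>s \<gamma>\<close> times the vector at \<gamma> + e. In coordinates the weight is therefore
  read at the source, \<open>de n - e\<close>.\<close>

definition wshift :: "(dual \<Rightarrow> complex) \<Rightarrow> dual \<Rightarrow> (nat \<Rightarrow> complex) \<Rightarrow> nat \<Rightarrow> complex" where
  "wshift s e = (\<lambda>x\<in>l2. \<lambda>n. s (de n - e) * x (en (de n - e)))"

lemma wshift_apply: "x \<in> l2 \<Longrightarrow> wshift s e x (en \<gamma>) = s (\<gamma> - e) * x (en (\<gamma> - e))"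
  by (simp add: wshift_def)

lemma wshift_in:
  assumes s: "\<And>\<gamma>. cmod (s \<gamma>) = 1"
  shows "wshift s e \<in> carrier BL"
proof -
  have L: "(\<lambda>n. s (de n - e) * x (en (de n - e))) \<in> l2 \<and>
      l2norm (\<lambda>n. s (de n - e) * x (en (de n - e))) \<le> l2norm x" if x: "x \<in> l2" for x
  proof -
    let ?b = "\<lambda>n. en (de n - e)"
    have inj: "inj ?b" by (rule injI) (simp, metis en_de)
    have "L2_set (\<lambda>n. cmod (s (de n - e) * x (?b n))) {..<N} \<le> l2norm x" for N
    proof -
      have "(\<Sum>n<N. (cmod (s (de n - e) * x (?b n)))\<^sup>2) = (\<Sum>n<N. (cmod (x (?b n)))\<^sup>2)"
        by (simp add: norm_mult s)
      also have "\<dots> = (\<Sum>m\<in>?b ` {..<N}. (cmod (x m))\<^sup>2)"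
        by (subst sum.reindex) (auto intro: inj_on_subset[OF inj])
      also have "\<dots> \<le> suminf (\<lambda>m. (cmod (x m))\<^sup>2)"
        by (rule sum_le_suminf) (use x in \<open>auto simp: l2_def\<close>)
      finally show ?thesis by (simp add: L2_set_def l2norm_def)
    qed
    from l2I[OF this] show ?thesis by blast
  qed
  show ?thesis
    by (rule BL_I[where K = 1])
      (use L in \<open>auto simp: wshift_def l2_add l2_scale algebra_simps\<close>)
qed

lemma BL_eqI:
  assumes "S \<in> carrier BL" "T \<in> carrier BL" "\<And>x \<gamma>. x \<in> l2 \<Longrightarrow> S x (en \<gamma>) = T x (en \<gamma>)"
  shows "S = T"
  using assms by (intro BL_ext ext) (metis en_de)+

lemma wshift_star:
  assumes s: "\<And>\<gamma>. cmod (s \<gamma>) = 1"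
  shows "star BL (wshift s e) = wshift (\<lambda>\<gamma>. cnj (s (\<gamma> - e))) (- e)"
proof -
  let ?S = "wshift (\<lambda>\<gamma>. cnj (s (\<gamma> - e))) (- e)"
  have S: "?S \<in> carrier BL" by (rule wshift_in) (simp add: s)
  show ?thesis
  proof (rule BL_star_eqI[OF wshift_in[OF s] S])
    fix x y assume x: "x \<in> l2" and y: "y \<in> l2"
    let ?b = "\<lambda>n. en (de n - e)"
    have b: "bij ?b"
      by (rule bij_betw_byWitness[where f' = "\<lambda>n. en (de n + e)"]) auto
    let ?f = "\<lambda>m. x m * cnj (?S y m)"
    have "ip (wshift s e x) y = suminf (\<lambda>n. ?f (?b n))"
      using x y by (simp add: ip_def wshift_def mult_ac)
    also have "\<dots> = ip x (?S y)"
      unfolding ip_def by (rule suminf_reindex_bij[OF ip_abs_summable(1)[OF x BL_D(1)[OF S y]] b])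
    finally show "ip (wshift s e x) y = ip x (?S y)" .
  qed
qed

lemma wshift_mult:
  assumes s: "\<And>\<gamma>. cmod (s \<gamma>) = 1" and t: "\<And>\<gamma>. cmod (t \<gamma>) = 1"
  shows "wshift s e \<otimes>\<^bsub>BL\<^esub> wshift t f = wshift (\<lambda>\<gamma>. s (\<gamma> + f) * t \<gamma>) (e + f)"
proof (rule BL_eqI)
  show "wshift s e \<otimes>\<^bsub>BL\<^esub> wshift t f \<in> carrier BL" by (intro BL_closed wshift_in s t)
  show "wshift (\<lambda>\<gamma>. s (\<gamma> + f) * t \<gamma>) (e + f) \<in> carrier BL"
    by (rule wshift_in) (simp add: norm_mult s t)
  fix x \<gamma> assume x: "x \<in> l2"
  have "wshift t f x \<in> l2" by (rule BL_D(1)[OF wshift_in[OF t] x])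
  then show "(wshift s e \<otimes>\<^bsub>BL\<^esub> wshift t f) x (en \<gamma>) = wshift (\<lambda>\<gamma>. s (\<gamma> + f) * t \<gamma>) (e + f) x (en \<gamma>)"
    using x by (simp add: BL_apply wshift_apply diff_diff_eq algebra_simps)
qed

lemma wshift_one: "wshift (\<lambda>\<gamma>. 1) 0 = \<one>\<^bsub>BL\<^esub>"
  by (rule BL_eqI[OF wshift_in one_BL_in]) (simp_all add: BL_apply wshift_apply)

lemma wshift_smult:
  assumes s: "\<And>\<gamma>. cmod (s \<gamma>) = 1" and c: "cmod c = 1"
  shows "c \<odot>\<^bsub>BL\<^esub> wshift s e = wshift (\<lambda>\<gamma>. c * s \<gamma>) e"
  by (rule BL_eqI[OF BL_smult(1)[OF wshift_in[OF s]] wshift_in])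
    (simp_all add: norm_mult s c BL_apply wshift_apply)

lemma wshift_delta: "wshift s e (delta \<gamma>) = (\<lambda>n. s \<gamma> * delta (\<gamma> + e) n)"
proof
  fix n
  have "wshift s e (delta \<gamma>) (en \<eta>) = s \<gamma> * delta (\<gamma> + e) (en \<eta>)" for \<eta>
    by (auto simp: wshift_apply delta_en algebra_simps)
  from this[of "de n"] show "wshift s e (delta \<gamma>) n = s \<gamma> * delta (\<gamma> + e) n" by simp
qed

section \<open>Shifts weighted by characters\<close>

definition lin :: "(nat \<Rightarrow> real) \<Rightarrow> dual \<Rightarrow> real" where
  "lin c \<gamma> = (\<Sum>m\<in>Poly_Mapping.keys \<gamma>. c m * of_int (Poly_Mapping.lookup \<gamma> m))"

lemma lin_eq_sum:
  "finite S \<Longrightarrow> Poly_Mapping.keys \<gamma> \<subseteq> S \<Longrightarrow> lin c \<gamma> = (\<Sum>m\<in>S. c m * of_int (Poly_Mapping.lookup \<gamma> m))"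
  unfolding lin_def by (rule sum.mono_neutral_left) (auto simp: in_keys_iff)

lemma lin_add: "lin c (\<gamma> + \<delta>) = lin c \<gamma> + lin c \<delta>"
proof -
  let ?S = "Poly_Mapping.keys \<gamma> \<union> Poly_Mapping.keys \<delta>"
  have "lin c (\<gamma> + \<delta>) = (\<Sum>m\<in>?S. c m * of_int (Poly_Mapping.lookup (\<gamma> + \<delta>) m))"
    by (rule lin_eq_sum) (use keys_add[of \<gamma> \<delta>] in auto)
  also have "\<dots> = (\<Sum>m\<in>?S. c m * of_int (Poly_Mapping.lookup \<gamma> m)) + (\<Sum>m\<in>?S. c m * of_int (Poly_Mapping.lookup \<delta> m))"
    by (simp add: lookup_add distrib_left sum.distrib)
  also have "\<dots> = lin c \<gamma> + lin c \<delta>"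
    by (intro arg_cong2[where f = "(+)"] lin_eq_sum[symmetric]) auto
  finally show ?thesis .
qed

lemma lin_single [simp]: "lin c (Poly_Mapping.single m k) = c m * of_int k"
  by (simp add: lin_def)

lemma lin_0 [simp]: "lin c 0 = 0"
  by (simp add: lin_def)

definition char_shift :: "(nat \<Rightarrow> real) \<Rightarrow> nat \<Rightarrow> (nat \<Rightarrow> complex) \<Rightarrow> nat \<Rightarrow> complex" where
  "char_shift c k = wshift (\<lambda>\<gamma>. cis (2 * pi * lin c \<gamma>)) (Poly_Mapping.single k 1)"

lemma char_shift_in [simp]: "char_shift c k \<in> carrier BL"
  unfolding char_shift_def by (rule wshift_in) simp

text \<open>The unweighted shifts commute. Each character is evaluated on the unit step of the other
  shift, and this contributes the exponents \<open>c m\<close> and \<open>d k\<close>.\<close>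

lemma char_shift_commute:
  "char_shift c k \<otimes>\<^bsub>BL\<^esub> char_shift d m =
     cis (2 * pi * (c m - d k)) \<odot>\<^bsub>BL\<^esub> (char_shift d m \<otimes>\<^bsub>BL\<^esub> char_shift c k)"
proof -
  have *: "char_shift c k \<otimes>\<^bsub>BL\<^esub> char_shift d m =
      wshift (\<lambda>\<gamma>. cis (2 * pi * (lin c \<gamma> + lin d \<gamma> + c m))) (Poly_Mapping.single k 1 + Poly_Mapping.single m 1)" for c d k m
    unfolding char_shift_def
    by (subst wshift_mult) (simp_all add: lin_add cis_mult algebra_simps)
  have "cis (2 * pi * (c m - d k)) * cis (2 * pi * (lin d \<gamma> + lin c \<gamma> + d k)) =
      cis (2 * pi * (lin c \<gamma> + lin d \<gamma> + c m))" for \<gamma>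
    unfolding cis_mult by (rule arg_cong[where f = cis]) (simp add: algebra_simps)
  then show ?thesis
    unfolding *[of c k d m] *[of d m c k] by (subst wshift_smult) (simp_all add: add.commute)
qed

lemma char_shift_unitary:
  "star BL (char_shift c k) \<otimes>\<^bsub>BL\<^esub> char_shift c k = \<one>\<^bsub>BL\<^esub>"
  "char_shift c k \<otimes>\<^bsub>BL\<^esub> star BL (char_shift c k) = \<one>\<^bsub>BL\<^esub>"
  unfolding char_shift_def
  by (simp_all add: wshift_star wshift_mult cis_cnj cis_mult wshift_one)

lemma char_shift_delta:
  "char_shift c k (delta \<gamma>) = (\<lambda>n. cis (2 * pi * lin c \<gamma>) * delta (\<gamma> + Poly_Mapping.single k 1) n)"
  unfolding char_shift_def by (rule wshift_delta)

lemma char_shift_star_apply: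
  "x \<in> l2 \<Longrightarrow> star BL (char_shift c k) x (en \<gamma>) =
     cis (- 2 * pi * lin c \<gamma>) * x (en (\<gamma> + Poly_Mapping.single k 1))"
  unfolding char_shift_def by (simp add: wshift_star wshift_apply cis_cnj)

lemma char_shift_apply:
  "x \<in> l2 \<Longrightarrow> char_shift c k x (en \<gamma>) =
     cis (2 * pi * lin c (\<gamma> - Poly_Mapping.single k 1)) * x (en (\<gamma> - Poly_Mapping.single k 1))"
  unfolding char_shift_def by (simp add: wshift_apply)

lemma char_shift_star_delta:
  "star BL (char_shift c k) (delta \<gamma>) =
     (\<lambda>n. cis (- 2 * pi * lin c (\<gamma> - Poly_Mapping.single k 1)) * delta (\<gamma> - Poly_Mapping.single k 1) n)"
  unfolding char_shift_def by (simp add: wshift_star wshift_delta cis_cnj)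

section \<open>Intertwining relations and vector states\<close>

lemma cont_linear_compose:
  "cont_linear A B f \<Longrightarrow> cont_linear B C g \<Longrightarrow> cont_linear A C (\<lambda>x. g (f x))"
  unfolding cont_linear_def by (auto simp: Pi_iff)

context cstar_algebra
begin

text \<open>Multiply the relation by the adjoint of v on both sides. Relations checked for u and w
  thereby extend to all of \<open>gens\<close>.\<close>

lemma unitary_commute_star:
  assumes v: "v \<in> carrier A" "star A v \<otimes> v = \<one>" "v \<otimes> star A v = \<one>" and x: "x \<in> carrier A"
    and c: "v \<otimes> x = c \<odot> (x \<otimes> v)"
  shows "x \<otimes> star A v = c \<odot> (star A v \<otimes> x)"
proof -
  note [simp] = v(1) x mult_in one_mult mult_one
  have "x \<otimes> star A v = (star A v \<otimes> v) \<otimes> x \<otimes> star A v" by (simp add: v(2))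
  also have "\<dots> = star A v \<otimes> (v \<otimes> x) \<otimes> star A v" by (simp add: mult_assoc)
  also have "\<dots> = c \<odot> (star A v \<otimes> x \<otimes> (v \<otimes> star A v))"
    unfolding c by (simp add: smult_mult_left smult_mult_right mult_assoc)
  finally show ?thesis by (simp add: v(3))
qed

text \<open>Two homomorphisms are allowed so that commutation up to a phase fits in: the phase is
  absorbed by composing one of them with a rotation. Combined with \<open>torus_generated\<close> or
  \<open>FP_generated\<close>, it reduces intertwining relations to generators.\<close>

lemma intertwined_subalgebra:
  assumes B: "cstar_algebra B" and f: "f \<in> star_hom A B" and g: "g \<in> star_hom A B" and b: "b \<in> carrier B"
  defines "W \<equiv> {x \<in> carrier A. f x \<otimes>\<^bsub>B\<^esub> b = b \<otimes>\<^bsub>B\<^esub> g x}"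
  shows "closed_subspace A W" "\<one> \<in> W" "\<And>x y. x \<in> W \<Longrightarrow> y \<in> W \<Longrightarrow> x \<otimes> y \<in> W"
proof -
  interpret B: cstar_algebra B by (rule B)
  note D = star_homD[OF f] star_homD[OF g]
  note [simp] = D(1,8) mult_in b B.mult_in
  show "closed_subspace A W"
    unfolding W_def
    by (rule closed_subspace_equalizer[OF
          cont_linear_compose[OF star_hom_cont_linear[OF f B] B.cont_linear_mult_right[OF b]]
          cont_linear_compose[OF star_hom_cont_linear[OF g B] B.cont_linear_mult_left[OF b]] B])
  show "\<one> \<in> W" by (simp add: W_def one_in D(6,13) B.one_mult B.mult_one)
  show "x \<otimes> y \<in> W" if "x \<in> W" "y \<in> W" for x y
  proof -
    have x: "x \<in> carrier A" "f x \<otimes>\<^bsub>B\<^esub> b = b \<otimes>\<^bsub>B\<^esub> g x"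
      and y: "y \<in> carrier A" "f y \<otimes>\<^bsub>B\<^esub> b = b \<otimes>\<^bsub>B\<^esub> g y" using that by (auto simp: W_def)
    have "f (x \<otimes> y) \<otimes>\<^bsub>B\<^esub> b = f x \<otimes>\<^bsub>B\<^esub> (f y \<otimes>\<^bsub>B\<^esub> b)"
      using x(1) y(1) by (simp add: D(2) B.mult_assoc)
    also have "\<dots> = (f x \<otimes>\<^bsub>B\<^esub> b) \<otimes>\<^bsub>B\<^esub> g y" unfolding y(2) using x(1) y(1) by (simp add: B.mult_assoc)
    also have "\<dots> = b \<otimes>\<^bsub>B\<^esub> g (x \<otimes> y)" unfolding x(2) using x(1) y(1) by (simp add: D(9) B.mult_assoc)
    finally show ?thesis using x(1) y(1) by (simp add: W_def)
  qed
qed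

lemma star_hom_compose:
  assumes f: "f \<in> star_hom A B" and g: "g \<in> star_hom B C"
  shows "compose (carrier A) g f \<in> star_hom A C"
  using star_homD[OF f] star_homD[OF g]
  by (intro star_homI) (simp_all add: compose_def one_in mult_in ring.ring_simprules(1)[OF ring_A])

lemma vector_functional_bounded:
  assumes h: "h \<in> star_hom A BL" and x: "x \<in> l2" and y: "y \<in> l2"
  shows "bounded_functional A (\<lambda>a. ip (h a x) y)"
  unfolding bounded_functional_def
proof (intro conjI ballI allI)
  note H = star_homD[OF h]
  note in' = BL_D(1)[OF H(1) x]
  show "ip (h (a \<oplus> b) x) y = ip (h a x) y + ip (h b x) y" if "a \<in> carrier A" "b \<in> carrier A" for a b
    using that in' x y by (simp add: H BL_apply ip_add_left)
  show "ip (h (c \<odot> a) x) y = c * ip (h a x) y" if "a \<in> carrier A" for a c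
    using that in' x y by (simp add: H BL_apply ip_scale_left)
  have "cmod (ip (h a x) y) \<le> (l2norm x * l2norm y) * cnorm A a" if a: "a \<in> carrier A" for a
  proof -
    have "cmod (ip (h a x) y) \<le> l2norm (h a x) * l2norm y" by (rule Cauchy_Schwarz_l2[OF in'[OF a] y])
    also have "\<dots> \<le> (cnorm BL (h a) * l2norm x) * l2norm y"
      by (rule mult_right_mono[OF BL_norm(1)[OF H(1)[OF a] x] l2norm_nonneg[OF y]])
    also have "\<dots> \<le> (cnorm A a * l2norm x) * l2norm y"
      by (intro mult_right_mono star_hom_contractive[OF h cstar_algebra_BL a] l2norm_nonneg x y)
    finally show ?thesis by (simp add: mult_ac)
  qed
  then show "\<exists>K. \<forall>a\<in>carrier A. cmod (ip (h a x) y) \<le> K * cnorm A a" by blast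
qed

lemma vector_state:
  assumes h: "h \<in> star_hom A BL" and x: "x \<in> l2" "l2norm x = 1"
  shows "is_state A (\<lambda>a\<in>carrier A. ip (h a x) x)"
proof -
  note H = star_homD[OF h]
  note b = vector_functional_bounded[OF h x(1) x(1), unfolded bounded_functional_def]
  have "ip (h (star A a \<otimes> a) x) x \<in> \<real>\<^sub>\<ge>\<^sub>0" if a: "a \<in> carrier A" for a
  proof -
    have y: "h a x \<in> l2" by (rule BL_D(1)[OF H(1)[OF a] x(1)])
    have "star A (star A a) \<otimes> star A a \<in> carrier A" using a mult_in by simp
    have sa: "star BL (star BL (h a)) = h a"
      using H(5)[OF star_in[OF a]] H(5)[OF a] a by simp
    have S: "star BL (h a) \<in> carrier BL" by (rule BL_star(1)[OF H(1)[OF a]])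
    have "ip (h (star A a \<otimes> a) x) x = ip (star BL (h a) (h a x)) x"
      using a x by (simp add: H BL_apply)
    also have "\<dots> = ip (h a x) (h a x)"
      using BL_star(2)[OF S y x(1)] sa by simp
    also have "\<dots> = of_real ((l2norm (h a x))\<^sup>2)" by (rule ip_self[OF y])
    finally show ?thesis by (simp add: complex_nonneg_Reals_iff)
  qed
  moreover have "ip (h \<one> x) x = 1" using x ip_self[OF x(1)] by (simp add: H BL_apply)
  ultimately show ?thesis using b unfolding is_state_def by (simp add: one_in mult_in)
qed

end

section \<open>Left and right multiplications in the twisted group algebra\<close>

locale twisted = nctorus \<alpha> for \<alpha> :: real +
  fixes \<theta> :: real
begin

text \<open>The operators \<open>Lop\<close> and \<open>Rop\<close> are multiplication by the generators from the left and from the right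
  in the twisted group algebra of \<open>\<Gamma>\<close> whose cocycle has exponent \<open>th\<close>; so they commute with each other.\<close>

definition th :: "nat \<Rightarrow> nat \<Rightarrow> real" where
  "th k m = (if even k \<and> m = Suc k then \<alpha> else if k < m \<and> (even k \<longleftrightarrow> even m) then \<theta> else 0)"

abbreviation "Lop k \<equiv> char_shift (th k) k"
abbreviation "Rop k \<equiv> char_shift (\<lambda>m. th m k) k"

sublocale BL: cstar_algebra BL
  by (rule cstar_algebra_BL)

text \<open>Both exponents in \<open>char_shift_commute\<close> are \<open>th k m\<close> here, so
  they cancel.\<close>

lemma Lop_Rop: "Lop k \<otimes>\<^bsub>BL\<^esub> Rop m = Rop m \<otimes>\<^bsub>BL\<^esub> Lop k"
  using char_shift_commute[of "th k" k "\<lambda>j. th j m" m] by (simp add: BL.mult_in)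

lemma Lop_Lop: "Lop k \<otimes>\<^bsub>BL\<^esub> Lop m = cis (2 * pi * (th k m - th m k)) \<odot>\<^bsub>BL\<^esub> (Lop m \<otimes>\<^bsub>BL\<^esub> Lop k)"
  by (rule char_shift_commute)

definition iota :: "nat \<Rightarrow> torus_elt \<Rightarrow> (nat \<Rightarrow> complex) \<Rightarrow> nat \<Rightarrow> complex" where
  "iota j = (SOME h. h \<in> star_hom \<A> BL \<and> h u = Lop (2 * j) \<and> h w = Lop (Suc (2 * j)))"

lemma iota: "iota j \<in> star_hom \<A> BL" "iota j u = Lop (2 * j)" "iota j w = Lop (Suc (2 * j))"
proof -
  have "th (2 * j) (Suc (2 * j)) = \<alpha>" "th (Suc (2 * j)) (2 * j) = 0" by (simp_all add: th_def)
  then have rel: "Lop (2 * j) \<otimes>\<^bsub>BL\<^esub> Lop (Suc (2 * j)) = \<omega> \<odot>\<^bsub>BL\<^esub> (Lop (Suc (2 * j)) \<otimes>\<^bsub>BL\<^esub> Lop (2 * j))"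
    using Lop_Lop[of "2 * j" "Suc (2 * j)"] by simp
  obtain h where "h \<in> star_hom \<A> BL" "h u = Lop (2 * j)" "h w = Lop (Suc (2 * j))"
    by (rule torus_hom_exists[OF cstar_algebra_BL char_shift_in char_shift_in
        char_shift_unitary(2,1) char_shift_unitary(2,1) rel])
  then have "\<exists>h. h \<in> star_hom \<A> BL \<and> h u = Lop (2 * j) \<and> h w = Lop (Suc (2 * j))" by blast
  from someI_ex[OF this] show "iota j \<in> star_hom \<A> BL" "iota j u = Lop (2 * j)" "iota j w = Lop (Suc (2 * j))"
    unfolding iota_def by blast+
qed

lemmas iotaD = star_homD[OF iota(1)]

lemma iota_star: "iota j (star \<A> u) = star BL (Lop (2 * j))" "iota j (star \<A> w) = star BL (Lop (Suc (2 * j)))"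
  by (simp_all add: iotaD iota)

definition supp :: "dual set \<Rightarrow> (nat \<Rightarrow> complex) set" where
  "supp C = {x \<in> l2. \<forall>\<gamma>. \<gamma> \<notin> C \<longrightarrow> x (en \<gamma>) = 0}"

text \<open>The generators of copy j and their adjoints move supports by one unit in the two
  coordinates of that copy. The property passes to the whole algebra because the coordinates of an
  image vector depend continuously on the algebra element.\<close>

lemma iota_supp:
  assumes C: "\<And>\<gamma> k. \<gamma> \<in> C \<Longrightarrow> k = 2 * j \<or> k = Suc (2 * j) \<Longrightarrow>
      \<gamma> + Poly_Mapping.single k 1 \<in> C \<and> \<gamma> - Poly_Mapping.single k 1 \<in> C"
    and a: "a \<in> carrier \<A>" and x: "x \<in> supp C"
  shows "iota j a x \<in> supp C"
proof -
  let ?W = "{a \<in> carrier \<A>. \<forall>x\<in>supp C. iota j a x \<in> supp C}"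
  have "?W = carrier \<A>"
  proof (rule torus_generated)
    \<comment> \<open>Vanishing of a coordinate is written as agreement with the functional given by
      the zero vector, so that \<open>closed_subspace_functional_eq\<close> applies.\<close>
    let ?F = "\<lambda>(x, \<gamma>). {a \<in> carrier \<A>. ip (iota j a x) (delta \<gamma>) = ip (iota j a x) (\<lambda>n. 0)}"
    have z: "ip y (\<lambda>n. 0) = 0" for y by (simp add: ip_def)
    have F: "closed_subspace \<A> (?F p)" if pC: "p \<in> supp C \<times> - C" for p
    proof -
      obtain x \<gamma> where p: "p = (x, \<gamma>)" "x \<in> l2" using pC by (auto simp: supp_def)
      show ?thesis unfolding p(1) prod.case
        by (rule T.closed_subspace_functional_eq[OF
            T.vector_functional_bounded[OF iota(1) p(2) delta_in] T.vector_functional_bounded[OF iota(1) p(2) l2_zero(1)]])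
    qed
    have "?W = \<Inter>(insert (carrier \<A>) (?F ` (supp C \<times> - C)))"
      using BL_D(1)[OF iotaD(1)] by (auto simp: supp_def z)
    moreover have "closed_subspace \<A> (\<Inter>(insert (carrier \<A>) (?F ` (supp C \<times> - C))))"
      by (rule T.closed_subspace_Inter) (use F T.closed_subspace_carrier in blast)+
    ultimately show "closed_subspace \<A> ?W" by simp
    show "\<one>\<^bsub>\<A>\<^esub> \<in> ?W" by (auto simp: T.one_in iotaD(6) BL_apply supp_def)
    show "a \<otimes>\<^bsub>\<A>\<^esub> b \<in> ?W" if "a \<in> ?W" "b \<in> ?W" for a b
    proof -
      have "iota j (a \<otimes>\<^bsub>\<A>\<^esub> b) x = iota j a (iota j b x)" if "x \<in> supp C" for x
        using \<open>a \<in> ?W\<close> \<open>b \<in> ?W\<close> that by (simp add: iotaD(2) BL_apply supp_def)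
      then show ?thesis using that T.mult_in by simp
    qed
    have L: "Lop k x \<in> supp C" "star BL (Lop k) x \<in> supp C"
      if k: "k = 2 * j \<or> k = Suc (2 * j)" and x: "x \<in> supp C" for k x
    proof -
      have xl: "x \<in> l2" using x by (simp add: supp_def)
      have "\<gamma> - Poly_Mapping.single k 1 \<notin> C" "\<gamma> + Poly_Mapping.single k 1 \<notin> C" if "\<gamma> \<notin> C" for \<gamma>
        using C[OF _ k, of "\<gamma> - Poly_Mapping.single k 1"] C[OF _ k, of "\<gamma> + Poly_Mapping.single k 1"] that
        by auto
      then show "Lop k x \<in> supp C" "star BL (Lop k) x \<in> supp C"
        using x BL_D(1)[OF char_shift_in xl] BL_D(1)[OF BL_star(1)[OF char_shift_in] xl]
        by (auto simp: supp_def char_shift_apply[OF xl] char_shift_star_apply[OF xl])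
    qed
    show "gens \<subseteq> ?W" using L by (auto simp: gens_def iota iota_star)
  qed
  then show ?thesis using a x by blast
qed

definition \<xi> :: "nat \<Rightarrow> complex" where "\<xi> = delta 0"

lemma \<xi>_in [simp]: "\<xi> \<in> l2" "l2norm \<xi> = 1"
  by (simp_all add: \<xi>_def delta_def)

lemma pow_step:
  "u [^]\<^bsub>\<A>\<^esub> (i::int) \<in> carrier \<A>" "u \<otimes>\<^bsub>\<A>\<^esub> u [^]\<^bsub>\<A>\<^esub> i = u [^]\<^bsub>\<A>\<^esub> (i + 1)" "star \<A> u \<otimes>\<^bsub>\<A>\<^esub> u [^]\<^bsub>\<A>\<^esub> i = u [^]\<^bsub>\<A>\<^esub> (i - 1)"
  "w [^]\<^bsub>\<A>\<^esub> (i::int) \<in> carrier \<A>" "w \<otimes>\<^bsub>\<A>\<^esub> w [^]\<^bsub>\<A>\<^esub> i = w [^]\<^bsub>\<A>\<^esub> (i + 1)" "star \<A> w \<otimes>\<^bsub>\<A>\<^esub> w [^]\<^bsub>\<A>\<^esub> i = w [^]\<^bsub>\<A>\<^esub> (i - 1)"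
  using monoid.int_pow_unit_step[OF ring.is_monoid[OF T.ring_A], of u "star \<A> u" i]
    monoid.int_pow_unit_step[OF ring.is_monoid[OF T.ring_A], of w "star \<A> w" i] torus_rel by simp_all

lemma pow_0: "u [^]\<^bsub>\<A>\<^esub> (0::int) = \<one>\<^bsub>\<A>\<^esub>" "w [^]\<^bsub>\<A>\<^esub> (0::int) = \<one>\<^bsub>\<A>\<^esub>"
  by (simp_all add: int_pow_def2)

text \<open>The phase stays existential: it varies with \<gamma> and i, while the trace sees only
  whether the basis vector returns to its origin.\<close>

lemma iota_pow_delta:
  assumes z: "(z, k) = (u, 2 * j) \<or> (z, k) = (w, Suc (2 * j))"
  shows "\<exists>c. cmod c = 1 \<and> iota j (z [^]\<^bsub>\<A>\<^esub> (i::int)) (delta \<gamma>) = (\<lambda>n. c * delta (\<gamma> + Poly_Mapping.single k i) n)"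
proof -
  have zk: "z \<in> carrier \<A>" "iota j z = Lop k" "iota j (star \<A> z) = star BL (Lop k)"
    using z iota iota_star by auto
  have step: "z [^]\<^bsub>\<A>\<^esub> i \<in> carrier \<A>" "z [^]\<^bsub>\<A>\<^esub> (i + 1) = z \<otimes>\<^bsub>\<A>\<^esub> z [^]\<^bsub>\<A>\<^esub> i" "z [^]\<^bsub>\<A>\<^esub> (i - 1) = star \<A> z \<otimes>\<^bsub>\<A>\<^esub> z [^]\<^bsub>\<A>\<^esub> i"
      "z [^]\<^bsub>\<A>\<^esub> (0::int) = \<one>\<^bsub>\<A>\<^esub>" for i :: int
    using z pow_step[of i] pow_0 by auto
  show ?thesis
  proof (induction i rule: int_induct[where k = 0])
    case base
    show ?case by (intro exI[of _ 1]) (simp add: step(4) iotaD(6) BL_apply)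
  next
    case (step1 i)
    then obtain c where c: "cmod c = 1"
      "iota j (z [^]\<^bsub>\<A>\<^esub> i) (delta \<gamma>) = (\<lambda>n. c * delta (\<gamma> + Poly_Mapping.single k i) n)" by blast
    let ?d = "cis (2 * pi * lin (th k) (\<gamma> + Poly_Mapping.single k i))"
    have "iota j (z [^]\<^bsub>\<A>\<^esub> (i + 1)) (delta \<gamma>) = Lop k (\<lambda>n. c * delta (\<gamma> + Poly_Mapping.single k i) n)"
      unfolding step(2) by (simp add: iotaD(2)[OF zk(1) step(1)] zk(2) BL_apply c)
    also have "\<dots> = (\<lambda>n. (c * ?d) * delta (\<gamma> + Poly_Mapping.single k (i + 1)) n)"
      unfolding BL_D(3)[OF char_shift_in delta_in] char_shift_delta
      by (simp add: single_add add.assoc mult.assoc)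
    finally show ?case using c(1) by (intro exI[of _ "c * ?d"]) (simp add: norm_mult)
  next
    case (step2 i)
    then obtain c where c: "cmod c = 1"
      "iota j (z [^]\<^bsub>\<A>\<^esub> i) (delta \<gamma>) = (\<lambda>n. c * delta (\<gamma> + Poly_Mapping.single k i) n)" by blast
    let ?d = "cis (- 2 * pi * lin (th k) (\<gamma> + Poly_Mapping.single k i - Poly_Mapping.single k 1))"
    have "iota j (z [^]\<^bsub>\<A>\<^esub> (i - 1)) (delta \<gamma>) = star BL (Lop k) (\<lambda>n. c * delta (\<gamma> + Poly_Mapping.single k i) n)"
      unfolding step(3) by (simp add: iotaD(2)[OF T.star_in[OF zk(1)] step(1)] zk(3) BL_apply c)
    also have "\<dots> = (\<lambda>n. (c * ?d) * delta (\<gamma> + Poly_Mapping.single k (i - 1)) n)"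
      unfolding BL_D(3)[OF BL_star(1)[OF char_shift_in] delta_in] char_shift_star_delta
      by (simp add: single_diff add_diff_eq mult.assoc)
    finally show ?case using c(1) by (intro exI[of _ "c * ?d"]) (simp add: norm_mult)
  qed
qed

section \<open>The canonical trace as a vacuum state\<close>

definition vtr :: "nat \<Rightarrow> torus_elt \<Rightarrow> complex" where
  "vtr j = (\<lambda>a\<in>carrier \<A>. ip (iota j a \<xi>) \<xi>)"

lemma vtr_state: "is_state \<A> (vtr j)"
  unfolding vtr_def by (rule T.vector_state[OF iota(1)]) simp_all

lemma vtr_monomial: "vtr j (u [^]\<^bsub>\<A>\<^esub> (i::int) \<otimes>\<^bsub>\<A>\<^esub> w [^]\<^bsub>\<A>\<^esub> (k::int)) = (if i = 0 \<and> k = 0 then 1 else 0)"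
proof -
  obtain c where c: "iota j (w [^]\<^bsub>\<A>\<^esub> k) (delta 0) = (\<lambda>n. c * delta (0 + Poly_Mapping.single (Suc (2 * j)) k) n)"
    using iota_pow_delta[of w "Suc (2 * j)" j k 0] by blast
  obtain d where d: "iota j (u [^]\<^bsub>\<A>\<^esub> i) (delta (0 + Poly_Mapping.single (Suc (2 * j)) k)) =
      (\<lambda>n. d * delta (0 + Poly_Mapping.single (Suc (2 * j)) k + Poly_Mapping.single (2 * j) i) n)"
    using iota_pow_delta[of u "2 * j" j i "0 + Poly_Mapping.single (Suc (2 * j)) k"] by blast
  have m: "u [^]\<^bsub>\<A>\<^esub> i \<otimes>\<^bsub>\<A>\<^esub> w [^]\<^bsub>\<A>\<^esub> k \<in> carrier \<A>" using pow_step T.mult_in by blast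
  show ?thesis
  proof (cases "i = 0 \<and> k = 0")
    case True
    then show ?thesis using ip_self[of \<xi>] by (simp add: pow_0 T.one_in T.one_mult vtr_def iotaD(6) BL_apply)
  next
    case False
    let ?\<gamma> = "Poly_Mapping.single (Suc (2 * j)) k + Poly_Mapping.single (2 * j) i"
    have "Poly_Mapping.lookup ?\<gamma> (Suc (2 * j)) = k" "Poly_Mapping.lookup ?\<gamma> (2 * j) = i"
      by (simp_all add: lookup_add lookup_single when_def)
    then have nz: "?\<gamma> \<noteq> 0" using False by (metis lookup_zero)
    have "iota j (u [^]\<^bsub>\<A>\<^esub> i \<otimes>\<^bsub>\<A>\<^esub> w [^]\<^bsub>\<A>\<^esub> k) \<xi> = (\<lambda>n. c * (d * delta ?\<gamma> n))"
      using BL_D(3)[OF iotaD(1)[OF pow_step(1)] delta_in] c d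
      by (simp add: iotaD(2)[OF pow_step(1,4)] BL_apply \<xi>_def)
    then show ?thesis using False m nz by (simp add: vtr_def \<xi>_def delta_en)
  qed
qed

text \<open>Induction on the exponent in both directions; \<open>unitary_commute_star\<close>
  supplies the step with the adjoint of u, where the scalar c is inverted.\<close>

lemma commute_pow:
  assumes y: "y \<in> carrier \<A>" and c: "y \<otimes>\<^bsub>\<A>\<^esub> u = c \<odot>\<^bsub>\<A>\<^esub> (u \<otimes>\<^bsub>\<A>\<^esub> y)" and c0: "c \<noteq> 0"
  shows "\<exists>d. y \<otimes>\<^bsub>\<A>\<^esub> u [^]\<^bsub>\<A>\<^esub> (i::int) = d \<odot>\<^bsub>\<A>\<^esub> (u [^]\<^bsub>\<A>\<^esub> i \<otimes>\<^bsub>\<A>\<^esub> y)"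
proof -
  note [simp] = y T.mult_in pow_step(1)
  have "(1 / c) \<odot>\<^bsub>\<A>\<^esub> (y \<otimes>\<^bsub>\<A>\<^esub> u) = u \<otimes>\<^bsub>\<A>\<^esub> y" unfolding c using c0 by simp
  then have "y \<otimes>\<^bsub>\<A>\<^esub> star \<A> u = (1 / c) \<odot>\<^bsub>\<A>\<^esub> (star \<A> u \<otimes>\<^bsub>\<A>\<^esub> y)"
    by (intro T.unitary_commute_star) (simp_all add: torus_rel)
  then have step: "y \<otimes>\<^bsub>\<A>\<^esub> (z \<otimes>\<^bsub>\<A>\<^esub> p) = (e * d) \<odot>\<^bsub>\<A>\<^esub> ((z \<otimes>\<^bsub>\<A>\<^esub> p) \<otimes>\<^bsub>\<A>\<^esub> y)"
    if "(z, e) = (u, c) \<or> (z, e) = (star \<A> u, 1 / c)" "p \<in> carrier \<A>"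
      "y \<otimes>\<^bsub>\<A>\<^esub> p = d \<odot>\<^bsub>\<A>\<^esub> (p \<otimes>\<^bsub>\<A>\<^esub> y)" for z e p d
  proof -
    have z: "z \<in> carrier \<A>" "y \<otimes>\<^bsub>\<A>\<^esub> z = e \<odot>\<^bsub>\<A>\<^esub> (z \<otimes>\<^bsub>\<A>\<^esub> y)"
      using that(1) c \<open>y \<otimes>\<^bsub>\<A>\<^esub> star \<A> u = _\<close> by auto
    have "y \<otimes>\<^bsub>\<A>\<^esub> (z \<otimes>\<^bsub>\<A>\<^esub> p) = (y \<otimes>\<^bsub>\<A>\<^esub> z) \<otimes>\<^bsub>\<A>\<^esub> p" using z(1) that(2) by (simp add: T.mult_assoc)
    also have "\<dots> = e \<odot>\<^bsub>\<A>\<^esub> (z \<otimes>\<^bsub>\<A>\<^esub> (y \<otimes>\<^bsub>\<A>\<^esub> p))"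
      unfolding z(2) using z(1) that(2) by (simp add: T.smult_mult_left T.mult_assoc)
    also have "\<dots> = (e * d) \<odot>\<^bsub>\<A>\<^esub> ((z \<otimes>\<^bsub>\<A>\<^esub> p) \<otimes>\<^bsub>\<A>\<^esub> y)"
      unfolding that(3) using z(1) that(2) by (simp add: T.smult_mult_right T.mult_assoc)
    finally show ?thesis .
  qed
  show ?thesis
  proof (induction i rule: int_induct[where k = 0])
    case base
    show ?case by (intro exI[of _ 1]) (simp add: pow_0 T.one_mult T.mult_one)
  next
    case (step1 i)
    then obtain d where "y \<otimes>\<^bsub>\<A>\<^esub> u [^]\<^bsub>\<A>\<^esub> i = d \<odot>\<^bsub>\<A>\<^esub> (u [^]\<^bsub>\<A>\<^esub> i \<otimes>\<^bsub>\<A>\<^esub> y)" by blast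
    from step[OF _ pow_step(1) this, of u c] show ?case unfolding pow_step(2) by blast
  next
    case (step2 i)
    then obtain d where "y \<otimes>\<^bsub>\<A>\<^esub> u [^]\<^bsub>\<A>\<^esub> i = d \<odot>\<^bsub>\<A>\<^esub> (u [^]\<^bsub>\<A>\<^esub> i \<otimes>\<^bsub>\<A>\<^esub> y)" by blast
    from step[OF _ pow_step(1) this, of "star \<A> u" "1 / c"] show ?case unfolding pow_step(3) by blast
  qed
qed

text \<open>Scalar multiples of the monomials are stable under left multiplication by the
  generators: u and its adjoint change the first exponent directly, while w and its adjoint are
  first moved past the power of u.\<close>

lemma torus_spanned:
  assumes W: "closed_subspace \<A> W" and m: "\<And>(i::int) (k::int). u [^]\<^bsub>\<A>\<^esub> i \<otimes>\<^bsub>\<A>\<^esub> w [^]\<^bsub>\<A>\<^esub> k \<in> W"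
  shows "W = carrier \<A>"
proof (rule T.closed_span_eq[OF torus_generated gens_in _ _ _ W])
  note [simp] = T.mult_in pow_step(1,4)
  let ?D = "{c \<odot>\<^bsub>\<A>\<^esub> (u [^]\<^bsub>\<A>\<^esub> i \<otimes>\<^bsub>\<A>\<^esub> w [^]\<^bsub>\<A>\<^esub> k) | c (i::int) (k::int). True}"
  show "?D \<subseteq> carrier \<A>" by auto
  have sc: "c \<odot>\<^bsub>\<A>\<^esub> x \<in> W" if "x \<in> W" for c x using W that unfolding closed_subspace_def by blast
  show "?D \<subseteq> W"
  proof
    fix x assume "x \<in> ?D"
    then obtain c i k where x: "x = c \<odot>\<^bsub>\<A>\<^esub> (u [^]\<^bsub>\<A>\<^esub> (i::int) \<otimes>\<^bsub>\<A>\<^esub> w [^]\<^bsub>\<A>\<^esub> (k::int))"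
      unfolding mem_Collect_eq by metis
    show "x \<in> W" unfolding x by (rule sc[OF m])
  qed
  show "\<one>\<^bsub>\<A>\<^esub> \<in> ?D"
    by (intro CollectI exI[of _ 1] exI[of _ 0]) (simp add: pow_0 T.one_in T.one_mult)
  fix g d assume g: "g \<in> gens" and "d \<in> ?D"
  then obtain c i k where d: "d = c \<odot>\<^bsub>\<A>\<^esub> (u [^]\<^bsub>\<A>\<^esub> (i::int) \<otimes>\<^bsub>\<A>\<^esub> w [^]\<^bsub>\<A>\<^esub> (k::int))" by blast
  have ww: "w \<otimes>\<^bsub>\<A>\<^esub> u = (1 / \<omega>) \<odot>\<^bsub>\<A>\<^esub> (u \<otimes>\<^bsub>\<A>\<^esub> w)"
    unfolding torus_rel(5) by simp
  have "u \<otimes>\<^bsub>\<A>\<^esub> star \<A> w = (1 / \<omega>) \<odot>\<^bsub>\<A>\<^esub> (star \<A> w \<otimes>\<^bsub>\<A>\<^esub> u)"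
    by (rule T.unitary_commute_star[OF _ _ _ _ ww]) (simp_all add: torus_rel)
  then have ws: "star \<A> w \<otimes>\<^bsub>\<A>\<^esub> u = \<omega> \<odot>\<^bsub>\<A>\<^esub> (u \<otimes>\<^bsub>\<A>\<^esub> star \<A> w)" by simp
  have "\<exists>e i' k'. g \<otimes>\<^bsub>\<A>\<^esub> (u [^]\<^bsub>\<A>\<^esub> i \<otimes>\<^bsub>\<A>\<^esub> w [^]\<^bsub>\<A>\<^esub> k) = e \<odot>\<^bsub>\<A>\<^esub> (u [^]\<^bsub>\<A>\<^esub> (i'::int) \<otimes>\<^bsub>\<A>\<^esub> w [^]\<^bsub>\<A>\<^esub> (k'::int))"
  proof -
    have wcase: ?thesis if y: "y \<in> carrier \<A>" and r: "y \<otimes>\<^bsub>\<A>\<^esub> u = a \<odot>\<^bsub>\<A>\<^esub> (u \<otimes>\<^bsub>\<A>\<^esub> y)" "a \<noteq> 0"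
      and k': "y \<otimes>\<^bsub>\<A>\<^esub> w [^]\<^bsub>\<A>\<^esub> k = w [^]\<^bsub>\<A>\<^esub> (k' :: int)" and gy: "g = y" for y a k'
    proof -
      obtain e where e: "y \<otimes>\<^bsub>\<A>\<^esub> u [^]\<^bsub>\<A>\<^esub> i = e \<odot>\<^bsub>\<A>\<^esub> (u [^]\<^bsub>\<A>\<^esub> i \<otimes>\<^bsub>\<A>\<^esub> y)" using commute_pow[OF y r] by blast
      have "y \<otimes>\<^bsub>\<A>\<^esub> (u [^]\<^bsub>\<A>\<^esub> i \<otimes>\<^bsub>\<A>\<^esub> w [^]\<^bsub>\<A>\<^esub> k) = (y \<otimes>\<^bsub>\<A>\<^esub> u [^]\<^bsub>\<A>\<^esub> i) \<otimes>\<^bsub>\<A>\<^esub> w [^]\<^bsub>\<A>\<^esub> k"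
        using y by (simp add: T.mult_assoc)
      also have "\<dots> = e \<odot>\<^bsub>\<A>\<^esub> (u [^]\<^bsub>\<A>\<^esub> i \<otimes>\<^bsub>\<A>\<^esub> w [^]\<^bsub>\<A>\<^esub> k')"
        unfolding e using y by (simp add: T.smult_mult_left T.mult_assoc k')
      finally show ?thesis unfolding gy by blast
    qed
    have ucase: ?thesis if y: "y \<in> carrier \<A>" and i': "y \<otimes>\<^bsub>\<A>\<^esub> u [^]\<^bsub>\<A>\<^esub> i = u [^]\<^bsub>\<A>\<^esub> (i' :: int)" and gy: "g = y" for y i'
    proof -
      have "y \<otimes>\<^bsub>\<A>\<^esub> (u [^]\<^bsub>\<A>\<^esub> i \<otimes>\<^bsub>\<A>\<^esub> w [^]\<^bsub>\<A>\<^esub> k) = 1 \<odot>\<^bsub>\<A>\<^esub> (u [^]\<^bsub>\<A>\<^esub> i' \<otimes>\<^bsub>\<A>\<^esub> w [^]\<^bsub>\<A>\<^esub> k)"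
        using y by (simp flip: T.mult_assoc i')
      then show ?thesis unfolding gy by blast
    qed
    show ?thesis
      using g ucase[OF u_in pow_step(2)] ucase[OF T.star_in[OF u_in] pow_step(3)]
        wcase[OF w_in ww _ pow_step(5)] wcase[OF T.star_in[OF w_in] ws _ pow_step(6)]
      unfolding gens_def by fastforce
  qed
  then obtain e i' k' where "g \<otimes>\<^bsub>\<A>\<^esub> (u [^]\<^bsub>\<A>\<^esub> i \<otimes>\<^bsub>\<A>\<^esub> w [^]\<^bsub>\<A>\<^esub> k) = e \<odot>\<^bsub>\<A>\<^esub> (u [^]\<^bsub>\<A>\<^esub> (i'::int) \<otimes>\<^bsub>\<A>\<^esub> w [^]\<^bsub>\<A>\<^esub> (k'::int))" by blast
  then have "g \<otimes>\<^bsub>\<A>\<^esub> d = (c * e) \<odot>\<^bsub>\<A>\<^esub> (u [^]\<^bsub>\<A>\<^esub> i' \<otimes>\<^bsub>\<A>\<^esub> w [^]\<^bsub>\<A>\<^esub> k')"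
    unfolding d using g gens_in by (subst T.smult_mult_right) auto
  then show "g \<otimes>\<^bsub>\<A>\<^esub> d \<in> ?D" by blast
qed

text \<open>The index j is free: every copy induces the same state, so each letter of a word can be
  evaluated in its own copy. Uniqueness holds because states are bounded and the monomials span a
  dense subspace.\<close>

lemma canonical_trace_eq: "canonical_trace \<alpha> = vtr j"
  unfolding canonical_trace_def
proof (rule the_equality)
  show "is_state \<A> (vtr j) \<and> (\<forall>(i::int) (k::int).
      vtr j (u [^]\<^bsub>\<A>\<^esub> i \<otimes>\<^bsub>\<A>\<^esub> w [^]\<^bsub>\<A>\<^esub> k) = (if i = 0 \<and> k = 0 then 1 else 0))"
    by (simp add: vtr_state vtr_monomial)
  fix \<tau> assume \<tau>: "is_state \<A> \<tau> \<and> (\<forall>(i::int) (k::int).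
      \<tau> (u [^]\<^bsub>\<A>\<^esub> i \<otimes>\<^bsub>\<A>\<^esub> w [^]\<^bsub>\<A>\<^esub> k) = (if i = 0 \<and> k = 0 then 1 else 0))"
  have "{a \<in> carrier \<A>. \<tau> a = vtr j a} = carrier \<A>"
  proof (rule torus_spanned)
    show "closed_subspace \<A> {a \<in> carrier \<A>. \<tau> a = vtr j a}"
      by (rule T.closed_subspace_functional_eq[OF T.state_bounded[OF conjunct1[OF \<tau>]] T.state_bounded[OF vtr_state]])
    show "u [^]\<^bsub>\<A>\<^esub> i \<otimes>\<^bsub>\<A>\<^esub> w [^]\<^bsub>\<A>\<^esub> k \<in> {a \<in> carrier \<A>. \<tau> a = vtr j a}" for i k :: int
      using \<tau> vtr_monomial pow_step T.mult_in by simp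
  qed
  then have eq: "\<tau> a = vtr j a" if "a \<in> carrier \<A>" for a using that by blast
  have "\<tau> \<in> extensional (carrier \<A>)" using \<tau> unfolding is_state_def by (elim conjE)
  moreover have "vtr j \<in> extensional (carrier \<A>)" by (simp add: vtr_def)
  ultimately show "\<tau> = vtr j" by (rule extensionalityI[OF _ _ eq])
qed

end

section \<open>Closed ideals and quotients\<close>

context cstar_algebra
begin

lemma closedinI_lim:
  "J \<subseteq> carrier A \<Longrightarrow> (\<And>X x. (\<And>n. X n \<in> J) \<Longrightarrow> cstar_lim A X x \<Longrightarrow> x \<in> J) \<Longrightarrow>
    closedin (cstar_topology A) J"
  unfolding closedin_iff_lim by meson

lemma closedinD_lim:
  "closedin (cstar_topology A) J \<Longrightarrow> (\<And>n. X n \<in> J) \<Longrightarrow> cstar_lim A X x \<Longrightarrow> x \<in> J"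
  unfolding closedin_iff_lim by meson

lemma closed_ideal_generated:
  assumes S: "S \<subseteq> carrier A"
  shows "ideal (closed_ideal_generated A S) A" "closedin (cstar_topology A) (closed_ideal_generated A S)"
    "S \<subseteq> closed_ideal_generated A S"
proof -
  let ?\<J> = "{I. ideal I A \<and> closedin (cstar_topology A) I \<and> S \<subseteq> I}"
  have "carrier A \<in> ?\<J>"
    using S ring.oneideal[OF ring_A] by (auto simp: closedin_iff_lim dest: lim_in)
  then have ne: "?\<J> \<noteq> {}" by blast
  show "ideal (closed_ideal_generated A S) A"
    unfolding closed_ideal_generated_def by (rule ring.i_Intersect[OF ring_A _ ne]) blast
  show "closedin (cstar_topology A) (closed_ideal_generated A S)"
    unfolding closed_ideal_generated_def by (rule closedin_Inter[OF ne]) blast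
  show "S \<subseteq> closed_ideal_generated A S" unfolding closed_ideal_generated_def by blast
qed

lemma closed_ideal_generated_least:
  "ideal J A \<Longrightarrow> closedin (cstar_topology A) J \<Longrightarrow> S \<subseteq> J \<Longrightarrow> closed_ideal_generated A S \<subseteq> J"
  unfolding closed_ideal_generated_def by blast

lemma ideal_simps:
  assumes I: "ideal I A"
  shows "I \<subseteq> carrier A" "\<zero> \<in> I" "x \<in> I \<Longrightarrow> y \<in> I \<Longrightarrow> x \<oplus> y \<in> I"
    "x \<in> I \<Longrightarrow> a \<in> carrier A \<Longrightarrow> a \<otimes> x \<in> I" "x \<in> I \<Longrightarrow> a \<in> carrier A \<Longrightarrow> x \<otimes> a \<in> I"
    "x \<in> I \<Longrightarrow> c \<odot> x \<in> I" "x \<in> I \<Longrightarrow> y \<in> I \<Longrightarrow> x \<ominus> y \<in> I"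
proof -
  interpret I: ideal I A by (rule I)
  show sub: "I \<subseteq> carrier A" by (rule I.a_subset)
  show "\<zero> \<in> I" by (rule I.zero_closed)
  show add: "x \<oplus> y \<in> I" if "x \<in> I" "y \<in> I" for x y using that by (rule I.a_closed)
  show lm: "a \<otimes> x \<in> I" if "x \<in> I" "a \<in> carrier A" for a x using that by (rule I.I_l_closed)
  show "x \<otimes> a \<in> I" if "x \<in> I" "a \<in> carrier A" for a x using that by (rule I.I_r_closed)
  \<comment> \<open>Stability under scalars is stability under left multiplication by
    \<open>c \<odot> \<one>\<close>.\<close>
  show sm: "c \<odot> x \<in> I" if "x \<in> I" for x c
    using lm[OF that, of "c \<odot> \<one>"] smult_one_mult[of x c] sub that one_in by auto
  show "x \<ominus> y \<in> I" if "x \<in> I" "y \<in> I" for x y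
    using add[OF that(1) sm[OF that(2), of "-1"]] sub that by (simp add: minus_eq_smult subset_iff)
qed

lemma ideal_I:
  assumes "I \<subseteq> carrier A" "\<zero> \<in> I" "\<And>x y. x \<in> I \<Longrightarrow> y \<in> I \<Longrightarrow> x \<oplus> y \<in> I"
    "\<And>a x. x \<in> I \<Longrightarrow> a \<in> carrier A \<Longrightarrow> a \<otimes> x \<in> I" "\<And>a x. x \<in> I \<Longrightarrow> a \<in> carrier A \<Longrightarrow> x \<otimes> a \<in> I"
  shows "ideal I A"
proof (rule idealI[OF ring_A])
  show "subgroup I (add_monoid A)"
  proof (rule group.subgroupI)
    show "Group.group (add_monoid A)"
      using abelian_group.a_group[OF ring.axioms(1)[OF ring_A]] .
    show "inv\<^bsub>add_monoid A\<^esub> x \<in> I" if "x \<in> I" for x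
    proof -
      have "((-1) \<odot> \<one>) \<otimes> x \<in> I" using assms(4)[OF that, of "(-1) \<odot> \<one>"] one_in by simp
      moreover have "((-1) \<odot> \<one>) \<otimes> x = \<ominus> x"
        using smult_one_mult[of x "-1"] smult_minus1[of x] that assms(1) by auto
      ultimately show ?thesis by (simp add: a_inv_def)
    qed
  qed (use assms in auto)
qed (use assms in auto)

text \<open>The preimage of the ideal under the involution is again a closed ideal, since left and
  right multiplication trade places, and it contains \<open>S\<close> by assumption.\<close>

lemma star_closed_ideal_generated:
  assumes S: "S \<subseteq> carrier A" and star: "\<And>s. s \<in> S \<Longrightarrow> star A s \<in> closed_ideal_generated A S"
    and x: "x \<in> closed_ideal_generated A S"
  shows "star A x \<in> closed_ideal_generated A S"
proof -
  let ?I = "closed_ideal_generated A S"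
  note I = ideal_simps[OF closed_ideal_generated(1)[OF S]]
  have "?I \<subseteq> {x \<in> carrier A. star A x \<in> ?I}"
  proof (rule closed_ideal_generated_least)
    show "ideal {x \<in> carrier A. star A x \<in> ?I} A"
      by (rule ideal_I) (auto simp: I star_add star_mult mult_in)
    show "closedin (cstar_topology A) {x \<in> carrier A. star A x \<in> ?I}"
    proof (rule closedinI_lim)
      fix X x assume X: "\<And>n. X n \<in> {x \<in> carrier A. star A x \<in> ?I}" and l: "cstar_lim A X x"
      have "star A (X n) \<in> ?I" for n using X by simp
      then have "star A x \<in> ?I" by (rule closedinD_lim[OF closed_ideal_generated(2)[OF S] _ lim_star[OF l]])
      then show "x \<in> {x \<in> carrier A. star A x \<in> ?I}" using lim_in(2)[OF l] by simp
    qed simp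
    show "S \<subseteq> {x \<in> carrier A. star A x \<in> ?I}" using S star by blast
  qed
  then show ?thesis using x by blast
qed

lemma kernel_closed_ideal:
  assumes h: "h \<in> star_hom A B" and B: "cstar_algebra B"
  shows "ideal {x \<in> carrier A. h x = \<zero>\<^bsub>B\<^esub>} A" "closedin (cstar_topology A) {x \<in> carrier A. h x = \<zero>\<^bsub>B\<^esub>}"
proof -
  interpret B: cstar_algebra B by (rule B)
  note H = star_homD[OF h]
  show "ideal {x \<in> carrier A. h x = \<zero>\<^bsub>B\<^esub>} A"
    by (rule ideal_I) (auto simp: H mult_in star_hom_zero[OF h B] ring.ring_simprules[OF B.ring_A])
  show "closedin (cstar_topology A) {x \<in> carrier A. h x = \<zero>\<^bsub>B\<^esub>}"
  proof (rule closedinI_lim)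
    fix X x assume X: "\<And>n. X n \<in> {x \<in> carrier A. h x = \<zero>\<^bsub>B\<^esub>}" and l: "cstar_lim A X x"
    have "cstar_lim B (\<lambda>n. h (X n)) (h x)"
      using star_hom_cont_linear[OF h B] l by (simp add: cont_linear_def)
    moreover have "h (X n) = \<zero>\<^bsub>B\<^esub>" for n using X by simp
    ultimately have "cstar_lim B (\<lambda>n. \<zero>\<^bsub>B\<^esub>) (h x)" by simp
    then have "h x = \<zero>\<^bsub>B\<^esub>" using B.lim_unique[OF _ B.lim_const] by simp
    then show "x \<in> {x \<in> carrier A. h x = \<zero>\<^bsub>B\<^esub>}" using lim_in(2)[OF l] by simp
  qed simp
qed

lemma vimage_closed_ideal:
  assumes h: "h \<in> star_hom A B" and B: "cstar_algebra B"
    and J: "ideal J B" "closedin (cstar_topology B) J"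
  shows "ideal {x \<in> carrier A. h x \<in> J} A" "closedin (cstar_topology A) {x \<in> carrier A. h x \<in> J}"
proof -
  interpret B: cstar_algebra B by (rule B)
  note H = star_homD[OF h] and J' = B.ideal_simps[OF J(1)]
  show "ideal {x \<in> carrier A. h x \<in> J} A"
    by (rule ideal_I) (auto simp: H mult_in star_hom_zero[OF h B] J')
  show "closedin (cstar_topology A) {x \<in> carrier A. h x \<in> J}"
  proof (rule closedinI_lim)
    fix X x assume X: "\<And>n. X n \<in> {x \<in> carrier A. h x \<in> J}" and l: "cstar_lim A X x"
    have "cstar_lim B (\<lambda>n. h (X n)) (h x)"
      using star_hom_cont_linear[OF h B] l by (simp add: cont_linear_def)
    moreover have "h (X n) \<in> J" for n using X by simp
    ultimately have "h x \<in> J" using B.closedinD_lim[OF J(2), of "\<lambda>n. h (X n)"] by simp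
    then show "x \<in> {x \<in> carrier A. h x \<in> J}" using lim_in(2)[OF l] by simp
  qed simp
qed

end

section \<open>Quotients by self-adjoint ideals\<close>

locale star_ideal = cstar_algebra A + ideal I A for A :: "'a cstar" (structure) and I +
  assumes star_I: "x \<in> I \<Longrightarrow> star A x \<in> I"
begin

abbreviation "Q \<equiv> cstar_quotient A I"
abbreviation "p \<equiv> quotient_map A I"

lemma p_def: "x \<in> carrier A \<Longrightarrow> p x = I +> x"
  by (simp add: quotient_map_def)

lemma p_eq_iff: "x \<in> carrier A \<Longrightarrow> y \<in> carrier A \<Longrightarrow> p x = p y \<longleftrightarrow> x \<ominus> y \<in> I"
  using ring.quotient_eq_iff_same_a_r_cos[OF ring_A ideal_axioms] by (simp add: p_def)

lemma carrier_Q: "carrier Q = p ` carrier A"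
  by (auto simp: cstar_quotient_def FactRing_def A_RCOSETS_def' p_def)

lemma p_in [simp]: "x \<in> carrier A \<Longrightarrow> p x \<in> carrier Q"
  by (simp add: carrier_Q)

lemma mem_p: "x \<in> carrier A \<Longrightarrow> y \<in> p x \<longleftrightarrow> y \<in> carrier A \<and> p y = p x"
proof
  assume x: "x \<in> carrier A" and "y \<in> p x"
  then obtain i where i: "i \<in> I" "y = i \<oplus> x" by (auto simp: p_def a_r_coset_def')
  have iA: "i \<in> carrier A" using i ideal_simps(1)[OF ideal_axioms] by blast
  have "i \<oplus> x \<ominus> x = i" using iA x by algebra
  then show "y \<in> carrier A \<and> p y = p x" using i iA x by (simp add: p_eq_iff)
next
  assume x: "x \<in> carrier A" and y: "y \<in> carrier A \<and> p y = p x"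
  then have "y \<ominus> x \<in> I" using p_eq_iff[of y x] by metis
  moreover have "y = (y \<ominus> x) \<oplus> x" using x conjunct1[OF y] by algebra
  ultimately have "\<exists>i\<in>I. y = i \<oplus> x" by blast
  then show "y \<in> p x" by (simp add: p_def[OF x] a_r_coset_def')
qed

text \<open>Scalar multiplication and involution of the quotient are formed over all members of a
  coset. They give the expected coset because the ideal is stable under scalars and under the
  involution. Computations in the quotient can then be carried out on representatives.\<close>

lemma p_ops:
  "\<one>\<^bsub>Q\<^esub> = p \<one>"
  "x \<in> carrier A \<Longrightarrow> y \<in> carrier A \<Longrightarrow> p x \<otimes>\<^bsub>Q\<^esub> p y = p (x \<otimes> y)"
  "x \<in> carrier A \<Longrightarrow> y \<in> carrier A \<Longrightarrow> p x \<oplus>\<^bsub>Q\<^esub> p y = p (x \<oplus> y)"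
  "x \<in> carrier A \<Longrightarrow> c \<odot>\<^bsub>Q\<^esub> p x = p (c \<odot> x)"
  "x \<in> carrier A \<Longrightarrow> star Q (p x) = p (star A x)"
proof -
  note I = ideal_simps[OF ideal_axioms]
  show "\<one>\<^bsub>Q\<^esub> = p \<one>" by (simp add: cstar_quotient_def FactRing_def p_def one_in)
  show "p x \<otimes>\<^bsub>Q\<^esub> p y = p (x \<otimes> y)" if "x \<in> carrier A" "y \<in> carrier A" for x y
    using that rcoset_mult_add[OF that] by (simp add: cstar_quotient_def FactRing_def p_def mult_in)
  show "p x \<oplus>\<^bsub>Q\<^esub> p y = p (x \<oplus> y)" if "x \<in> carrier A" "y \<in> carrier A" for x y
    using that a_rcos_sum[OF that] by (simp add: cstar_quotient_def FactRing_def p_def)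
  show "c \<odot>\<^bsub>Q\<^esub> p x = p (c \<odot> x)" if x: "x \<in> carrier A" for x c
  proof -
    have eq: "I +> (c \<odot> y) = p (c \<odot> x)" if y: "y \<in> p x" for y
    proof -
      have yA: "y \<in> carrier A" "y \<ominus> x \<in> I" using mem_p[OF x] p_eq_iff[of y x] y x by auto
      have "c \<odot> y \<ominus> c \<odot> x = c \<odot> (y \<ominus> x)" using yA x by (simp add: smult_diff_right)
      then show ?thesis using yA x I(6) p_eq_iff[of "c \<odot> y" "c \<odot> x"] by (simp flip: p_def)
    qed
    have "x \<in> p x" using x by (simp add: mem_p)
    have "c \<odot>\<^bsub>Q\<^esub> p x = (\<Union>y\<in>p x. I +> (c \<odot> y))" by (simp add: cstar_quotient_def)
    also have "\<dots> = (\<Union>y\<in>p x. p (c \<odot> x))" using eq by blast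
    finally show ?thesis using \<open>x \<in> p x\<close> by blast
  qed
  show "star Q (p x) = p (star A x)" if x: "x \<in> carrier A" for x
  proof -
    have st: "star A y \<in> p (star A x)" if x: "x \<in> carrier A" and y: "y \<in> p x" for x y
    proof -
      have yA: "y \<in> carrier A" "y \<ominus> x \<in> I" using mem_p[OF x] p_eq_iff[of y x] y x by auto
      then have "star A y \<ominus> star A x \<in> I" using star_I[OF yA(2)] x by (simp add: star_diff)
      then show ?thesis using yA x by (simp add: mem_p p_eq_iff)
    qed
    have "star A ` p x = p (star A x)"
    proof
      show "star A ` p x \<subseteq> p (star A x)" using st[OF x] by blast
      show "p (star A x) \<subseteq> star A ` p x"
      proof
        fix z assume z: "z \<in> p (star A x)"
        have "star A z \<in> p (star A (star A x))" by (rule st[OF star_in[OF x] z])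
        moreover have "z \<in> carrier A" using z mem_p x by blast
        ultimately show "z \<in> star A ` p x" using x by (metis image_eqI star_star)
      qed
    qed
    then show ?thesis by (simp add: cstar_quotient_def)
  qed
qed

text \<open>A state vanishing on \<open>I\<close> is constant on cosets, so its value at any
  representative defines the induced state.\<close>

lemma state_quotient_iff:
  assumes \<phi>: "is_state A \<phi>" and z: "\<And>x. x \<in> I \<Longrightarrow> \<phi> x = 0"
  shows "\<exists>\<psi>. is_state Q \<psi> \<and> (\<forall>x\<in>carrier A. \<psi> (p x) = \<phi> x)"
proof -
  note \<phi>D = \<phi>[unfolded is_state_def]
  have eq: "\<phi> x = \<phi> y" if "x \<in> carrier A" "y \<in> carrier A" "p x = p y" for x y
  proof -
    have "\<phi> (x \<ominus> y) = \<phi> x - \<phi> y" using \<phi>D that by (simp add: minus_eq_smult)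
    then show ?thesis using z[of "x \<ominus> y"] that by (simp add: p_eq_iff)
  qed
  define \<psi> where "\<psi> = (\<lambda>X\<in>carrier Q. \<phi> (SOME x. x \<in> carrier A \<and> p x = X))"
  have \<psi>: "\<psi> (p x) = \<phi> x" if x: "x \<in> carrier A" for x
  proof -
    let ?y = "SOME y. y \<in> carrier A \<and> p y = p x"
    have "?y \<in> carrier A \<and> p ?y = p x" by (rule someI[of _ x]) (simp add: x)
    then show ?thesis using eq[of ?y x] x by (simp add: \<psi>_def)
  qed
  have "is_state Q \<psi>"
    unfolding is_state_def
  proof (intro conjI ballI allI)
    show "\<psi> \<in> extensional (carrier Q)" by (simp add: \<psi>_def)
    show "\<psi> \<one>\<^bsub>Q\<^esub> = 1" using \<phi>D by (simp add: p_ops \<psi> one_in)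
    fix X assume "X \<in> carrier Q"
    then obtain x where x: "x \<in> carrier A" "X = p x" by (auto simp: carrier_Q)
    show "\<psi> (c \<odot>\<^bsub>Q\<^esub> X) = c * \<psi> X" for c using \<phi>D x by (simp add: p_ops \<psi>)
    show "\<psi> (star Q X \<otimes>\<^bsub>Q\<^esub> X) \<in> \<real>\<^sub>\<ge>\<^sub>0" using \<phi>D x by (simp add: p_ops \<psi> mult_in)
    fix Y assume "Y \<in> carrier Q"
    then obtain y where y: "y \<in> carrier A" "Y = p y" by (auto simp: carrier_Q)
    show "\<psi> (X \<oplus>\<^bsub>Q\<^esub> Y) = \<psi> X + \<psi> Y" using \<phi>D x y by (simp add: p_ops \<psi>)
  qed
  then show ?thesis using \<psi> by blast
qed

lemma state_lift:
  assumes \<psi>: "is_state Q \<psi>"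
  shows "is_state A (compose (carrier A) \<psi> p)" "x \<in> I \<Longrightarrow> compose (carrier A) \<psi> p x = 0"
proof -
  note D = \<psi>[unfolded is_state_def]
  show "is_state A (compose (carrier A) \<psi> p)"
    unfolding is_state_def
  proof (intro conjI ballI allI)
    show "compose (carrier A) \<psi> p \<in> extensional (carrier A)" by (simp add: compose_def)
    show "compose (carrier A) \<psi> p \<one> = 1" using D by (simp add: compose_def one_in p_ops)
    fix x assume x: "x \<in> carrier A"
    have "\<psi> (c \<odot>\<^bsub>Q\<^esub> p x) = c * \<psi> (p x)" for c using D x by simp
    then show "compose (carrier A) \<psi> p (c \<odot> x) = c * compose (carrier A) \<psi> p x" for c
      using x by (simp add: compose_def p_ops)
    have "\<psi> (star Q (p x) \<otimes>\<^bsub>Q\<^esub> p x) \<in> \<real>\<^sub>\<ge>\<^sub>0" using D x p_in by blast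
    then show "compose (carrier A) \<psi> p (star A x \<otimes> x) \<in> \<real>\<^sub>\<ge>\<^sub>0"
      using x by (simp add: compose_def p_ops mult_in)
    fix y assume y: "y \<in> carrier A"
    have "\<psi> (p x \<oplus>\<^bsub>Q\<^esub> p y) = \<psi> (p x) + \<psi> (p y)" using D x y by simp
    then show "compose (carrier A) \<psi> p (x \<oplus> y) = compose (carrier A) \<psi> p x + compose (carrier A) \<psi> p y"
      using x y by (simp add: compose_def p_ops)
  qed
  show "compose (carrier A) \<psi> p x = 0" if x: "x \<in> I"
  proof -
    have xA: "x \<in> carrier A" using x ideal_simps(1)[OF ideal_axioms] by blast
    have "x \<ominus> 0 \<odot> x = x" using xA by (simp add: minus_eq_smult)
    then have "p x = p (0 \<odot> x)" using x xA p_eq_iff[of x "0 \<odot> x"] by simp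
    then have "\<psi> (p x) = \<psi> (0 \<odot>\<^bsub>Q\<^esub> p x)" using p_ops(4)[OF xA, of 0] by simp
    also have "\<dots> = 0" using D xA by simp
    finally show ?thesis using xA by (simp add: compose_def)
  qed
qed

end

section \<open>The twisted tensor product\<close>

context twisted
begin

definition tw :: "int \<times> int \<Rightarrow> int \<times> int \<Rightarrow> complex" where
  "tw d e = cis (2 * pi * (\<theta> * of_int (fst d) * of_int (fst e) + \<theta> * of_int (snd d) * of_int (snd e)))"

abbreviation "\<zeta> \<equiv> cis (2 * pi * \<theta>)"

abbreviation "\<F> \<equiv> free_product \<A>"
abbreviation "\<epsilon> \<equiv> free_emb \<A>"

sublocale F: cstar_algebra \<F>
  by (rule T.cstar_algebra_FP)

lemmas emb = T.emb_star_hom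
lemmas embD = star_homD[OF T.emb_star_hom]

lemma powi_zeta: "\<zeta> powi k = cis (2 * pi * \<theta> * of_int k)"
  by (simp add: cis_power_int mult.commute)

section \<open>The representation of the free product and its commutation relations\<close>

definition Pi_rep :: "torus_elt free_product_elt \<Rightarrow> (nat \<Rightarrow> complex) \<Rightarrow> nat \<Rightarrow> complex" where
  "Pi_rep = (SOME h. h \<in> star_hom \<F> BL \<and> (\<forall>j. \<forall>a\<in>carrier \<A>. h (\<epsilon> j a) = iota j a))"

lemma Pi_rep: "Pi_rep \<in> star_hom \<F> BL" "a \<in> carrier \<A> \<Longrightarrow> Pi_rep (\<epsilon> j a) = iota j a"
proof -
  obtain h where "h \<in> star_hom \<F> BL" "\<And>j a. a \<in> carrier \<A> \<Longrightarrow> h (\<epsilon> j a) = iota j a"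
    using T.FP_hom_exists[where \<kappa> = iota, OF cstar_algebra_BL iota(1)] by metis
  then have "\<exists>h. h \<in> star_hom \<F> BL \<and> (\<forall>j. \<forall>a\<in>carrier \<A>. h (\<epsilon> j a) = iota j a)" by blast
  from someI_ex[OF this, folded Pi_rep_def]
  show "Pi_rep \<in> star_hom \<F> BL" "a \<in> carrier \<A> \<Longrightarrow> Pi_rep (\<epsilon> j a) = iota j a" by simp_all
qed

lemmas PiD = star_homD[OF Pi_rep(1)]

text \<open>Commuting with the generators of copy k up to the phases c and d means that conjugation
  by \<open>Lop m\<close> implements the rotation by these phases on that copy; it suffices to look
  at generators. This is the link to homogeneity, which is defined through rotations.\<close>

lemma Lop_iota:
  assumes c: "cmod c = 1" "cmod d = 1"
    and m: "Lop m \<otimes>\<^bsub>BL\<^esub> Lop (2 * k) = c \<odot>\<^bsub>BL\<^esub> (Lop (2 * k) \<otimes>\<^bsub>BL\<^esub> Lop m)"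
      "Lop m \<otimes>\<^bsub>BL\<^esub> Lop (Suc (2 * k)) = d \<odot>\<^bsub>BL\<^esub> (Lop (Suc (2 * k)) \<otimes>\<^bsub>BL\<^esub> Lop m)"
    and b: "b \<in> carrier \<A>"
  shows "Lop m \<otimes>\<^bsub>BL\<^esub> iota k b = iota k (rotation \<alpha> c d b) \<otimes>\<^bsub>BL\<^esub> Lop m"
proof -
  let ?r = "rotation \<alpha> c d"
  note R = star_homD[OF rotation(1)[OF c]]
  note [simp] = iotaD(1) R(1) BL.mult_in T.mult_in
  let ?W = "{b \<in> carrier \<A>. compose (carrier \<A>) (iota k) ?r b \<otimes>\<^bsub>BL\<^esub> Lop m = Lop m \<otimes>\<^bsub>BL\<^esub> iota k b}"
  note W = T.intertwined_subalgebra[OF cstar_algebra_BL T.star_hom_compose[OF rotation(1)[OF c] iota(1)]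
      iota(1) char_shift_in]
  have "?W = carrier \<A>"
  proof (rule torus_generated[OF W])
    have st: "Lop m \<otimes>\<^bsub>BL\<^esub> star BL (Lop j) = cnj e \<odot>\<^bsub>BL\<^esub> (star BL (Lop j) \<otimes>\<^bsub>BL\<^esub> Lop m)"
      if e: "cmod e = 1" and r: "Lop m \<otimes>\<^bsub>BL\<^esub> Lop j = e \<odot>\<^bsub>BL\<^esub> (Lop j \<otimes>\<^bsub>BL\<^esub> Lop m)" for j e
    proof (rule BL.unitary_commute_star)
      have "cnj e * e = 1" using complex_norm_square[of e] e by (simp add: mult.commute)
      then show "Lop j \<otimes>\<^bsub>BL\<^esub> Lop m = cnj e \<odot>\<^bsub>BL\<^esub> (Lop m \<otimes>\<^bsub>BL\<^esub> Lop j)" unfolding r by simp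
    qed (simp_all add: char_shift_unitary)
    show "gens \<subseteq> ?W"
      using m st[OF c(1) m(1)] st[OF c(2) m(2)]
      by (simp add: compose_def gens_def iota iotaD(4) R(5) iota_star rotation[OF c] T.star_smult BL.smult_mult_left)
  qed
  then have "b \<in> ?W" using b by blast
  then show ?thesis using b by (simp add: compose_def)
qed

lemma th_values:
  assumes "l < k"
  shows "th (2 * l) (2 * k) - th (2 * k) (2 * l) = \<theta>" "th (2 * l) (Suc (2 * k)) - th (Suc (2 * k)) (2 * l) = 0"
    "th (Suc (2 * l)) (2 * k) - th (2 * k) (Suc (2 * l)) = 0"
    "th (Suc (2 * l)) (Suc (2 * k)) - th (Suc (2 * k)) (Suc (2 * l)) = \<theta>"
  using assms by (auto simp: th_def)

text \<open>Two rounds of the same argument. Homogeneity of b turns the rotation implemented by a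
  generator of copy l into a power of \<open>\<zeta>\<close>. With these phases
  \<open>iota k b\<close> in turn intertwines copy l with a rotation of it, and homogeneity of a
  evaluates that rotation.\<close>

lemma twisted_commutation:
  assumes lk: "l < k" and a: "homogeneous \<alpha> d a" and b: "homogeneous \<alpha> e b"
  shows "iota l a \<otimes>\<^bsub>BL\<^esub> iota k b = tw d e \<odot>\<^bsub>BL\<^esub> (iota k b \<otimes>\<^bsub>BL\<^esub> iota l a)"
proof -
  have aA: "a \<in> carrier \<A>" and bA: "b \<in> carrier \<A>" using a b by (auto simp: homogeneous_def)
  let ?z1 = "\<zeta> powi fst e" and ?z2 = "\<zeta> powi snd e"
  have z: "cmod ?z1 = 1" "cmod ?z2 = 1" by (simp_all add: powi_zeta)
  let ?r = "rotation \<alpha> ?z1 ?z2"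
  note R = star_homD[OF rotation(1)[OF z]]
  note [simp] = iotaD(1) R(1) BL.mult_in T.mult_in
  note L = Lop_Lop[of "2 * l" "2 * k"] Lop_Lop[of "2 * l" "Suc (2 * k)"]
    Lop_Lop[of "Suc (2 * l)" "2 * k"] Lop_Lop[of "Suc (2 * l)" "Suc (2 * k)"]
  note L = L[unfolded th_values[OF lk]]
  have n1: "cmod \<zeta> = 1" "cmod (cis (2 * pi * 0)) = 1" by simp_all
  have U: "Lop (2 * l) \<otimes>\<^bsub>BL\<^esub> iota k b = ?z1 \<odot>\<^bsub>BL\<^esub> (iota k b \<otimes>\<^bsub>BL\<^esub> Lop (2 * l))"
    using Lop_iota[OF n1 L(1,2) bA] b bA by (simp add: homogeneous_def iotaD(4) BL.smult_mult_left)
  have V: "Lop (Suc (2 * l)) \<otimes>\<^bsub>BL\<^esub> iota k b = ?z2 \<odot>\<^bsub>BL\<^esub> (iota k b \<otimes>\<^bsub>BL\<^esub> Lop (Suc (2 * l)))"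
    using Lop_iota[OF n1(2,1) L(3,4) bA] b bA by (simp add: homogeneous_def iotaD(4) BL.smult_mult_left)
  let ?W = "{a \<in> carrier \<A>. iota l a \<otimes>\<^bsub>BL\<^esub> iota k b = iota k b \<otimes>\<^bsub>BL\<^esub> compose (carrier \<A>) (iota l) ?r a}"
  note W = T.intertwined_subalgebra[OF cstar_algebra_BL iota(1)
      T.star_hom_compose[OF rotation(1)[OF z] iota(1)] iotaD(1)[OF bA]]
  have "?W = carrier \<A>"
  proof (rule torus_generated[OF W])
    have st: "star BL (Lop j) \<otimes>\<^bsub>BL\<^esub> iota k b = cnj c \<odot>\<^bsub>BL\<^esub> (iota k b \<otimes>\<^bsub>BL\<^esub> star BL (Lop j))"
      if c: "cmod c = 1" and r: "Lop j \<otimes>\<^bsub>BL\<^esub> iota k b = c \<odot>\<^bsub>BL\<^esub> (iota k b \<otimes>\<^bsub>BL\<^esub> Lop j)" for j c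
    proof -
      have "iota k b \<otimes>\<^bsub>BL\<^esub> star BL (Lop j) = c \<odot>\<^bsub>BL\<^esub> (star BL (Lop j) \<otimes>\<^bsub>BL\<^esub> iota k b)"
        by (rule BL.unitary_commute_star[OF _ _ _ _ r]) (simp_all add: char_shift_unitary bA)
      moreover have "cnj c * c = 1" using complex_norm_square[of c] c by (simp add: mult.commute)
      ultimately show ?thesis using bA by simp
    qed
    show "gens \<subseteq> ?W"
      using U V st[OF z(1) U] st[OF z(2) V] bA
      by (simp add: compose_def gens_def iota iotaD(4) R(5) iota_star rotation[OF z] T.star_smult BL.smult_mult_right)
  qed
  then have "a \<in> ?W" using aA by blast
  then have "iota l a \<otimes>\<^bsub>BL\<^esub> iota k b = iota k b \<otimes>\<^bsub>BL\<^esub> iota l (?r a)" using aA by (simp add: compose_def)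
  also have "?r a = (?z1 powi fst d * ?z2 powi snd d) \<odot>\<^bsub>\<A>\<^esub> a" using a z by (simp add: homogeneous_def)
  also have "?z1 powi fst d * ?z2 powi snd d = tw d e"
    unfolding powi_zeta cis_power_int cis_mult tw_def by (rule arg_cong[where f = cis]) (simp add: algebra_simps)
  finally show ?thesis using aA bA by (simp add: iotaD(4) BL.smult_mult_right)
qed

definition twist_gens :: "torus_elt free_product_elt set" where
  "twist_gens = {(\<epsilon> l a \<otimes>\<^bsub>\<F>\<^esub> \<epsilon> k b) \<ominus>\<^bsub>\<F>\<^esub> (tw d e \<odot>\<^bsub>\<F>\<^esub> (\<epsilon> k b \<otimes>\<^bsub>\<F>\<^esub> \<epsilon> l a)) |l k a b d e.
        l < k \<and> homogeneous \<alpha> d a \<and> homogeneous \<alpha> e b}"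

abbreviation "\<I> \<equiv> twist_ideal \<alpha> tw"

lemma I_eq: "\<I> = closed_ideal_generated \<F> twist_gens"
  by (simp add: twist_ideal_def twist_gens_def Let_def)

lemma twist_gens_E:
  assumes "s \<in> twist_gens"
  obtains l k a b d e where "l < k" "homogeneous \<alpha> d a" "homogeneous \<alpha> e b" "a \<in> carrier \<A>" "b \<in> carrier \<A>"
    "s = (\<epsilon> l a \<otimes>\<^bsub>\<F>\<^esub> \<epsilon> k b) \<ominus>\<^bsub>\<F>\<^esub> (tw d e \<odot>\<^bsub>\<F>\<^esub> (\<epsilon> k b \<otimes>\<^bsub>\<F>\<^esub> \<epsilon> l a))"
proof -
  obtain l k a b d e where *: "l < k" "homogeneous \<alpha> d a" "homogeneous \<alpha> e b"
    "s = (\<epsilon> l a \<otimes>\<^bsub>\<F>\<^esub> \<epsilon> k b) \<ominus>\<^bsub>\<F>\<^esub> (tw d e \<odot>\<^bsub>\<F>\<^esub> (\<epsilon> k b \<otimes>\<^bsub>\<F>\<^esub> \<epsilon> l a))"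
    using assms unfolding twist_gens_def mem_Collect_eq by metis
  then show ?thesis using that unfolding homogeneous_def by metis
qed

lemma twist_gens_I:
  assumes "l < k" "homogeneous \<alpha> d a" "homogeneous \<alpha> e b"
  shows "(\<epsilon> l a \<otimes>\<^bsub>\<F>\<^esub> \<epsilon> k b) \<ominus>\<^bsub>\<F>\<^esub> (tw d e \<odot>\<^bsub>\<F>\<^esub> (\<epsilon> k b \<otimes>\<^bsub>\<F>\<^esub> \<epsilon> l a)) \<in> twist_gens"
  unfolding twist_gens_def mem_Collect_eq using assms by metis

lemma twist_gens_in: "twist_gens \<subseteq> carrier \<F>"
proof
  fix s assume "s \<in> twist_gens"
  then show "s \<in> carrier \<F>" by (rule twist_gens_E) (simp add: embD(1) F.mult_in)
qed

lemma I_ideal: "ideal \<I> \<F>" "closedin (cstar_topology \<F>) \<I>" "twist_gens \<subseteq> \<I>"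
  unfolding I_eq by (rule F.closed_ideal_generated[OF twist_gens_in])+

text \<open>The adjoint of the relation for a and b is a scalar multiple of the relation for their
  adjoints: both degrees change sign, which leaves the bicharacter unchanged.\<close>

lemma I_star: assumes "x \<in> \<I>" shows "star \<F> x \<in> \<I>"
  unfolding I_eq
proof (rule F.star_closed_ideal_generated[OF twist_gens_in])
  show "x \<in> closed_ideal_generated \<F> twist_gens" using assms by (simp add: I_eq)
  fix s assume "s \<in> twist_gens"
  then show "star \<F> s \<in> closed_ideal_generated \<F> twist_gens"
  proof (rule twist_gens_E)
    fix l k a b d e
    assume lk: "l < k" and a: "homogeneous \<alpha> d a" and b: "homogeneous \<alpha> e b"
      and in': "a \<in> carrier \<A>" "b \<in> carrier \<A>"
      and s: "s = (\<epsilon> l a \<otimes>\<^bsub>\<F>\<^esub> \<epsilon> k b) \<ominus>\<^bsub>\<F>\<^esub> (tw d e \<odot>\<^bsub>\<F>\<^esub> (\<epsilon> k b \<otimes>\<^bsub>\<F>\<^esub> \<epsilon> l a))"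
    let ?d = "(- fst d, - snd d)" and ?e = "(- fst e, - snd e)"
    let ?P = "\<epsilon> l (star \<A> a) \<otimes>\<^bsub>\<F>\<^esub> \<epsilon> k (star \<A> b)" and ?P' = "\<epsilon> k (star \<A> b) \<otimes>\<^bsub>\<F>\<^esub> \<epsilon> l (star \<A> a)"
    have P: "?P \<in> carrier \<F>" "?P' \<in> carrier \<F>" using in' by (simp_all add: embD(1) F.mult_in)
    have t: "tw ?d ?e = tw d e" "cnj (tw d e) * tw d e = 1" by (simp_all add: tw_def cis_cnj cis_mult)
    have "?P \<ominus>\<^bsub>\<F>\<^esub> (tw d e \<odot>\<^bsub>\<F>\<^esub> ?P') \<in> \<I>"
      using twist_gens_I[OF lk homogeneous_star[OF a] homogeneous_star[OF b]] I_ideal(3) t(1) by auto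
    then have "(- cnj (tw d e)) \<odot>\<^bsub>\<F>\<^esub> (?P \<ominus>\<^bsub>\<F>\<^esub> (tw d e \<odot>\<^bsub>\<F>\<^esub> ?P')) \<in> \<I>"
      by (rule F.ideal_simps(6)[OF I_ideal(1)])
    also have "(- cnj (tw d e)) \<odot>\<^bsub>\<F>\<^esub> (?P \<ominus>\<^bsub>\<F>\<^esub> (tw d e \<odot>\<^bsub>\<F>\<^esub> ?P')) =
        (- cnj (tw d e)) \<odot>\<^bsub>\<F>\<^esub> ?P \<oplus>\<^bsub>\<F>\<^esub> ?P'"
      using P t(2) by (simp add: F.minus_eq_smult F.smult_add_right)
    also have "\<dots> = ?P' \<ominus>\<^bsub>\<F>\<^esub> (cnj (tw d e) \<odot>\<^bsub>\<F>\<^esub> ?P)"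
      using P by (simp add: F.minus_eq_smult ring.ring_simprules(10)[OF F.ring_A])
    also have "\<dots> = star \<F> s"
      unfolding s using in' by (simp add: embD F.mult_in F.star_diff F.star_smult F.star_mult)
    finally show ?thesis by (simp add: I_eq)
  qed
qed

sublocale SI: star_ideal \<F> \<I>
  by (intro star_ideal.intro star_ideal_axioms.intro T.cstar_algebra_FP I_ideal(1) I_star)

lemma Pi_I: assumes "x \<in> \<I>" shows "Pi_rep x = \<zero>\<^bsub>BL\<^esub>"
proof -
  have "\<I> \<subseteq> {x \<in> carrier \<F>. Pi_rep x = \<zero>\<^bsub>BL\<^esub>}"
    unfolding I_eq
  proof (rule F.closed_ideal_generated_least[OF F.kernel_closed_ideal[OF Pi_rep(1) cstar_algebra_BL]], rule subsetI)
    fix s assume "s \<in> twist_gens"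
    then show "s \<in> {x \<in> carrier \<F>. Pi_rep x = \<zero>\<^bsub>BL\<^esub>}"
    proof (rule twist_gens_E)
      fix l k a b d e
      assume lk: "l < k" and a: "homogeneous \<alpha> d a" and b: "homogeneous \<alpha> e b"
        and in': "a \<in> carrier \<A>" "b \<in> carrier \<A>"
        and s: "s = (\<epsilon> l a \<otimes>\<^bsub>\<F>\<^esub> \<epsilon> k b) \<ominus>\<^bsub>\<F>\<^esub> (tw d e \<odot>\<^bsub>\<F>\<^esub> (\<epsilon> k b \<otimes>\<^bsub>\<F>\<^esub> \<epsilon> l a))"
      have P: "\<epsilon> l a \<otimes>\<^bsub>\<F>\<^esub> \<epsilon> k b \<in> carrier \<F>" "\<epsilon> k b \<otimes>\<^bsub>\<F>\<^esub> \<epsilon> l a \<in> carrier \<F>"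
        using in' by (simp_all add: embD(1) F.mult_in)
      have "Pi_rep s = (iota l a \<otimes>\<^bsub>BL\<^esub> iota k b) \<ominus>\<^bsub>BL\<^esub> (tw d e \<odot>\<^bsub>BL\<^esub> (iota k b \<otimes>\<^bsub>BL\<^esub> iota l a))"
        unfolding s using P in' F.star_hom_diff[OF Pi_rep(1) cstar_algebra_BL P(1) F.smult_in[OF P(2)], of "tw d e"]
        by (simp add: PiD embD Pi_rep)
      also have "\<dots> = \<zero>\<^bsub>BL\<^esub>"
        unfolding twisted_commutation[OF lk a b] using in' by (simp add: iotaD(1) BL.mult_in)
      finally show ?thesis using P s by simp
    qed
  qed
  then have "x \<in> {x \<in> carrier \<F>. Pi_rep x = \<zero>\<^bsub>BL\<^esub>}" using assms by (rule subsetD)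
  then show ?thesis by simp
qed

end

section \<open>Ordered words and the states they determine\<close>

context twisted
begin

text \<open>Strict order leaves at most one letter per copy, as in the formula defining the product
  state; homogeneity is what permits letters to be exchanged.\<close>

definition ordered_word :: "(nat \<times> torus_elt) list \<Rightarrow> bool" where
  "ordered_word xs \<longleftrightarrow> sorted_wrt (<) (map fst xs) \<and> (\<forall>x\<in>set xs. \<exists>d. homogeneous \<alpha> d (snd x))"

lemma homogeneous_in: "homogeneous \<alpha> d a \<Longrightarrow> a \<in> carrier \<A>"
  by (simp add: homogeneous_def)

lemma ordered_word_in: "ordered_word xs \<Longrightarrow> snd ` set xs \<subseteq> carrier \<A>"
  by (auto simp: ordered_word_def homogeneous_in)

lemma ordered_word_Cons:
  "ordered_word ((j, a) # xs) \<longleftrightarrow>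
    ordered_word xs \<and> (\<exists>d. homogeneous \<alpha> d a) \<and> (\<forall>i\<in>fst ` set xs. j < i)"
  by (auto simp: ordered_word_def simp del: split_paired_Ex)

lemma word_in: "ordered_word xs \<Longrightarrow> free_word \<A> xs \<in> carrier \<F>"
  by (rule T.free_word_in[OF ordered_word_in])

lemma tw_nonzero: "tw d e \<noteq> 0"
  by (simp add: tw_def)

lemma swap_mod_I:
  assumes lk: "l < k" and a: "homogeneous \<alpha> d a" and b: "homogeneous \<alpha> e b"
  shows "SI.p (\<epsilon> l a \<otimes>\<^bsub>\<F>\<^esub> \<epsilon> k b) = SI.p (tw d e \<odot>\<^bsub>\<F>\<^esub> (\<epsilon> k b \<otimes>\<^bsub>\<F>\<^esub> \<epsilon> l a))"
proof -
  have "\<epsilon> l a \<in> carrier \<F>" "\<epsilon> k b \<in> carrier \<F>"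
    using homogeneous_in[OF a] homogeneous_in[OF b] by (simp_all add: embD(1))
  then show ?thesis
    using twist_gens_I[OF lk a b] I_ideal(3)
      SI.p_eq_iff[of "\<epsilon> l a \<otimes>\<^bsub>\<F>\<^esub> \<epsilon> k b" "tw d e \<odot>\<^bsub>\<F>\<^esub> (\<epsilon> k b \<otimes>\<^bsub>\<F>\<^esub> \<epsilon> l a)"]
    by (auto simp: F.mult_in)
qed

text \<open>One step of insertion sort modulo the ideal: the new letter stays in front, is merged
  with a letter of the same copy, or moves past a smaller index at the cost of a scalar. The bound
  on the indices of \<open>ys\<close> is what allows the smaller letter to be put back in
  front.\<close>

lemma insert_letter:
  assumes "ordered_word xs" and a: "homogeneous \<alpha> d a"
  shows "\<exists>c ys. ordered_word ys \<and> fst ` set ys \<subseteq> insert j (fst ` set xs) \<and>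
    SI.p (\<epsilon> j a \<otimes>\<^bsub>\<F>\<^esub> free_word \<A> xs) = SI.p (c \<odot>\<^bsub>\<F>\<^esub> free_word \<A> ys)"
  using assms(1)
proof (induction xs)
  case Nil
  have "ordered_word [(j, a)]" using a Nil by (simp add: ordered_word_Cons del: split_paired_Ex) blast
  then show ?case
    using homogeneous_in[OF a] by (intro exI[of _ 1] exI[of _ "[(j, a)]"]) (simp add: embD(1) F.mult_in F.one_in)
next
  case (Cons x xs)
  obtain k b where x: "x = (k, b)" by fastforce
  note P = Cons.prems[unfolded x ordered_word_Cons]
  obtain e where b: "homogeneous \<alpha> e b" using P by blast
  have xs: "ordered_word xs" and k: "\<And>i. i \<in> fst ` set xs \<Longrightarrow> k < i" using P by blast+
  have W: "free_word \<A> xs \<in> carrier \<F>" by (rule word_in[OF xs])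
  have aA: "a \<in> carrier \<A>" and bA: "b \<in> carrier \<A>" using homogeneous_in a b by blast+
  have ea: "\<epsilon> j a \<in> carrier \<F>" and eb: "\<epsilon> k b \<in> carrier \<F>" using aA bA by (simp_all add: embD(1))
  note [simp] = W ea eb F.mult_in
  consider "j < k" | "j = k" | "k < j" by linarith
  then show ?case
  proof cases
    case 1
    have "\<forall>i\<in>fst ` set (x # xs). j < i" using 1 k x less_trans by auto
    then have "ordered_word ((j, a) # x # xs)"
      unfolding ordered_word_Cons using Cons.prems a by blast
    then show ?thesis
      by (intro exI[of _ 1] exI[of _ "(j, a) # x # xs"]) (auto simp: x)
  next
    case 2
    have "ordered_word ((j, a \<otimes>\<^bsub>\<A>\<^esub> b) # xs)"
      unfolding ordered_word_Cons using xs homogeneous_mult[OF a b] k 2 by blast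
    moreover have "\<epsilon> j a \<otimes>\<^bsub>\<F>\<^esub> free_word \<A> (x # xs) = free_word \<A> ((j, a \<otimes>\<^bsub>\<A>\<^esub> b) # xs)"
      using 2 aA bA F.mult_assoc[OF ea eb W] by (simp add: x embD(2))
    ultimately show ?thesis
      using T.mult_in[OF aA bA] by (intro exI[of _ 1] exI[of _ "(j, a \<otimes>\<^bsub>\<A>\<^esub> b) # xs"]) (auto simp: embD(1))
  next
    case 3
    obtain c ys where ys: "ordered_word ys" "fst ` set ys \<subseteq> insert j (fst ` set xs)"
      "SI.p (\<epsilon> j a \<otimes>\<^bsub>\<F>\<^esub> free_word \<A> xs) = SI.p (c \<odot>\<^bsub>\<F>\<^esub> free_word \<A> ys)"
      using Cons.IH[OF xs] by blast
    have "k < i" if "i \<in> fst ` set ys" for i using ys(2) that k 3 by blast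
    then have ord: "ordered_word (x # ys)" unfolding x ordered_word_Cons using ys(1) b by blast
    have Y: "free_word \<A> ys \<in> carrier \<F>" by (rule word_in[OF ys(1)])
    \<comment> \<open>The relation has the smaller index k on the left, so moving j to the right
      past k uses it backwards; hence the inverse, and the degrees in the order e, d.\<close>
    let ?t = "1 / tw e d"
    have "SI.p (?t \<odot>\<^bsub>\<F>\<^esub> (\<epsilon> k b \<otimes>\<^bsub>\<F>\<^esub> \<epsilon> j a)) = SI.p (?t \<odot>\<^bsub>\<F>\<^esub> (tw e d \<odot>\<^bsub>\<F>\<^esub> (\<epsilon> j a \<otimes>\<^bsub>\<F>\<^esub> \<epsilon> k b)))"
      using swap_mod_I[OF 3 b a] by (simp del: F.smult_smult flip: SI.p_ops(4))
    then have sw: "SI.p (\<epsilon> j a \<otimes>\<^bsub>\<F>\<^esub> \<epsilon> k b) = SI.p (?t \<odot>\<^bsub>\<F>\<^esub> (\<epsilon> k b \<otimes>\<^bsub>\<F>\<^esub> \<epsilon> j a))"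
      using tw_nonzero[of e d] by simp
    have "SI.p (\<epsilon> j a \<otimes>\<^bsub>\<F>\<^esub> free_word \<A> (x # xs)) = SI.p ((\<epsilon> j a \<otimes>\<^bsub>\<F>\<^esub> \<epsilon> k b) \<otimes>\<^bsub>\<F>\<^esub> free_word \<A> xs)"
      by (simp add: x F.mult_assoc)
    also have "\<dots> = SI.p ((?t \<odot>\<^bsub>\<F>\<^esub> (\<epsilon> k b \<otimes>\<^bsub>\<F>\<^esub> \<epsilon> j a)) \<otimes>\<^bsub>\<F>\<^esub> free_word \<A> xs)"
      using SI.p_ops(2)[of "\<epsilon> j a \<otimes>\<^bsub>\<F>\<^esub> \<epsilon> k b" "free_word \<A> xs"]
        SI.p_ops(2)[of "?t \<odot>\<^bsub>\<F>\<^esub> (\<epsilon> k b \<otimes>\<^bsub>\<F>\<^esub> \<epsilon> j a)" "free_word \<A> xs"] sw by simp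
    also have "(?t \<odot>\<^bsub>\<F>\<^esub> (\<epsilon> k b \<otimes>\<^bsub>\<F>\<^esub> \<epsilon> j a)) \<otimes>\<^bsub>\<F>\<^esub> free_word \<A> xs =
        (?t \<odot>\<^bsub>\<F>\<^esub> \<epsilon> k b) \<otimes>\<^bsub>\<F>\<^esub> (\<epsilon> j a \<otimes>\<^bsub>\<F>\<^esub> free_word \<A> xs)"
      by (simp add: F.smult_mult_left F.mult_assoc)
    also have "SI.p \<dots> = SI.p ((?t \<odot>\<^bsub>\<F>\<^esub> \<epsilon> k b) \<otimes>\<^bsub>\<F>\<^esub> (c \<odot>\<^bsub>\<F>\<^esub> free_word \<A> ys))"
      using SI.p_ops(2)[of "?t \<odot>\<^bsub>\<F>\<^esub> \<epsilon> k b" "\<epsilon> j a \<otimes>\<^bsub>\<F>\<^esub> free_word \<A> xs"]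
        SI.p_ops(2)[of "?t \<odot>\<^bsub>\<F>\<^esub> \<epsilon> k b" "c \<odot>\<^bsub>\<F>\<^esub> free_word \<A> ys"] ys(3) Y by simp
    also have "(?t \<odot>\<^bsub>\<F>\<^esub> \<epsilon> k b) \<otimes>\<^bsub>\<F>\<^esub> (c \<odot>\<^bsub>\<F>\<^esub> free_word \<A> ys) = (?t * c) \<odot>\<^bsub>\<F>\<^esub> free_word \<A> (x # ys)"
      using Y by (simp add: x F.smult_mult_left F.smult_mult_right mult.commute)
    finally have "SI.p (\<epsilon> j a \<otimes>\<^bsub>\<F>\<^esub> free_word \<A> (x # xs)) = SI.p ((?t * c) \<odot>\<^bsub>\<F>\<^esub> free_word \<A> (x # ys))" .
    moreover have "fst ` set (x # ys) \<subseteq> insert j (fst ` set (x # xs))" using ys(2) by auto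
    ultimately show ?thesis using ord by blast
  qed
qed

lemma state_mod_I:
  assumes \<phi>: "is_state \<F> \<phi>" "\<And>x. x \<in> \<I> \<Longrightarrow> \<phi> x = 0"
    and xy: "x \<in> carrier \<F>" "y \<in> carrier \<F>" "SI.p x = SI.p y"
  shows "\<phi> x = \<phi> y"
proof -
  have "\<phi> (x \<ominus>\<^bsub>\<F>\<^esub> y) = \<phi> x - \<phi> y" using \<phi>(1) xy by (simp add: is_state_def F.minus_eq_smult)
  moreover have "\<phi> (x \<ominus>\<^bsub>\<F>\<^esub> y) = 0" using \<phi>(2) SI.p_eq_iff[OF xy(1,2)] xy(3) by blast
  ultimately show ?thesis by simp
qed

lemma state_extensional: "is_state A \<phi> \<Longrightarrow> \<phi> \<in> extensional (carrier A)"
  unfolding is_state_def by (elim conjE)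

text \<open>Modulo the twist relations, homogeneous letters can be moved past each other, so the ordered words span a
  dense subspace.\<close>

lemma states_eqI:
  assumes \<phi>: "is_state \<F> \<phi>" "\<And>x. x \<in> \<I> \<Longrightarrow> \<phi> x = 0"
    and \<psi>: "is_state \<F> \<psi>" "\<And>x. x \<in> \<I> \<Longrightarrow> \<psi> x = 0"
    and eq: "\<And>xs. sorted_wrt (<) (map fst xs) \<Longrightarrow> snd ` set xs \<subseteq> carrier \<A> \<Longrightarrow>
      \<phi> (free_word \<A> xs) = \<psi> (free_word \<A> xs)"
  shows "\<phi> = \<psi>"
proof -
  let ?W = "{x \<in> carrier \<F>. \<phi> x = \<psi> x}"
  \<comment> \<open>All elements congruent to multiples of ordered words, rather than the words
    alone, so that reordering after a multiplication by a letter does not leave the set.\<close>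
  let ?D = "{x \<in> carrier \<F>. \<exists>c xs. ordered_word xs \<and> SI.p x = SI.p (c \<odot>\<^bsub>\<F>\<^esub> free_word \<A> xs)}"
  let ?X = "{\<epsilon> j a | j a. a \<in> gens}"
  have gA: "a \<in> carrier \<A>" if "a \<in> gens" for a using that gens_in by blast
  have "?W = carrier \<F>"
  proof (rule F.closed_span_eq[where X = ?X and D = ?D])
    show "M = carrier \<F>"
      if M: "closed_subspace \<F> M" "\<one>\<^bsub>\<F>\<^esub> \<in> M" "\<And>x y. x \<in> M \<Longrightarrow> y \<in> M \<Longrightarrow> x \<otimes>\<^bsub>\<F>\<^esub> y \<in> M" "?X \<subseteq> M" for M
    proof (rule T.FP_generated[OF M(1,2,3)])
      fix j a assume a: "a \<in> carrier \<A>"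
      have "{a \<in> carrier \<A>. \<epsilon> j a \<in> M} = carrier \<A>"
      proof (rule torus_generated)
        show "closed_subspace \<A> {a \<in> carrier \<A>. \<epsilon> j a \<in> M}"
          by (rule T.closed_subspace_vimage[OF T.star_hom_cont_linear[OF emb T.cstar_algebra_FP] T.cstar_algebra_FP M(1)])
        show "\<one>\<^bsub>\<A>\<^esub> \<in> {a \<in> carrier \<A>. \<epsilon> j a \<in> M}" using M(2) by (simp add: T.one_in embD(6))
        show "x \<otimes>\<^bsub>\<A>\<^esub> y \<in> {a \<in> carrier \<A>. \<epsilon> j a \<in> M}"
          if "x \<in> {a \<in> carrier \<A>. \<epsilon> j a \<in> M}" "y \<in> {a \<in> carrier \<A>. \<epsilon> j a \<in> M}" for x y
          using that M(3) by (simp add: T.mult_in embD(2))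
        show "gens \<subseteq> {a \<in> carrier \<A>. \<epsilon> j a \<in> M}" using M(4) gA by blast
      qed
      then show "\<epsilon> j a \<in> M" using a by blast
    qed
    show "?X \<subseteq> carrier \<F>" using gA embD(1) by blast
    show "?D \<subseteq> carrier \<F>" by blast
    have "ordered_word []" by (simp add: ordered_word_def)
    moreover have "SI.p \<one>\<^bsub>\<F>\<^esub> = SI.p (1 \<odot>\<^bsub>\<F>\<^esub> free_word \<A> [])" by (simp add: F.one_in)
    ultimately show "\<one>\<^bsub>\<F>\<^esub> \<in> ?D" using F.one_in by blast
    show "closed_subspace \<F> ?W"
      by (rule F.closed_subspace_functional_eq[OF F.state_bounded[OF \<phi>(1)] F.state_bounded[OF \<psi>(1)]])
    show "?D \<subseteq> ?W"
    proof
      fix x assume "x \<in> ?D"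
      then obtain c xs where x: "x \<in> carrier \<F>" "ordered_word xs" "SI.p x = SI.p (c \<odot>\<^bsub>\<F>\<^esub> free_word \<A> xs)" by blast
      have w: "free_word \<A> xs \<in> carrier \<F>" by (rule word_in[OF x(2)])
      have "\<phi> (free_word \<A> xs) = \<psi> (free_word \<A> xs)"
        using eq ordered_word_in[OF x(2)] x(2) by (simp add: ordered_word_def)
      then have "\<phi> (c \<odot>\<^bsub>\<F>\<^esub> free_word \<A> xs) = \<psi> (c \<odot>\<^bsub>\<F>\<^esub> free_word \<A> xs)"
        using \<phi>(1) \<psi>(1) w by (simp add: is_state_def)
      then have "\<phi> x = \<psi> x"
        using state_mod_I[OF \<phi> x(1) F.smult_in[OF w] x(3)] state_mod_I[OF \<psi> x(1) F.smult_in[OF w] x(3)] by simp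
      then show "x \<in> ?W" using x(1) by simp
    qed
    fix g x assume "g \<in> ?X" and "x \<in> ?D"
    then obtain j a where g: "g = \<epsilon> j a" "a \<in> gens" by blast
    obtain c xs where x: "x \<in> carrier \<F>" "ordered_word xs" "SI.p x = SI.p (c \<odot>\<^bsub>\<F>\<^esub> free_word \<A> xs)"
      using \<open>x \<in> ?D\<close> by blast
    obtain d where d: "homogeneous \<alpha> d a" using gens_homogeneous[OF g(2)] by blast
    obtain c' ys where ys: "ordered_word ys"
      "SI.p (\<epsilon> j a \<otimes>\<^bsub>\<F>\<^esub> free_word \<A> xs) = SI.p (c' \<odot>\<^bsub>\<F>\<^esub> free_word \<A> ys)"
      using insert_letter[OF x(2) d] by blast
    have w: "free_word \<A> xs \<in> carrier \<F>" "free_word \<A> ys \<in> carrier \<F>" "\<epsilon> j a \<in> carrier \<F>"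
      using word_in[OF x(2)] word_in[OF ys(1)] embD(1)[OF gA[OF g(2)]] by blast+
    have "SI.p (g \<otimes>\<^bsub>\<F>\<^esub> x) = SI.p g \<otimes>\<^bsub>SI.Q\<^esub> SI.p (c \<odot>\<^bsub>\<F>\<^esub> free_word \<A> xs)"
      using SI.p_ops(2)[of g x] w x(1,3) g by simp
    also have "\<dots> = SI.p (c \<odot>\<^bsub>\<F>\<^esub> (\<epsilon> j a \<otimes>\<^bsub>\<F>\<^esub> free_word \<A> xs))"
      using w by (simp add: g SI.p_ops(2) F.smult_mult_right)
    also have "\<dots> = c \<odot>\<^bsub>SI.Q\<^esub> SI.p (c' \<odot>\<^bsub>\<F>\<^esub> free_word \<A> ys)"
      using w by (simp add: F.mult_in flip: ys(2) SI.p_ops(4))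
    also have "\<dots> = SI.p ((c * c') \<odot>\<^bsub>\<F>\<^esub> free_word \<A> ys)"
      using SI.p_ops(4)[OF F.smult_in[OF w(2)], of c c'] w by simp
    finally show "g \<otimes>\<^bsub>\<F>\<^esub> x \<in> ?D" using ys(1) F.mult_in[of g x] w(3) x(1) g(1) by blast
  qed
  then have "\<phi> x = \<psi> x" if "x \<in> carrier \<F>" for x using that by blast
  then show ?thesis
    by (rule extensionalityI[OF state_extensional[OF \<phi>(1)] state_extensional[OF \<psi>(1)]])
qed

section \<open>The vacuum state, the product state and spreadability\<close>

definition \<Phi> :: "torus_elt free_product_elt \<Rightarrow> complex" where
  "\<Phi> = (\<lambda>x\<in>carrier \<F>. ip (Pi_rep x \<xi>) \<xi>)"

lemma \<Phi>_state: "is_state \<F> \<Phi>"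
  unfolding \<Phi>_def by (rule F.vector_state[OF Pi_rep(1)]) simp_all

lemma \<Phi>_I: assumes "x \<in> \<I>" shows "\<Phi> x = 0"
proof -
  have "x \<in> carrier \<F>" using F.ideal_simps(1)[OF I_ideal(1)] assms by blast
  then show ?thesis using Pi_I[OF assms] by (simp add: \<Phi>_def BL_apply ip_def)
qed

lemma Pi_word:
  assumes "snd ` set xs \<subseteq> carrier \<A>"
  shows "Pi_rep (free_word \<A> xs) = cstar_prod BL (map (\<lambda>(j, a). iota j a) xs)"
proof -
  have "map (\<lambda>(j, a). Pi_rep (\<epsilon> j a)) xs = map (\<lambda>(j, a). iota j a) xs"
  proof (rule map_cong[OF HOL.refl])
    fix x assume "x \<in> set xs"
    then have "snd x \<in> carrier \<A>" using assms by blast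
    then show "(case x of (j, a) \<Rightarrow> Pi_rep (\<epsilon> j a)) = (case x of (j, a) \<Rightarrow> iota j a)"
      unfolding case_prod_beta by (rule Pi_rep(2))
  qed
  then show ?thesis unfolding T.star_hom_free_word[OF Pi_rep(1) assms] by (rule arg_cong[where f = "cstar_prod BL"])
qed

text \<open>Modulo the component along \<open>\<xi>\<close>, the vector to the right of the first letter is supported outside the
  subgroup of the dual group seen by that letter.\<close>

lemma word_vector:
  assumes "sorted_wrt (<) (map fst xs)" "snd ` set xs \<subseteq> carrier \<A>" "\<And>j. j \<in> fst ` set xs \<Longrightarrow> n \<le> j"
  shows "Pi_rep (free_word \<A> xs) \<xi> \<in> supp {\<gamma>. \<forall>m < 2 * n. Poly_Mapping.lookup \<gamma> m = 0} \<and>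
    Pi_rep (free_word \<A> xs) \<xi> (en 0) = (\<Prod>(j, a)\<leftarrow>xs. canonical_trace \<alpha> a)"
  using assms
proof (induction xs arbitrary: n)
  case Nil
  show ?case by (auto simp: PiD(6) BL_apply supp_def \<xi>_def delta_en)
next
  case (Cons x xs)
  obtain j a where x: "x = (j, a)" by fastforce
  have a: "a \<in> carrier \<A>" and xs: "snd ` set xs \<subseteq> carrier \<A>" and nj: "n \<le> j"
    using Cons.prems(2,3) x by auto
  \<comment> \<open>The remaining letters belong to later copies, so the induction hypothesis with
    bound \<open>Suc j\<close> shows that \<open>?y\<close> has no degrees in the copies 0 to
    j.\<close>
  have sj: "Suc j \<le> i" if "i \<in> fst ` set xs" for i using Cons.prems(1) x that by auto
  let ?y = "Pi_rep (free_word \<A> xs) \<xi>"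
  let ?E = "\<lambda>n. {\<gamma> :: dual. \<forall>m < 2 * n. Poly_Mapping.lookup \<gamma> m = 0}"
  have IH: "?y \<in> supp (?E (Suc j))" "?y (en 0) = (\<Prod>(j, a)\<leftarrow>xs. canonical_trace \<alpha> a)"
    using Cons.IH[OF _ xs sj] Cons.prems(1) by simp_all
  have y: "?y \<in> l2" using IH(1) by (simp add: supp_def)
  have eq: "Pi_rep (free_word \<A> (x # xs)) \<xi> = iota j a ?y"
    using a xs by (simp add: x PiD(2) embD(1) T.free_word_in Pi_rep(2) BL_apply)
  have "?y \<in> supp (?E n)"
  proof -
    have "?E (Suc j) \<subseteq> ?E n" using nj by auto
    then show ?thesis using IH(1) unfolding supp_def by blast
  qed
  then have 1: "iota j a ?y \<in> supp (?E n)"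
    by (rule iota_supp[OF _ a, rotated]) (use nj in \<open>auto simp: lookup_add lookup_minus lookup_single when_def\<close>)
  \<comment> \<open>Degrees with a nonzero entry outside copy j. Copy j acts within this set, and 0
    is not in it, whereas every nonzero degree occurring in \<open>?y\<close> is. So the part of
    \<open>?y\<close> away from the vacuum contributes nothing to the value at 0.\<close>
  let ?C = "{\<gamma> :: dual. \<exists>m. m \<noteq> 2 * j \<and> m \<noteq> Suc (2 * j) \<and> Poly_Mapping.lookup \<gamma> m \<noteq> 0}"
  let ?c = "?y (en 0)"
  define z where "z = (\<lambda>n. ?y n - ?c * \<xi> n)"
  have zl: "z \<in> l2" unfolding z_def by (rule l2_diff(1)[OF y l2_scale(1)]) simp
  have "z \<in> supp ?C"
    unfolding supp_def
  proof (intro CollectI conjI allI impI zl)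
    fix \<gamma> :: dual assume g: "\<gamma> \<notin> ?C"
    show "z (en \<gamma>) = 0"
    proof (cases "\<gamma> \<in> ?E (Suc j)")
      case True
      have "Poly_Mapping.lookup \<gamma> m = 0" for m
        using True g by (cases "m = 2 * j \<or> m = Suc (2 * j)") auto
      then have "\<gamma> = 0" by (intro poly_mapping_eqI) simp
      then show ?thesis by (simp add: z_def \<xi>_def delta_en)
    next
      case False
      then have "\<gamma> \<noteq> 0" by auto
      then show ?thesis using False IH(1) by (simp add: z_def \<xi>_def delta_en supp_def)
    qed
  qed
  then have "iota j a z \<in> supp ?C"
    by (rule iota_supp[OF _ a, rotated])
      (auto simp: lookup_add lookup_minus lookup_single when_def intro!: exI)
  then have z0: "iota j a z (en 0) = 0" by (simp add: supp_def)
  have "?y = (\<lambda>n. ?c * \<xi> n + z n)" by (simp add: z_def)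
  then have "iota j a ?y = iota j a (\<lambda>n. ?c * \<xi> n + z n)" by (rule arg_cong)
  also have "\<dots> = (\<lambda>n. ?c * iota j a \<xi> n + iota j a z n)"
    unfolding BL_D(2)[OF iotaD(1)[OF a] l2_scale(1)[OF \<xi>_in(1)] zl] BL_D(3)[OF iotaD(1)[OF a] \<xi>_in(1)]
    by (rule HOL.refl)
  finally have "iota j a ?y = (\<lambda>n. ?c * iota j a \<xi> n + iota j a z n)" .
  then have "iota j a ?y (en 0) = ?c * iota j a \<xi> (en 0)" using z0 by simp
  moreover have "iota j a \<xi> (en 0) = canonical_trace \<alpha> a"
    unfolding canonical_trace_eq[of j] using a by (simp add: vtr_def \<xi>_def)
  ultimately show ?case unfolding eq using 1 IH(2) by (simp add: x)
qed

lemma \<Phi>_ordered_word: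
  assumes "sorted_wrt (<) (map fst xs)" "snd ` set xs \<subseteq> carrier \<A>"
  shows "\<Phi> (free_word \<A> xs) = (\<Prod>(j, a)\<leftarrow>xs. canonical_trace \<alpha> a)"
  using word_vector[OF assms, of 0] T.free_word_in[OF assms(2)] by (simp add: \<Phi>_def \<xi>_def)

text \<open>Existence is the vacuum state passed to the quotient. For uniqueness a competitor is
  pulled back to the free product, where it vanishes on the ideal and agrees with the vacuum state
  on ordered words.\<close>

lemma product_trace:
  "is_state SI.Q (product_trace \<alpha> tw)" "x \<in> carrier \<F> \<Longrightarrow> product_trace \<alpha> tw (SI.p x) = \<Phi> x"
proof -
  obtain \<psi> where \<psi>: "is_state SI.Q \<psi>" "\<And>x. x \<in> carrier \<F> \<Longrightarrow> \<psi> (SI.p x) = \<Phi> x"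
    using SI.state_quotient_iff[OF \<Phi>_state \<Phi>_I] by blast
  have "product_trace \<alpha> tw = \<psi>"
    unfolding product_trace_def twisted_tensor_product_def twist_quotient_map_def
  proof (rule the_equality)
    show "is_state SI.Q \<psi> \<and> (\<forall>xs. sorted_wrt (<) (map fst xs) \<and> snd ` set xs \<subseteq> carrier \<A> \<longrightarrow>
        \<psi> (SI.p (free_word \<A> xs)) = (\<Prod>(j, a)\<leftarrow>xs. canonical_trace \<alpha> a))"
    proof (intro conjI allI impI \<psi>(1), elim conjE)
      fix xs :: "(nat \<times> torus_elt) list"
      assume xs: "sorted_wrt (<) (map fst xs)" "snd ` set xs \<subseteq> carrier \<A>"
      show "\<psi> (SI.p (free_word \<A> xs)) = (\<Prod>(j, a)\<leftarrow>xs. canonical_trace \<alpha> a)"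
        unfolding \<psi>(2)[OF T.free_word_in[OF xs(2)]] by (rule \<Phi>_ordered_word[OF xs])
    qed
    fix \<omega> assume \<omega>: "is_state SI.Q \<omega> \<and> (\<forall>xs. sorted_wrt (<) (map fst xs) \<and> snd ` set xs \<subseteq> carrier \<A> \<longrightarrow>
        \<omega> (SI.p (free_word \<A> xs)) = (\<Prod>(j, a)\<leftarrow>xs. canonical_trace \<alpha> a))"
    let ?\<omega> = "compose (carrier \<F>) \<omega> SI.p"
    have "?\<omega> = \<Phi>"
    proof (rule states_eqI[OF SI.state_lift[OF conjunct1[OF \<omega>]] \<Phi>_state \<Phi>_I])
      fix xs :: "(nat \<times> torus_elt) list"
      assume xs: "sorted_wrt (<) (map fst xs)" "snd ` set xs \<subseteq> carrier \<A>"
      show "?\<omega> (free_word \<A> xs) = \<Phi> (free_word \<A> xs)"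
        unfolding compose_eq[OF T.free_word_in[OF xs(2)]] \<Phi>_ordered_word[OF xs]
        by (rule mp[OF spec[OF conjunct2[OF \<omega>]] conjI[OF xs]])
    qed
    then have eq: "\<omega> (SI.p x) = \<psi> (SI.p x)" if "x \<in> carrier \<F>" for x
      using fun_cong[of ?\<omega> \<Phi> x] unfolding compose_eq[OF that] \<psi>(2)[OF that] by blast
    show "\<omega> = \<psi>"
    proof (rule extensionalityI[OF state_extensional[OF conjunct1[OF \<omega>]] state_extensional[OF \<psi>(1)]])
      fix X assume "X \<in> carrier SI.Q"
      then obtain x where "x \<in> carrier \<F>" "X = SI.p x" unfolding SI.carrier_Q by blast
      then show "\<omega> X = \<psi> X" using eq by simp
    qed
  qed
  then show "is_state SI.Q (product_trace \<alpha> tw)" "x \<in> carrier \<F> \<Longrightarrow> product_trace \<alpha> tw (SI.p x) = \<Phi> x"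
    using \<psi> by simp_all
qed

lemma process_distribution_eq: "process_distribution \<A> ell2 iota \<xi> = \<Phi>"
  unfolding process_distribution_def
proof (rule the_equality)
  have w: "\<Phi> (free_word \<A> xs) = ip (cstar_prod BL (map (\<lambda>(j, a). iota j a) xs) \<xi>) \<xi>"
    if "snd ` set xs \<subseteq> carrier \<A>" for xs
    using that T.free_word_in[OF that] by (simp add: \<Phi>_def Pi_word)
  then show "is_state \<F> \<Phi> \<and> (\<forall>xs. snd ` set xs \<subseteq> carrier \<A> \<longrightarrow> \<Phi> (free_word \<A> xs) =
      cinner ell2 (cstar_prod BL (map (\<lambda>(j, a). iota j a) xs) \<xi>) \<xi>)"
    using \<Phi>_state by simp
  fix \<phi> assume \<phi>: "is_state \<F> \<phi> \<and> (\<forall>xs. snd ` set xs \<subseteq> carrier \<A> \<longrightarrow> \<phi> (free_word \<A> xs) =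
      cinner ell2 (cstar_prod BL (map (\<lambda>(j, a). iota j a) xs) \<xi>) \<xi>)"
  have "{x \<in> carrier \<F>. \<phi> x = \<Phi> x} = carrier \<F>"
  proof (rule T.FP_spanned)
    show "closed_subspace \<F> {x \<in> carrier \<F>. \<phi> x = \<Phi> x}"
      by (rule F.closed_subspace_functional_eq[OF F.state_bounded[OF conjunct1[OF \<phi>]] F.state_bounded[OF \<Phi>_state]])
    fix xs :: "(nat \<times> torus_elt) list" assume "snd ` set xs \<subseteq> carrier \<A>"
    then show "free_word \<A> xs \<in> {x \<in> carrier \<F>. \<phi> x = \<Phi> x}"
      using \<phi> w T.free_word_in by simp
  qed
  then have "\<phi> x = \<Phi> x" if "x \<in> carrier \<F>" for x using that by blast
  then show "\<phi> = \<Phi>"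
    by (rule extensionalityI[OF state_extensional[OF conjunct1[OF \<phi>]] state_extensional[OF \<Phi>_state]])
qed

lemma distribution_eq_compose:
  "\<Phi> = compose (carrier \<F>) (product_trace \<alpha> tw) (twist_quotient_map \<alpha> tw)"
proof (rule extensionalityI)
  show "\<Phi> \<in> extensional (carrier \<F>)" by (simp add: \<Phi>_def)
  show "\<Phi> x = compose (carrier \<F>) (product_trace \<alpha> tw) (twist_quotient_map \<alpha> tw) x" if "x \<in> carrier \<F>" for x
    using that product_trace(2)[OF that] by (simp add: compose_def twist_quotient_map_def)
qed (simp add: compose_def)

lemma factorizes: "factorizes_via \<A> ell2 iota \<xi> \<I> (product_trace \<alpha> tw)"
  unfolding factorizes_via_def
  using product_trace(1) process_distribution_eq distribution_eq_compose by (simp add: twist_quotient_map_def)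

lemma is_spreadable: "spreadable \<A> ell2 iota \<xi>"
  unfolding spreadable_def process_distribution_eq
proof (intro allI impI)
  fix f :: "nat \<Rightarrow> nat" assume f: "strict_mono f"
  let ?h = "index_endo \<A> f"
  note h = T.index_endo(1)[of f] and he = T.index_endo(2)[of _ f]
  note H = star_homD[OF h]
  have hI: "?h x \<in> \<I>" if x: "x \<in> \<I>" for x
  proof -
    have "\<I> \<subseteq> {x \<in> carrier \<F>. ?h x \<in> \<I>}"
      unfolding I_eq[of] 
    proof (rule F.closed_ideal_generated_least)
      note V = F.vimage_closed_ideal[OF h T.cstar_algebra_FP I_ideal(1,2)]
      show "ideal {x \<in> carrier \<F>. ?h x \<in> closed_ideal_generated \<F> twist_gens} \<F>"
        "closedin (cstar_topology \<F>) {x \<in> carrier \<F>. ?h x \<in> closed_ideal_generated \<F> twist_gens}"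
        using V by (simp_all add: I_eq)
      show "twist_gens \<subseteq> {x \<in> carrier \<F>. ?h x \<in> closed_ideal_generated \<F> twist_gens}"
      proof
        fix s assume s: "s \<in> twist_gens"
        then show "s \<in> {x \<in> carrier \<F>. ?h x \<in> closed_ideal_generated \<F> twist_gens}"
        proof (rule twist_gens_E)
          fix l k a b d e
          assume lk: "l < k" and a: "homogeneous \<alpha> d a" and b: "homogeneous \<alpha> e b"
            and in': "a \<in> carrier \<A>" "b \<in> carrier \<A>"
            and s': "s = (\<epsilon> l a \<otimes>\<^bsub>\<F>\<^esub> \<epsilon> k b) \<ominus>\<^bsub>\<F>\<^esub> (tw d e \<odot>\<^bsub>\<F>\<^esub> (\<epsilon> k b \<otimes>\<^bsub>\<F>\<^esub> \<epsilon> l a))"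
          have P: "\<epsilon> l a \<otimes>\<^bsub>\<F>\<^esub> \<epsilon> k b \<in> carrier \<F>" "\<epsilon> k b \<otimes>\<^bsub>\<F>\<^esub> \<epsilon> l a \<in> carrier \<F>"
            using in' by (simp_all add: embD(1) F.mult_in)
          have "?h s = (\<epsilon> (f l) a \<otimes>\<^bsub>\<F>\<^esub> \<epsilon> (f k) b) \<ominus>\<^bsub>\<F>\<^esub> (tw d e \<odot>\<^bsub>\<F>\<^esub> (\<epsilon> (f k) b \<otimes>\<^bsub>\<F>\<^esub> \<epsilon> (f l) a))"
            unfolding s' using P in' F.star_hom_diff[OF h T.cstar_algebra_FP P(1) F.smult_in[OF P(2)], of "tw d e"]
            by (simp add: H embD(1) he)
          \<comment> \<open>Strict monotonicity preserves l < k and hence the orientation of the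
            relation.\<close>
          then have "?h s \<in> twist_gens"
            using twist_gens_I[OF strict_monoD[OF f lk] a b] by simp
          then show "s \<in> {x \<in> carrier \<F>. ?h x \<in> closed_ideal_generated \<F> twist_gens}"
            using s twist_gens_in I_ideal(3) unfolding I_eq by blast
        qed
      qed
    qed
    then show ?thesis using x by (blast dest: subsetD)
  qed
  let ?\<phi> = "compose (carrier \<F>) \<Phi> ?h"
  have st: "is_state \<F> ?\<phi>"
    unfolding is_state_def
  proof (intro conjI ballI allI)
    note D = \<Phi>_state[unfolded is_state_def]
    show "?\<phi> \<in> extensional (carrier \<F>)" by (simp add: compose_def)
    show "?\<phi> \<one>\<^bsub>\<F>\<^esub> = 1" using D by (simp add: compose_def F.one_in H(6))
    fix x assume x: "x \<in> carrier \<F>"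
    show "?\<phi> (c \<odot>\<^bsub>\<F>\<^esub> x) = c * ?\<phi> x" for c using D x by (simp add: compose_def H)
    show "?\<phi> (star \<F> x \<otimes>\<^bsub>\<F>\<^esub> x) \<in> \<real>\<^sub>\<ge>\<^sub>0" using D x by (simp add: compose_def H F.mult_in)
    fix y assume y: "y \<in> carrier \<F>"
    show "?\<phi> (x \<oplus>\<^bsub>\<F>\<^esub> y) = ?\<phi> x + ?\<phi> y" using D x y by (simp add: compose_def H)
  qed
  show "?\<phi> = \<Phi>"
  proof (rule states_eqI[OF st _ \<Phi>_state \<Phi>_I])
    show "?\<phi> x = 0" if "x \<in> \<I>" for x
      using that hI[OF that] F.ideal_simps(1)[OF I_ideal(1)] \<Phi>_I by (auto simp: compose_def)
    fix xs :: "(nat \<times> torus_elt) list"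
    assume xs: "sorted_wrt (<) (map fst xs)" "snd ` set xs \<subseteq> carrier \<A>"
    let ?ys = "map (\<lambda>(j, a). (f j, a)) xs"
    have "map fst ?ys = map f (map fst xs)" by (simp add: o_def case_prod_beta)
    moreover have "sorted_wrt (\<lambda>x y. f x < f y) (map fst xs)"
      by (rule sorted_wrt_mono_rel[OF _ xs(1)]) (rule strict_monoD[OF f])
    ultimately have ys: "sorted_wrt (<) (map fst ?ys)" "snd ` set ?ys \<subseteq> carrier \<A>"
      using xs(2) by (simp_all only: sorted_wrt_map set_map image_image case_prod_beta snd_conv)
    have "map (\<lambda>(j, a). ?h (\<epsilon> j a)) xs = map ((\<lambda>(j, a). \<epsilon> j a) \<circ> (\<lambda>(j, a). (f j, a))) xs"
    proof (rule map_cong[OF HOL.refl])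
      fix x assume "x \<in> set xs"
      then have "snd x \<in> carrier \<A>" using xs(2) by blast
      then show "(case x of (j, a) \<Rightarrow> ?h (\<epsilon> j a)) = ((\<lambda>(j, a). \<epsilon> j a) \<circ> (\<lambda>(j, a). (f j, a))) x"
        unfolding case_prod_beta o_def fst_conv snd_conv by (rule he)
    qed
    then have "?h (free_word \<A> xs) = free_word \<A> ?ys"
      unfolding T.star_hom_free_word[OF h xs(2)] unfolding free_word_def map_map
      by (rule arg_cong[where f = "cstar_prod \<F>"])
    then have "?\<phi> (free_word \<A> xs) = \<Phi> (free_word \<A> ?ys)"
      unfolding compose_eq[OF T.free_word_in[OF xs(2)]] by (rule arg_cong[where f = \<Phi>])
    also have "\<dots> = (\<Prod>(j, a)\<leftarrow>?ys. canonical_trace \<alpha> a)" by (rule \<Phi>_ordered_word[OF ys])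
    also have "map (\<lambda>(j, a). canonical_trace \<alpha> a) ?ys = map (\<lambda>(j, a). canonical_trace \<alpha> a) xs"
      unfolding map_map o_def case_prod_beta fst_conv snd_conv by (rule HOL.refl)
    also have "prod_list \<dots> = \<Phi> (free_word \<A> xs)" by (rule \<Phi>_ordered_word[OF xs, symmetric])
    finally show "?\<phi> (free_word \<A> xs) = \<Phi> (free_word \<A> xs)" .
  qed
qed

end

section \<open>Cyclicity of the vacuum\<close>

lemma hilbert_dist_ell2:
  "hilbert_dist ell2 x y = (if x \<in> l2 \<and> y \<in> l2 then l2norm (\<lambda>n. x n - y n) else 0)"
  by (simp add: hilbert_dist_def hnorm_ell2 l2_diff(1))

lemma Metric_ell2: "Metric_space l2 (hilbert_dist ell2)"
proof
  show "hilbert_dist ell2 x y = hilbert_dist ell2 y x" for x y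
    by (simp add: hilbert_dist_ell2 l2norm_def norm_minus_commute)
  show "0 \<le> hilbert_dist ell2 x y" for x y
    by (simp add: hilbert_dist_ell2 l2norm_nonneg l2_diff(1))
  show "hilbert_dist ell2 x y = 0 \<longleftrightarrow> x = y" if "x \<in> l2" "y \<in> l2" for x y
    using that l2norm_eq_0[OF l2_diff(1)[OF that]] by (simp add: hilbert_dist_ell2 fun_eq_iff)
  show "hilbert_dist ell2 x z \<le> hilbert_dist ell2 x y + hilbert_dist ell2 y z"
    if "x \<in> l2" "y \<in> l2" "z \<in> l2" for x y z
    using that l2_add(2)[OF l2_diff(1)[OF that(1,2)] l2_diff(1)[OF that(2,3)]] by (simp add: hilbert_dist_ell2)
qed

context twisted
begin

definition gen_alg :: "((nat \<Rightarrow> complex) \<Rightarrow> nat \<Rightarrow> complex) set" where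
  "gen_alg = cstar_generated BL (\<Union>j. iota j ` carrier \<A>)"

text \<open>Membership in the carrier is recorded next to membership in the generated algebra,
  because the algebra laws of \<open>BL\<close> ask for it.\<close>

definition orbit :: "(nat \<Rightarrow> complex) set" where
  "orbit = {T \<xi> |T. T \<in> gen_alg \<and> T \<in> carrier BL}"

lemma orbitI: "T \<in> gen_alg \<Longrightarrow> T \<in> carrier BL \<Longrightarrow> x = T \<xi> \<Longrightarrow> x \<in> orbit"
  by (auto simp: orbit_def)

lemma orbitE: assumes "x \<in> orbit" obtains T where "T \<in> gen_alg" "T \<in> carrier BL" "x = T \<xi>"
  using assms unfolding orbit_def by blast

lemma gen_alg_closed:
  "S \<in> gen_alg \<Longrightarrow> T \<in> gen_alg \<Longrightarrow> S \<otimes>\<^bsub>BL\<^esub> T \<in> gen_alg"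
  "S \<in> gen_alg \<Longrightarrow> T \<in> gen_alg \<Longrightarrow> S \<oplus>\<^bsub>BL\<^esub> T \<in> gen_alg"
  "S \<in> gen_alg \<Longrightarrow> c \<odot>\<^bsub>BL\<^esub> S \<in> gen_alg" "\<one>\<^bsub>BL\<^esub> \<in> gen_alg"
  unfolding gen_alg_def cstar_generated_def
  using subringE(3,6,7)[where R = BL] by auto

lemma iota_gen_alg: "a \<in> carrier \<A> \<Longrightarrow> iota j a \<in> gen_alg"
  unfolding gen_alg_def cstar_generated_def by (auto simp: UN_subset_iff image_subset_iff)

lemma orbit_scale: assumes "x \<in> orbit" shows "(\<lambda>n. c * x n) \<in> orbit"
proof -
  obtain T where T: "T \<in> gen_alg" "T \<in> carrier BL" "x = T \<xi>" using assms by (auto simp: orbit_def)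
  show ?thesis by (rule orbitI[OF gen_alg_closed(3)[OF T(1)] BL.smult_in[OF T(2)]]) (simp add: BL_apply T)
qed

lemma orbit_add: assumes "x \<in> orbit" "y \<in> orbit" shows "(\<lambda>n. x n + y n) \<in> orbit"
proof -
  obtain S T where T: "S \<in> gen_alg" "S \<in> carrier BL" "x = S \<xi>" "T \<in> gen_alg" "T \<in> carrier BL" "y = T \<xi>"
    using assms by (auto simp: orbit_def)
  show ?thesis
    by (rule orbitI[OF gen_alg_closed(2)[OF T(1,4)] ring.ring_simprules(1)[OF BL.ring_A T(2,5)]]) (simp add: BL_apply T)
qed

lemma orbit_iota: assumes "x \<in> orbit" "a \<in> carrier \<A>" shows "iota j a x \<in> orbit"
proof -
  obtain T where T: "T \<in> gen_alg" "T \<in> carrier BL" "x = T \<xi>" using assms by (auto simp: orbit_def)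
  show ?thesis
    by (rule orbitI[OF gen_alg_closed(1)[OF iota_gen_alg[OF assms(2), of j] T(1)] BL.mult_in[OF iotaD(1)[OF assms(2)] T(2)]])
      (simp add: BL_apply T)
qed

lemma orbit_Lop: assumes "x \<in> orbit" shows "Lop k x \<in> orbit" "star BL (Lop k) x \<in> orbit"
proof -
  consider j where "k = 2 * j" | j where "k = Suc (2 * j)" by (metis evenE oddE Suc_eq_plus1)
  then have "Lop k x \<in> orbit \<and> star BL (Lop k) x \<in> orbit"
    using orbit_iota[OF assms] T.star_in u_in w_in iota(2,3) iota_star by cases metis+
  then show "Lop k x \<in> orbit" "star BL (Lop k) x \<in> orbit" by blast+
qed

text \<open>A generator moves a basis vector by one unit up to a phase, and multiplying by the
  inverse phase leaves the next basis vector; adjoints serve the negative direction.\<close>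

lemma delta_orbit_step:
  assumes "delta \<gamma> \<in> orbit"
  shows "delta (\<gamma> + Poly_Mapping.single k m) \<in> orbit"
proof (induction m rule: int_induct[where k = 0])
  case base
  then show ?case using assms by simp
next
  case (step1 i)
  let ?g = "\<gamma> + Poly_Mapping.single k i"
  have "?g + Poly_Mapping.single k 1 = \<gamma> + Poly_Mapping.single k (i + 1)" by (simp only: add.assoc single_add)
  then have "delta (\<gamma> + Poly_Mapping.single k (i + 1)) = delta (?g + Poly_Mapping.single k 1)"
    by (rule arg_cong[OF HOL.sym])
  also have "\<dots> = (\<lambda>n. cis (- (2 * pi * lin (th k) ?g)) * Lop k (delta ?g) n)"
    by (simp add: char_shift_delta cis_mult flip: mult.assoc)
  finally show ?case using orbit_scale[OF orbit_Lop(1)[OF step1(2)]] by simp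
next
  case (step2 i)
  let ?g = "\<gamma> + Poly_Mapping.single k i"
  have "?g - Poly_Mapping.single k 1 = \<gamma> + Poly_Mapping.single k (i - 1)" by (simp only: add_diff_eq[symmetric] single_diff)
  then have "delta (\<gamma> + Poly_Mapping.single k (i - 1)) = delta (?g - Poly_Mapping.single k 1)"
    by (rule arg_cong[OF HOL.sym])
  also have "\<dots> =
      (\<lambda>n. cis (2 * pi * lin (th k) (?g - Poly_Mapping.single k 1)) * star BL (Lop k) (delta ?g) n)"
    by (simp add: char_shift_star_delta cis_mult flip: mult.assoc)
  finally show ?case using orbit_scale[OF orbit_Lop(2)[OF step2(2)]] by simp
qed

lemma delta_orbit: "delta \<gamma> \<in> orbit"
proof -
  have 0: "delta 0 \<in> orbit"
    by (rule orbitI[OF gen_alg_closed(4) BL.one_in]) (simp add: BL_apply flip: \<xi>_def)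
  have "delta (\<Sum>w\<in>S. Poly_Mapping.single w (Poly_Mapping.lookup \<gamma> w)) \<in> orbit" if "finite S" for S
    using that
  proof induction
    case (insert w S)
    then show ?case using delta_orbit_step[OF insert(3)] by (simp add: add.commute)
  qed (simp add: 0)
  then show ?thesis using poly_mapping_eq_sum[of \<gamma>] by (metis finite_keys)
qed

lemma l2trunc_orbit: "l2trunc N x \<in> orbit"
proof (induction N)
  case 0
  have "l2trunc 0 x = (\<lambda>n. 0 * delta 0 n)" by (simp add: l2trunc_def)
  then show ?case using orbit_scale[OF delta_orbit] by metis
next
  case (Suc N)
  have "l2trunc (Suc N) x = (\<lambda>n. l2trunc N x n + x N * delta (de N) n)"
    by (auto simp: l2trunc_def delta_def l2basis_def fun_eq_iff less_Suc_eq)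
  then show ?case using orbit_add[OF Suc orbit_scale[OF delta_orbit]] by simp
qed

text \<open>The orbit of the vacuum contains all basis vectors, hence all truncations, and these
  approximate every square-summable sequence.\<close>

lemma cyclic_vector:
  "Metric_space.mtopology (carrier ell2) (hilbert_dist ell2) closure_of
     {T \<xi> |T. T \<in> cstar_generated BL (\<Union>j. iota j ` carrier \<A>)} = carrier ell2"
proof -
  interpret M: Metric_space l2 "hilbert_dist ell2" by (rule Metric_ell2)
  have "\<exists>y\<in>{T \<xi> |T. T \<in> gen_alg}. y \<in> M.mball x r" if x: "x \<in> l2" and r: "r > 0" for x r
  proof -
    have "eventually (\<lambda>N. l2norm (\<lambda>n. x n - l2trunc N x n) < r) sequentially"
      by (rule order_tendstoD(2)[OF l2trunc_tendsto[OF x] r])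
    then obtain N where "l2norm (\<lambda>n. x n - l2trunc N x n) < r" by (auto simp: eventually_sequentially)
    then have "l2trunc N x \<in> M.mball x r" using x by (simp add: hilbert_dist_ell2)
    moreover obtain T where T: "T \<in> gen_alg" "T \<in> carrier BL" "l2trunc N x = T \<xi>"
      by (rule orbitE[OF l2trunc_orbit])
    have "T \<xi> \<in> {T \<xi> |T. T \<in> gen_alg}" 
      by (rule CollectI, rule exI[of _ T], rule conjI[OF HOL.refl T(1)])
    ultimately show ?thesis unfolding T(3) by (rule bexI)
  qed
  then show ?thesis
    unfolding ell2_simps(1) M.metric_closure_of gen_alg_def[symmetric] by (intro equalityI subsetI) simp_all
qed

lemma process_ell2: "quantum_stochastic_process \<A> ell2 iota \<xi>"
  by (intro quantum_stochastic_process.intro quantum_stochastic_process_axioms.intro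
      cstar_algebra_torus hilbert_space_ell2 iota(1) cyclic_vector)
    (simp_all add: hnorm_ell2)

end

section \<open>Failure of braidability\<close>

lemma braid_class_eqI: "braid_eq x y \<Longrightarrow> braid_class x = braid_class y"
  unfolding braid_class_def by (blast intro: braid_eq.sym braid_eq.trans)

text \<open>The product in \<open>braid_group\<close> is a union over all representatives; since
  \<open>braid_eq\<close> is a congruence, they all contribute the same class.\<close>

lemma braid_class_mult:
  assumes "x \<in> braid_words" "y \<in> braid_words"
  shows "braid_class x \<otimes>\<^bsub>braid_group\<^esub> braid_class y = braid_class (x @ y)"
proof -
  have "braid_class (x' @ y') = braid_class (x @ y)" if "x' \<in> braid_class x" "y' \<in> braid_class y" for x' y'
  proof (rule braid_class_eqI)
    have "braid_eq (x' @ y') (x @ y')"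
      using braid_eq.cong[of x' x "[]" y'] that(1) by (simp add: braid_class_def braid_eq.sym)
    moreover have "braid_eq (x @ y') (x @ y)"
      using braid_eq.cong[of y' y x "[]"] that(2) by (simp add: braid_class_def braid_eq.sym)
    ultimately show "braid_eq (x' @ y') (x @ y)" by (rule braid_eq.trans)
  qed
  then have "(\<Union>x'\<in>braid_class x. \<Union>y'\<in>braid_class y. braid_class (x' @ y')) =
      (\<Union>x'\<in>braid_class x. \<Union>y'\<in>braid_class y. braid_class (x @ y))" by (intro SUP_cong HOL.refl)
  moreover have "braid_class x \<noteq> {}" "braid_class y \<noteq> {}"
    using assms braid_eq.refl unfolding braid_class_def by blast+
  ultimately show ?thesis by (simp add: braid_group_def)
qed

lemma braid_words_closed:
  "[] \<in> braid_words" "1 \<le> n \<Longrightarrow> x \<in> braid_words \<Longrightarrow> (n, b) # x \<in> braid_words"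
  by (auto simp: braid_words_def)

lemma braid_class_in: "x \<in> braid_words \<Longrightarrow> braid_class x \<in> carrier braid_group"
  by (simp add: braid_group_def)

text \<open>The last equation is the braid relation of the first two generators, read as a relation
  between \<open>braid_gen\<close> and \<open>braid_desc 2\<close>.\<close>

lemma braid_desc_eq:
  "braid_desc 1 = braid_class [(1, True)]" "braid_desc 2 = braid_class [(2, True), (1, True)]"
  "braid_gen 1 \<otimes>\<^bsub>braid_group\<^esub> braid_desc 2 = braid_desc 2 \<otimes>\<^bsub>braid_group\<^esub> braid_gen 2"
proof -
  have o: "\<one>\<^bsub>braid_group\<^esub> = braid_class []" by (simp add: braid_group_def)
  note [simp] = braid_words_closed braid_class_mult
  show 1: "braid_desc 1 = braid_class [(1, True)]" by (simp add: o braid_gen_def)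
  show 2: "braid_desc 2 = braid_class [(2, True), (1, True)]"
    using 1 by (simp add: numeral_2_eq_2 braid_gen_def)
  show "braid_gen 1 \<otimes>\<^bsub>braid_group\<^esub> braid_desc 2 = braid_desc 2 \<otimes>\<^bsub>braid_group\<^esub> braid_gen 2"
    unfolding 2 braid_gen_def
    using braid_class_eqI[OF braid_eq.braid[of 1]] by (simp add: numeral_2_eq_2)
qed

lemma star_aut_group_mult:
  assumes "f \<in> carrier (star_aut_group A)" "g \<in> carrier (star_aut_group A)"
  shows "f \<otimes>\<^bsub>star_aut_group A\<^esub> g = compose (carrier A) f g"
  using assms by (simp add: star_aut_group_def BijGroup_def)

context twisted
begin

lemma quotient_emb_apply: "a \<in> carrier \<A> \<Longrightarrow> quotient_emb \<A> \<I> n a = SI.p (\<epsilon> n a)"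
  by (simp add: quotient_emb_def compose_def)

lemma p_emb_in: "a \<in> carrier \<A> \<Longrightarrow> SI.p (\<epsilon> n a) \<in> carrier SI.Q"
  by (rule SI.p_in[OF embD(1)])

text \<open>Since \<open>\<sigma>\<^sub>1 (\<sigma>\<^sub>2 \<sigma>\<^sub>1) = (\<sigma>\<^sub>2 \<sigma>\<^sub>1) \<sigma>\<^sub>2\<close> and \<open>\<sigma>\<^sub>2\<close> fixes the copy 0, \<open>\<sigma>\<^sub>1\<close> fixes the copy 2.\<close>

lemma braidable_automorphism:
  assumes "braidable \<A> ell2 iota \<xi> \<I>"
  obtains \<beta> where "\<beta> \<in> star_hom SI.Q SI.Q" "\<And>a. a \<in> carrier \<A> \<Longrightarrow> \<beta> (SI.p (\<epsilon> 0 a)) = SI.p (\<epsilon> 1 a)"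
    "\<And>a. a \<in> carrier \<A> \<Longrightarrow> \<beta> (SI.p (\<epsilon> 2 a)) = SI.p (\<epsilon> 2 a)"
proof -
  obtain \<psi> \<rho> where \<rho>: "\<rho> \<in> hom braid_group (star_aut_group SI.Q)"
    and desc: "\<forall>n\<ge>1. quotient_emb \<A> \<I> n = compose (carrier \<A>) (\<rho> (braid_desc n)) (quotient_emb \<A> \<I> 0)"
    and fix0: "\<forall>n\<ge>2. quotient_emb \<A> \<I> 0 = compose (carrier \<A>) (\<rho> (braid_gen n)) (quotient_emb \<A> \<I> 0)"
    using assms unfolding braidable_def by blast
  have d: "\<rho> (braid_desc n) (SI.p (\<epsilon> 0 a)) = SI.p (\<epsilon> n a)" if "1 \<le> n" "a \<in> carrier \<A>" for n a
  proof -
    have "quotient_emb \<A> \<I> n a = compose (carrier \<A>) (\<rho> (braid_desc n)) (quotient_emb \<A> \<I> 0) a"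
      using desc that(1) by metis
    then show ?thesis unfolding compose_eq[OF that(2)] quotient_emb_apply[OF that(2)] by (rule HOL.sym)
  qed
  have f: "\<rho> (braid_gen 2) (SI.p (\<epsilon> 0 a)) = SI.p (\<epsilon> 0 a)" if "a \<in> carrier \<A>" for a
  proof -
    have "quotient_emb \<A> \<I> 0 a = compose (carrier \<A>) (\<rho> (braid_gen 2)) (quotient_emb \<A> \<I> 0) a"
      using fix0 by (metis order_refl)
    then show ?thesis unfolding compose_eq[OF that] quotient_emb_apply[OF that] by (rule HOL.sym)
  qed
  have g: "braid_gen 1 \<in> carrier braid_group" "braid_gen 2 \<in> carrier braid_group" "braid_desc 2 \<in> carrier braid_group"
    unfolding braid_gen_def braid_desc_eq(2) by (simp_all add: braid_class_in braid_words_closed)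
  have h: "\<rho> (x \<otimes>\<^bsub>braid_group\<^esub> y) X = \<rho> x (\<rho> y X)"
    if "x \<in> carrier braid_group" "y \<in> carrier braid_group" "X \<in> carrier SI.Q" for x y X
    unfolding hom_mult[OF \<rho> that(1,2)] star_aut_group_mult[OF hom_in_carrier[OF \<rho> that(1)] hom_in_carrier[OF \<rho> that(2)]]
    by (rule compose_eq[OF that(3)])
  show thesis
  proof (rule that)
    show "\<rho> (braid_gen 1) \<in> star_hom SI.Q SI.Q"
      using hom_in_carrier[OF \<rho> g(1)] by (simp add: star_aut_group_def)
    fix a assume a: "a \<in> carrier \<A>"
    show "\<rho> (braid_gen 1) (SI.p (\<epsilon> 0 a)) = SI.p (\<epsilon> 1 a)"
      using d[OF order_refl a] unfolding braid_desc_eq(1) braid_gen_def .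
    have "\<rho> (braid_gen 1) (SI.p (\<epsilon> 2 a)) = \<rho> (braid_gen 1 \<otimes>\<^bsub>braid_group\<^esub> braid_desc 2) (SI.p (\<epsilon> 0 a))"
      unfolding h[OF g(1,3) p_emb_in[OF a]] using d[of 2, OF _ a] by simp
    also have "\<dots> = SI.p (\<epsilon> 2 a)"
      unfolding braid_desc_eq(3) h[OF g(3,2) p_emb_in[OF a]] f[OF a] using d[of 2, OF _ a] by simp
    finally show "\<rho> (braid_gen 1) (SI.p (\<epsilon> 2 a)) = SI.p (\<epsilon> 2 a)" .
  qed
qed

section \<open>The obstruction to braidability\<close>

lemma Pi_cong:
  assumes "x \<in> carrier \<F>" "y \<in> carrier \<F>" "SI.p x = SI.p y"
  shows "Pi_rep x = Pi_rep y"
proof -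
  have "Pi_rep (x \<ominus>\<^bsub>\<F>\<^esub> y) = \<zero>\<^bsub>BL\<^esub>" using Pi_I SI.p_eq_iff[OF assms(1,2)] assms(3) by blast
  then have "Pi_rep x \<ominus>\<^bsub>BL\<^esub> Pi_rep y = \<zero>\<^bsub>BL\<^esub>"
    using F.star_hom_diff[OF Pi_rep(1) cstar_algebra_BL assms(1,2)] by simp
  then show ?thesis
    using PiD(1)[OF assms(1)] PiD(1)[OF assms(2)] by (metis ring.r_right_minus_eq[OF BL.ring_A])
qed

lemma iota_Rop:
  assumes "a \<in> carrier \<A>"
  shows "iota j a \<otimes>\<^bsub>BL\<^esub> Rop k = Rop k \<otimes>\<^bsub>BL\<^esub> iota j a"
proof -
  let ?W = "{a \<in> carrier \<A>. iota j a \<otimes>\<^bsub>BL\<^esub> Rop k = Rop k \<otimes>\<^bsub>BL\<^esub> iota j a}"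
  have "?W = carrier \<A>"
  proof (rule torus_generated[OF T.intertwined_subalgebra[OF cstar_algebra_BL iota(1) iota(1) char_shift_in]])
    have "star BL (Lop m) \<otimes>\<^bsub>BL\<^esub> Rop k = Rop k \<otimes>\<^bsub>BL\<^esub> star BL (Lop m)" for m
      using BL.unitary_commute_star[of "Lop m" "Rop k" 1] Lop_Rop[of m k]
      by (simp add: char_shift_unitary BL.mult_in)
    then show "gens \<subseteq> ?W" using Lop_Rop by (auto simp: gens_def iota iota_star)
  qed
  then show ?thesis using assms by blast
qed

lemma Pi_Rop:
  assumes "x \<in> carrier \<F>"
  shows "Pi_rep x \<otimes>\<^bsub>BL\<^esub> Rop k = Rop k \<otimes>\<^bsub>BL\<^esub> Pi_rep x"
proof -
  let ?W = "{x \<in> carrier \<F>. Pi_rep x \<otimes>\<^bsub>BL\<^esub> Rop k = Rop k \<otimes>\<^bsub>BL\<^esub> Pi_rep x}"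
  have "?W = carrier \<F>"
  proof (rule T.FP_generated[OF F.intertwined_subalgebra[OF cstar_algebra_BL Pi_rep(1) Pi_rep(1) char_shift_in]])
    show "\<epsilon> j a \<in> ?W" if "a \<in> carrier \<A>" for j a
      using that by (simp add: embD(1) Pi_rep(2) iota_Rop)
  qed
  then show ?thesis using assms by blast
qed

text \<open>At degree 0 both characters are 1, so \<open>Lop m\<close> and \<open>Rop m\<close>
  agree on \<xi>. Applying the relation to \<xi> and commuting \<open>Rop m\<close> past
  \<open>T\<close> shows that they agree on \<open>T \<xi>\<close> up to the phase of s. Comparing
  the coordinates one step beyond \<gamma> leaves an equality of phases, so the exponents agree up
  to an integer.\<close>

lemma coordinate_relation:
  assumes T: "T \<in> carrier BL" "T \<otimes>\<^bsub>BL\<^esub> Rop m = Rop m \<otimes>\<^bsub>BL\<^esub> T"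
    and r: "Lop m \<otimes>\<^bsub>BL\<^esub> T = cis (2 * pi * s) \<odot>\<^bsub>BL\<^esub> (T \<otimes>\<^bsub>BL\<^esub> Lop m)"
    and y: "T \<xi> (en \<gamma>) \<noteq> 0"
  shows "\<exists>n::int. lin (th m) \<gamma> - lin (\<lambda>j. th j m) \<gamma> = s + of_int n"
proof -
  let ?g = "\<gamma> + Poly_Mapping.single m 1"
  have y2: "T \<xi> \<in> l2" by (rule BL_D(1)[OF T(1)]) simp
  have "Lop m \<xi> = Rop m \<xi>" unfolding \<xi>_def char_shift_delta by simp
  then have "(T \<otimes>\<^bsub>BL\<^esub> Lop m) \<xi> = (T \<otimes>\<^bsub>BL\<^esub> Rop m) \<xi>" using T(1) by (simp add: BL_apply)
  then have "(T \<otimes>\<^bsub>BL\<^esub> Lop m) \<xi> = Rop m (T \<xi>)" unfolding T(2) using T(1) by (simp add: BL_apply)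
  then have "Lop m (T \<xi>) (en ?g) = cis (2 * pi * s) * Rop m (T \<xi>) (en ?g)"
    using fun_cong[OF r, of \<xi>] T(1) BL.mult_in[OF T(1) char_shift_in] by (simp add: BL_apply)
  then have "cis (2 * pi * lin (th m) \<gamma>) = cis (2 * pi * s) * cis (2 * pi * lin (\<lambda>j. th j m) \<gamma>)"
    using y by (simp add: char_shift_apply[OF y2])
  moreover have "cis (2 * pi * (lin (th m) \<gamma> - lin (\<lambda>j. th j m) \<gamma> - s)) =
      cis (2 * pi * lin (th m) \<gamma>) / (cis (2 * pi * s) * cis (2 * pi * lin (\<lambda>j. th j m) \<gamma>))"
    unfolding cis_mult cis_divide by (rule arg_cong[where f = cis]) (simp add: algebra_simps)
  ultimately have "cis (2 * pi * (lin (th m) \<gamma> - lin (\<lambda>j. th j m) \<gamma> - s)) = 1" by simp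
  then have "cos (2 * pi * (lin (th m) \<gamma> - lin (\<lambda>j. th j m) \<gamma> - s)) = 1" by (metis cis.sel(1) one_complex.sel(1))
  then obtain n :: int where "2 * pi * (lin (th m) \<gamma> - lin (\<lambda>j. th j m) \<gamma> - s) = of_int n * 2 * pi"
    unfolding cos_one_2pi_int by blast
  then have "lin (th m) \<gamma> - lin (\<lambda>j. th j m) \<gamma> - s = of_int n" by simp
  then show ?thesis by (intro exI[of _ n]) simp
qed

text \<open>The \<open>\<alpha>\<close>- and \<open>\<theta>\<close>-coefficients of the commutation exponent of the generators \<open>m\<close> and \<open>k\<close>.\<close>

definition alpha_coeff :: "nat \<Rightarrow> nat \<Rightarrow> int" where
  "alpha_coeff m k = (if even m \<and> k = Suc m then 1 else if even k \<and> m = Suc k then - 1 else 0)"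

definition theta_coeff :: "nat \<Rightarrow> nat \<Rightarrow> int" where
  "theta_coeff m k = (if even m = even k then (if m < k then 1 else if k < m then - 1 else 0) else 0)"

lemma th_diff: "th m k - th k m = \<alpha> * of_int (alpha_coeff m k) + \<theta> * of_int (theta_coeff m k)"
proof -
  consider "m < k" | "m = k" | "k < m" by linarith
  then show ?thesis
    by cases (cases "even m"; cases "even k"; auto simp: th_def alpha_coeff_def theta_coeff_def)+
qed

lemma not_braidable:
  assumes ri: "\<And>q r s :: rat. of_rat q * \<theta> + of_rat r * 1 + of_rat s * \<alpha> = 0 \<Longrightarrow> q = 0 \<and> r = 0 \<and> s = 0"
  shows "\<not> braidable \<A> ell2 iota \<xi> \<I>"
proof
  assume "braidable \<A> ell2 iota \<xi> \<I>"
  then obtain \<beta> where \<beta>: "\<beta> \<in> star_hom SI.Q SI.Q"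
    and \<beta>0: "\<And>a. a \<in> carrier \<A> \<Longrightarrow> \<beta> (SI.p (\<epsilon> 0 a)) = SI.p (\<epsilon> 1 a)"
    and \<beta>2: "\<And>a. a \<in> carrier \<A> \<Longrightarrow> \<beta> (SI.p (\<epsilon> 2 a)) = SI.p (\<epsilon> 2 a)"
    by (rule braidable_automorphism) blast
  note B = star_homD[OF \<beta>]
  have eu: "\<epsilon> 1 u \<in> carrier \<F>" by (simp add: embD(1))
  \<comment> \<open>A representative of the image of \<open>\<epsilon> 1 u\<close> in the free
    product, where \<open>Pi_rep\<close> is defined.\<close>
  obtain x where x: "x \<in> carrier \<F>" "\<beta> (SI.p (\<epsilon> 1 u)) = SI.p x"
    using B(1)[OF SI.p_in[OF eu]] unfolding SI.carrier_Q by blast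
  let ?T = "Pi_rep x"
  have T: "?T \<in> carrier BL" by (rule PiD(1)[OF x(1)])
  \<comment> \<open>Commutation up to a scalar modulo the ideal is carried along by \<beta>, and
    then to operators by \<open>Pi_rep\<close>, which depends only on classes modulo the
    ideal.\<close>
  have rel: "Pi_rep b1 \<otimes>\<^bsub>BL\<^esub> Pi_rep b2 = c \<odot>\<^bsub>BL\<^esub> (Pi_rep b2 \<otimes>\<^bsub>BL\<^esub> Pi_rep b1)"
    if in': "a1 \<in> carrier \<F>" "a2 \<in> carrier \<F>" "b1 \<in> carrier \<F>" "b2 \<in> carrier \<F>"
      and b: "\<beta> (SI.p a1) = SI.p b1" "\<beta> (SI.p a2) = SI.p b2"
      and eq: "SI.p (a1 \<otimes>\<^bsub>\<F>\<^esub> a2) = SI.p (c \<odot>\<^bsub>\<F>\<^esub> (a2 \<otimes>\<^bsub>\<F>\<^esub> a1))" for a1 a2 b1 b2 c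
  proof -
    have 1: "\<beta> (SI.p (a1 \<otimes>\<^bsub>\<F>\<^esub> a2)) = SI.p (b1 \<otimes>\<^bsub>\<F>\<^esub> b2)" and 2: "\<beta> (SI.p (a2 \<otimes>\<^bsub>\<F>\<^esub> a1)) = SI.p (b2 \<otimes>\<^bsub>\<F>\<^esub> b1)"
      using in' b by (simp_all add: B(2) flip: SI.p_ops(2))
    have "SI.p (b1 \<otimes>\<^bsub>\<F>\<^esub> b2) = \<beta> (SI.p (c \<odot>\<^bsub>\<F>\<^esub> (a2 \<otimes>\<^bsub>\<F>\<^esub> a1)))" unfolding 1[symmetric] eq by (rule HOL.refl)
    also have "\<dots> = SI.p (c \<odot>\<^bsub>\<F>\<^esub> (b2 \<otimes>\<^bsub>\<F>\<^esub> b1))"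
      using B(4)[OF SI.p_in[OF F.mult_in[OF in'(2,1)]], of c] 2 SI.p_ops(4)[OF F.mult_in[OF in'(2,1)], of c]
        SI.p_ops(4)[OF F.mult_in[OF in'(4,3)], of c] by simp
    finally have "Pi_rep (b1 \<otimes>\<^bsub>\<F>\<^esub> b2) = Pi_rep (c \<odot>\<^bsub>\<F>\<^esub> (b2 \<otimes>\<^bsub>\<F>\<^esub> b1))"
      by (rule Pi_cong[OF F.mult_in[OF in'(3,4)] F.smult_in[OF F.mult_in[OF in'(4,3)]]])
    then show ?thesis using in' by (simp add: PiD F.mult_in)
  qed
  \<comment> \<open>From the relation between copies 0 and 1: x stands to copy 1 as an element u of
    a later copy would.\<close>
  have h0: "iota 1 a \<otimes>\<^bsub>BL\<^esub> ?T = tw d (1, 0) \<odot>\<^bsub>BL\<^esub> (?T \<otimes>\<^bsub>BL\<^esub> iota 1 a)" if a: "homogeneous \<alpha> d a" for d a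
    using rel[OF embD(1) eu embD(1) x(1) \<beta>0 x(2) swap_mod_I[OF _ a homogeneous_u]] homogeneous_in[OF a]
    by (simp add: Pi_rep(2))
  \<comment> \<open>From the relation between copies 1 and 2: x stands to copy 2 as an element u of
    an earlier copy would.\<close>
  have h2: "?T \<otimes>\<^bsub>BL\<^esub> iota 2 b = tw (1, 0) e \<odot>\<^bsub>BL\<^esub> (iota 2 b \<otimes>\<^bsub>BL\<^esub> ?T)" if b: "homogeneous \<alpha> e b" for e b
    using rel[OF eu embD(1) x(1) embD(1) x(2) \<beta>2 swap_mod_I[OF _ homogeneous_u b]] homogeneous_in[OF b]
    by (simp add: Pi_rep(2))
  \<comment> \<open>Indices 2 and 3 are u and w of copy 1, indices 4 and 5 are u and w of copy 2.
    All four relations are brought into the form required by \<open>coordinate_relation\<close>,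
    which inverts the phase at index 4.\<close>
  have r2: "Lop 2 \<otimes>\<^bsub>BL\<^esub> ?T = cis (2 * pi * (\<theta> * of_int 1)) \<odot>\<^bsub>BL\<^esub> (?T \<otimes>\<^bsub>BL\<^esub> Lop 2)"
    using h0[OF homogeneous_u] iota(2)[of 1] by (simp add: tw_def)
  have r3: "Lop 3 \<otimes>\<^bsub>BL\<^esub> ?T = cis (2 * pi * (\<theta> * of_int 0)) \<odot>\<^bsub>BL\<^esub> (?T \<otimes>\<^bsub>BL\<^esub> Lop 3)"
    using h0[OF homogeneous_w] iota(3)[of 1] T by (simp add: tw_def eval_nat_numeral BL.mult_in)
  have r4: "Lop 4 \<otimes>\<^bsub>BL\<^esub> ?T = cis (2 * pi * (\<theta> * of_int (- 1))) \<odot>\<^bsub>BL\<^esub> (?T \<otimes>\<^bsub>BL\<^esub> Lop 4)"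
  proof -
    have "?T \<otimes>\<^bsub>BL\<^esub> Lop 4 = \<zeta> \<odot>\<^bsub>BL\<^esub> (Lop 4 \<otimes>\<^bsub>BL\<^esub> ?T)" using h2[OF homogeneous_u] iota(2)[of 2] by (simp add: tw_def)
    then show ?thesis using T by (simp add: BL.mult_in cis_mult)
  qed
  have r5: "Lop 5 \<otimes>\<^bsub>BL\<^esub> ?T = cis (2 * pi * (\<theta> * of_int 0)) \<odot>\<^bsub>BL\<^esub> (?T \<otimes>\<^bsub>BL\<^esub> Lop 5)"
    using h2[OF homogeneous_w] iota(3)[of 2] T by (simp add: tw_def eval_nat_numeral BL.mult_in)
  have zero: "?T \<xi> (en \<gamma>) = 0" for \<gamma>
  proof (rule ccontr)
    assume y: "?T \<xi> (en \<gamma>) \<noteq> 0"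
    let ?g = "Poly_Mapping.lookup \<gamma>"
    obtain S :: "nat set" where S: "finite S" "Poly_Mapping.keys \<gamma> \<subseteq> S" "2 \<in> S" "4 \<in> S"
      by (rule that[of "Poly_Mapping.keys \<gamma> \<union> {2, 4}"]) auto
    have AB: "(\<Sum>k\<in>S. alpha_coeff m k * ?g k) = 0 \<and> (\<Sum>k\<in>S. theta_coeff m k * ?g k) = s"
      if r: "Lop m \<otimes>\<^bsub>BL\<^esub> ?T = cis (2 * pi * (\<theta> * of_int s)) \<odot>\<^bsub>BL\<^esub> (?T \<otimes>\<^bsub>BL\<^esub> Lop m)" for m and s :: int
    proof -
      let ?a = "\<Sum>k\<in>S. alpha_coeff m k * ?g k" and ?b = "\<Sum>k\<in>S. theta_coeff m k * ?g k"
      obtain n :: int where n: "lin (th m) \<gamma> - lin (\<lambda>j. th j m) \<gamma> = \<theta> * of_int s + of_int n"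
        using coordinate_relation[OF T Pi_Rop[OF x(1)] r y] by blast
      have "lin (th m) \<gamma> - lin (\<lambda>j. th j m) \<gamma> = (\<Sum>k\<in>S. (th m k - th k m) * of_int (?g k))"
        unfolding lin_eq_sum[OF S(1,2)] by (simp add: left_diff_distrib sum_subtractf)
      also have "\<dots> = \<alpha> * of_int ?a + \<theta> * of_int ?b"
        by (simp add: th_diff distrib_right sum.distrib sum_distrib_left mult.assoc)
      finally have e: "\<theta> * of_int s + of_int n = \<alpha> * of_int ?a + \<theta> * of_int ?b" unfolding n .
      define A B where AB: "A = ?a" "B = ?b"
      \<comment> \<open>Both expressions for the exponent have integer coefficients at \<theta>, 1
        and \<alpha>, so rational independence compares them termwise.\<close>
      have "of_rat (of_int (B - s)) * \<theta> + of_rat (of_int (- n)) * 1 + of_rat (of_int A) * \<alpha> = 0"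
        using e[folded AB] by (simp add: algebra_simps of_rat_diff of_rat_minus)
      from ri[OF this] show ?thesis unfolding AB[symmetric] by simp
    qed
    \<comment> \<open>The generator w of a copy meets \<alpha> only through the u-degree of the same
      copy, and the exponents prescribed at indices 3 and 5 contain no \<alpha>.\<close>
    have "alpha_coeff 3 k * ?g k = (if k = 2 then - ?g 2 else 0)" "alpha_coeff 5 k * ?g k = (if k = 4 then - ?g 4 else 0)" for k
      by (auto simp: alpha_coeff_def)
    then have g24: "?g 2 = 0" "?g 4 = 0" using AB[OF r3] AB[OF r5] S by (simp_all add: sum.delta)
    \<comment> \<open>2 and 4 are consecutive even indices, so every other degree contributes
      equally to both and cancels. The prescribed \<theta>-exponents 1 and -1 then make the degrees
      at 2 and 4 add up to 2.\<close>
    have "theta_coeff 2 k - theta_coeff 4 k = (if k = 2 then 1 else 0) + (if k = 4 then 1 else 0)" for k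
    proof -
      consider "k = 0" | "k = 1" | "k = 2" | "k = 3" | "k = 4" | "4 < k" by linarith
      then show ?thesis by cases (auto simp: theta_coeff_def)
    qed
    then have "(theta_coeff 2 k - theta_coeff 4 k) * ?g k = (if k = 2 then ?g 2 else 0) + (if k = 4 then ?g 4 else 0)" for k by simp
    then have "(\<Sum>k\<in>S. (theta_coeff 2 k - theta_coeff 4 k) * ?g k) =
        (\<Sum>k\<in>S. (if k = 2 then ?g 2 else 0) + (if k = 4 then ?g 4 else 0))" by (intro sum.cong HOL.refl)
    also have "\<dots> = ?g 2 + ?g 4" using S(3,4) by (simp add: sum.distrib sum.delta S(1))
    finally have "(1 :: int) - (- 1) = ?g 2 + ?g 4"
      using AB[OF r2] AB[OF r4] by (simp add: left_diff_distrib sum_subtractf)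
    then show False using g24 by simp
  qed
  have T0: "?T \<xi> = (\<lambda>n. 0)"
  proof
    fix n show "?T \<xi> n = 0" using zero[of "de n"] by simp
  qed
  \<comment> \<open>Unitarity of u passes through \<beta> and \<open>Pi_rep\<close>, so
    \<open>?T\<close> is an isometry and cannot annihilate \<xi>.\<close>
  have 1: "star BL ?T \<otimes>\<^bsub>BL\<^esub> ?T = \<one>\<^bsub>BL\<^esub>"
  proof -
    have s: "star \<F> (\<epsilon> 1 u) \<otimes>\<^bsub>\<F>\<^esub> \<epsilon> 1 u = \<one>\<^bsub>\<F>\<^esub>"
      using torus_rel by (simp add: embD(6) flip: embD(2,5))
    let ?e = "\<epsilon> 1 u"
    have "SI.p (star \<F> x \<otimes>\<^bsub>\<F>\<^esub> x) = star SI.Q (\<beta> (SI.p ?e)) \<otimes>\<^bsub>SI.Q\<^esub> \<beta> (SI.p ?e)"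
      unfolding x(2) using x(1) by (simp add: SI.p_ops(2,5) F.star_in)
    also have "\<dots> = \<beta> (SI.p (star \<F> ?e)) \<otimes>\<^bsub>SI.Q\<^esub> \<beta> (SI.p ?e)"
      unfolding B(5)[OF SI.p_in[OF eu], symmetric] SI.p_ops(5)[OF eu] by (rule HOL.refl)
    also have "\<dots> = \<beta> (SI.p (star \<F> ?e \<otimes>\<^bsub>\<F>\<^esub> ?e))"
      unfolding B(2)[OF SI.p_in[OF F.star_in[OF eu]] SI.p_in[OF eu], symmetric] SI.p_ops(2)[OF F.star_in[OF eu] eu]
      by (rule HOL.refl)
    also have "\<dots> = SI.p \<one>\<^bsub>\<F>\<^esub>" unfolding s using B(6) SI.p_ops(1) by simp
    finally show ?thesis
      using Pi_cong[OF F.mult_in[OF F.star_in[OF x(1)] x(1)] F.one_in] x(1) by (simp add: PiD)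
  qed
  have "\<xi> = (star BL ?T \<otimes>\<^bsub>BL\<^esub> ?T) \<xi>" unfolding 1 by (simp add: BL_apply(2))
  also have "\<dots> = star BL ?T (\<lambda>n. 0)" unfolding BL_apply(1)[OF \<xi>_in(1)] T0 by (rule HOL.refl)
  also have "\<dots> = (\<lambda>n. 0)" using BL_D(3)[OF BL.star_in[OF T], of "\<lambda>n. 0" 0] by simp
  finally have "l2norm \<xi> = l2norm (\<lambda>n. 0)" by (rule arg_cong)
  then show False by simp
qed

end

theorem theorem3p12:
  fixes \<alpha> \<theta> :: real and v :: "int \<times> int \<Rightarrow> int \<times> int \<Rightarrow> complex"
  assumes rationally_independent:
      "\<And>q r s :: rat. of_rat q * \<theta> + of_rat r * 1 + of_rat s * \<alpha> = 0 \<Longrightarrow> q = 0 \<and> r = 0 \<and> s = 0"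
    and v: "\<And>k l. v k l = exp (2 * pi * \<i> *
        complex_of_real (\<theta> * of_int (fst k) * of_int (fst l) + \<theta> * of_int (snd k) * of_int (snd l)))"
  shows "\<exists>(H :: (nat \<Rightarrow> complex) hilbert) \<iota> \<xi>.
     quantum_stochastic_process (nc_torus \<alpha>) H \<iota> \<xi> \<and>
     process_distribution (nc_torus \<alpha>) H \<iota> \<xi> =
       compose (carrier (free_product (nc_torus \<alpha>))) (product_trace \<alpha> v) (twist_quotient_map \<alpha> v) \<and>
     factorizes_via (nc_torus \<alpha>) H \<iota> \<xi> (twist_ideal \<alpha> v) (product_trace \<alpha> v) \<and>
     spreadable (nc_torus \<alpha>) H \<iota> \<xi> \<and>
     \<not> braidable (nc_torus \<alpha>) H \<iota> \<xi> (twist_ideal \<alpha> v)"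
proof -
  interpret twisted \<alpha> \<theta> .
  have v: "v = tw" unfolding tw_def using v by (intro ext) (simp add: cis_conv_exp mult_ac)
  show ?thesis
    unfolding v
    using process_ell2 process_distribution_eq distribution_eq_compose factorizes is_spreadable
      not_braidable[OF rationally_independent]
    by (intro exI[of _ ell2] exI[of _ iota] exI[of _ \<xi>] conjI) simp_all
qed

end
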